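(* Let $\pi$ be a set of primes, let $\mathfrak F$ be an $\mathfrak N^\pi$-Fitting class and let $G$ be a finite $\pi'$-soluble group. Then $G$ possesses exactly one conjugacy class of $\mathfrak F$-injectors (that is, $\mathfrak F$-injectors of $G$ exist, and they form a single conjugacy class of subgroups of $G$). Moreover, if $V$ and $V^*$ are $\mathfrak F$-injectors of $G$, there exists $g\in G^{\mathfrak N^\pi}$ such that $(V^* )^g=V$. Also, if $I$ is an $\mathfrak F$-injector of $G$ and $N$ is an $\mathfrak N^\pi$-Dnormal subgroup of $G$, then $I\cap N$ is an $\mathfrak F$-injector of $N$.
   Context: All groups are finite. Classes of groups are closed under isomorphism. $\pi'$ is the complement of $\pi$ in the set of all primes. For a set of primes $\rho$, a group is $\rho$-separable if each of its composition factors is either a $\rho$-group or a $\rho'$-group; it is $\rho$-soluble if it is $\rho$-separable and each composition factor that is a $\rho$-group is a $p$-group for some prime $p\in\rho$. $\mathfrak N^\pi$ is the class of all groups $H\times K$ with $H$ a $\pi$-group and $K$ a nilpotent $\pi'$-group. For a group $X$, the $\mathfrak N^\pi$-residual $X^{\mathfrak N^\pi}$ is the smallest normal subgroup of $X$ whose quotient belongs to $\mathfrak N^\pi$. $O^\pi(X)$ is the smallest normal subgroup of $X$ whose quotient is a $\pi$-group. $\mathfrak N^\pi$-Dnormal subgroups: For a Sylow $p$-subgroup $G_p$ of a group $G$ and $H\le G$, write $G_p\searrow H$ if $G_p\cap H$ is a Sylow $p$-subgroup of $H$. A subgroup $H$ of $G$ is $\mathfrak N^\pi$-Dnormal in $G$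 if (1) whenever $p\in\pi'$, $G_p\in\mathrm{Syl}_p(G)$ and $G_p\searrow H$, then $G_p\le N_G(H)$; and (2) whenever $p\in\pi$, $G_p\in\mathrm{Syl}_p(G)$ and $G_p\searrow H$, then $G_p\le N_G(H)$ if $\pi=\{p\}$, and $G_p\le N_G(O^\pi(H))$ if $|\pi|\ge 2$. A non-empty class $\mathfrak F$ of groups is an $\mathfrak N^\pi$-Fitting class if: (i) if $G\in\mathfrak F$ and $N$ is an $\mathfrak N^\pi$-Dnormal subgroup of $G$, then $N\in\mathfrak F$; (ii) if $M,N$ are $\mathfrak N^\pi$-Dnormal subgroups of $G=\langle M,N\rangle$ with $M,N\in\mathfrak F$, then $G\in\mathfrak F$. An $\mathfrak F$-injector of a group $G$ is a subgroup $V$ of $G$ such that, for every subnormal subgroup $K$ of $G$, $V\cap K$ is an $\mathfrak F$-maximal subgroup of $K$, i.e. $V\cap K$ is maximal, with respect to inclusion, among the subgroups of $K$ belonging to $\mathfrak F$. $A^x=x^{-1}Ax$. *)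

theory Defs
  imports "HOL-Algebra.SimpleGroups" "HOL-Algebra.Group_Action" "HOL-Algebra.Generated_Groups"
begin

definition primes_compl :: "nat set \<Rightarrow> nat set" where
  "primes_compl \<rho> = {p. prime p} - \<rho>"

definition pi_group :: "nat set \<Rightarrow> ('a, 'm) monoid_scheme \<Rightarrow> bool" where
  "pi_group \<rho> X \<longleftrightarrow>
     group X \<and> finite (carrier X) \<and> (\<forall>p. prime p \<and> p dvd order X \<longrightarrow> p \<in> \<rho>)"

definition composition_series :: "('a, 'm) monoid_scheme \<Rightarrow> 'a set list \<Rightarrow> bool" where
  "composition_series X Hs \<longleftrightarrow>
     Hs \<noteq> [] \<and> hd Hs = {\<one>\<^bsub>X\<^esub>} \<and> last Hs = carrier X \<and>
     (\<forall>i. Suc i < length Hs \<longrightarrow>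
        Hs ! i \<lhd> X\<lparr>carrier := Hs ! Suc i\<rparr> \<and>
        simple_group (X\<lparr>carrier := Hs ! Suc i\<rparr> Mod Hs ! i))"

definition composition_factors :: "('a, 'm) monoid_scheme \<Rightarrow> 'a set monoid set" where
  "composition_factors X =
     {X\<lparr>carrier := Hs ! Suc i\<rparr> Mod Hs ! i | Hs i.
        composition_series X Hs \<and> Suc i < length Hs}"

definition separable_group :: "nat set \<Rightarrow> ('a, 'm) monoid_scheme \<Rightarrow> bool" where
  "separable_group \<rho> X \<longleftrightarrow>
     (\<forall>S \<in> composition_factors X. pi_group \<rho> S \<or> pi_group (primes_compl \<rho>) S)"

definition soluble_group :: "nat set \<Rightarrow> ('a, 'm) monoid_scheme \<Rightarrow> bool" where
  "soluble_group \<rho> X \<longleftrightarrow>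
     separable_group \<rho> X \<and>
     (\<forall>S \<in> composition_factors X. pi_group \<rho> S \<longrightarrow> (\<exists>p \<in> \<rho>. pi_group {p} S))"

primrec lower_central :: "('a, 'm) monoid_scheme \<Rightarrow> nat \<Rightarrow> 'a set" where
  "lower_central X 0 = carrier X"
| "lower_central X (Suc n) =
     generate X {x \<otimes>\<^bsub>X\<^esub> y \<otimes>\<^bsub>X\<^esub> inv\<^bsub>X\<^esub> x \<otimes>\<^bsub>X\<^esub> inv\<^bsub>X\<^esub> y | x y.
       x \<in> lower_central X n \<and> y \<in> carrier X}"

definition nilpotent_group :: "('a, 'm) monoid_scheme \<Rightarrow> bool" where
  "nilpotent_group X \<longleftrightarrow> group X \<and> (\<exists>n. lower_central X n = {\<one>\<^bsub>X\<^esub>})"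

text \<open>
  The class of direct products of a \<open>\<pi>\<close>-group and a nilpotent \<open>\<pi>'\<close>-group. As the class is
  closed under isomorphism, the two factors may be taken inside \<open>X\<close>, with the multiplication of
  \<open>X\<close> as the isomorphism.
\<close>
definition npi_group :: "nat set \<Rightarrow> ('a, 'm) monoid_scheme \<Rightarrow> bool" where
  "npi_group \<pi> X \<longleftrightarrow>
     group X \<and>
     (\<exists>H K. subgroup H X \<and> subgroup K X \<and>
        (\<lambda>(h, k). h \<otimes>\<^bsub>X\<^esub> k) \<in> iso (X\<lparr>carrier := H\<rparr> \<times>\<times> X\<lparr>carrier := K\<rparr>) X \<and>
        pi_group \<pi> (X\<lparr>carrier := H\<rparr>) \<and>
        pi_group (primes_compl \<pi>) (X\<lparr>carrier := K\<rparr>) \<and>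
        nilpotent_group (X\<lparr>carrier := K\<rparr>))"

text \<open>The order in both \<open>LEAST\<close> terms is inclusion, so they denote the smallest such normal subgroup.\<close>

definition npi_residual :: "nat set \<Rightarrow> ('a, 'm) monoid_scheme \<Rightarrow> 'a set" where
  "npi_residual \<pi> X = (LEAST N. N \<lhd> X \<and> npi_group \<pi> (X Mod N))"

definition O_upper :: "nat set \<Rightarrow> ('a, 'm) monoid_scheme \<Rightarrow> 'a set" where
  "O_upper \<pi> X = (LEAST N. N \<lhd> X \<and> pi_group \<pi> (X Mod N))"

definition sylow_subgroup :: "nat \<Rightarrow> ('a, 'm) monoid_scheme \<Rightarrow> 'a set \<Rightarrow> bool" where
  "sylow_subgroup p X P \<longleftrightarrow> subgroup P X \<and> card P = p ^ multiplicity p (order X)"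

definition sylow_reduces :: "nat \<Rightarrow> ('a, 'm) monoid_scheme \<Rightarrow> 'a set \<Rightarrow> 'a set \<Rightarrow> bool" where
  "sylow_reduces p G P H \<longleftrightarrow> sylow_subgroup p (G\<lparr>carrier := H\<rparr>) (P \<inter> H)"

text \<open>\<open>card \<pi>\<close> is \<open>0\<close> for infinite \<open>\<pi>\<close>, so \<open>|\<pi>| \<ge> 2\<close> needs the extra disjunct.\<close>
definition npi_dnormal :: "nat set \<Rightarrow> ('a, 'm) monoid_scheme \<Rightarrow> 'a set \<Rightarrow> bool" where
  "npi_dnormal \<pi> G H \<longleftrightarrow>
     subgroup H G \<and>
     (\<forall>p P. p \<in> primes_compl \<pi> \<and> sylow_subgroup p G P \<and> sylow_reduces p G P H \<longrightarrow>
        P \<subseteq> normalizer G H) \<and>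
     (\<forall>p P. p \<in> \<pi> \<and> sylow_subgroup p G P \<and> sylow_reduces p G P H \<longrightarrow>
        (\<pi> = {p} \<longrightarrow> P \<subseteq> normalizer G H) \<and>
        (infinite \<pi> \<or> card \<pi> \<ge> 2 \<longrightarrow>
           P \<subseteq> normalizer G (O_upper \<pi> (G\<lparr>carrier := H\<rparr>))))"

text \<open>
  Every finite group is isomorphic to one whose elements are natural numbers, so an
  isomorphism-closed class of finite groups is represented by its members over \<open>nat\<close>.
  Membership of a group over another type is tested up to isomorphism.
\<close>
definition group_class :: "nat monoid set \<Rightarrow> bool" where
  "group_class F \<longleftrightarrow>
     (\<forall>X \<in> F. group X \<and> finite (carrier X)) \<and>
     (\<forall>X \<in> F. \<forall>Y. group Y \<and> X \<cong> Y \<longrightarrow> Y \<in> F)"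

definition in_class :: "('a, 'm) monoid_scheme \<Rightarrow> nat monoid set \<Rightarrow> bool" where
  "in_class X F \<longleftrightarrow> group X \<and> (\<exists>Y \<in> F. X \<cong> Y)"

definition npi_fitting_class :: "nat set \<Rightarrow> nat monoid set \<Rightarrow> bool" where
  "npi_fitting_class \<pi> F \<longleftrightarrow>
     group_class F \<and> F \<noteq> {} \<and>
     (\<forall>G N. G \<in> F \<and> npi_dnormal \<pi> G N \<longrightarrow> G\<lparr>carrier := N\<rparr> \<in> F) \<and>
     (\<forall>(G :: nat monoid) M N.
        group G \<and> finite (carrier G) \<and>
        npi_dnormal \<pi> G M \<and> npi_dnormal \<pi> G N \<and> carrier G = generate G (M \<union> N) \<and>
        G\<lparr>carrier := M\<rparr> \<in> F \<and> G\<lparr>carrier := N\<rparr> \<in> F \<longrightarrow> G \<in> F)"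

inductive subnormal :: "('a, 'm) monoid_scheme \<Rightarrow> 'a set \<Rightarrow> bool" for G where
  whole: "subnormal G (carrier G)"
| step: "subnormal G H \<Longrightarrow> K \<lhd> G\<lparr>carrier := H\<rparr> \<Longrightarrow> subnormal G K"

definition F_maximal :: "nat monoid set \<Rightarrow> ('a, 'm) monoid_scheme \<Rightarrow> 'a set \<Rightarrow> bool" where
  "F_maximal F K U \<longleftrightarrow>
     subgroup U K \<and> in_class (K\<lparr>carrier := U\<rparr>) F \<and>
     (\<forall>W. subgroup W K \<and> in_class (K\<lparr>carrier := W\<rparr>) F \<and> U \<subseteq> W \<longrightarrow> W = U)"

definition F_injector :: "nat monoid set \<Rightarrow> ('a, 'm) monoid_scheme \<Rightarrow> 'a set \<Rightarrow> bool" where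
  "F_injector F G V \<longleftrightarrow>
     subgroup V G \<and> (\<forall>K. subnormal G K \<longrightarrow> F_maximal F (G\<lparr>carrier := K\<rparr>) (V \<inter> K))"

definition conj_subset :: "('a, 'm) monoid_scheme \<Rightarrow> 'a set \<Rightarrow> 'a \<Rightarrow> 'a set" where
  "conj_subset G A x = inv\<^bsub>G\<^esub> x <#\<^bsub>G\<^esub> A #>\<^bsub>G\<^esub> x"

end

theory Submission
  imports Defs "HOL-Algebra.FiniteProduct" "HOL-Algebra.Sylow"
begin

text \<open>
  Call \<open>\<pi>\<close> itself and each \<open>{p}\<close> with \<open>p \<notin> \<pi>\<close> a block. An \<open>N\<^sup>\<pi>\<close>-group is the direct
  product of its Hall subgroups for the blocks, and a class satisfying the hypotheses has, above a
  normal \<open>F\<close>-subgroup \<open>W\<close> of \<open>J\<close> with \<open>J/W\<close> in \<open>N\<^sup>\<pi>\<close>, a largest \<open>F\<close>-subgroup of \<open>J\<close>. The core is an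
  analogue of Hartley's lemma: if \<open>N\<close> is normal in \<open>H\<close> with \<open>H/N\<close> in \<open>N\<^sup>\<pi>\<close> and \<open>W\<close> is \<open>F\<close>-maximal in
  \<open>N\<close>, then the \<open>F\<close>-maximal subgroups of \<open>H\<close> containing \<open>W\<close> are conjugate under \<open>N\<close>. This is an
  induction along chief factors \<open>K/W\<close> below the normalizer of \<open>W\<close> in \<open>N\<close>, where \<open>K/W\<close>
  is complemented, uniquely up to conjugacy, in the part belonging to the other blocks: either \<open>K/W\<close> is an
  abelian \<open>p\<close>-group, or it is a \<open>\<pi>\<close>-group and the quotient above it is a direct product of Sylow
  subgroups, so that Sylow's theorem and the Frattini argument suffice. Injectors of \<open>G\<close> are then
  obtained from injectors of its \<open>N\<^sup>\<pi>\<close>-residual. Finally, an \<open>N\<^sup>\<pi>\<close>-Dnormal subgroup is normal, or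
  it is normalized by a normal subgroup \<open>P\<close> of \<open>\<pi>\<close>-index and hence normal in \<open>N P\<close>, and injectors
  restrict to subgroups containing \<open>P\<close>.

  Sections \<open>J/K\<close> are described by the pair of subgroups \<open>K \<le> J\<close> of one ambient group, which avoids
  quotient groups in the inductions.
\<close>

section \<open>Conjugation and normalization\<close>

text \<open>Two obstacles fix the shape of the argument. First, a \<pi>-quotient \<open>J/W\<close>
  may be insoluble, and then closure under normal subgroups and normal products alone need not give
  a largest \<open>F\<close>-subgroup above \<open>W\<close>. When \<pi> has at least two primes,
  Dnormality repairs this: a subgroup between \<open>W\<close> and \<open>J\<close> has the same
  \<open>O_upper \<pi>\<close> as \<open>W\<close> and contains every Sylow p-subgroup of
  \<open>J\<close> with p outside \<pi>, so it is Dnormal however far from subnormal it may be. A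
  block with a single prime, including \<pi> = {p}, is handled by subnormality inside p-groups
  instead. Second, conjugacy of complements to a normal Hall subgroup needs some solubility of that
  subgroup or of the quotient. For a \<pi>-section it has to come from the quotient, and there it is
  available because only block-nilpotent quotients are ever complemented; for an abelian p-section
  no information on the quotient is used. Since sections are pairs of subgroups, coprimality
  arguments become comparisons of prime multiplicities of orders.\<close>

locale fin_group = group G for G (structure) +
  assumes fin: "finite (carrier G)"

text \<open>Only the inclusion of each conjugate in \<open>W\<close> is asked. For a subgroup
  \<open>X\<close> the inverses yield equality, so \<open>X\<close> then lies in the normalizer
  (\<open>subset_normalizer_iff\<close>); but the predicate passes to subsets of \<open>X\<close>
  and to intersections with no side condition.\<close>

definition (in group) normalizes :: "'a set \<Rightarrow> 'a set \<Rightarrow> bool" where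
  "normalizes X W \<longleftrightarrow> (\<forall>x\<in>X. \<forall>w\<in>W. inv x \<otimes> w \<otimes> x \<in> W)"

context group
begin

lemma conj_subset_image:
  assumes "A \<subseteq> carrier G" "x \<in> carrier G"
  shows "conj_subset G A x = (\<lambda>a. inv x \<otimes> a \<otimes> x) ` A"
  unfolding conj_subset_def l_coset_def r_coset_def by auto

lemma mult_inv_cancel:
  assumes "x \<in> carrier G" "y \<in> carrier G"
  shows "x \<otimes> (inv x \<otimes> y) = y" "inv x \<otimes> (x \<otimes> y) = y"
  using assms by (simp_all flip: m_assoc)

lemma conj_elem_cancel:
  assumes "a \<in> carrier G" "x \<in> carrier G"
  shows "x \<otimes> (inv x \<otimes> a \<otimes> x) \<otimes> inv x = a" "inv x \<otimes> (x \<otimes> a \<otimes> inv x) \<otimes> x = a"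
  using assms by (simp_all add: m_assoc mult_inv_cancel)

lemma mem_conj_subset:
  assumes "A \<subseteq> carrier G" "x \<in> carrier G" "y \<in> carrier G"
  shows "y \<in> conj_subset G A x \<longleftrightarrow> x \<otimes> y \<otimes> inv x \<in> A"
proof
  assume "y \<in> conj_subset G A x"
  then obtain a where a: "a \<in> A" "y = inv x \<otimes> a \<otimes> x"
    using assms by (auto simp: conj_subset_image)
  then show "x \<otimes> y \<otimes> inv x \<in> A"
    using conj_elem_cancel(1)[of a x] assms by auto
next
  assume "x \<otimes> y \<otimes> inv x \<in> A"
  moreover have "inv x \<otimes> (x \<otimes> y \<otimes> inv x) \<otimes> x = y"
    by (rule conj_elem_cancel(2)) (use assms in auto)
  ultimately show "y \<in> conj_subset G A x"
    using assms by (auto simp: conj_subset_image image_iff intro!: bexI[of _ "x \<otimes> y \<otimes> inv x"])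
qed

lemma conj_subset_carrier:
  assumes "A \<subseteq> carrier G" "x \<in> carrier G"
  shows "conj_subset G A x \<subseteq> carrier G"
  using assms by (auto simp: conj_subset_image)

lemma conj_subset_mono:
  "A \<subseteq> B \<Longrightarrow> B \<subseteq> carrier G \<Longrightarrow> x \<in> carrier G \<Longrightarrow> conj_subset G A x \<subseteq> conj_subset G B x"
  using conj_subset_image[of A x] conj_subset_image[of B x] by auto

lemma conj_subset_one: "A \<subseteq> carrier G \<Longrightarrow> conj_subset G A \<one> = A"
  by (auto simp: conj_subset_image subset_iff image_iff)

lemma conj_subset_mult:
  assumes "A \<subseteq> carrier G" "x \<in> carrier G" "y \<in> carrier G"
  shows "conj_subset G (conj_subset G A x) y = conj_subset G A (x \<otimes> y)"
proof -
  have "inv y \<otimes> (inv x \<otimes> a \<otimes> x) \<otimes> y = inv (x \<otimes> y) \<otimes> a \<otimes> (x \<otimes> y)" if "a \<in> A" for a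
    using that assms by (simp add: inv_mult_group m_assoc subset_iff)
  then show ?thesis
    using assms by (subst (1 2 3) conj_subset_image) (auto simp: image_image conj_subset_image subset_iff)
qed

lemma conj_subset_inv [simp]:
  assumes "A \<subseteq> carrier G" "x \<in> carrier G"
  shows "conj_subset G (conj_subset G A x) (inv x) = A" "conj_subset G (conj_subset G A (inv x)) x = A"
  using assms by (simp_all add: conj_subset_mult conj_subset_one)

lemma conj_subset_subgroup:
  assumes "subgroup A G" "x \<in> carrier G"
  shows "subgroup (conj_subset G A x) G"
proof
  interpret A: subgroup A G by fact
  show "conj_subset G A x \<subseteq> carrier G"
    using assms A.subset by (intro conj_subset_carrier)
  show "\<one> \<in> conj_subset G A x"
    using assms A.subset by (simp add: mem_conj_subset)
  fix y assume y: "y \<in> conj_subset G A x"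
  then have yc: "y \<in> carrier G" using A.subset assms conj_subset_carrier by blast
  have yA: "x \<otimes> y \<otimes> inv x \<in> A" using y yc mem_conj_subset[OF A.subset] assms by blast
  have "inv (x \<otimes> y \<otimes> inv x) \<in> A" using yA by blast
  moreover have "inv (x \<otimes> y \<otimes> inv x) = x \<otimes> inv y \<otimes> inv x"
    using yc assms by (simp add: inv_mult_group m_assoc)
  ultimately show "inv y \<in> conj_subset G A x" using yc assms A.subset by (simp add: mem_conj_subset)
  fix z assume z: "z \<in> conj_subset G A x"
  then have zc: "z \<in> carrier G" using A.subset assms conj_subset_carrier by blast
  have zA: "x \<otimes> z \<otimes> inv x \<in> A" using z zc mem_conj_subset[OF A.subset] assms by blast
  have "(x \<otimes> y \<otimes> inv x) \<otimes> (x \<otimes> z \<otimes> inv x) \<in> A" using yA zA by blast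
  moreover have "(x \<otimes> y \<otimes> inv x) \<otimes> (x \<otimes> z \<otimes> inv x) = x \<otimes> (y \<otimes> z) \<otimes> inv x"
    using yc zc assms by (simp add: m_assoc mult_inv_cancel)
  ultimately show "y \<otimes> z \<in> conj_subset G A x" using yc zc assms A.subset by (simp add: mem_conj_subset)
qed

lemma conj_elem_inj: "x \<in> carrier G \<Longrightarrow> inj_on (\<lambda>a. inv x \<otimes> a \<otimes> x) (carrier G)"
  by (rule inj_onI) (metis conj_elem_cancel(1))

lemma card_conj_subset:
  assumes "A \<subseteq> carrier G" "x \<in> carrier G"
  shows "card (conj_subset G A x) = card A"
  unfolding conj_subset_image[OF assms]
  by (rule card_image) (rule inj_on_subset[OF conj_elem_inj[OF assms(2)] assms(1)])

lemma conj_subset_Int: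
  assumes "A \<subseteq> carrier G" "B \<subseteq> carrier G" "x \<in> carrier G"
  shows "conj_subset G (A \<inter> B) x = conj_subset G A x \<inter> conj_subset G B x"
  using assms inj_on_image_Int[OF conj_elem_inj[OF assms(3)] assms(1,2)]
  by (simp add: conj_subset_image le_infI1)

lemma normalizes_mono: "normalizes X W \<Longrightarrow> Y \<subseteq> X \<Longrightarrow> normalizes Y W"
  by (auto simp: normalizes_def)

lemma normalizes_Int: "normalizes X A \<Longrightarrow> normalizes X B \<Longrightarrow> normalizes X (A \<inter> B)"
  by (auto simp: normalizes_def)

lemma normalizes_self: "subgroup H G \<Longrightarrow> normalizes H H"
  by (auto simp: normalizes_def subgroup.m_closed subgroup.m_inv_closed)

lemma normalizesD: "normalizes X W \<Longrightarrow> x \<in> X \<Longrightarrow> w \<in> W \<Longrightarrow> inv x \<otimes> w \<otimes> x \<in> W"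
  by (auto simp: normalizes_def)

lemma normalizesD':
  assumes "normalizes X W" "subgroup X G" "x \<in> X" "w \<in> W"
  shows "x \<otimes> w \<otimes> inv x \<in> W"
  using normalizesD[OF assms(1), of "inv x" w] assms
  by (simp add: subgroup.m_inv_closed subgroup.mem_carrier)

lemma conj_subset_normalizes:
  assumes "normalizes X W" "subgroup X G" "W \<subseteq> carrier G" "x \<in> X"
  shows "conj_subset G W x = W"
proof -
  have xc: "x \<in> carrier G" using assms subgroup.mem_carrier by metis
  have "conj_subset G W y \<subseteq> W" if "y \<in> X" for y
    using that assms by (auto simp: conj_subset_image subgroup.mem_carrier normalizesD)
  from this[of x] this[of "inv x"] have "conj_subset G W x \<subseteq> W" "conj_subset G W (inv x) \<subseteq> W"
    using assms by (auto simp: subgroup.m_inv_closed)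
  then show ?thesis
    using conj_subset_mono[of "conj_subset G W (inv x)" W x] assms xc by auto
qed

lemma normalizes_iff_conj:
  assumes "X \<subseteq> carrier G" "W \<subseteq> carrier G"
  shows "normalizes X W \<longleftrightarrow> (\<forall>x\<in>X. conj_subset G W x \<subseteq> W)"
  using assms by (auto simp: normalizes_def conj_subset_image subset_iff image_subset_iff)

lemma normalizes_conj:
  assumes "normalizes X W" "X \<subseteq> carrier G" "W \<subseteq> carrier G" "g \<in> carrier G"
  shows "normalizes (conj_subset G X g) (conj_subset G W g)"
  unfolding normalizes_def
proof (intro ballI)
  fix x' w' assume "x' \<in> conj_subset G X g" "w' \<in> conj_subset G W g"
  then obtain x w where xw: "x \<in> X" "w \<in> W" "x' = inv g \<otimes> x \<otimes> g" "w' = inv g \<otimes> w \<otimes> g"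
    using conj_subset_image[OF assms(2,4)] conj_subset_image[OF assms(3,4)] by blast
  have c: "x \<in> carrier G" "w \<in> carrier G" using xw(1,2) assms(2,3) by auto
  have "inv x' \<otimes> w' \<otimes> x' = inv g \<otimes> (inv x \<otimes> w \<otimes> x) \<otimes> g"
    unfolding xw using c assms(4) by (simp add: inv_mult_group m_assoc mult_inv_cancel)
  then show "inv x' \<otimes> w' \<otimes> x' \<in> conj_subset G W g"
    using normalizesD[OF assms(1) xw(1,2)] conj_subset_image[OF assms(3,4)] by blast
qed

text \<open>The bridge from normality in a restricted group to conditions in the one ambient group,
  where sections are treated as pairs of subgroups.\<close>

lemma normal_restrict_iff:
  assumes "subgroup H G"
  shows "N \<lhd> G\<lparr>carrier := H\<rparr> \<longleftrightarrow> subgroup N G \<and> N \<subseteq> H \<and> normalizes H N"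
proof -
  interpret H: group "G\<lparr>carrier := H\<rparr>" using assms by (rule subgroup_imp_group)
  have sub: "subgroup N (G\<lparr>carrier := H\<rparr>) \<longleftrightarrow> subgroup N G \<and> N \<subseteq> H"
  proof
    assume "subgroup N (G\<lparr>carrier := H\<rparr>)"
    then show "subgroup N G \<and> N \<subseteq> H"
      using incl_subgroup[OF assms] subgroup.subset by fastforce
  next
    assume "subgroup N G \<and> N \<subseteq> H"
    then show "subgroup N (G\<lparr>carrier := H\<rparr>)"
      using subgroup_incl assms by blast
  qed
  have "(\<forall>x\<in>H. \<forall>h\<in>N. x \<otimes> h \<otimes> inv\<^bsub>G\<lparr>carrier := H\<rparr>\<^esub> x \<in> N) \<longleftrightarrow> normalizes H N"
  proof -
    have "(\<forall>x\<in>H. \<forall>h\<in>N. x \<otimes> h \<otimes> inv\<^bsub>G\<lparr>carrier := H\<rparr>\<^esub> x \<in> N) \<longleftrightarrow> (\<forall>x\<in>H. \<forall>h\<in>N. x \<otimes> h \<otimes> inv x \<in> N)"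
      using assms by (simp add: m_inv_consistent)
    also have "\<dots> \<longleftrightarrow> normalizes H N"
    proof
      assume L: "\<forall>x\<in>H. \<forall>h\<in>N. x \<otimes> h \<otimes> inv x \<in> N"
      show "normalizes H N" unfolding normalizes_def
      proof (intro ballI)
        fix x w assume "x \<in> H" "w \<in> N"
        then show "inv x \<otimes> w \<otimes> x \<in> N"
          using L[rule_format, of "inv x" w] assms by (simp add: subgroup.m_inv_closed subgroup.mem_carrier)
      qed
    qed (auto intro: normalizesD' assms)
    finally show ?thesis .
  qed
  then show ?thesis
    using sub by (auto simp: H.normal_inv_iff)
qed

lemma normal_iff_normalizes: "N \<lhd> G \<longleftrightarrow> subgroup N G \<and> normalizes (carrier G) N"
  using normal_restrict_iff[OF subgroup_self] subgroup.subset[of N G] by auto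

text \<open>The \<open>normalizer\<close> is a stabilizer under x H inv x, whereas
  \<open>conj_subset\<close> has the inverse on the left; passing to \<open>inv x\<close> reconciles
  the two.\<close>

lemma mem_normalizer_iff:
  assumes "H \<subseteq> carrier G"
  shows "x \<in> normalizer G H \<longleftrightarrow> x \<in> carrier G \<and> conj_subset G H x = H"
proof -
  have *: "x <# H #> inv x = conj_subset G H (inv x)" if "x \<in> carrier G"
    using that by (simp add: conj_subset_def)
  have "x \<in> normalizer G H \<longleftrightarrow> x \<in> carrier G \<and> x <# H #> inv x = H"
    using assms by (auto simp: normalizer_def stabilizer_def)
  also have "\<dots> \<longleftrightarrow> x \<in> carrier G \<and> conj_subset G H (inv x) = H"
    using * by auto
  also have "\<dots> \<longleftrightarrow> x \<in> carrier G \<and> conj_subset G H x = H"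
    using assms conj_subset_inv by metis
  finally show ?thesis .
qed

lemma normalizer_subgroup:
  assumes "H \<subseteq> carrier G"
  shows "subgroup (normalizer G H) G"
proof
  show "normalizer G H \<subseteq> carrier G" using mem_normalizer_iff[OF assms] by auto
  show "\<one> \<in> normalizer G H" using mem_normalizer_iff[OF assms] conj_subset_one assms by auto
next
  fix x y assume "x \<in> normalizer G H" "y \<in> normalizer G H"
  then show "x \<otimes> y \<in> normalizer G H"
    using mem_normalizer_iff[OF assms] conj_subset_mult[OF assms, of x y] by auto
next
  fix x assume "x \<in> normalizer G H"
  then show "inv x \<in> normalizer G H"
    using mem_normalizer_iff[OF assms] conj_subset_inv(1)[OF assms, of x] by auto
qed

lemma subset_normalizer_iff:
  assumes "subgroup X G" "H \<subseteq> carrier G"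
  shows "X \<subseteq> normalizer G H \<longleftrightarrow> normalizes X H"
  using assms mem_normalizer_iff[OF assms(2)] conj_subset_normalizes[OF _ assms]
    normalizes_iff_conj[OF subgroup.subset[OF assms(1)] assms(2)] subgroup.mem_carrier[OF assms(1)]
  by blast

lemma normalizes_normalizer: "H \<subseteq> carrier G \<Longrightarrow> normalizes (normalizer G H) H"
  using subset_normalizer_iff[OF normalizer_subgroup] by blast

end

section \<open>Indices and products\<close>

text \<open>
  For subgroups \<open>B \<le> A\<close> this says that \<open>|A : B|\<close> is a \<open>\<rho>\<close>-number; with multiplicities neither
  division nor the inclusion is needed.
\<close>

definition index_in :: "nat set \<Rightarrow> 'a set \<Rightarrow> 'a set \<Rightarrow> bool" where
  "index_in \<rho> A B \<longleftrightarrow> (\<forall>p. prime p \<and> p \<notin> \<rho> \<longrightarrow> multiplicity p (card A) = multiplicity p (card B))"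

lemma index_inD: "index_in \<rho> A B \<Longrightarrow> prime p \<Longrightarrow> p \<notin> \<rho> \<Longrightarrow> multiplicity p (card A) = multiplicity p (card B)"
  by (auto simp: index_in_def)

lemma index_in_refl [simp]: "index_in \<rho> A A"
  by (simp add: index_in_def)

lemma index_in_trans: "index_in \<rho> A B \<Longrightarrow> index_in \<rho> B C \<Longrightarrow> index_in \<rho> A C"
  by (simp add: index_in_def)

lemma index_in_mono: "index_in \<rho> A B \<Longrightarrow> \<rho> \<subseteq> \<sigma> \<Longrightarrow> index_in \<sigma> A B"
  by (auto simp: index_in_def)

section \<open>Fixed points of p-group actions modulo p\<close>

context group_action
begin

text \<open>An orbit has size dividing \<open>p ^ n\<close>, so an orbit with more than one point
  vanishes modulo \<open>p\<close> and only fixed points are counted. This one congruence yields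
  Sylow conjugacy, the growth of normalizers and the centre of a p-group below.\<close>

lemma card_fixed_points_mod_prime:
  assumes p: "prime p" and order: "order G = p ^ n" and fin: "finite E"
  shows "card E mod p = card {x \<in> E. \<forall>g\<in>carrier G. \<phi> g x = x} mod p"
proof -
  let ?F = "{x \<in> E. \<forall>g\<in>carrier G. \<phi> g x = x}"
  have orb1: "card (orbit G \<phi> x) mod p = (if x \<in> ?F then 1 mod p else 0)" if x: "x \<in> E" for x
  proof (cases "x \<in> ?F")
    case True
    then have "orbit G \<phi> x = {x}"
      using orbit_refl[OF x] by (auto simp: orbit_def)
    then show ?thesis using True by simp
  next
    case False
    then obtain g where g: "g \<in> carrier G" "\<phi> g x \<noteq> x" using x by auto
    have "{x, \<phi> g x} \<subseteq> orbit G \<phi> x" using orbit_refl[OF x] g by (auto simp: orbit_def)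
    moreover have "finite (orbit G \<phi> x)"
      using orbits_coverture fin x by (metis (mono_tags, lifting) Union_upper finite_subset mem_Collect_eq orbits_def)
    ultimately have "card (orbit G \<phi> x) \<noteq> 1"
      using g by (metis card_1_singletonE insert_subset singletonD)
    moreover have "card (orbit G \<phi> x) dvd p ^ n"
      using orbit_stabilizer_theorem[OF x] order by (metis dvd_triv_left)
    ultimately have "p dvd card (orbit G \<phi> x)"
      by (metis divides_primepow_nat dvd_power not_gr_zero p power_0)
    then show ?thesis using False by auto
  qed
  have orbF: "orb \<subseteq> ?F \<or> orb \<inter> ?F = {}" if "orb \<in> orbits G E \<phi>" for orb
  proof -
    obtain x where x: "x \<in> E" "orb = orbit G \<phi> x" using \<open>orb \<in> orbits G E \<phi>\<close> by (auto simp: orbits_def)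
    have "orb = {y}" if y: "y \<in> orb" "y \<in> ?F" for y
    proof -
      have "orbit G \<phi> y = {y}" using y orbit_refl[of y] by (auto simp: orbit_def)
      moreover have "orbit G \<phi> y \<in> orbits G E \<phi>" using y by (auto simp: orbits_def)
      ultimately show ?thesis using disjoint_union[OF _ \<open>orb \<in> orbits G E \<phi>\<close>] y by blast
    qed
    then show ?thesis by blast
  qed
  have "card E = (\<Sum>x\<in>E. 1)" by simp
  also have "\<dots> = (\<Sum>orb\<in>orbits G E \<phi>. \<Sum>x\<in>orb. 1)"
    using disjoint_sum[OF fin, of "\<lambda>_. 1"] by (rule sym)
  finally have E: "card E = (\<Sum>orb\<in>orbits G E \<phi>. card orb)" by simp
  have "card ?F = (\<Sum>x\<in>E. if x \<in> ?F then 1 else 0)"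
    by (rule card_as_sums) (use fin in auto)
  also have "\<dots> = (\<Sum>orb\<in>orbits G E \<phi>. \<Sum>x\<in>orb. if x \<in> ?F then 1 else 0)"
    using disjoint_sum[OF fin, of "\<lambda>x. if x \<in> ?F then 1 else 0"] by (rule sym)
  finally have F: "card ?F = (\<Sum>orb\<in>orbits G E \<phi>. \<Sum>x\<in>orb. if x \<in> ?F then 1 else 0)" .
  have "card orb mod p = (\<Sum>x\<in>orb. if x \<in> ?F then 1 else 0) mod p" if orb: "orb \<in> orbits G E \<phi>" for orb
  proof -
    obtain x where x: "x \<in> E" "orb = orbit G \<phi> x" using orb by (auto simp: orbits_def)
    show ?thesis
    proof (cases "x \<in> ?F")
      case True
      then have "orb = {x}" using x orbit_refl[of x] by (auto simp: orbit_def)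
      then show ?thesis using True by simp
    next
      case False
      have "x \<in> orb" using x orbit_refl by auto
      then have "orb \<inter> ?F = {}" using orbF[OF orb] False by blast
      then have "(\<Sum>x\<in>orb. if x \<in> ?F then 1 else 0) = (0::nat)"
        by (intro sum.neutral) auto
      then show ?thesis using orb1[OF x(1)] False x by auto
    qed
  qed
  then have "(\<Sum>orb\<in>orbits G E \<phi>. card orb mod p) mod p
      = (\<Sum>orb\<in>orbits G E \<phi>. (\<Sum>x\<in>orb. if x \<in> ?F then 1 else 0) mod p) mod p"
    by (simp only: cong: sum.cong)
  then show ?thesis unfolding E F by (simp only: mod_sum_eq)
qed

end

text \<open>An action is a homomorphism into \<open>BijGroup E\<close>, whose elements are
  extensional functions; hence the restriction to \<open>E\<close>.\<close>

lemma (in group) group_actionI: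
  assumes closed: "\<And>g x. g \<in> carrier G \<Longrightarrow> x \<in> E \<Longrightarrow> act g x \<in> E"
    and one: "\<And>x. x \<in> E \<Longrightarrow> act \<one> x = x"
    and mult: "\<And>g h x. g \<in> carrier G \<Longrightarrow> h \<in> carrier G \<Longrightarrow> x \<in> E \<Longrightarrow> act (g \<otimes> h) x = act g (act h x)"
  shows "group_action G E (\<lambda>g. restrict (act g) E)"
proof -
  have bij: "restrict (act g) E \<in> Bij E" if g: "g \<in> carrier G" for g
  proof -
    have "bij_betw (act g) E E"
      by (rule bij_betw_byWitness[where f' = "act (inv g)"])
         (use g closed one mult[of "inv g" g] mult[of g "inv g"] in auto)
    then have "bij_betw (restrict (act g) E) E E"
      by (simp add: bij_betw_def inj_on_def)
    then show ?thesis by (simp add: Bij_def)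
  qed
  have "(\<lambda>g. restrict (act g) E) \<in> hom G (BijGroup E)"
  proof (rule homI)
    fix g h assume gh: "g \<in> carrier G" "h \<in> carrier G"
    have "restrict (act (g \<otimes> h)) E = compose E (restrict (act g) E) (restrict (act h) E)"
      using gh mult closed by (auto simp: compose_def restrict_def)
    then show "restrict (act (g \<otimes> h)) E = restrict (act g) E \<otimes>\<^bsub>BijGroup E\<^esub> restrict (act h) E"
      using bij gh by (simp add: BijGroup_def)
  qed (use bij in \<open>simp add: BijGroup_def\<close>)
  then show ?thesis
    by (simp add: group_action_def group_hom_def group_BijGroup group_hom_axioms_def)
qed

section \<open>Orders of subgroups and of products of subgroups\<close>

context fin_group
begin

lemma subgroup_finite: "subgroup A G \<Longrightarrow> finite A"
  using fin finite_subset subgroup.subset by blast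

lemma subgroup_card_pos: "subgroup A G \<Longrightarrow> card A > 0"
  using subgroup_finite subgroup.one_closed by (metis card_gt_0_iff empty_iff)

lemma card_subgroup_dvd:
  assumes "subgroup A G" "subgroup B G" "A \<subseteq> B"
  shows "card A dvd card B"
proof -
  interpret B: group "G\<lparr>carrier := B\<rparr>" using assms(2) by (rule subgroup_imp_group)
  have "subgroup A (G\<lparr>carrier := B\<rparr>)" using assms subgroup_incl by blast
  from B.lagrange[OF this] have "card (rcosets\<^bsub>G\<lparr>carrier := B\<rparr>\<^esub> A) * card A = card B"
    by (simp add: order_def)
  then show ?thesis by (metis dvd_triv_right)
qed

lemma multiplicity_card_mono:
  assumes "subgroup A G" "subgroup B G" "A \<subseteq> B"
  shows "multiplicity p (card A) \<le> multiplicity p (card B)"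
  using dvd_imp_multiplicity_le[OF card_subgroup_dvd[OF assms]] subgroup_card_pos[OF assms(2)] by simp

lemma subgroup_eqI:
  assumes "subgroup A G" "subgroup B G" "A \<subseteq> B"
    and "\<And>p. prime p \<Longrightarrow> multiplicity p (card A) = multiplicity p (card B)"
  shows "A = B"
  using assms multiplicity_eq_nat[of "card A" "card B"] subgroup_card_pos card_subset_eq[of B A] subgroup_finite
  by metis

lemma subgroup_Int: "subgroup A G \<Longrightarrow> subgroup B G \<Longrightarrow> subgroup (A \<inter> B) G"
  by (rule subgroups_Inter_pair)

text \<open>Counts \<open>A \<times> B\<close> along the multiplication map: all fibres have as many
  elements as \<open>A \<inter> B\<close>, whether or not the product set is a subgroup.\<close>

lemma card_set_mult:
  assumes A: "subgroup A G" and B: "subgroup B G"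
  shows "card (A <#> B) * card (A \<inter> B) = card A * card B"
proof -
  interpret A: subgroup A G by fact
  interpret B: subgroup B G by fact
  let ?f = "\<lambda>(a, b). a \<otimes> b"
  have im: "?f ` (A \<times> B) = A <#> B" by (auto simp: set_mult_def)
  have fibre: "card {z \<in> A \<times> B. ?f z = y} = card (A \<inter> B)" if "y \<in> A <#> B" for y
  proof -
    obtain a b where ab: "a \<in> A" "b \<in> B" "y = a \<otimes> b" using \<open>y \<in> A <#> B\<close> by (auto simp: set_mult_def)
    \<comment> \<open>The pairs with product \<open>a \<otimes> b\<close> arise from
      \<open>(a, b)\<close> by moving an element \<open>d\<close> of both subgroups across the
      product sign.\<close>
    have "bij_betw (\<lambda>d. (a \<otimes> d, inv d \<otimes> b)) (A \<inter> B) {z \<in> A \<times> B. ?f z = y}"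
    proof (rule bij_betwI[where g = "\<lambda>z. inv a \<otimes> fst z"])
      show "(\<lambda>d. (a \<otimes> d, inv d \<otimes> b)) \<in> A \<inter> B \<rightarrow> {z \<in> A \<times> B. ?f z = y}"
        using ab by (auto simp: m_assoc mult_inv_cancel)
      show "(\<lambda>z. inv a \<otimes> fst z) \<in> {z \<in> A \<times> B. ?f z = y} \<rightarrow> A \<inter> B"
      proof (rule funcsetI, clarify)
        fix a' b' assume *: "a' \<in> A" "b' \<in> B" "y = a' \<otimes> b'"
        have "inv a \<otimes> a' = b \<otimes> inv b'"
        proof -
          have "a' \<otimes> b' = a \<otimes> b" using * ab by simp
          then have "inv a \<otimes> (a' \<otimes> b') = b" using ab * by (simp add: mult_inv_cancel)
          then have "inv a \<otimes> a' \<otimes> b' \<otimes> inv b' = b \<otimes> inv b'" using ab * by (simp add: m_assoc)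
          then show ?thesis using ab * by (simp add: m_assoc)
        qed
        moreover have "inv a \<otimes> a' \<in> A" "b \<otimes> inv b' \<in> B" using * ab by auto
        ultimately show "inv a \<otimes> fst (a', b') \<in> A \<inter> B" by simp
      qed
      show "inv a \<otimes> fst (a \<otimes> d, inv d \<otimes> b) = d" if "d \<in> A \<inter> B" for d
        using that ab by (simp add: mult_inv_cancel)
      show "(a \<otimes> (inv a \<otimes> fst z), inv (inv a \<otimes> fst z) \<otimes> b) = z" if zz: "z \<in> {z \<in> A \<times> B. ?f z = y}" for z
      proof -
        obtain a' b' where z: "z = (a', b')" "a' \<in> A" "b' \<in> B" "a' \<otimes> b' = a \<otimes> b"
          using zz ab by (cases z) auto
        have "inv a' \<otimes> (a \<otimes> b) = b'" using z(2,3) unfolding z(4)[symmetric] by (simp add: mult_inv_cancel)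
        moreover have "a \<in> carrier G" "b \<in> carrier G" "a' \<in> carrier G" using z ab by auto
        ultimately show ?thesis unfolding z(1) by (simp add: mult_inv_cancel inv_mult_group m_assoc)
      qed
    qed
    from bij_betw_same_card[OF this] show ?thesis by (rule sym)
  qed
  have "card A * card B = card (A \<times> B)" by (simp add: card_cartesian_product)
  also have "\<dots> = (\<Sum>y\<in>A <#> B. card {z \<in> A \<times> B. ?f z = y})"
    using sum.image_gen[of "A \<times> B" "\<lambda>_. 1::nat" ?f] subgroup_finite[OF A] subgroup_finite[OF B] im by simp
  also have "\<dots> = card (A <#> B) * card (A \<inter> B)" using fibre by simp
  finally show ?thesis by simp
qed

lemma multiplicity_set_mult:
  assumes "subgroup A G" "subgroup B G" "prime p"
  shows "multiplicity p (card (A <#> B)) + multiplicity p (card (A \<inter> B))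
    = multiplicity p (card A) + multiplicity p (card B)"
proof -
  have "card (A <#> B) \<noteq> 0"
    using card_set_mult[OF assms(1,2)] subgroup_card_pos assms by (metis mult_is_0 not_less_zero)
  then show ?thesis
    using card_set_mult[OF assms(1,2)] subgroup_card_pos[OF subgroup_Int[OF assms(1,2)]]
      subgroup_card_pos[OF assms(1)] subgroup_card_pos[OF assms(2)] assms(3)
    by (metis less_irrefl_nat prime_elem_multiplicity_mult_distrib prime_imp_prime_elem)
qed

end

section \<open>Products of two subgroups, one normalizing the other\<close>

context group
begin

lemma set_mult_incl:
  assumes "subgroup A G" "subgroup B G"
  shows "A \<subseteq> A <#> B" "B \<subseteq> A <#> B"
proof -
  show "A \<subseteq> A <#> B"
    using assms subgroup.one_closed[OF assms(2)] subgroup.mem_carrier[OF assms(1)]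
    by (force simp: set_mult_def)
  show "B \<subseteq> A <#> B"
    using assms subgroup.one_closed[OF assms(1)] subgroup.mem_carrier[OF assms(2)]
    by (force simp: set_mult_def)
qed

lemma set_mult_least:
  assumes "subgroup C G" "A \<subseteq> C" "B \<subseteq> C"
  shows "A <#> B \<subseteq> C"
  using assms by (auto simp: set_mult_def subset_iff subgroup.m_closed)

lemma set_mult_subgroup:
  assumes A: "subgroup A G" and B: "subgroup B G" and n: "normalizes A B"
  shows "subgroup (A <#> B) G"
proof (rule subgroupI)
  interpret A: subgroup A G by fact
  interpret B: subgroup B G by fact
  show "A <#> B \<subseteq> carrier G" by (auto simp: set_mult_def)
  show "A <#> B \<noteq> {}" using A.one_closed B.one_closed unfolding set_mult_def by blast
  fix x assume "x \<in> A <#> B"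
  then obtain a b where x: "a \<in> A" "b \<in> B" "x = a \<otimes> b" by (auto simp: set_mult_def)
  have "inv x = inv a \<otimes> (a \<otimes> inv b \<otimes> inv a)"
    using x by (simp add: inv_mult_group m_assoc mult_inv_cancel)
  then show "inv x \<in> A <#> B"
    using normalizesD'[OF n A x(1), of "inv b"] x by (auto simp: set_mult_def)
  fix y assume "y \<in> A <#> B"
  then obtain a' b' where y: "a' \<in> A" "b' \<in> B" "y = a' \<otimes> b'" by (auto simp: set_mult_def)
  have "x \<otimes> y = (a \<otimes> a') \<otimes> ((inv a' \<otimes> b \<otimes> a') \<otimes> b')"
    using x y by (simp add: m_assoc mult_inv_cancel)
  then show "x \<otimes> y \<in> A <#> B"
    using normalizesD[OF n y(1) x(2)] x y by (auto simp: set_mult_def)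
qed

text \<open>Dedekind's modular law: if \<open>a \<otimes> b\<close> and \<open>a\<close> lie in
  \<open>C\<close>, so does \<open>b\<close>.\<close>

lemma set_mult_modular:
  assumes "subgroup A G" "subgroup C G" "A \<subseteq> C" "B \<subseteq> carrier G"
  shows "(A <#> B) \<inter> C = A <#> (B \<inter> C)"
proof
  show "(A <#> B) \<inter> C \<subseteq> A <#> (B \<inter> C)"
  proof
    fix x assume "x \<in> (A <#> B) \<inter> C"
    then obtain a b where x: "a \<in> A" "b \<in> B" "x = a \<otimes> b" "x \<in> C" by (auto simp: set_mult_def)
    have "b = inv a \<otimes> x" using x assms by (metis mult_inv_cancel(2) subgroup.mem_carrier subsetD)
    then have "b \<in> C" using x assms by (metis subgroup.m_closed subgroup.m_inv_closed subsetD)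
    then show "x \<in> A <#> (B \<inter> C)" using x by (auto simp: set_mult_def)
  qed
  show "A <#> (B \<inter> C) \<subseteq> (A <#> B) \<inter> C"
    using assms by (auto simp: set_mult_def subset_iff subgroup.m_closed)
qed

lemma set_mult_normal_commute:
  assumes A: "subgroup A G" and B: "subgroup B G" and n: "normalizes A B"
  shows "A <#> B = B <#> A"
proof -
  interpret A: subgroup A G by fact
  interpret B: subgroup B G by fact
  have "a \<otimes> b = (a \<otimes> b \<otimes> inv a) \<otimes> a" "b \<otimes> a = a \<otimes> (inv a \<otimes> b \<otimes> a)" if "a \<in> A" "b \<in> B" for a b
    using that by (simp_all add: m_assoc mult_inv_cancel)
  then show ?thesis
    using normalizesD[OF n] normalizesD'[OF n A] by (auto simp: set_mult_def) metis+
qed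

lemma normalizes_set_mult:
  assumes "normalizes X A" "normalizes X B" "X \<subseteq> carrier G" "A \<subseteq> carrier G" "B \<subseteq> carrier G"
  shows "normalizes X (A <#> B)"
  unfolding normalizes_def
proof (intro ballI)
  fix x w assume x: "x \<in> X" and "w \<in> A <#> B"
  then obtain a b where w: "a \<in> A" "b \<in> B" "w = a \<otimes> b" by (auto simp: set_mult_def)
  have "x \<in> carrier G" "a \<in> carrier G" "b \<in> carrier G" using w x assms by auto
  then have "inv x \<otimes> w \<otimes> x = (inv x \<otimes> a \<otimes> x) \<otimes> (inv x \<otimes> b \<otimes> x)"
    unfolding w by (simp add: m_assoc mult_inv_cancel)
  then show "inv x \<otimes> w \<otimes> x \<in> A <#> B"
    using normalizesD[OF assms(1) x w(1)] normalizesD[OF assms(2) x w(2)] by (auto simp: set_mult_def)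
qed

lemma normalizes_by_set_mult:
  assumes "normalizes A W" "normalizes B W" "A \<subseteq> carrier G" "B \<subseteq> carrier G" "W \<subseteq> carrier G"
  shows "normalizes (A <#> B) W"
  unfolding normalizes_def
proof (intro ballI)
  fix x w assume w: "w \<in> W" and "x \<in> A <#> B"
  then obtain a b where x: "a \<in> A" "b \<in> B" "x = a \<otimes> b" by (auto simp: set_mult_def)
  have "w \<in> carrier G" "a \<in> carrier G" "b \<in> carrier G" using w x assms by auto
  then have "inv x \<otimes> w \<otimes> x = inv b \<otimes> (inv a \<otimes> w \<otimes> a) \<otimes> b"
    unfolding x by (simp add: m_assoc inv_mult_group)
  then show "inv x \<otimes> w \<otimes> x \<in> W"
    using normalizesD[OF assms(2) x(2) normalizesD[OF assms(1) x(1) w]] by simp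
qed

end

section \<open>Arithmetic of indices\<close>

context fin_group
begin

text \<open>Multiplicities can only grow along inclusions, so equality at the two ends forces
  equality in between.\<close>

lemma index_in_sandwich:
  assumes "subgroup A G" "subgroup B G" "subgroup C G" "C \<subseteq> B" "B \<subseteq> A" "index_in \<rho> A C"
  shows "index_in \<rho> A B" "index_in \<rho> B C"
  using multiplicity_card_mono[OF assms(3,2,4)] multiplicity_card_mono[OF assms(2,1,5)] assms(6)
  unfolding index_in_def by (metis le_antisym)+

text \<open>The second isomorphism theorem, as far as orders see it: |T K : K| = |T : T \<inter>
  K|.\<close>

lemma index_in_set_mult_iff:
  assumes "subgroup T G" "subgroup K G"
  shows "index_in \<rho> (T <#> K) K \<longleftrightarrow> index_in \<rho> T (T \<inter> K)"
  using multiplicity_set_mult[OF assms] unfolding index_in_def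
  by (metis add.commute add_left_cancel)

text \<open>The index |T : T \<inter> K| is |T K : K|, which divides |J : K|. In this form sections
  are intersected with subgroups throughout.\<close>

lemma index_in_Int:
  assumes "subgroup J G" "subgroup K G" "subgroup T G" "K \<subseteq> J" "T \<subseteq> J" "normalizes T K" "index_in \<rho> J K"
  shows "index_in \<rho> T (T \<inter> K)"
proof -
  have s: "subgroup (T <#> K) G" using assms set_mult_subgroup by blast
  have "T <#> K \<subseteq> J" by (rule set_mult_least) (use assms in auto)
  then have "index_in \<rho> (T <#> K) K"
    using index_in_sandwich(2)[OF assms(1) s assms(2)] set_mult_incl[OF assms(3,2)] assms by blast
  then show ?thesis using index_in_set_mult_iff assms by blast
qed

lemma index_in_conj:
  "A \<subseteq> carrier G \<Longrightarrow> B \<subseteq> carrier G \<Longrightarrow> x \<in> carrier G \<Longrightarrow>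
    index_in \<rho> (conj_subset G A x) (conj_subset G B x) \<longleftrightarrow> index_in \<rho> A B"
  by (simp add: index_in_def card_conj_subset)

text \<open>An index made of primes from two disjoint sets is 1. Many equalities of subgroups below
  are obtained this way, where an argument in quotient groups would speak of coprime orders.\<close>

lemma index_in_disjoint_eq:
  assumes "subgroup A G" "subgroup B G" "B \<subseteq> A" "index_in \<rho> A B" "index_in \<sigma> A B" "\<rho> \<inter> \<sigma> = {}"
  shows "A = B"
  using subgroup_eqI[OF assms(2,1,3)] assms(4-6) unfolding index_in_def by (metis disjoint_iff)

lemma rcosets_restrict:
  "rcosets\<^bsub>G\<lparr>carrier := J\<rparr>\<^esub> A = (\<lambda>x. A #> x) ` J"
  by (auto simp: RCOSETS_def r_coset_def)

lemma card_rcosets_restrict: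
  assumes "subgroup A G" "subgroup J G" "A \<subseteq> J"
  shows "card ((\<lambda>x. A #> x) ` J) * card A = card J"
proof -
  interpret J: group "G\<lparr>carrier := J\<rparr>" using assms(2) by (rule subgroup_imp_group)
  have "subgroup A (G\<lparr>carrier := J\<rparr>)" using assms subgroup_incl by blast
  from J.lagrange[OF this] show ?thesis by (simp add: order_def rcosets_restrict)
qed

text \<open>The action is by right multiplication on the cosets of \<open>A\<close> in
  \<open>J\<close>. The inverse inserted in the proof makes it a left action; it does not change the
  fixed points.\<close>

lemma card_fixed_cosets:
  assumes p: "prime p" and P: "subgroup P G" "card P = p ^ n"
    and A: "subgroup A G" and J: "subgroup J G" and sub: "A \<subseteq> J" "P \<subseteq> J"
  shows "card ((\<lambda>x. A #> x) ` J) mod p = card {c \<in> (\<lambda>x. A #> x) ` J. \<forall>g\<in>P. c #> g = c} mod p"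
proof -
  interpret P: group "G\<lparr>carrier := P\<rparr>" using P(1) by (rule subgroup_imp_group)
  interpret A: subgroup A G by fact
  interpret J: subgroup J G by fact
  let ?E = "(\<lambda>x. A #> x) ` J"
  have Pc: "g \<in> carrier G" if "g \<in> P" for g using that P subgroup.mem_carrier by metis
  have "group_action (G\<lparr>carrier := P\<rparr>) ?E (\<lambda>g. restrict (\<lambda>c. c #> inv g) ?E)"
  proof (rule P.group_actionI)
    fix g c assume g: "g \<in> carrier (G\<lparr>carrier := P\<rparr>)" and "c \<in> ?E"
    then obtain x where x: "x \<in> J" "c = A #> x" by auto
    have "c #> inv g = A #> (x \<otimes> inv g)" using g x Pc by (simp add: coset_mult_assoc A.subset)
    then show "c #> inv g \<in> ?E" using g x sub by auto
  next
    fix c assume "c \<in> ?E"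
    then show "c #> inv \<one>\<^bsub>G\<lparr>carrier := P\<rparr>\<^esub> = c" using A.subset by (auto simp: coset_mult_assoc)
  next
    fix g h c assume gh: "g \<in> carrier (G\<lparr>carrier := P\<rparr>)" "h \<in> carrier (G\<lparr>carrier := P\<rparr>)" and "c \<in> ?E"
    then obtain x where x: "x \<in> J" "c = A #> x" by auto
    then show "c #> inv (g \<otimes>\<^bsub>G\<lparr>carrier := P\<rparr>\<^esub> h) = c #> inv h #> inv g"
      using gh Pc A.subset by (simp add: coset_mult_assoc inv_mult_group m_assoc)
  qed
  then interpret act: group_action "G\<lparr>carrier := P\<rparr>" ?E "\<lambda>g. restrict (\<lambda>c. c #> inv g) ?E" .
  have "{c \<in> ?E. \<forall>g\<in>carrier (G\<lparr>carrier := P\<rparr>). restrict (\<lambda>c. c #> inv g) ?E c = c} = {c \<in> ?E. \<forall>g\<in>P. c #> g = c}"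
  proof -
    have "(\<forall>g\<in>P. c #> inv g = c) \<longleftrightarrow> (\<forall>g\<in>P. c #> g = c)" for c
      using subgroup.m_inv_closed[OF P(1)] Pc by (metis inv_inv)
    then show ?thesis by auto
  qed
  moreover have "finite ?E" using subgroup_finite[OF J] by simp
  moreover have "order (G\<lparr>carrier := P\<rparr>) = p ^ n" using P by (simp add: order_def)
  ultimately show ?thesis using act.card_fixed_points_mod_prime[OF p] by metis
qed

text \<open>Turns a fixed coset into a conjugation: a subgroup fixes \<open>A #> x\<close> exactly
  when its conjugate under \<open>inv x\<close> lies in \<open>A\<close>.\<close>

lemma rcoset_fixed_iff:
  assumes A: "subgroup A G" and "x \<in> carrier G" "g \<in> carrier G"
  shows "A #> x #> g = A #> x \<longleftrightarrow> x \<otimes> g \<otimes> inv x \<in> A"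
proof -
  interpret A: subgroup A G by fact
  have "A #> x #> g = A #> x \<longleftrightarrow> A #> (x \<otimes> g) = A #> x" using assms A.subset by (simp add: coset_mult_assoc)
  also have "\<dots> \<longleftrightarrow> x \<otimes> g \<in> A #> x"
    using assms A rcos_self repr_independence by (metis m_closed A.subset)
  also have "\<dots> \<longleftrightarrow> x \<otimes> g \<otimes> inv x \<in> A"
    using A.rcos_module[of x "x \<otimes> g"] assms by auto
  finally show ?thesis .
qed

end

lemma (in group) normalizesI_commuting:
  assumes "\<And>x w. x \<in> X \<Longrightarrow> w \<in> W \<Longrightarrow> x \<otimes> w = w \<otimes> x" "X \<subseteq> carrier G" "W \<subseteq> carrier G"
  shows "normalizes X W"
  unfolding normalizes_def
proof (intro ballI)
  fix x w assume xw: "x \<in> X" "w \<in> W"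
  then have "x \<in> carrier G" "w \<in> carrier G" using assms by auto
  moreover from this have "inv x \<otimes> w \<otimes> x = inv x \<otimes> (x \<otimes> w)" using assms(1)[OF xw] by (simp add: m_assoc)
  ultimately show "inv x \<otimes> w \<otimes> x \<in> W" using xw by (simp add: mult_inv_cancel)
qed

context fin_group
begin

section \<open>Relative Sylow theory\<close>

lemma sylow_exists:
  assumes p: "prime p" and J: "subgroup J G"
  obtains P where "subgroup P G" "P \<subseteq> J" "card P = p ^ multiplicity p (card J)"
proof -
  interpret J: group "G\<lparr>carrier := J\<rparr>" using J by (rule subgroup_imp_group)
  have "p ^ multiplicity p (card J) dvd card J" by (rule multiplicity_dvd)
  then obtain m where "card J = p ^ multiplicity p (card J) * m" by (auto elim: dvdE)
  then have "order (G\<lparr>carrier := J\<rparr>) = p ^ multiplicity p (card J) * m" by (simp add: order_def)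
  from sylow_thm[OF p J.is_group this] obtain P
    where P: "subgroup P (G\<lparr>carrier := J\<rparr>)" "card P = p ^ multiplicity p (card J)"
    using subgroup_finite[OF J] by auto
  have "P \<subseteq> J" using subgroup.subset[OF P(1)] by simp
  then show thesis using that P incl_subgroup[OF J P(1)] by blast
qed

lemma multiplicity_prime_power: "prime p \<Longrightarrow> multiplicity p (p ^ n) = n" for p :: nat
  by (simp add: multiplicity_same_power prime_gt_0_nat)

lemma multiplicity_distinct_prime_power: "prime p \<Longrightarrow> prime q \<Longrightarrow> p \<noteq> q \<Longrightarrow> multiplicity q (p ^ n) = 0" for p q :: nat
  by (metis multiplicity_distinct_prime_power)

text \<open>The number of cosets of \<open>P\<close> in \<open>J\<close> is prime to
  \<open>p\<close>, so the p-group \<open>S\<close> fixes one of them, and a fixed coset puts a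
  conjugate of \<open>S\<close> into \<open>P\<close>.\<close>

lemma sylow_dominates:
  assumes p: "prime p" and J: "subgroup J G"
    and P: "subgroup P G" "P \<subseteq> J" "card P = p ^ multiplicity p (card J)"
    and S: "subgroup S G" "S \<subseteq> J" "card S = p ^ n"
  obtains x where "x \<in> J" "conj_subset G S x \<subseteq> P"
proof -
  let ?E = "(\<lambda>x. P #> x) ` J"
  have "card ?E * card P = card J" by (rule card_rcosets_restrict) fact+
  then have "multiplicity p (card ?E) + multiplicity p (card P) = multiplicity p (card J)"
    using subgroup_card_pos[OF J] p
    by (metis mult_is_0 not_less_zero prime_elem_multiplicity_mult_distrib prime_imp_prime_elem)
  then have "multiplicity p (card ?E) = 0" using P(3) multiplicity_prime_power[OF p] by simp
  moreover have "card ?E \<noteq> 0" using \<open>card ?E * card P = card J\<close> subgroup_card_pos[OF J] by (metis mult_0 less_irrefl)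
  ultimately have "card ?E mod p \<noteq> 0"
    using p prime_multiplicity_gt_zero_iff[of p "card ?E"] by (metis dvd_eq_mod_eq_0 less_irrefl prime_imp_prime_elem)
  then have "card {c \<in> ?E. \<forall>g\<in>S. c #> g = c} mod p \<noteq> 0"
    using card_fixed_cosets[OF p S(1,3) P(1) J P(2) S(2)] by simp
  then have "card {c \<in> ?E. \<forall>g\<in>S. c #> g = c} \<noteq> 0" by (metis mod_0)
  then have "{c \<in> ?E. \<forall>g\<in>S. c #> g = c} \<noteq> {}" by (metis card.empty)
  then obtain x where x: "x \<in> J" "\<forall>g\<in>S. P #> x #> g = P #> x" by blast
  have xc: "x \<in> carrier G" using x(1) J subgroup.mem_carrier by metis
  have "x \<otimes> g \<otimes> inv x \<in> P" if "g \<in> S" for g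
    using rcoset_fixed_iff[OF P(1) xc, of g] x(2) that subgroup.mem_carrier[OF S(1)] by blast
  then have "conj_subset G S (inv x) \<subseteq> P"
    using conj_subset_image[OF subgroup.subset[OF S(1)], of "inv x"] xc by auto
  then show thesis using that[of "inv x"] x(1) J by (simp add: subgroup.m_inv_closed)
qed

lemma normal_Int_set_mult:
  assumes "subgroup J G" "subgroup W G" "normalizes J W" "W \<subseteq> J" "subgroup P G" "P \<subseteq> J"
  shows "subgroup (P <#> W) G" "P <#> W \<subseteq> J"
  using assms set_mult_subgroup[OF assms(5,2)] normalizes_mono[of J W P] set_mult_least[of J P W] by blast+

text \<open>The product has the full p-part of \<open>S\<close> because of \<open>P\<close>, and the
  part for all other primes because of \<open>W\<close>.\<close>

lemma p_section_generated:
  assumes p: "prime p" and J: "subgroup S G" and W: "subgroup W G" "W \<subseteq> S" "normalizes S W"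
    and ind: "index_in {p} S W" and P: "subgroup P G" "P \<subseteq> S" "card P = p ^ multiplicity p (card S)"
  shows "P <#> W = S"
proof (rule subgroup_eqI)
  show sub: "subgroup (P <#> W) G" and le: "P <#> W \<subseteq> S"
    using normal_Int_set_mult[OF J W(1,3,2) P(1,2)] by auto
  show "subgroup S G" by fact
  fix q :: nat assume q: "prime q"
  have 1: "multiplicity q (card (P <#> W)) \<le> multiplicity q (card S)"
    by (rule multiplicity_card_mono[OF sub J le])
  have 2: "multiplicity q (card W) \<le> multiplicity q (card (P <#> W))"
    by (rule multiplicity_card_mono[OF W(1) sub]) (rule set_mult_incl[OF P(1) W(1)])
  have 3: "multiplicity q (card P) \<le> multiplicity q (card (P <#> W))"
    by (rule multiplicity_card_mono[OF P(1) sub]) (rule set_mult_incl[OF P(1) W(1)])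
  show "multiplicity q (card (P <#> W)) = multiplicity q (card S)"
  proof (cases "q = p")
    case True
    then show ?thesis using 1 3 P(3) multiplicity_prime_power[OF p] by simp
  next
    case False
    then show ?thesis using 1 2 index_inD[OF ind q] by simp
  qed
qed

text \<open>\<open>Q\<close> is the preimage of a Sylow p-subgroup of \<open>J/W\<close>, obtained
  as \<open>P <#> W\<close> from a Sylow p-subgroup \<open>P\<close> of \<open>J\<close>.\<close>

lemma relative_sylow_exists:
  assumes p: "prime p" and J: "subgroup J G" and W: "subgroup W G" "W \<subseteq> J" "normalizes J W"
  obtains Q where "subgroup Q G" "W \<subseteq> Q" "Q \<subseteq> J" "index_in {p} Q W" "index_in (- {p}) J Q"
proof -
  obtain P where P: "subgroup P G" "P \<subseteq> J" "card P = p ^ multiplicity p (card J)"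
    using sylow_exists[OF p J] .
  note PW = normal_Int_set_mult[OF J W(1,3,2) P(1,2)]
  have "index_in {p} P (P \<inter> W)"
    unfolding index_in_def
  proof (intro allI impI)
    fix q :: nat assume "prime q \<and> q \<notin> {p}"
    then have "multiplicity q (card P) = 0" using P(3) multiplicity_distinct_prime_power[OF p, of q] by simp
    then show "multiplicity q (card P) = multiplicity q (card (P \<inter> W))"
      using multiplicity_card_mono[of "P \<inter> W" P q] subgroup_Int P(1) W(1) by fastforce
  qed
  then have 1: "index_in {p} (P <#> W) W" using index_in_set_mult_iff[OF P(1) W(1)] by blast
  have "multiplicity p (card (P <#> W)) = multiplicity p (card J)"
    using multiplicity_card_mono[OF PW(1) J PW(2), of p]
      multiplicity_card_mono[OF P(1) PW(1) set_mult_incl(1)[OF P(1) W(1)], of p] P(3) multiplicity_prime_power[OF p]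
    by simp
  then have 2: "index_in (- {p}) J (P <#> W)" by (simp add: index_in_def)
  show thesis using that[OF PW(1) set_mult_incl(2)[OF P(1) W(1)] PW(2) 1 2] .
qed

text \<open>Sylow's theorem for \<open>J/W\<close>. A Sylow p-subgroup \<open>T\<close> of
  \<open>S\<close> is moved into one of \<open>Q\<close>, and \<open>S = T <#> W\<close> follows it
  because \<open>W\<close> is invariant under \<open>J\<close>.\<close>

lemma relative_sylow_dominates:
  assumes p: "prime p" and J: "subgroup J G" and W: "subgroup W G" "normalizes J W"
    and Q: "subgroup Q G" "W \<subseteq> Q" "Q \<subseteq> J" "index_in (- {p}) J Q"
    and S: "subgroup S G" "W \<subseteq> S" "S \<subseteq> J" "index_in {p} S W"
  obtains x where "x \<in> J" "conj_subset G S x \<subseteq> Q"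
proof -
  obtain P where P: "subgroup P G" "P \<subseteq> Q" "card P = p ^ multiplicity p (card Q)"
    using sylow_exists[OF p Q(1)] .
  obtain T where T: "subgroup T G" "T \<subseteq> S" "card T = p ^ multiplicity p (card S)"
    using sylow_exists[OF p S(1)] .
  have "card P = p ^ multiplicity p (card J)" using P(3) index_inD[OF Q(4) p] by simp
  then obtain x where x: "x \<in> J" "conj_subset G T x \<subseteq> P"
    using sylow_dominates[OF p J P(1) _ _ T(1) _ T(3)] P(2) T(2) Q(3) S(3) by (metis subset_trans)
  have xc: "x \<in> carrier G" using x(1) J subgroup.mem_carrier by metis
  have TW: "T <#> W = S"
    by (rule p_section_generated[OF p S(1) W(1) S(2) _ S(4) T]) (rule normalizes_mono[OF W(2) S(3)])
  have "conj_subset G W x = W" by (rule conj_subset_normalizes[OF W(2) J subgroup.subset[OF W(1)] x(1)])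
  moreover have "T <#> W \<subseteq> conj_subset G Q (inv x)"
  proof (rule set_mult_least)
    show "subgroup (conj_subset G Q (inv x)) G" using Q(1) xc by (intro conj_subset_subgroup) auto
    have *: "A \<subseteq> conj_subset G Q (inv x)" if "conj_subset G A x \<subseteq> Q" "A \<subseteq> carrier G" for A
      using conj_subset_mono[OF that(1) subgroup.subset[OF Q(1)], of "inv x"] that(2) xc by simp
    show "T \<subseteq> conj_subset G Q (inv x)" using x(2) P(2) subgroup.subset[OF T(1)] by (intro *) auto
    show "W \<subseteq> conj_subset G Q (inv x)"
      using Q(2) \<open>conj_subset G W x = W\<close> subgroup.subset[OF W(1)] by (intro *) auto
  qed
  ultimately have "conj_subset G S x \<subseteq> Q"
    using conj_subset_mono[of S "conj_subset G Q (inv x)" x] TW xc subgroup.subset[OF Q(1)]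
      conj_subset_carrier[of Q "inv x"] by simp
  then show thesis using that x(1) by blast
qed

text \<open>A Sylow subgroup \<open>P\<close> of \<open>A\<close> acts on the cosets of
  \<open>A\<close> in \<open>J\<close>. Their number is divisible by \<open>p\<close> and the coset
  \<open>A\<close> is fixed, so a second coset \<open>A #> x\<close> is fixed as well; then
  \<open>x\<close> normalizes \<open>A = P <#> W\<close> without lying in it. This is the normalizer
  condition in the p-group \<open>J/W\<close>.\<close>

lemma normalizer_grows:
  assumes p: "prime p" and J: "subgroup J G" and W: "subgroup W G" "normalizes J W"
    and A: "subgroup A G" "W \<subseteq> A" "A \<subset> J" and ind: "index_in {p} J W"
  obtains N where "subgroup N G" "A \<subset> N" "N \<subseteq> J" "normalizes N A"
proof -
  obtain P where P: "subgroup P G" "P \<subseteq> A" "card P = p ^ multiplicity p (card A)"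
    using sylow_exists[OF p A(1)] .
  have AJ: "A \<subseteq> J" using A(3) by blast
  have indA: "index_in {p} J A" "index_in {p} A W"
    using index_in_sandwich[OF J A(1) W(1) A(2) AJ ind] by auto
  have PW: "P <#> W = A"
    by (rule p_section_generated[OF p A(1) W(1) A(2) _ indA(2) P]) (rule normalizes_mono[OF W(2) AJ])
  let ?E = "(\<lambda>x. A #> x) ` J"
  have cE: "card ?E * card A = card J" by (rule card_rcosets_restrict) fact+
  have "multiplicity p (card A) \<noteq> multiplicity p (card J)"
  proof
    assume "multiplicity p (card A) = multiplicity p (card J)"
    then have "index_in {} J A" using indA(1) unfolding index_in_def by (metis singletonD)
    then have "J = A" using index_in_disjoint_eq[OF J A(1) AJ, of "{}" "{}"] by simp
    then show False using A(3) by blast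
  qed
  moreover have "multiplicity p (card ?E) + multiplicity p (card A) = multiplicity p (card J)"
    using cE subgroup_card_pos[OF J] p
    by (metis mult_is_0 not_less_zero prime_elem_multiplicity_mult_distrib prime_imp_prime_elem)
  ultimately have "multiplicity p (card ?E) \<noteq> 0" by simp
  then have "card ?E mod p = 0" by (metis dvd_imp_mod_0 not_dvd_imp_multiplicity_0)
  moreover let ?F = "{c \<in> ?E. \<forall>g\<in>P. c #> g = c}"
  have "card ?E mod p = card ?F mod p"
    using card_fixed_cosets[OF p P(1,3) A(1) J AJ] P(2) AJ by blast
  ultimately have cF: "card ?F mod p = 0" by simp
  have "A \<in> ?F"
  proof -
    have "A #> \<one> = A" using subgroup.subset[OF A(1)] by simp
    moreover have "A #> g = A" if "g \<in> P" for g using subgroup.rcos_const[OF A(1) is_group] that P(2) by blast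
    ultimately show ?thesis using subgroup.one_closed[OF J] by (auto intro: rev_image_eqI[of \<one>])
  qed
  moreover have "?F \<noteq> {A}"
  proof
    assume "?F = {A}"
    then have "card ?F = 1" by simp
    then show False using cF prime_gt_1_nat[OF p] by simp
  qed
  ultimately obtain c where c: "c \<in> ?F" "c \<noteq> A" by blast
  then obtain x where x: "x \<in> J" "A #> x \<noteq> A" "\<forall>g\<in>P. A #> x #> g = A #> x" by auto
  have xc: "x \<in> carrier G" using x(1) J subgroup.mem_carrier by metis
  have xA: "x \<notin> A" using x(2) subgroup.rcos_const[OF A(1) is_group] by blast
  have "conj_subset G P (inv x) \<subseteq> A"
  proof -
    have "x \<otimes> g \<otimes> inv x \<in> A" if "g \<in> P" for g
      using rcoset_fixed_iff[OF A(1) xc, of g] x(3) that subgroup.mem_carrier[OF P(1)] by blast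
    then show ?thesis using conj_subset_image[OF subgroup.subset[OF P(1)], of "inv x"] xc by auto
  qed
  have *: "B \<subseteq> conj_subset G A x" if "conj_subset G B (inv x) \<subseteq> A" "B \<subseteq> carrier G" for B
    using conj_subset_mono[OF that(1) subgroup.subset[OF A(1)] xc] that(2) xc by simp
  have "P <#> W \<subseteq> conj_subset G A x"
  proof (rule set_mult_least)
    show "subgroup (conj_subset G A x) G" using A(1) xc by (rule conj_subset_subgroup)
    show "P \<subseteq> conj_subset G A x" using \<open>conj_subset G P (inv x) \<subseteq> A\<close> subgroup.subset[OF P(1)] by (rule *)
    have "conj_subset G W (inv x) = W"
      using conj_subset_normalizes[OF W(2) J subgroup.subset[OF W(1)]] x(1) J subgroup.m_inv_closed by metis
    then show "W \<subseteq> conj_subset G A x" using A(2) subgroup.subset[OF W(1)] by (intro *) auto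
  qed
  then have "conj_subset G A x = A"
    using PW card_subset_eq[of "conj_subset G A x" A] card_conj_subset[OF subgroup.subset[OF A(1)] xc]
      subgroup_finite[OF conj_subset_subgroup[OF A(1) xc]] by simp
  then have xN: "x \<in> normalizer G A" using mem_normalizer_iff[OF subgroup.subset[OF A(1)]] xc by blast
  have AN: "A \<subseteq> normalizer G A"
    using subset_normalizer_iff[OF A(1) subgroup.subset[OF A(1)]] normalizes_self[OF A(1)] by blast
  show thesis
  proof (rule that[of "normalizer G A \<inter> J"])
    show "subgroup (normalizer G A \<inter> J) G"
      by (rule subgroup_Int[OF normalizer_subgroup[OF subgroup.subset[OF A(1)]] J])
    show "A \<subset> normalizer G A \<inter> J" using AN AJ xA xN x(1) by blast
    show "normalizes (normalizer G A \<inter> J) A"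
      by (rule normalizes_mono[OF normalizes_normalizer[OF subgroup.subset[OF A(1)]]]) blast
  qed blast
qed

text \<open>Choose \<open>M\<close> maximal among the proper subgroups containing \<open>A\<close>;
  the strictly larger subgroup normalizing it can only be \<open>J\<close>.\<close>

lemma proper_in_normal:
  assumes p: "prime p" and J: "subgroup J G" and W: "subgroup W G" "normalizes J W"
    and A: "subgroup A G" "W \<subseteq> A" "A \<subset> J" and ind: "index_in {p} J W"
  obtains M where "subgroup M G" "A \<subseteq> M" "M \<subset> J" "normalizes J M"
proof -
  let ?S = "{M. subgroup M G \<and> A \<subseteq> M \<and> M \<subset> J}"
  have "?S \<subseteq> Pow J" by auto
  then have "finite ?S" using subgroup_finite[OF J] by (meson finite_Pow_iff finite_subset)
  moreover have "?S \<noteq> {}" using A by blast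
  ultimately obtain M where M: "M \<in> ?S" "\<forall>M'\<in>?S. M \<subseteq> M' \<longrightarrow> M = M'"
    using finite_has_maximal by meson
  obtain N where N: "subgroup N G" "M \<subset> N" "N \<subseteq> J" "normalizes N M"
    using normalizer_grows[OF p J W, of M] M(1) A(2) ind by blast
  have "N = J"
  proof (rule ccontr)
    assume "N \<noteq> J"
    then have "N \<in> ?S" using N M(1) by blast
    then show False using M(2) N(2) by blast
  qed
  then show thesis using that M(1) N(4) by blast
qed

text \<open>Under conjugation the fixed points are the central elements; their number is divisible
  by \<open>p\<close>, and the identity is one of them.\<close>

lemma p_group_center:
  assumes p: "prime p" and ord: "card (carrier G) = p ^ n" and n: "n > 0"
  obtains z where "z \<in> carrier G" "z \<noteq> \<one>" "\<forall>g\<in>carrier G. g \<otimes> z = z \<otimes> g"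
proof -
  interpret act: group_action G "carrier G" "\<lambda>g. \<lambda>h\<in>carrier G. g \<otimes> h \<otimes> inv g"
    by (rule action_by_conjugation)
  let ?F = "{x \<in> carrier G. \<forall>g\<in>carrier G. (\<lambda>h\<in>carrier G. g \<otimes> h \<otimes> inv g) x = x}"
  have "card ?F mod p = 0"
    using act.card_fixed_points_mod_prime[OF p _ fin, of n] ord n by (simp add: order_def)
  moreover have "\<one> \<in> ?F" by simp
  moreover have "?F \<noteq> {\<one>}"
  proof
    assume "?F = {\<one>}"
    then have "card ?F = 1" by simp
    then show False using \<open>card ?F mod p = 0\<close> prime_gt_1_nat[OF p] by simp
  qed
  ultimately obtain z where z: "z \<in> ?F" "z \<noteq> \<one>" by blast
  have "g \<otimes> z = z \<otimes> g" if "g \<in> carrier G" for g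
  proof -
    have zc: "z \<in> carrier G" using z(1) by blast
    have "g \<otimes> z \<otimes> inv g = z" using z(1) that zc by (metis (mono_tags, lifting) mem_Collect_eq restrict_apply')
    then have "g \<otimes> z \<otimes> inv g \<otimes> g = z \<otimes> g" by (rule arg_cong)
    then show ?thesis using zc that by (simp add: m_assoc)
  qed
  then show thesis using that z by blast
qed

end

section \<open>Complements\<close>

text \<open>
  A transversal of \<open>K\<close> defines a crossed homomorphism from \<open>G\<close> to \<open>K\<close> that is the \<open>|G : K|\<close>-th power
  map on \<open>K\<close>; its kernel is a complement, and every complement, being a transversal, arises so.
\<close>

locale abelian_normal_hall = fin_group +
  fixes K
  assumes K_normal: "K \<lhd> G"
    and K_comm: "\<And>x y. x \<in> K \<Longrightarrow> y \<in> K \<Longrightarrow> x \<otimes> y = y \<otimes> x"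
    and K_coprime: "coprime (card K) (card (rcosets K))"
begin

sublocale K: normal K G by (rule K_normal)

sublocale KK: comm_group "G\<lparr>carrier := K\<rparr>"
  by (rule group.group_comm_groupI[OF subgroup_imp_group[OF K.is_subgroup]]) (simp add: K_comm)

abbreviation "prodK f \<equiv> finprod (G\<lparr>carrier := K\<rparr>) f (rcosets K)"

definition transversal :: "('a set \<Rightarrow> 'a) \<Rightarrow> bool" where
  "transversal t \<longleftrightarrow> (\<forall>c \<in> rcosets K. t c \<in> c)"

text \<open>Measures how far \<open>t\<close> is from commuting with left translation by
  \<open>x\<close>. Left translation permutes the right cosets because \<open>K\<close> is
  normal.\<close>

definition defect :: "('a set \<Rightarrow> 'a) \<Rightarrow> 'a \<Rightarrow> 'a set \<Rightarrow> 'a" where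
  "defect t x c = x \<otimes> t c \<otimes> inv (t (x <# c))"

definition crossed :: "('a set \<Rightarrow> 'a) \<Rightarrow> 'a \<Rightarrow> 'a" where
  "crossed t x = prodK (defect t x)"

definition crossed_kernel :: "('a set \<Rightarrow> 'a) \<Rightarrow> 'a set" where
  "crossed_kernel t = {x \<in> carrier G. crossed t x = \<one>}"

lemma finite_rcosets: "finite (rcosets K)"
  using fin by (simp add: RCOSETS_def)

lemma lcos_rcos: "x \<in> carrier G \<Longrightarrow> u \<in> carrier G \<Longrightarrow> x <# (K #> u) = K #> (x \<otimes> u)"
  using rcos_assoc_lcos[OF K.subset] K.coset_eq coset_mult_assoc[OF K.subset]
  by (metis K.subset l_coset_subset_G set_mult_assoc lcos_m_assoc r_coset_subset_G coset_assoc)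

lemma lcos_closed: "x \<in> carrier G \<Longrightarrow> c \<in> rcosets K \<Longrightarrow> x <# c \<in> rcosets K"
  by (auto simp: RCOSETS_def lcos_rcos)

lemma lcos_mult: "x \<in> carrier G \<Longrightarrow> y \<in> carrier G \<Longrightarrow> c \<in> rcosets K \<Longrightarrow> (x \<otimes> y) <# c = x <# (y <# c)"
  by (auto simp: RCOSETS_def lcos_rcos m_assoc)

lemma lcos_one: "c \<in> rcosets K \<Longrightarrow> \<one> <# c = c"
  by (auto simp: RCOSETS_def lcos_rcos)

lemma lcos_bij: "x \<in> carrier G \<Longrightarrow> bij_betw (\<lambda>c. x <# c) (rcosets K) (rcosets K)"
  by (rule bij_betw_byWitness[where f' = "\<lambda>c. inv x <# c"])
    (auto simp: lcos_closed lcos_one simp flip: lcos_mult)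

lemma rcos_elem:
  assumes "c \<in> rcosets K" "u \<in> c"
  shows "u \<in> carrier G" "c = K #> u"
proof -
  obtain x where x: "x \<in> carrier G" "c = K #> x" using assms(1) by (auto simp: RCOSETS_def)
  then show "u \<in> carrier G" using assms(2) K.subset r_coset_subset_G by blast
  show "c = K #> u" using x assms(2) repr_independence[OF _ _ K.is_subgroup] by auto
qed

lemma same_coset:
  assumes "c \<in> rcosets K" "u \<in> c" "v \<in> c"
  shows "u \<otimes> inv v \<in> K"
  using K.rcos_module_imp[of v u] rcos_elem[OF assms(1,2)] rcos_elem[OF assms(1,3)] assms by auto

lemma lcos_mem: "x \<in> carrier G \<Longrightarrow> c \<in> rcosets K \<Longrightarrow> u \<in> c \<Longrightarrow> x \<otimes> u \<in> x <# c"
  by (auto simp: l_coset_def)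

lemma transversal_carrier: "transversal t \<Longrightarrow> c \<in> rcosets K \<Longrightarrow> t c \<in> carrier G"
  using rcos_elem(1) by (auto simp: transversal_def)

lemma defect_closed:
  assumes "transversal t" "x \<in> carrier G" "c \<in> rcosets K"
  shows "defect t x c \<in> K"
  unfolding defect_def using assms same_coset[OF lcos_closed[OF assms(2,3)]] lcos_mem[OF assms(2,3)] lcos_closed
  by (auto simp: transversal_def)

text \<open>The intermediate value \<open>t (y <# c)\<close> cancels. Multiplied over all cosets
  this becomes the rule for crossed homomorphisms.\<close>

lemma defect_mult:
  assumes t: "transversal t" and x: "x \<in> carrier G" and y: "y \<in> carrier G" and c: "c \<in> rcosets K"
  shows "defect t (x \<otimes> y) c = (x \<otimes> defect t y c \<otimes> inv x) \<otimes> defect t x (y <# c)"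
  using transversal_carrier[OF t c] transversal_carrier[OF t lcos_closed[OF y c]]
    transversal_carrier[OF t lcos_closed[OF x lcos_closed[OF y c]]] x y c
  by (simp add: defect_def lcos_mult m_assoc mult_inv_cancel)

lemma conj_closed: "x \<in> carrier G \<Longrightarrow> k \<in> K \<Longrightarrow> x \<otimes> k \<otimes> inv x \<in> K"
  by (rule K.inv_op_closed2)

lemma conj_finprod:
  assumes "finite A" "f \<in> A \<rightarrow> K" "x \<in> carrier G"
  shows "x \<otimes> finprod (G\<lparr>carrier := K\<rparr>) f A \<otimes> inv x = finprod (G\<lparr>carrier := K\<rparr>) (\<lambda>c. x \<otimes> f c \<otimes> inv x) A"
  using assms(1,2)
proof (induction A rule: finite_induct)
  case empty
  then show ?case using assms(3) by simp
next
  case (insert a A)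
  have c: "f a \<in> carrier G" "finprod (G\<lparr>carrier := K\<rparr>) f A \<in> carrier G"
    using insert.prems KK.finprod_closed[of f A] K.subset by (auto simp: Pi_iff)
  have "finprod (G\<lparr>carrier := K\<rparr>) f (insert a A) = f a \<otimes> finprod (G\<lparr>carrier := K\<rparr>) f A"
    using insert by (simp add: Pi_iff)
  moreover have "x \<otimes> (f a \<otimes> finprod (G\<lparr>carrier := K\<rparr>) f A) \<otimes> inv x
      = (x \<otimes> f a \<otimes> inv x) \<otimes> (x \<otimes> finprod (G\<lparr>carrier := K\<rparr>) f A \<otimes> inv x)"
    using c assms(3) by (simp add: m_assoc mult_inv_cancel)
  moreover have "x \<otimes> finprod (G\<lparr>carrier := K\<rparr>) f A \<otimes> inv x = finprod (G\<lparr>carrier := K\<rparr>) (\<lambda>c. x \<otimes> f c \<otimes> inv x) A"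
    using insert by (simp add: Pi_iff)
  moreover have "finprod (G\<lparr>carrier := K\<rparr>) (\<lambda>c. x \<otimes> f c \<otimes> inv x) (insert a A)
      = (x \<otimes> f a \<otimes> inv x) \<otimes> finprod (G\<lparr>carrier := K\<rparr>) (\<lambda>c. x \<otimes> f c \<otimes> inv x) A"
    using insert conj_closed assms(3) by (simp add: Pi_iff)
  ultimately have "x \<otimes> finprod (G\<lparr>carrier := K\<rparr>) f (insert a A) \<otimes> inv x
      = finprod (G\<lparr>carrier := K\<rparr>) (\<lambda>c. x \<otimes> f c \<otimes> inv x) (insert a A)"
    by (simp only:)
  then show ?case .
qed

lemma crossed_closed: "transversal t \<Longrightarrow> x \<in> carrier G \<Longrightarrow> crossed t x \<in> K"
  unfolding crossed_def using KK.finprod_closed[of "defect t x" "rcosets K"] by (auto simp: defect_closed)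

lemma prodK_lcos:
  assumes "f \<in> rcosets K \<rightarrow> K" "x \<in> carrier G"
  shows "prodK (\<lambda>c. f (x <# c)) = prodK f"
  using KK.finprod_reindex[of f "\<lambda>c. x <# c" "rcosets K"] lcos_bij[OF assms(2)] assms(1)
  by (simp add: bij_betw_def)

text \<open>In the product of the identities \<open>defect_mult\<close> the second factor is
  evaluated at \<open>y <# c\<close>, a permutation of the cosets, and so gives the product for
  \<open>x\<close> again.\<close>

lemma crossed_mult:
  assumes t: "transversal t" and x: "x \<in> carrier G" and y: "y \<in> carrier G"
  shows "crossed t (x \<otimes> y) = (x \<otimes> crossed t y \<otimes> inv x) \<otimes> crossed t x"
proof -
  have "crossed t (x \<otimes> y) = prodK (\<lambda>c. (x \<otimes> defect t y c \<otimes> inv x) \<otimes> defect t x (y <# c))"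
    unfolding crossed_def
    by (rule KK.finprod_cong') (use assms in \<open>auto simp: defect_mult defect_closed conj_closed lcos_closed\<close>)
  also have "\<dots> = prodK (\<lambda>c. x \<otimes> defect t y c \<otimes> inv x) \<otimes> prodK (\<lambda>c. defect t x (y <# c))"
    using KK.finprod_multf[of "\<lambda>c. x \<otimes> defect t y c \<otimes> inv x" "rcosets K" "\<lambda>c. defect t x (y <# c)"] assms
    by (simp add: defect_closed conj_closed lcos_closed Pi_iff)
  also have "prodK (\<lambda>c. defect t x (y <# c)) = crossed t x"
    unfolding crossed_def by (rule prodK_lcos) (use assms in \<open>auto simp: defect_closed\<close>)
  also have "prodK (\<lambda>c. x \<otimes> defect t y c \<otimes> inv x) = x \<otimes> crossed t y \<otimes> inv x"
    unfolding crossed_def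
    by (rule conj_finprod[symmetric]) (use assms finite_rcosets in \<open>auto simp: defect_closed\<close>)
  finally show ?thesis .
qed

text \<open>Left translation by an element of \<open>K\<close> fixes every coset, so each of the
  factors is \<open>k\<close> itself.\<close>

lemma crossed_K:
  assumes t: "transversal t" and k: "k \<in> K"
  shows "crossed t k = k [^] card (rcosets K)"
proof -
  have "defect t k c = k" if c: "c \<in> rcosets K" for c
  proof -
    have "k <# c = c"
    proof -
      obtain u where u: "u \<in> carrier G" "c = K #> u" using c by (auto simp: RCOSETS_def)
      then have "k <# c = K #> k #> u" using k by (simp add: lcos_rcos coset_mult_assoc K.subset)
      then show ?thesis using u k by (simp add: K.rcos_const)
    qed
    then show ?thesis using transversal_carrier[OF t c] k by (simp add: defect_def m_assoc)
  qed
  then have "crossed t k = prodK (\<lambda>_. k)"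
    unfolding crossed_def by (intro KK.finprod_cong') (use k in auto)
  also have "\<dots> = k [^]\<^bsub>G\<lparr>carrier := K\<rparr>\<^esub> card (rcosets K)"
    by (rule KK.finprod_const) (use k in simp)
  finally show ?thesis by (simp flip: nat_pow_consistent)
qed

text \<open>With n the index of \<open>K\<close>, Bezout turns coprimality into n m = |K| q + 1, and
  \<open>u [^] m\<close> is the root because \<open>u [^] card K\<close> is the identity.\<close>

lemma root_exists:
  assumes "u \<in> K"
  obtains v where "v \<in> K" "v [^] card (rcosets K) = u"
proof -
  have ord: "u [^] card K = \<one>"
    using KK.power_order_eq_one[of u] assms subgroup_finite[OF K.is_subgroup] by (simp flip: nat_pow_consistent)
  have "card (rcosets K) \<noteq> 0"
    using lagrange[OF K.is_subgroup] fin by (metis mult_0 order_gt_0_iff_finite less_irrefl)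
  then obtain m q where "card (rcosets K) * m = card K * q + gcd (card (rcosets K)) (card K)"
    using bezout_nat[of "card (rcosets K)" "card K"] by auto
  then have q: "card (rcosets K) * m = card K * q + 1"
    using K_coprime by (simp add: coprime_iff_gcd_eq_1 gcd.commute)
  have uc: "u \<in> carrier G" using assms by simp
  have "u [^] (card K * q) = \<one>"
    using ord uc by (simp flip: nat_pow_pow)
  then have "u [^] (card (rcosets K) * m) = u"
    unfolding q using uc by (simp flip: nat_pow_mult)
  moreover have "u [^] m \<in> K" using KK.nat_pow_closed[of u m] assms by (simp flip: nat_pow_consistent)
  ultimately show thesis using that[of "u [^] m"] uc by (simp add: nat_pow_pow mult.commute)
qed

text \<open>The power map is onto \<open>K\<close> by \<open>root_exists\<close>, hence injective by
  finiteness.\<close>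

lemma root_unique:
  assumes "u \<in> K" "u [^] card (rcosets K) = \<one>"
  shows "u = \<one>"
proof -
  have uc: "u \<in> carrier G" using assms by simp
  have "inj_on (\<lambda>v. v [^] card (rcosets K)) K"
  proof (rule eq_card_imp_inj_on)
    have "(\<lambda>v. v [^] card (rcosets K)) ` K = K"
    proof
      show "(\<lambda>v. v [^] card (rcosets K)) ` K \<subseteq> K"
        using KK.nat_pow_closed by (auto simp flip: nat_pow_consistent)
      show "K \<subseteq> (\<lambda>v. v [^] card (rcosets K)) ` K"
      proof
        fix u assume "u \<in> K"
        then obtain v where "v \<in> K" "v [^] card (rcosets K) = u" by (rule root_exists)
        then show "u \<in> (\<lambda>v. v [^] card (rcosets K)) ` K" by blast
      qed
    qed
    then show "card ((\<lambda>v. v [^] card (rcosets K)) ` K) = card K" by simp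
  qed (rule subgroup_finite[OF K.is_subgroup])
  from inj_onD[OF this, of u \<one>] show ?thesis using assms by simp
qed

lemma crossed_kernel_subgroup:
  assumes t: "transversal t"
  shows "subgroup (crossed_kernel t) G"
proof -
  have one: "crossed t \<one> = \<one>"
    using crossed_K[OF t K.one_closed] by simp
  show ?thesis
  proof (rule subgroupI)
    show "crossed_kernel t \<noteq> {}" using one by (auto simp: crossed_kernel_def)
    fix x assume x: "x \<in> crossed_kernel t"
    then have "crossed t (inv x \<otimes> x) = crossed t (inv x)"
      using crossed_mult[OF t, of "inv x" x] crossed_closed[OF t, of "inv x"] by (simp add: crossed_kernel_def)
    then show "inv x \<in> crossed_kernel t" using x one by (simp add: crossed_kernel_def)
  qed (auto simp: crossed_kernel_def crossed_mult[OF t])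
qed

lemma crossed_kernel_Int: "transversal t \<Longrightarrow> crossed_kernel t \<inter> K = {\<one>}"
  using root_unique crossed_K subgroup.one_closed[OF crossed_kernel_subgroup] K.one_closed
  by (auto simp: crossed_kernel_def)

text \<open>Multiplying \<open>x\<close> on the left by \<open>k\<close> in \<open>K\<close>
  multiplies its crossed value by \<open>k [^] card (rcosets K)\<close>; a root of the inverse value
  therefore moves \<open>x\<close> into the kernel.\<close>

lemma crossed_kernel_mult:
  assumes t: "transversal t"
  shows "crossed_kernel t <#> K = carrier G"
proof
  show "crossed_kernel t <#> K \<subseteq> carrier G" by (auto simp: crossed_kernel_def set_mult_def)
  show "carrier G \<subseteq> crossed_kernel t <#> K"
  proof
    fix x assume x: "x \<in> carrier G"
    have d: "crossed t x \<in> K" using crossed_closed[OF t x] .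
    obtain k where k: "k \<in> K" "k [^] card (rcosets K) = inv (crossed t x)"
      using root_exists[of "inv (crossed t x)"] d by auto
    have "crossed t (k \<otimes> x) = (k \<otimes> crossed t x \<otimes> inv k) \<otimes> inv (crossed t x)"
      using crossed_mult[OF t, of k x] crossed_K[OF t k(1)] k x by simp
    also have "\<dots> = \<one>" using k(1) d K_comm[OF k(1) d] by (simp add: m_assoc)
    finally have "k \<otimes> x \<in> crossed_kernel t" using k x by (simp add: crossed_kernel_def)
    moreover have "x = (k \<otimes> x) \<otimes> (inv x \<otimes> inv k \<otimes> x)" using k x by (simp add: m_assoc mult_inv_cancel)
    moreover have "inv x \<otimes> inv k \<otimes> x \<in> K" using K.inv_op_closed1[OF x, of "inv k"] k by simp
    ultimately show "x \<in> crossed_kernel t <#> K" unfolding set_mult_def by blast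
  qed
qed

lemma transversal_exists: "\<exists>t. transversal t"
proof -
  have "\<forall>c\<in>rcosets K. \<exists>u. u \<in> c" using K.rcosets_non_empty by blast
  then show ?thesis unfolding transversal_def by (rule bchoice)
qed

text \<open>A complement meets every coset. A transversal chosen inside \<open>H\<close> has its
  defects at elements of \<open>H\<close> in \<open>H \<inter> K\<close>, so \<open>H\<close> lies
  in the kernel, and the orders agree.\<close>

lemma complement_is_crossed_kernel:
  assumes H: "subgroup H G" and Int: "H \<inter> K = {\<one>}" and mult: "H <#> K = carrier G"
  shows "\<exists>t. transversal t \<and> H = crossed_kernel t"
proof -
  interpret H: subgroup H G by fact
  have "\<exists>u. u \<in> c \<and> u \<in> H" if c: "c \<in> rcosets K" for c
  proof -
    obtain x where x: "x \<in> carrier G" "c = K #> x" using c by (auto simp: RCOSETS_def)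
    then obtain h k where hk: "h \<in> H" "k \<in> K" "x = h \<otimes> k" using mult unfolding set_mult_def by blast
    have "h = (h \<otimes> inv k \<otimes> inv h) \<otimes> x" using hk by (simp add: m_assoc mult_inv_cancel)
    moreover have "h \<otimes> inv k \<otimes> inv h \<in> K" using conj_closed[of h "inv k"] hk by simp
    ultimately have "h \<in> c" unfolding x(2) r_coset_def by blast
    then show ?thesis using hk by blast
  qed
  then obtain t where t: "\<forall>c\<in>rcosets K. t c \<in> c \<and> t c \<in> H" by metis
  then have tr: "transversal t" by (simp add: transversal_def)
  have "H \<subseteq> crossed_kernel t"
  proof
    fix x assume x: "x \<in> H"
    have "defect t x c = \<one>" if c: "c \<in> rcosets K" for c
    proof -
      have "defect t x c \<in> H" unfolding defect_def using t x c lcos_closed[of x c] by (simp add: H.mem_carrier)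
      moreover have "defect t x c \<in> K" using defect_closed[OF tr H.mem_carrier[OF x] c] .
      ultimately have "defect t x c \<in> H \<inter> K" by (rule IntI)
      then show ?thesis unfolding Int by simp
    qed
    then have "crossed t x = prodK (\<lambda>_. \<one>)"
      unfolding crossed_def by (intro KK.finprod_cong') auto
    also have "\<dots> = \<one>" using KK.finprod_one by simp
    finally show "x \<in> crossed_kernel t" using x by (simp add: crossed_kernel_def)
  qed
  moreover have "card H = card (crossed_kernel t)"
  proof -
    have "card H * card K = card (carrier G)"
      using card_set_mult[OF H K.is_subgroup] unfolding Int mult by simp
    moreover have "card (crossed_kernel t) * card K = card (carrier G)"
      using card_set_mult[OF crossed_kernel_subgroup[OF tr] K.is_subgroup]
      unfolding crossed_kernel_Int[OF tr] crossed_kernel_mult[OF tr] by simp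
    ultimately show ?thesis using subgroup_card_pos[OF K.is_subgroup] by (metis mult_cancel2 less_irrefl)
  qed
  ultimately have "H = crossed_kernel t"
    using card_subset_eq[OF subgroup_finite[OF crossed_kernel_subgroup[OF tr]]] by blast
  then show ?thesis using tr by blast
qed

text \<open>Two transversals differ coset by coset by elements of \<open>K\<close>. Their product
  \<open>U\<close> changes the crossed homomorphism by the coboundary
  \<open>x \<otimes> U \<otimes> inv x \<otimes> inv U\<close>.\<close>

lemma crossed_change:
  assumes t: "transversal t" and s: "transversal s" and x: "x \<in> carrier G"
  defines "U \<equiv> prodK (\<lambda>c. s c \<otimes> inv (t c))"
  shows "crossed s x = (x \<otimes> U \<otimes> inv x) \<otimes> crossed t x \<otimes> inv U" "U \<in> K"
proof -
  let ?u = "\<lambda>c. s c \<otimes> inv (t c)"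
  have u: "?u c \<in> K" if "c \<in> rcosets K" for c
    using that t s same_coset[OF that] by (auto simp: transversal_def)
  show UK: "U \<in> K" unfolding U_def using KK.finprod_closed[of ?u "rcosets K"] u by (simp add: Pi_iff)
  have "defect s x c \<otimes> ?u (x <# c) = (x \<otimes> ?u c \<otimes> inv x) \<otimes> defect t x c" if c: "c \<in> rcosets K" for c
    using transversal_carrier[OF t c] transversal_carrier[OF s c] transversal_carrier[OF t lcos_closed[OF x c]]
      transversal_carrier[OF s lcos_closed[OF x c]] x
    by (simp add: defect_def m_assoc mult_inv_cancel)
  then have "prodK (\<lambda>c. defect s x c \<otimes> ?u (x <# c)) = prodK (\<lambda>c. (x \<otimes> ?u c \<otimes> inv x) \<otimes> defect t x c)"
    using u x t s by (intro KK.finprod_cong') (auto simp: defect_closed conj_closed)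
  moreover have "prodK (\<lambda>c. defect s x c \<otimes> ?u (x <# c)) = crossed s x \<otimes> U"
  proof -
    have "prodK (\<lambda>c. defect s x c \<otimes> ?u (x <# c)) = crossed s x \<otimes> prodK (\<lambda>c. ?u (x <# c))"
      unfolding crossed_def
      using KK.finprod_multf[of "defect s x" "rcosets K" "\<lambda>c. ?u (x <# c)"] s x u
      by (simp add: defect_closed lcos_closed Pi_iff)
    then show ?thesis unfolding U_def using prodK_lcos[of ?u x] u x by (simp add: Pi_iff)
  qed
  moreover have "prodK (\<lambda>c. (x \<otimes> ?u c \<otimes> inv x) \<otimes> defect t x c) = (x \<otimes> U \<otimes> inv x) \<otimes> crossed t x"
  proof -
    have "prodK (\<lambda>c. (x \<otimes> ?u c \<otimes> inv x) \<otimes> defect t x c) = prodK (\<lambda>c. x \<otimes> ?u c \<otimes> inv x) \<otimes> crossed t x"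
      unfolding crossed_def
      using KK.finprod_multf[of "\<lambda>c. x \<otimes> ?u c \<otimes> inv x" "rcosets K" "defect t x"] t x u
      by (simp add: defect_closed conj_closed Pi_iff)
    then show ?thesis unfolding U_def using conj_finprod[of "rcosets K" ?u x] u x finite_rcosets by (simp add: Pi_iff)
  qed
  ultimately have *: "crossed s x \<otimes> U = (x \<otimes> U \<otimes> inv x) \<otimes> crossed t x" by simp
  have c: "crossed s x \<in> carrier G" "U \<in> carrier G" using crossed_closed[OF s x] UK by auto
  have "crossed s x = crossed s x \<otimes> U \<otimes> inv U" using c by (simp add: m_assoc)
  then show "crossed s x = (x \<otimes> U \<otimes> inv x) \<otimes> crossed t x \<otimes> inv U" unfolding * .
qed

lemma crossed_kernels_conj:
  assumes t: "transversal t" and s: "transversal s"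
  shows "\<exists>w\<in>K. crossed_kernel s = conj_subset G (crossed_kernel t) w"
proof -
  let ?n = "card (rcosets K)"
  define U where "U = prodK (\<lambda>c. s c \<otimes> inv (t c))"
  have UK: "U \<in> K" using crossed_change(2)[OF t s one_closed] by (simp add: U_def)
  \<comment> \<open>With this root of \<open>inv U\<close>, conjugation by \<open>w\<close> produces
    exactly the coboundary of \<open>U\<close>, as the crossed homomorphism is the power map on
    \<open>K\<close>.\<close>
  obtain w where w: "w \<in> K" "w [^] ?n = inv U" using root_exists[of "inv U"] UK by auto
  have wi: "inv w [^] ?n = U" using w UK by (simp add: nat_pow_inv)
  have key: "crossed t (w \<otimes> x \<otimes> inv w) = crossed s x" if x: "x \<in> carrier G" for x
  proof -
    have c: "crossed t x \<in> K" "crossed t (x \<otimes> inv w) \<in> K" using crossed_closed[OF t] x w by auto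
    have "crossed t (w \<otimes> (x \<otimes> inv w)) = (w \<otimes> crossed t (x \<otimes> inv w) \<otimes> inv w) \<otimes> inv U"
      using crossed_mult[OF t, of w "x \<otimes> inv w"] crossed_K[OF t w(1)] w x by simp
    also have "w \<otimes> crossed t (x \<otimes> inv w) \<otimes> inv w = crossed t (x \<otimes> inv w)"
      using K_comm[OF w(1) c(2)] c(2) w(1) by (simp add: m_assoc)
    also have "crossed t (x \<otimes> inv w) = (x \<otimes> U \<otimes> inv x) \<otimes> crossed t x"
      using crossed_mult[OF t, of x "inv w"] crossed_K[OF t, of "inv w"] w x wi by simp
    finally show ?thesis using crossed_change(1)[OF t s x] w x by (simp add: U_def m_assoc)
  qed
  have "crossed_kernel s = conj_subset G (crossed_kernel t) w"
  proof -
    have sub: "crossed_kernel t \<subseteq> carrier G" by (auto simp: crossed_kernel_def)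
    have "x \<in> crossed_kernel s \<longleftrightarrow> x \<in> conj_subset G (crossed_kernel t) w" if x: "x \<in> carrier G" for x
      using mem_conj_subset[OF sub _ x, of w] w x key[OF x] by (auto simp: crossed_kernel_def)
    moreover have "crossed_kernel s \<subseteq> carrier G" by (auto simp: crossed_kernel_def)
    moreover have "conj_subset G (crossed_kernel t) w \<subseteq> carrier G"
      using conj_subset_carrier[OF sub] w K.mem_carrier by simp
    ultimately show ?thesis by (meson subset_antisym subset_iff)
  qed
  then show ?thesis using w by blast
qed

theorem complement_exists: "\<exists>H. subgroup H G \<and> H \<inter> K = {\<one>} \<and> H <#> K = carrier G"
  using transversal_exists crossed_kernel_subgroup crossed_kernel_Int crossed_kernel_mult by blast

theorem complements_conj:
  assumes "subgroup H G" "H \<inter> K = {\<one>}" "H <#> K = carrier G"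
    and "subgroup H' G" "H' \<inter> K = {\<one>}" "H' <#> K = carrier G"
  shows "\<exists>k\<in>K. H' = conj_subset G H k"
  using complement_is_crossed_kernel[OF assms(1-3)] complement_is_crossed_kernel[OF assms(4-6)]
    crossed_kernels_conj by blast

end

section \<open>Complements in sections\<close>

definition (in group) complement_over :: "'a set \<Rightarrow> 'a set \<Rightarrow> 'a set \<Rightarrow> 'a set \<Rightarrow> bool" where
  "complement_over J K W H \<longleftrightarrow> subgroup H G \<and> W \<subseteq> H \<and> H \<subseteq> J \<and> H \<inter> K = W \<and> H <#> K = J"

text \<open>\<open>J/K\<close> is the direct product of its normal Hall subgroups for \<rho> and for
  the complement of \<rho>. The two halves are exchanged by passing to \<open>- \<rho>\<close>,
  which lets the closure properties below be proved for one half and used for both.\<close>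

definition (in group) splits :: "nat set \<Rightarrow> 'a set \<Rightarrow> 'a set \<Rightarrow> bool" where
  "splits \<rho> J K \<longleftrightarrow> (\<exists>A B. subgroup A G \<and> K \<subseteq> A \<and> A \<subseteq> J \<and> normalizes J A \<and> index_in \<rho> A K \<and> index_in (- \<rho>) J A \<and>
     subgroup B G \<and> K \<subseteq> B \<and> B \<subseteq> J \<and> normalizes J B \<and> index_in (- \<rho>) B K \<and> index_in \<rho> J B)"

context group
begin

lemma complement_overD:
  assumes "complement_over J K W H"
  shows "subgroup H G" "W \<subseteq> H" "H \<subseteq> J" "H \<inter> K = W" "H <#> K = J"
  using assms by (auto simp: complement_over_def)

end

context fin_group
begin

text \<open>The section is carried to the quotient \<open>Q\<close> of \<open>J\<close> by
  \<open>W\<close>, where the image of \<open>K\<close> is an abelian normal Hall subgroup;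
  complements and their conjugacy are pulled back from there.\<close>

lemma complements_abelian:
  assumes J: "subgroup J G" and K: "subgroup K G" "K \<subseteq> J" "normalizes J K"
    and W: "subgroup W G" "W \<subseteq> K" "normalizes J W"
    and comm: "\<And>x y. x \<in> K \<Longrightarrow> y \<in> K \<Longrightarrow> W #> (x \<otimes> y) = W #> (y \<otimes> x)"
    and ind: "index_in \<rho> K W" "index_in (- \<rho>) J K"
  shows "\<exists>H. complement_over J K W H"
    and "complement_over J K W H1 \<Longrightarrow> complement_over J K W H2 \<Longrightarrow> \<exists>k\<in>K. conj_subset G H1 k = H2"
proof -
  let ?J = "G\<lparr>carrier := J\<rparr>"
  let ?q = "\<lambda>x. W #> x"
  interpret J: group ?J using J by (rule subgroup_imp_group)
  interpret Js: subgroup J G by fact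
  interpret Ks: subgroup K G by fact
  interpret Ws: subgroup W G by fact
  have WJ: "W \<lhd> ?J" using normal_restrict_iff[OF J] W K by blast
  interpret W: normal W ?J by (rule WJ)
  define Q where "Q = ?J Mod W"
  have Qg: "group Q" unfolding Q_def by (rule W.factorgroup_is_group)
  have Qc: "carrier Q = ?q ` J" unfolding Q_def by (simp add: carrier_FactGroup)
  have Qfin: "fin_group Q"
    by (intro fin_group.intro Qg fin_group_axioms.intro) (simp add: Qc subgroup_finite[OF J])
  interpret Q: fin_group Q by (rule Qfin)
  interpret q: group_hom ?J Q ?q
    by (intro group_hom.intro J.is_group Qg group_hom_axioms.intro)
       (use W.r_coset_hom_Mod in \<open>simp add: Q_def\<close>)
  have q_mult: "?q (x \<otimes> y) = ?q x \<otimes>\<^bsub>Q\<^esub> ?q y" if "x \<in> J" "y \<in> J" for x y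
    using q.hom_mult[of x y] that by simp
  have q_inv: "?q (inv x) = inv\<^bsub>Q\<^esub> ?q x" if "x \<in> J" for x
    using q.hom_inv[of x] that by (simp add: m_inv_consistent[OF J that])
  have q_one: "\<one>\<^bsub>Q\<^esub> = W" by (simp add: Q_def)
  have q_mem: "?q x \<in> ?q ` H \<longleftrightarrow> x \<in> H" if H: "subgroup H G" "W \<subseteq> H" "H \<subseteq> J" and x: "x \<in> J" for H x
  proof
    assume "?q x \<in> ?q ` H"
    then obtain h where h: "h \<in> H" "?q x = ?q h" by blast
    have xc: "x \<in> carrier G" "h \<in> carrier G" using x h H by auto
    have "x \<in> ?q h" using rcos_self[OF xc(1) W(1)] h(2) by simp
    then obtain w where "w \<in> W" "x = w \<otimes> h" by (auto simp: r_coset_def)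
    then show "x \<in> H" using h H by (meson subgroup.m_closed subset_iff)
  qed blast
  have q_one_iff: "?q x = W \<longleftrightarrow> x \<in> W" if "x \<in> J" for x
    using coset_join1[OF _ Js.mem_carrier[OF that] W(1)] Ws.rcos_const[OF is_group, of x] by blast
  define K' where "K' = ?q ` K"
  have sub_img: "subgroup (?q ` H) Q" if "subgroup H G" "H \<subseteq> J" for H
    using q.subgroup_img_is_subgroup[of H] that subgroup_incl[OF that(1) J] by simp
  have K'sub: "subgroup K' Q" unfolding K'_def using sub_img[OF K(1,2)] .
  have K'norm: "K' \<lhd> Q"
  proof -
    have "Q.normalizes (carrier Q) K'"
      unfolding Q.normalizes_def
    proof (intro ballI)
      fix x' w' assume "x' \<in> carrier Q" "w' \<in> K'"
      then obtain x w where xw: "x \<in> J" "w \<in> K" "x' = ?q x" "w' = ?q w" unfolding Qc K'_def by blast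
      have wJ: "w \<in> J" "inv x \<in> J" using xw K by auto
      have "inv\<^bsub>Q\<^esub> x' \<otimes>\<^bsub>Q\<^esub> w' \<otimes>\<^bsub>Q\<^esub> x' = ?q (inv x \<otimes> w \<otimes> x)"
        unfolding xw using xw(1) wJ by (simp add: q_mult q_inv)
      then show "inv\<^bsub>Q\<^esub> x' \<otimes>\<^bsub>Q\<^esub> w' \<otimes>\<^bsub>Q\<^esub> x' \<in> K'"
        unfolding K'_def using normalizesD[OF K(3) xw(1,2)] by blast
    qed
    then show ?thesis using Q.normal_iff_normalizes K'sub by blast
  qed
  have cardK': "card K' * card W = card K"
    unfolding K'_def by (rule card_rcosets_restrict[OF W(1) K(1) W(2)])
  have cardQ: "card (carrier Q) * card W = card J"
    unfolding Qc by (rule card_rcosets_restrict[OF W(1) J]) (use W K in blast)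
  let ?n = "card (rcosets\<^bsub>Q\<^esub> K')"
  have "?n * card K' = card (carrier Q)"
    using Q.lagrange[OF K'sub] by (simp add: order_def)
  then have cardn: "?n * card K = card J" using cardK' cardQ by (metis mult.assoc)
  have mult_v: "multiplicity p (a * b) = multiplicity p a + multiplicity p b"
    if "prime p" "a * b > 0" for p a b :: nat
    using that by (simp add: prime_elem_multiplicity_mult_distrib)
  \<comment> \<open>A common prime would divide both |K : W| and |J : K|, which are numbers for
    disjoint sets of primes.\<close>
  have cop: "coprime (card K') ?n"
  proof (rule ccontr)
    assume "\<not> coprime (card K') ?n"
    then have "gcd (card K') ?n \<noteq> 1" by (simp add: coprime_iff_gcd_eq_1)
    then obtain p where p: "prime p" "p dvd gcd (card K') ?n" using prime_factor_nat by blast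
    have pos: "card K' * card W > 0" "?n * card K > 0"
      using cardK' cardn subgroup_card_pos[OF K(1)] subgroup_card_pos[OF J] by simp_all
    have "multiplicity p (card K') > 0" "multiplicity p ?n > 0"
      using p pos prime_multiplicity_gt_zero_iff[of p "card K'"] prime_multiplicity_gt_zero_iff[of p ?n] by auto
    then have "multiplicity p (card K) > multiplicity p (card W)" "multiplicity p (card J) > multiplicity p (card K)"
      using mult_v[OF p(1) pos(1)] mult_v[OF p(1) pos(2)] cardK' cardn by auto
    then have "p \<in> \<rho>" "p \<notin> \<rho>"
      using index_inD[OF ind(1) p(1)] index_inD[OF ind(2) p(1)] by auto
    then show False by simp
  qed
  interpret A: abelian_normal_hall Q K'
  proof (intro abelian_normal_hall.intro abelian_normal_hall_axioms.intro)
    fix x y assume "x \<in> K'" "y \<in> K'"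
    then obtain a b where ab: "a \<in> K" "b \<in> K" "x = ?q a" "y = ?q b" unfolding K'_def by blast
    then have abJ: "a \<in> J" "b \<in> J" using K(2) by auto
    show "x \<otimes>\<^bsub>Q\<^esub> y = y \<otimes>\<^bsub>Q\<^esub> x"
      unfolding ab(3,4) q_mult[OF abJ, symmetric] q_mult[OF abJ(2,1), symmetric] by (rule comm[OF ab(1,2)])
  qed (rule Qfin K'norm cop)+
  \<comment> \<open>Subgroups between \<open>W\<close> and \<open>J\<close> are determined by their
    images, so being a complement can be tested in the quotient.\<close>
  have down: "complement_over J K W H \<longleftrightarrow> ?q ` H \<inter> K' = {\<one>\<^bsub>Q\<^esub>} \<and> ?q ` H <#>\<^bsub>Q\<^esub> K' = carrier Q"
    if H: "subgroup H G" "W \<subseteq> H" "H \<subseteq> J" for H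
  proof -
    have qInt: "?q ` H \<inter> K' = ?q ` (H \<inter> K)"
    proof
      show "?q ` H \<inter> K' \<subseteq> ?q ` (H \<inter> K)"
      proof
        fix z assume "z \<in> ?q ` H \<inter> K'"
        then obtain h where h: "h \<in> H" "z = ?q h" "?q h \<in> ?q ` K" unfolding K'_def by blast
        have "h \<in> K" using q_mem[OF K(1) W(2) K(2)] h H(3) by blast
        then show "z \<in> ?q ` (H \<inter> K)" using h by blast
      qed
    qed (auto simp: K'_def)
    have 1: "?q ` H \<inter> K' = {\<one>\<^bsub>Q\<^esub>} \<longleftrightarrow> H \<inter> K = W"
    proof
      assume L: "?q ` H \<inter> K' = {\<one>\<^bsub>Q\<^esub>}"
      have "x \<in> W" if x: "x \<in> H \<inter> K" for x
      proof -
        have "?q x \<in> {\<one>\<^bsub>Q\<^esub>}" using x unfolding L[symmetric] qInt by blast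
        then show ?thesis using q_one_iff[of x] x H(3) unfolding q_one by blast
      qed
      then show "H \<inter> K = W" using H W by blast
    next
      assume "H \<inter> K = W"
      then show "?q ` H \<inter> K' = {\<one>\<^bsub>Q\<^esub>}"
        unfolding qInt q_one using q_one_iff W K Ws.one_closed by blast
    qed
    have img: "?q ` (H <#> K) = ?q ` H <#>\<^bsub>Q\<^esub> K'"
      unfolding K'_def using H(3) K(2) by (auto simp: set_mult_def q_mult image_iff subset_iff) (metis q_mult subsetD)+
    have 2: "?q ` H <#>\<^bsub>Q\<^esub> K' = carrier Q \<longleftrightarrow> H <#> K = J"
    proof -
      have s: "subgroup (H <#> K) G"
        by (rule set_mult_subgroup[OF H(1) K(1) normalizes_mono[OF K(3) H(3)]])
      have le: "W \<subseteq> H <#> K" "H <#> K \<subseteq> J"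
        using set_mult_incl[OF H(1) K(1)] W(2) set_mult_least[OF J H(3) K(2)] by blast+
      show ?thesis unfolding img[symmetric] Qc
      proof
        assume L: "?q ` (H <#> K) = ?q ` J"
        have "x \<in> H <#> K" if "x \<in> J" for x
          using q_mem[OF s le that] that unfolding L by blast
        then show "H <#> K = J" using le(2) by blast
      qed simp
    qed
    show ?thesis unfolding complement_over_def using 1 2 H by blast
  qed
  show "\<exists>H. complement_over J K W H"
  proof -
    obtain H' where H': "subgroup H' Q" "H' \<inter> K' = {\<one>\<^bsub>Q\<^esub>}" "H' <#>\<^bsub>Q\<^esub> K' = carrier Q"
      using A.complement_exists by blast
    have sub: "subgroup H' (?J Mod W)" using H'(1) by (simp add: Q_def)
    define H where "H = \<Union> H'"
    have Heq: "H = {x \<in> J. ?q x \<in> H'}"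
      unfolding H_def using W.factgroup_subgroup_union_char[OF sub] by simp
    have Hs: "subgroup H G"
      unfolding H_def using incl_subgroup[OF J W.factgroup_subgroup_union_subgroup[OF sub]] .
    have img: "?q ` H = H'"
      using subgroup.subset[OF H'(1)] unfolding Heq Qc by blast
    have "W \<subseteq> H"
    proof
      fix x assume x: "x \<in> W"
      then have xJ: "x \<in> J" using W K by blast
      then have "?q x = \<one>\<^bsub>Q\<^esub>" using q_one_iff x q_one by simp
      then show "x \<in> H" unfolding Heq using xJ subgroup.one_closed[OF H'(1)] by simp
    qed
    moreover have "H \<subseteq> J" unfolding Heq by blast
    ultimately have "complement_over J K W H" using down[OF Hs] H' img by blast
    then show ?thesis by blast
  qed
  show "\<exists>k\<in>K. conj_subset G H1 k = H2" if c1: "complement_over J K W H1" and c2: "complement_over J K W H2"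
  proof -
    note d1 = complement_overD[OF c1] and d2 = complement_overD[OF c2]
    have 1: "?q ` H1 \<inter> K' = {\<one>\<^bsub>Q\<^esub>}" "?q ` H1 <#>\<^bsub>Q\<^esub> K' = carrier Q"
      using down[OF d1(1-3)] c1 by simp_all
    have 2: "?q ` H2 \<inter> K' = {\<one>\<^bsub>Q\<^esub>}" "?q ` H2 <#>\<^bsub>Q\<^esub> K' = carrier Q"
      using down[OF d2(1-3)] c2 by simp_all
    obtain k' where k': "k' \<in> K'" "?q ` H2 = conj_subset Q (?q ` H1) k'"
      using A.complements_conj[OF sub_img[OF d1(1,3)] 1 sub_img[OF d2(1,3)] 2] by (rule bexE)
    obtain k where k: "k \<in> K" "k' = ?q k" using k'(1) unfolding K'_def by blast
    have kJ: "k \<in> J" "inv k \<in> J" using k K by auto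
    have kc: "k \<in> carrier G" using kJ by simp
    have H1J: "h \<in> J" if "h \<in> H1" for h using that d1 by blast
    have "conj_subset Q (?q ` H1) k' = (\<lambda>a. inv\<^bsub>Q\<^esub> k' \<otimes>\<^bsub>Q\<^esub> a \<otimes>\<^bsub>Q\<^esub> k') ` (?q ` H1)"
      by (rule Q.conj_subset_image) (use d1 kJ k in \<open>auto simp: Qc\<close>)
    also have "\<dots> = (\<lambda>h. ?q (inv k \<otimes> h \<otimes> k)) ` H1"
      unfolding image_image k(2) by (rule image_cong) (use H1J kJ in \<open>simp_all add: q_mult q_inv\<close>)
    also have "\<dots> = ?q ` conj_subset G H1 k"
      unfolding conj_subset_image[OF subgroup.subset[OF d1(1)] kc] by (simp add: image_image)
    finally have eq: "?q ` H2 = ?q ` conj_subset G H1 k" using k'(2) by simp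
    have cs: "subgroup (conj_subset G H1 k) G" by (rule conj_subset_subgroup[OF d1(1) kc])
    have cJ: "conj_subset G H1 k \<subseteq> J"
      using conj_subset_mono[OF d1(3) Js.subset kc] conj_subset_normalizes[OF normalizes_self[OF J] J Js.subset kJ(1)] by simp
    have cW: "W \<subseteq> conj_subset G H1 k"
      using conj_subset_mono[OF d1(2) subgroup.subset[OF d1(1)] kc]
        conj_subset_normalizes[OF W(3) J Ws.subset kJ(1)] by simp
    have "x \<in> conj_subset G H1 k \<longleftrightarrow> x \<in> H2" if "x \<in> J" for x
      using q_mem[OF cs cW cJ that] q_mem[OF d2(1-3) that] eq by simp
    then have "conj_subset G H1 k = H2" using cJ d2(3) by blast
    then show ?thesis using k(1) by blast
  qed
qed


lemma splitsE:
  assumes "splits \<rho> J K"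
  obtains A B where "subgroup A G" "K \<subseteq> A" "A \<subseteq> J" "normalizes J A" "index_in \<rho> A K" "index_in (- \<rho>) J A"
    "subgroup B G" "K \<subseteq> B" "B \<subseteq> J" "normalizes J B" "index_in (- \<rho>) B K" "index_in \<rho> J B"
  using assms unfolding splits_def by blast

text \<open>\<open>T/(T \<inter> K)\<close> embeds in \<open>J/K\<close>; its Hall parts are cut out
  by \<open>A\<close> and \<open>B\<close>.\<close>

lemma splits_Int:
  assumes "splits \<rho> J K" and J: "subgroup J G" and K: "subgroup K G" "normalizes J K" and T: "subgroup T G" "T \<subseteq> J"
  shows "splits \<rho> T (T \<inter> K)"
proof -
  obtain A B where A: "subgroup A G" "K \<subseteq> A" "A \<subseteq> J" "normalizes J A" "index_in \<rho> A K" "index_in (- \<rho>) J A"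
    and B: "subgroup B G" "K \<subseteq> B" "B \<subseteq> J" "normalizes J B" "index_in (- \<rho>) B K" "index_in \<rho> J B"
    using assms(1) by (rule splitsE)
  have *: "subgroup (T \<inter> A) G \<and> T \<inter> K \<subseteq> T \<inter> A \<and> T \<inter> A \<subseteq> T \<and> normalizes T (T \<inter> A)
      \<and> index_in \<sigma> (T \<inter> A) (T \<inter> K) \<and> index_in (- \<sigma>) T (T \<inter> A)"
    if A: "subgroup A G" "K \<subseteq> A" "A \<subseteq> J" "normalizes J A" "index_in \<sigma> A K" "index_in (- \<sigma>) J A" for A \<sigma>
  proof -
    have TA: "subgroup (T \<inter> A) G" using T(1) A(1) by (rule subgroup_Int)
    have "index_in \<sigma> (T \<inter> A) (T \<inter> A \<inter> K)"
      by (rule index_in_Int[OF A(1) K(1) TA A(2)]) (use A T K in \<open>auto intro: normalizes_mono\<close>)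
    moreover have "T \<inter> A \<inter> K = T \<inter> K" using A(2) by blast
    moreover have "index_in (- \<sigma>) T (T \<inter> A)"
      by (rule index_in_Int[OF J A(1) T(1) A(3) T(2) normalizes_mono[OF A(4) T(2)] A(6)])
    moreover have "normalizes T (T \<inter> A)"
      by (rule normalizes_Int[OF normalizes_self[OF T(1)] normalizes_mono[OF A(4) T(2)]])
    ultimately show ?thesis using TA A(2) by auto
  qed
  have "- (- \<rho>) = \<rho>" by simp
  then show ?thesis
    unfolding splits_def using *[OF A] *[of B "- \<rho>"] B by metis
qed

text \<open>Passage to the quotient \<open>J/M\<close>: the Hall parts there come from
  \<open>A <#> M\<close> and \<open>B <#> M\<close>.\<close>

lemma splits_mult:
  assumes "splits \<rho> J K" and J: "subgroup J G" and K: "subgroup K G"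
    and M: "subgroup M G" "K \<subseteq> M" "M \<subseteq> J" "normalizes J M"
  shows "splits \<rho> J M"
proof -
  obtain A B where A: "subgroup A G" "K \<subseteq> A" "A \<subseteq> J" "normalizes J A" "index_in \<rho> A K" "index_in (- \<rho>) J A"
    and B: "subgroup B G" "K \<subseteq> B" "B \<subseteq> J" "normalizes J B" "index_in (- \<rho>) B K" "index_in \<rho> J B"
    using assms(1) by (rule splitsE)
  have *: "subgroup (A <#> M) G \<and> M \<subseteq> A <#> M \<and> A <#> M \<subseteq> J \<and> normalizes J (A <#> M)
      \<and> index_in \<sigma> (A <#> M) M \<and> index_in (- \<sigma>) J (A <#> M)"
    if A: "subgroup A G" "K \<subseteq> A" "A \<subseteq> J" "normalizes J A" "index_in \<sigma> A K" "index_in (- \<sigma>) J A" for A \<sigma>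
  proof -
    have s: "subgroup (A <#> M) G" using set_mult_subgroup[OF A(1) M(1) normalizes_mono[OF M(4) A(3)]] .
    have le: "A <#> M \<subseteq> J" using set_mult_least[OF J A(3) M(3)] .
    have "index_in \<sigma> A (A \<inter> M)"
      by (rule index_in_sandwich(1)[OF A(1) subgroup_Int[OF A(1) M(1)] K]) (use A M in auto)
    then have "index_in \<sigma> (A <#> M) M" using index_in_set_mult_iff[OF A(1) M(1)] by blast
    moreover have "index_in (- \<sigma>) J (A <#> M)"
      by (rule index_in_sandwich(1)[OF J s A(1) set_mult_incl(1)[OF A(1) M(1)] le A(6)])
    moreover have "normalizes J (A <#> M)"
      by (rule normalizes_set_mult[OF A(4) M(4)]) (use J A M in \<open>auto dest: subgroup.subset\<close>)
    ultimately show ?thesis using s le set_mult_incl[OF A(1) M(1)] by blast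
  qed
  have "- (- \<rho>) = \<rho>" by simp
  then show ?thesis
    unfolding splits_def using *[OF A] *[of B "- \<rho>"] B by metis
qed

lemma complement_over_conj:
  assumes c: "complement_over J K W H" and J: "subgroup J G" and K: "subgroup K G" "K \<subseteq> J" "normalizes J K"
    and W: "subgroup W G" "normalizes J W" and x: "x \<in> J"
  shows "complement_over J K W (conj_subset G H x)"
proof -
  note d = complement_overD[OF c]
  have xc: "x \<in> carrier G" using x J subgroup.mem_carrier by metis
  have sc: "H \<subseteq> carrier G" "K \<subseteq> carrier G" "W \<subseteq> carrier G" "J \<subseteq> carrier G"
    using d J K W by (auto dest: subgroup.subset)
  have inv: "conj_subset G K x = K" "conj_subset G W x = W" "conj_subset G J x = J"
    using conj_subset_normalizes[OF K(3) J sc(2) x] conj_subset_normalizes[OF W(2) J sc(3) x]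
      conj_subset_normalizes[OF normalizes_self[OF J] J sc(4) x] by auto
  have s: "subgroup (conj_subset G H x) G" by (rule conj_subset_subgroup[OF d(1) xc])
  have "W \<subseteq> conj_subset G H x" using conj_subset_mono[OF d(2) sc(1) xc] inv by simp
  moreover have le: "conj_subset G H x \<subseteq> J" using conj_subset_mono[OF d(3) sc(4) xc] inv by simp
  moreover have I: "conj_subset G H x \<inter> K = W" using conj_subset_Int[OF sc(1,2) xc] d(4) inv by simp
  moreover have "conj_subset G H x <#> K = J"
  proof (rule card_subset_eq[OF subgroup_finite[OF J] set_mult_least[OF J le K(2)]])
    show "card (conj_subset G H x <#> K) = card J"
      using card_set_mult[OF s K(1)] card_set_mult[OF d(1) K(1)] I d(4,5) card_conj_subset[OF sc(1) xc]
        subgroup_card_pos[OF W(1)] by (metis mult_cancel2 less_irrefl)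
  qed
  ultimately show ?thesis using s by (simp add: complement_over_def)
qed


lemma index_in_Compl_prime: "prime q \<Longrightarrow> index_in (- {q}) A B \<longleftrightarrow> multiplicity q (card A) = multiplicity q (card B)"
  by (auto simp: index_in_def)

text \<open>
  Induction on \<open>|J : K|\<close>: for a prime \<open>q\<close> dividing it, let \<open>A/K\<close> be the normal Sylow \<open>q\<close>-subgroup of
  \<open>J/K\<close> and \<open>Q/W\<close> a Sylow \<open>q\<close>-subgroup of \<open>A/W\<close>. Then \<open>A = Q K\<close>, and the Frattini argument
  reduces to the normalizer of \<open>Q\<close> in \<open>J\<close>.
\<close>

lemma complements_split_quotient:
  assumes "subgroup J G" "subgroup K G" "K \<subseteq> J" "normalizes J K"
    and "subgroup W G" "W \<subseteq> K" "normalizes J W"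
    and "index_in \<rho> K W" "index_in (- \<rho>) J K"
    and "\<And>q. prime q \<Longrightarrow> q \<notin> \<rho> \<Longrightarrow> splits {q} J K"
  shows "(\<exists>H. complement_over J K W H) \<and>
    (\<forall>H1 H2. complement_over J K W H1 \<longrightarrow> complement_over J K W H2 \<longrightarrow> (\<exists>k\<in>K. conj_subset G H1 k = H2))"
  using assms
proof (induction "card J div card K" arbitrary: J K W rule: less_induct)
  case less
  note J = less.prems(1) and K = less.prems(2-4) and W = less.prems(5-7) and ind = less.prems(8,9) and spl = less.prems(10)
  interpret Js: subgroup J G by fact
  have WJ: "W \<subseteq> J" using W(2) K(2) by blast
  show ?case
  proof (cases "\<forall>q. prime q \<and> q \<notin> \<rho> \<longrightarrow> multiplicity q (card J) = multiplicity q (card K)")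
    case True
    then have "index_in \<rho> J K" by (auto simp: index_in_def)
    then have JK: "J = K" using index_in_disjoint_eq[OF J K(1,2) _ ind(2)] by auto
    have "W <#> K = J" using JK set_mult_least[OF K(1) W(2)] set_mult_incl(2)[OF W(1) K(1)] by blast
    then have "complement_over J K W W" using W JK by (auto simp: complement_over_def)
    moreover have "H = W" if "complement_over J K W H" for H
      using complement_overD[OF that] JK by blast
    moreover have "conj_subset G W \<one> = W" using conj_subset_one[OF subgroup.subset[OF W(1)]] .
    ultimately show ?thesis using subgroup.one_closed[OF K(1)] by metis
  next
    case False
    then obtain q where q: "prime q" "q \<notin> \<rho>" "multiplicity q (card J) \<noteq> multiplicity q (card K)" by blast
    obtain A where A: "subgroup A G" "K \<subseteq> A" "A \<subseteq> J" "normalizes J A" "index_in {q} A K" "index_in (- {q}) J A"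
      using spl[OF q(1,2)] by (rule splitsE)
    interpret As: subgroup A G by fact
    have WA: "W \<subseteq> A" "normalizes A W" using W A normalizes_mono[OF W(3) A(3)] by auto
    obtain Q where Q: "subgroup Q G" "W \<subseteq> Q" "Q \<subseteq> A" "index_in {q} Q W" "index_in (- {q}) A Q"
      using relative_sylow_exists[OF q(1) A(1) W(1) WA] .
    have QJ: "Q \<subseteq> J" using Q(3) A(3) by blast
    have QK: "Q \<inter> K = W"
    proof -
      have s: "subgroup (Q \<inter> K) G" using subgroup_Int[OF Q(1) K(1)] .
      have le: "W \<subseteq> Q \<inter> K" using Q(2) W(2) by blast
      have "index_in \<rho> (Q \<inter> K) W" using index_in_sandwich(2)[OF K(1) s W(1) le _ ind(1)] by blast
      moreover have "index_in {q} (Q \<inter> K) W" using index_in_sandwich(2)[OF Q(1) s W(1) le _ Q(4)] by blast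
      ultimately show ?thesis using index_in_disjoint_eq[OF s W(1) le, of \<rho> "{q}"] q(2) by blast
    qed
    have QKA: "Q <#> K = A"
    proof -
      have s: "subgroup (Q <#> K) G" using set_mult_subgroup[OF Q(1) K(1) normalizes_mono[OF K(3) QJ]] .
      have le: "Q <#> K \<subseteq> A" using set_mult_least[OF A(1) Q(3) A(2)] .
      have "index_in {q} A (Q <#> K)"
        using index_in_sandwich(1)[OF A(1) s K(1) set_mult_incl(2)[OF Q(1) K(1)] le A(5)] .
      moreover have "index_in (- {q}) A (Q <#> K)"
        using index_in_sandwich(1)[OF A(1) s Q(1) set_mult_incl(1)[OF Q(1) K(1)] le Q(5)] .
      ultimately show ?thesis using index_in_disjoint_eq[OF A(1) s le, of "{q}" "- {q}"] by blast
    qed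
    have KQA: "K <#> Q = A"
      using QKA set_mult_normal_commute[OF Q(1) K(1) normalizes_mono[OF K(3) QJ]] by simp
    have cardQ: "T = Q" if T: "subgroup T G" "T \<subseteq> Q" "index_in {q} T W" "index_in (- {q}) A T" for T
    proof (rule subgroup_eqI[OF T(1) Q(1) T(2)])
      fix r :: nat assume r: "prime r"
      show "multiplicity r (card T) = multiplicity r (card Q)"
      proof (cases "r = q")
        case True
        then show ?thesis using T(4) Q(5) unfolding index_in_Compl_prime[OF q(1)] by simp
      next
        case False
        then show ?thesis using index_inD[OF T(3) r] index_inD[OF Q(4) r] by simp
      qed
    qed
    define N where "N = normalizer G Q \<inter> J"
    have N: "subgroup N G" "N \<subseteq> J" "normalizes N Q"
      unfolding N_def using subgroup_Int[OF normalizer_subgroup J] subgroup.subset[OF Q(1)]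
        normalizes_mono[OF normalizes_normalizer] by auto
    have QN: "Q \<subseteq> N"
      unfolding N_def using subset_normalizer_iff[OF Q(1) subgroup.subset[OF Q(1)]] normalizes_self[OF Q(1)] QJ by blast
    have sub_N: "H \<subseteq> N" if "subgroup H G" "H \<subseteq> J" "normalizes H Q" for H
      unfolding N_def using subset_normalizer_iff[OF that(1) subgroup.subset[OF Q(1)]] that by blast
    \<comment> \<open>A conjugate of \<open>Q\<close> under \<open>j\<close> is again a Sylow
      q-subgroup of the normal subgroup \<open>A\<close> over \<open>W\<close>, so some
      \<open>a\<close> in \<open>A\<close> carries it back to \<open>Q\<close>; then
      \<open>j \<otimes> a\<close> lies in \<open>N\<close>.\<close>
    have NA: "N <#> A = J"
    proof
      show "N <#> A \<subseteq> J" using set_mult_least[OF J N(2) A(3)] .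
      show "J \<subseteq> N <#> A"
      proof
        fix j assume j: "j \<in> J"
        have jc: "j \<in> carrier G" using j by simp
        let ?S = "conj_subset G Q j"
        have Wj: "conj_subset G W j = W" by (rule conj_subset_normalizes[OF W(3) J subgroup.subset[OF W(1)] j])
        have Aj: "conj_subset G A j = A" by (rule conj_subset_normalizes[OF A(4) J As.subset j])
        have S: "subgroup ?S G" by (rule conj_subset_subgroup[OF Q(1) jc])
        have SW: "W \<subseteq> ?S" using conj_subset_mono[OF Q(2) subgroup.subset[OF Q(1)] jc] Wj by simp
        have SA: "?S \<subseteq> A" using conj_subset_mono[OF Q(3) As.subset jc] Aj by simp
        have iS: "index_in {q} ?S W"
          using Q(4) index_in_conj[of Q W j "{q}"] Wj jc subgroup.subset[OF Q(1)] subgroup.subset[OF W(1)] by simp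
        obtain a where a: "a \<in> A" "conj_subset G ?S a \<subseteq> Q"
          using relative_sylow_dominates[OF q(1) A(1) W(1) WA(2) Q(1-3,5) S SW SA iS] .
        have ac: "a \<in> carrier G" using a(1) by simp
        have "conj_subset G Q (j \<otimes> a) \<subseteq> Q"
          using a(2) conj_subset_mult[OF subgroup.subset[OF Q(1)] jc ac] by simp
        then have "conj_subset G Q (j \<otimes> a) = Q"
          using card_subset_eq[OF subgroup_finite[OF Q(1)]] card_conj_subset[OF subgroup.subset[OF Q(1)], of "j \<otimes> a"] jc ac
          by simp
        then have "j \<otimes> a \<in> N"
          unfolding N_def using mem_normalizer_iff[OF subgroup.subset[OF Q(1)]] jc ac j a(1) A(3) by auto
        moreover have "j = (j \<otimes> a) \<otimes> inv a" using jc ac by (simp add: m_assoc)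
        moreover have "inv a \<in> A" using a(1) by simp
        ultimately show "j \<in> N <#> A" unfolding set_mult_def by blast
      qed
    qed
    define L where "L = N \<inter> A"
    have KN: "subgroup (K \<inter> N) G" using subgroup_Int[OF K(1) N(1)] .
    have L: "subgroup L G" "L \<subseteq> N" "normalizes N L" "Q \<subseteq> L"
      unfolding L_def using subgroup_Int[OF N(1) A(1)] normalizes_Int[OF normalizes_self[OF N(1)]]
        normalizes_mono[OF A(4) N(2)] QN Q(3) by auto
    have LQ: "L = Q <#> (K \<inter> N)"
      unfolding L_def using set_mult_modular[OF Q(1) N(1) QN subgroup.subset[OF K(1)]] QKA by (simp add: Int_commute)
    have LQ': "L = (K \<inter> N) <#> Q"
      using set_mult_normal_commute[OF KN Q(1) normalizes_mono[OF N(3)]] LQ by blast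
    have indL: "index_in \<rho> L Q"
    proof -
      have "K \<inter> N \<inter> Q = W" using QK QN by blast
      moreover have "index_in \<rho> (K \<inter> N) W"
        using index_in_sandwich(2)[OF K(1) KN W(1) _ _ ind(1)] W(2) Q(2) QN by blast
      ultimately show ?thesis unfolding LQ' using index_in_set_mult_iff[OF KN Q(1)] by simp
    qed
    have indN: "index_in (- \<rho>) N L"
      unfolding L_def
      by (rule index_in_Int[OF J A(1) N(1) A(3) N(2) normalizes_mono[OF A(4) N(2)]])
        (rule index_in_sandwich(1)[OF J A(1) K(1) A(2,3) ind(2)])
    have splN: "splits {r} N L" if "prime r" "r \<notin> \<rho>" for r
      unfolding L_def
      by (rule splits_Int[OF splits_mult[OF spl[OF that] J K(1) A(1-4)] J A(1,4) N(1,2)])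
    \<comment> \<open>|N : L| equals |J : A|, and \<open>q\<close> divides |A : K|, so the measure
      drops.\<close>
    have smaller: "card N div card L < card J div card K"
    proof -
      have pos: "card L > 0" "card A > 0" "card K > 0" using subgroup_card_pos L(1) A(1) K(1) by auto
      have "card J * card L = card N * card A"
        using card_set_mult[OF N(1) A(1)] NA by (simp add: L_def)
      moreover obtain a where a: "card J = card A * a" using card_subgroup_dvd[OF A(1) J A(3)] by (auto elim: dvdE)
      ultimately have "card N = card L * a" using pos by (simp add: mult.commute mult.left_commute)
      then have 1: "card N div card L = a" using pos by simp
      obtain b where b: "card A = card K * b" using card_subgroup_dvd[OF K(1) A(1) A(2)] by (auto elim: dvdE)
      have 2: "card J div card K = b * a" using a b pos by simp
      have "b \<noteq> 1"
        using b q(3) A(6) index_in_Compl_prime[OF q(1), of J A] by auto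
      moreover have "b \<noteq> 0" using b pos by auto
      moreover have "a > 0" using a subgroup_card_pos[OF J] by (cases a) auto
      ultimately show ?thesis unfolding 1 2 by (cases b) auto
    qed
    have IH: "(\<exists>H. complement_over N L Q H) \<and>
      (\<forall>H1 H2. complement_over N L Q H1 \<longrightarrow> complement_over N L Q H2 \<longrightarrow> (\<exists>k\<in>L. conj_subset G H1 k = H2))"
      by (rule less.hyps[OF smaller N(1) L(1-3) Q(1) L(4) N(3) indL indN splN])
    show ?thesis
    proof (intro conjI allI impI)
      obtain H where "complement_over N L Q H" using IH by blast
      note H = complement_overD[OF this]
      have HJ: "H \<subseteq> J" using H(3) N(2) by blast
      have "H \<inter> K = W"
      proof
        have "H \<inter> K \<subseteq> Q" using H(3,4) A(2) unfolding L_def by blast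
        then show "H \<inter> K \<subseteq> W" using QK by blast
        show "W \<subseteq> H \<inter> K" using Q(2) H(2) W(2) by blast
      qed
      moreover have "H <#> K = J"
      proof
        show "H <#> K \<subseteq> J" using set_mult_least[OF J HJ K(2)] .
        have s: "subgroup (H <#> K) G" using set_mult_subgroup[OF H(1) K(1) normalizes_mono[OF K(3) HJ]] .
        note i = set_mult_incl[OF H(1) K(1)]
        have "L \<subseteq> H <#> K" unfolding LQ by (rule set_mult_least[OF s]) (use i H(2) in auto)
        then have "N \<subseteq> H <#> K" using set_mult_least[OF s i(1), of L] H(5) by blast
        moreover have "A \<subseteq> H <#> K" unfolding QKA[symmetric] by (rule set_mult_least[OF s]) (use i H(2) in auto)
        ultimately show "J \<subseteq> H <#> K" using set_mult_least[OF s] NA by blast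
      qed
      ultimately have "complement_over J K W H" using H HJ Q(2) by (auto simp: complement_over_def)
      then show "\<exists>H. complement_over J K W H" by blast
    next
      fix H1 H2 assume c: "complement_over J K W H1" "complement_over J K W H2"
      have norm: "\<exists>k\<in>K. complement_over N L Q (conj_subset G H k)" if c: "complement_over J K W H" for H
      proof -
        note H = complement_overD[OF c]
        let ?Q = "H \<inter> A"
        have s: "subgroup ?Q G" using subgroup_Int[OF H(1) A(1)] .
        have le: "W \<subseteq> ?Q" "?Q \<subseteq> A" using H(2) WA by auto
        have i1: "index_in {q} ?Q W"
        proof -
          have "index_in {q} ?Q (?Q \<inter> K)"
            using index_in_Int[OF A(1) K(1) s A(2) _ normalizes_mono[OF K(3)] A(5)] A(3) by blast
          moreover have "?Q \<inter> K = W" using H(4) A(2) by blast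
          ultimately show ?thesis by simp
        qed
        have i2: "index_in (- {q}) A ?Q"
        proof -
          have "multiplicity q (card J) + multiplicity q (card W) = multiplicity q (card H) + multiplicity q (card K)"
            using multiplicity_set_mult[OF H(1) K(1) q(1)] H(4,5) by simp
          moreover have "multiplicity q (card K) = multiplicity q (card W)" using index_inD[OF ind(1) q(1,2)] .
          moreover have "multiplicity q (card J) = multiplicity q (card A)"
            using A(6) index_in_Compl_prime[OF q(1)] by blast
          moreover have "multiplicity q (card H) = multiplicity q (card ?Q)"
            using index_in_Int[OF J A(1) H(1) A(3) H(3) normalizes_mono[OF A(4) H(3)] A(6)]
              index_in_Compl_prime[OF q(1)] by blast
          ultimately show ?thesis by (simp add: index_in_Compl_prime[OF q(1)])
        qed
        obtain a where a: "a \<in> A" "conj_subset G ?Q a \<subseteq> Q"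
          using relative_sylow_dominates[OF q(1) A(1) W(1) WA(2) Q(1-3,5) s le i1] .
        obtain k u where ku: "k \<in> K" "u \<in> Q" "a = k \<otimes> u"
          using a(1) unfolding KQA[symmetric] set_mult_def by blast
        have kc: "k \<in> carrier G" "u \<in> carrier G" "k \<in> J" "k \<in> A"
          using ku K(2) A(2) Js.mem_carrier subgroup.mem_carrier[OF Q(1)] by blast+
        have sc: "?Q \<subseteq> carrier G" by (rule subgroup.subset[OF s])
        have "conj_subset G (conj_subset G ?Q k) u \<subseteq> Q"
          using a(2) unfolding ku(3) conj_subset_mult[OF sc kc(1,2)] .
        then have "conj_subset G (conj_subset G (conj_subset G ?Q k) u) (inv u) \<subseteq> conj_subset G Q (inv u)"
          using conj_subset_mono[OF _ subgroup.subset[OF Q(1)]] kc(2) by simp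
        then have "conj_subset G ?Q k \<subseteq> Q"
          using conj_subset_carrier[OF sc kc(1)] kc(2)
            conj_subset_normalizes[OF normalizes_self[OF Q(1)] Q(1) subgroup.subset[OF Q(1)]
              subgroup.m_inv_closed[OF Q(1) ku(2)]] by simp
        moreover have Wk: "conj_subset G W k = W"
          by (rule conj_subset_normalizes[OF W(3) J subgroup.subset[OF W(1)] kc(3)])
        moreover have Ak: "conj_subset G A k = A"
          by (rule conj_subset_normalizes[OF A(4) J As.subset kc(3)])
        ultimately have Qk: "conj_subset G ?Q k = Q"
          using cardQ[OF conj_subset_subgroup[OF s kc(1)]] i1 i2 sc kc(1)
            index_in_conj[OF sc subgroup.subset[OF W(1)] kc(1)] index_in_conj[OF As.subset sc kc(1)] by simp
        have c': "complement_over J K W (conj_subset G H k)"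
          by (rule complement_over_conj[OF c J K W(1,3) kc(3)])
        note H' = complement_overD[OF c']
        let ?H = "conj_subset G H k"
        have HA: "?H \<inter> A = Q"
          using conj_subset_Int[OF subgroup.subset[OF H(1)] As.subset kc(1)] Qk Ak by simp
        have "normalizes ?H Q"
          unfolding HA[symmetric]
          by (rule normalizes_Int[OF normalizes_self[OF H'(1)] normalizes_mono[OF A(4) H'(3)]])
        then have HN: "?H \<subseteq> N" using sub_N[OF H'(1,3)] by blast
        have "?H <#> L = N"
        proof
          show "?H <#> L \<subseteq> N" using set_mult_least[OF N(1) HN L(2)] .
          have "N = ?H <#> (K \<inter> N)"
            using set_mult_modular[OF H'(1) N(1) HN subgroup.subset[OF K(1)]] H'(5) N(2) by blast
          also have "\<dots> \<subseteq> ?H <#> L"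
            by (rule mono_set_mult) (use A(2) in \<open>auto simp: L_def\<close>)
          finally show "N \<subseteq> ?H <#> L" .
        qed
        moreover have "?H \<inter> L = Q" "Q \<subseteq> ?H" unfolding L_def using HA HN by auto
        ultimately have "complement_over N L Q ?H" using H'(1) HN by (simp add: complement_over_def)
        then show ?thesis using ku(1) by blast
      qed
      obtain k1 k2 where k1: "k1 \<in> K" "complement_over N L Q (conj_subset G H1 k1)"
        and k2: "k2 \<in> K" "complement_over N L Q (conj_subset G H2 k2)"
        using norm[OF c(1)] norm[OF c(2)] by blast
      obtain l where l: "l \<in> L" "conj_subset G (conj_subset G H1 k1) l = conj_subset G H2 k2"
        using IH k1(2) k2(2) by blast
      \<comment> \<open>The factor of \<open>l\<close> from \<open>Q\<close> lies in the first
        complement and normalizes it. Dropping it leaves a conjugation by elements of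
        \<open>K\<close> only.\<close>
      obtain u n where un: "u \<in> Q" "n \<in> K" "n \<in> N" "l = u \<otimes> n"
        using l(1) unfolding LQ set_mult_def by blast
      have cc: "k1 \<in> carrier G" "k2 \<in> carrier G" "u \<in> carrier G" "n \<in> carrier G" "H1 \<subseteq> carrier G" "H2 \<subseteq> carrier G"
        using k1(1) k2(1) un subgroup.mem_carrier[OF K(1)] subgroup.mem_carrier[OF Q(1)]
          subgroup.subset[OF complement_overD(1)[OF c(1)]] subgroup.subset[OF complement_overD(1)[OF c(2)]] by auto
      have sc1: "conj_subset G H1 k1 \<subseteq> carrier G" using cc by (simp add: conj_subset_carrier)
      have "conj_subset G (conj_subset G H1 k1) u = conj_subset G H1 k1"
        using conj_subset_normalizes[OF normalizes_self[OF complement_overD(1)[OF k1(2)]] complement_overD(1)[OF k1(2)] sc1]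
          complement_overD(2)[OF k1(2)] un(1) by blast
      then have "conj_subset G H2 k2 = conj_subset G (conj_subset G H1 k1) n"
        using l(2) un(4) conj_subset_mult[OF sc1 cc(3,4)] by simp
      also have "\<dots> = conj_subset G H1 (k1 \<otimes> n)" using conj_subset_mult cc by simp
      finally have "conj_subset G (conj_subset G H2 k2) (inv k2) = conj_subset G (conj_subset G H1 (k1 \<otimes> n)) (inv k2)"
        by simp
      then have "H2 = conj_subset G H1 (k1 \<otimes> n \<otimes> inv k2)"
        using cc by (simp add: conj_subset_mult conj_subset_one)
      moreover have "k1 \<otimes> n \<otimes> inv k2 \<in> K"
        using k1(1) k2(1) un(2) K(1) by (simp add: subgroup.m_closed subgroup.m_inv_closed)
      ultimately show "\<exists>k\<in>K. conj_subset G H1 k = H2" by blast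
    qed
  qed
qed

text \<open>The domination clause is conjugacy of complements in the smaller group
  \<open>S <#> K\<close>, where both \<open>S\<close> and \<open>H \<inter> (S <#> K)\<close> are
  complements. Hence \<open>main\<close> is proved for every \<open>M\<close> between
  \<open>K\<close> and \<open>J\<close>.\<close>

theorem schur_zassenhaus_over:
  assumes J: "subgroup J G" and K: "subgroup K G" "K \<subseteq> J" "normalizes J K"
    and W: "subgroup W G" "W \<subseteq> K" "normalizes J W"
    and ind: "index_in \<rho> K W" "index_in (- \<rho>) J K"
    and cond: "(\<forall>x\<in>K. \<forall>y\<in>K. W #> (x \<otimes> y) = W #> (y \<otimes> x)) \<or> (\<forall>q. prime q \<and> q \<notin> \<rho> \<longrightarrow> splits {q} J K)"
  obtains H where "complement_over J K W H"
    "\<And>S. subgroup S G \<Longrightarrow> W \<subseteq> S \<Longrightarrow> S \<subseteq> J \<Longrightarrow> index_in (- \<rho>) S W \<Longrightarrow> \<exists>k\<in>K. conj_subset G S k \<subseteq> H"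
proof -
  have main: "(\<exists>H. complement_over M K W H) \<and>
    (\<forall>H1 H2. complement_over M K W H1 \<longrightarrow> complement_over M K W H2 \<longrightarrow> (\<exists>k\<in>K. conj_subset G H1 k = H2))"
    if M: "subgroup M G" "K \<subseteq> M" "M \<subseteq> J" for M
  proof -
    have n: "normalizes M K" "normalizes M W" using normalizes_mono[OF K(3) M(3)] normalizes_mono[OF W(3) M(3)] by auto
    have i: "index_in (- \<rho>) M K" by (rule index_in_sandwich(2)[OF J M(1) K(1) M(2,3) ind(2)])
    show ?thesis
    proof (cases "\<forall>x\<in>K. \<forall>y\<in>K. W #> (x \<otimes> y) = W #> (y \<otimes> x)")
      case True
      then show ?thesis
        using complements_abelian[OF M(1) K(1) M(2) n(1) W(1,2) n(2) _ ind(1) i] by blast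
    next
      case False
      then have "splits {q} J K" if "prime q" "q \<notin> \<rho>" for q using cond that by blast
      then have "splits {q} M K" if "prime q" "q \<notin> \<rho>" for q
        using splits_Int[OF _ J K(1,3) M(1,3)] that M(2) by (metis inf.absorb_iff2)
      then show ?thesis
        using complements_split_quotient[OF M(1) K(1) M(2) n(1) W(1,2) n(2) ind(1) i] by blast
    qed
  qed
  obtain H where c: "complement_over J K W H" using main[OF J K(2)] by blast
  note H = complement_overD[OF c]
  show thesis
  proof (rule that[OF c])
    fix S assume S: "subgroup S G" "W \<subseteq> S" "S \<subseteq> J" "index_in (- \<rho>) S W"
    have SK: "subgroup (S <#> K) G" by (rule set_mult_subgroup[OF S(1) K(1) normalizes_mono[OF K(3) S(3)]])
    have SKJ: "S <#> K \<subseteq> J" by (rule set_mult_least[OF J S(3) K(2)])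
    note i = set_mult_incl[OF S(1) K(1)]
    have "S \<inter> K = W"
    proof (rule index_in_disjoint_eq)
      show "subgroup (S \<inter> K) G" using subgroup_Int[OF S(1) K(1)] .
      then show "index_in \<rho> (S \<inter> K) W" "index_in (- \<rho>) (S \<inter> K) W"
        using index_in_sandwich(2)[OF K(1) _ W(1) _ _ ind(1), of "S \<inter> K"]
          index_in_sandwich(2)[OF S(1) _ W(1) _ _ S(4), of "S \<inter> K"] S(2) W(2) by auto
    qed (use W S in auto)
    then have c1: "complement_over (S <#> K) K W S" using S i by (simp add: complement_over_def)
    have "(H \<inter> (S <#> K)) <#> K = S <#> K"
    proof -
      have HS: "subgroup (H \<inter> (S <#> K)) G" using subgroup_Int[OF H(1) SK] .
      have "K <#> H = J" using H(5) set_mult_normal_commute[OF H(1) K(1) normalizes_mono[OF K(3) H(3)]] by simp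
      then have "S <#> K = K <#> (H \<inter> (S <#> K))"
        using set_mult_modular[OF K(1) SK i(2) subgroup.subset[OF H(1)]] SKJ by blast
      then show ?thesis
        using set_mult_normal_commute[OF HS K(1) normalizes_mono[OF K(3)]] SKJ by blast
    qed
    then have c2: "complement_over (S <#> K) K W (H \<inter> (S <#> K))"
      using H i S(2) subgroup_Int[OF H(1) SK] by (auto simp: complement_over_def)
    obtain k where "k \<in> K" "conj_subset G S k = H \<inter> (S <#> K)"
      using main[OF SK i(2) SKJ] c1 c2 by blast
    then show "\<exists>k\<in>K. conj_subset G S k \<subseteq> H" by blast
  qed
qed

end

section \<open>Fitting sets\<close>

definition blocks :: "nat set \<Rightarrow> nat set set" where
  "blocks \<pi> = insert \<pi> {{p} | p. prime p \<and> p \<notin> \<pi>}"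

lemma blocks_disjoint: "b \<in> blocks \<pi> \<Longrightarrow> c \<in> blocks \<pi> \<Longrightarrow> b \<noteq> c \<Longrightarrow> b \<inter> c = {}"
  by (auto simp: blocks_def)

lemma blocks_cover: "prime p \<Longrightarrow> \<exists>b\<in>blocks \<pi>. p \<in> b"
  by (auto simp: blocks_def)

text \<open>Asking for a splitting at each block separately, and not for one decomposition into all
  Hall parts, reduces every closure property to one of \<open>splits\<close>.\<close>

definition (in group) block_nilpotent :: "nat set \<Rightarrow> 'a set \<Rightarrow> 'a set \<Rightarrow> bool" where
  "block_nilpotent \<pi> J K \<longleftrightarrow> (\<forall>b\<in>blocks \<pi>. splits b J K)"

text \<open>
  \<open>S\<close> plays the role of the \<open>F\<close>-subgroups between \<open>W\<close> and \<open>X\<close>. The abstraction is needed because the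
  induction replaces \<open>W\<close> by a larger subgroup \<open>K\<close> and each \<open>T\<close> by \<open>T K\<close>, which no longer belongs to
  \<open>F\<close>.
\<close>

definition (in group) fitting_set :: "nat set \<Rightarrow> 'a set \<Rightarrow> 'a set \<Rightarrow> 'a set \<Rightarrow> 'a set set \<Rightarrow> bool" where
  "fitting_set \<pi> X Y W S \<longleftrightarrow>
     subgroup X G \<and> subgroup Y G \<and> subgroup W G \<and> W \<subseteq> Y \<and> Y \<subseteq> X \<and> normalizes X W \<and> normalizes X Y \<and>
     block_nilpotent \<pi> X Y \<and> W \<in> S \<and>
     (\<forall>T\<in>S. subgroup T G \<and> W \<subseteq> T \<and> T \<subseteq> X \<and> T \<inter> Y = W) \<and>
     (\<forall>T\<in>S. \<forall>x\<in>X. conj_subset G T x \<in> S) \<and>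
     (\<forall>T\<in>S. \<forall>U. subgroup U G \<and> W \<subseteq> U \<and> U \<subseteq> T \<and> normalizes T U \<longrightarrow> U \<in> S) \<and>
     (\<forall>T\<in>S. \<forall>U\<in>S. \<forall>J. subgroup J G \<and> T \<subseteq> J \<and> U \<subseteq> J \<and> J \<subseteq> X \<and> block_nilpotent \<pi> J W \<longrightarrow>
        (\<exists>V\<in>S. T \<subseteq> V \<and> U \<subseteq> V \<and> V \<subseteq> J))"

definition maximal_in :: "'a set set \<Rightarrow> 'a set \<Rightarrow> bool" where
  "maximal_in S V \<longleftrightarrow> V \<in> S \<and> (\<forall>U\<in>S. V \<subseteq> U \<longrightarrow> U = V)"

text \<open>The equation of cosets says that \<open>K/W\<close> is abelian. A \<pi>-section is
  restricted by its index alone, so it may be insoluble.\<close>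

definition (in group) soluble_step :: "nat set \<Rightarrow> 'a set \<Rightarrow> 'a set \<Rightarrow> bool" where
  "soluble_step \<pi> K W \<longleftrightarrow> index_in \<pi> K W \<or>
     (\<exists>p. prime p \<and> p \<notin> \<pi> \<and> index_in {p} K W \<and> (\<forall>x\<in>K. \<forall>y\<in>K. W #> (x \<otimes> y) = W #> (y \<otimes> x)))"

text \<open>Supplies the invariant factor just above \<open>W\<close> with which the induction on
  Fitting sets proceeds.\<close>

definition (in group) soluble_steps :: "nat set \<Rightarrow> 'a set \<Rightarrow> bool" where
  "soluble_steps \<pi> X \<longleftrightarrow>
     (\<forall>Y W. subgroup Y G \<and> subgroup W G \<and> W \<subset> Y \<and> Y \<subseteq> X \<and> normalizes X W \<and> normalizes X Y \<longrightarrow>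
       (\<exists>K. subgroup K G \<and> W \<subset> K \<and> K \<subseteq> Y \<and> normalizes X K \<and> soluble_step \<pi> K W))"

context group
begin

lemma fitting_setD:
  assumes "fitting_set \<pi> X Y W S"
  shows "subgroup X G" "subgroup Y G" "subgroup W G" "W \<subseteq> Y" "Y \<subseteq> X" "normalizes X W" "normalizes X Y"
    "block_nilpotent \<pi> X Y" "W \<in> S"
    "\<And>T. T \<in> S \<Longrightarrow> subgroup T G" "\<And>T. T \<in> S \<Longrightarrow> W \<subseteq> T" "\<And>T. T \<in> S \<Longrightarrow> T \<subseteq> X" "\<And>T. T \<in> S \<Longrightarrow> T \<inter> Y = W"
    "\<And>T x. T \<in> S \<Longrightarrow> x \<in> X \<Longrightarrow> conj_subset G T x \<in> S"
    "\<And>T U. T \<in> S \<Longrightarrow> subgroup U G \<Longrightarrow> W \<subseteq> U \<Longrightarrow> U \<subseteq> T \<Longrightarrow> normalizes T U \<Longrightarrow> U \<in> S"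
    "\<And>T U J. T \<in> S \<Longrightarrow> U \<in> S \<Longrightarrow> subgroup J G \<Longrightarrow> T \<subseteq> J \<Longrightarrow> U \<subseteq> J \<Longrightarrow> J \<subseteq> X \<Longrightarrow> block_nilpotent \<pi> J W \<Longrightarrow>
      \<exists>V\<in>S. T \<subseteq> V \<and> U \<subseteq> V \<and> V \<subseteq> J"
proof -
  note a = assms[unfolded fitting_set_def]
  show "subgroup X G" "subgroup Y G" "subgroup W G" "W \<subseteq> Y" "Y \<subseteq> X" "normalizes X W" "normalizes X Y"
    "block_nilpotent \<pi> X Y" "W \<in> S"
    using a by - (elim conjE, assumption)+
  have b: "\<forall>T\<in>S. subgroup T G \<and> W \<subseteq> T \<and> T \<subseteq> X \<and> T \<inter> Y = W"
    using a by (elim conjE)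
  show "\<And>T. T \<in> S \<Longrightarrow> subgroup T G" "\<And>T. T \<in> S \<Longrightarrow> W \<subseteq> T" "\<And>T. T \<in> S \<Longrightarrow> T \<subseteq> X"
    "\<And>T. T \<in> S \<Longrightarrow> T \<inter> Y = W"
    using b by blast+
  have c: "\<forall>T\<in>S. \<forall>x\<in>X. conj_subset G T x \<in> S"
    using a by (elim conjE)
  show "\<And>T x. T \<in> S \<Longrightarrow> x \<in> X \<Longrightarrow> conj_subset G T x \<in> S"
    using c by blast
  have d: "\<forall>T\<in>S. \<forall>U. subgroup U G \<and> W \<subseteq> U \<and> U \<subseteq> T \<and> normalizes T U \<longrightarrow> U \<in> S"
    using a by (elim conjE)
  show "\<And>T U. T \<in> S \<Longrightarrow> subgroup U G \<Longrightarrow> W \<subseteq> U \<Longrightarrow> U \<subseteq> T \<Longrightarrow> normalizes T U \<Longrightarrow> U \<in> S"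
    by (rule d[rule_format]) (assumption | intro conjI)+
  have e: "\<forall>T\<in>S. \<forall>U\<in>S. \<forall>J. subgroup J G \<and> T \<subseteq> J \<and> U \<subseteq> J \<and> J \<subseteq> X \<and> block_nilpotent \<pi> J W \<longrightarrow>
      (\<exists>V\<in>S. T \<subseteq> V \<and> U \<subseteq> V \<and> V \<subseteq> J)"
    using a by (elim conjE)
  show "\<And>T U J. T \<in> S \<Longrightarrow> U \<in> S \<Longrightarrow> subgroup J G \<Longrightarrow> T \<subseteq> J \<Longrightarrow> U \<subseteq> J \<Longrightarrow> J \<subseteq> X \<Longrightarrow> block_nilpotent \<pi> J W \<Longrightarrow>
      \<exists>V\<in>S. T \<subseteq> V \<and> U \<subseteq> V \<and> V \<subseteq> J"
    by (rule e[rule_format]) (assumption | intro conjI)+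
qed

lemma conj_set_mult:
  assumes "A \<subseteq> carrier G" "B \<subseteq> carrier G" "x \<in> carrier G"
  shows "conj_subset G (A <#> B) x = conj_subset G A x <#> conj_subset G B x"
proof -
  have "inv x \<otimes> (a \<otimes> b) \<otimes> x = (inv x \<otimes> a \<otimes> x) \<otimes> (inv x \<otimes> b \<otimes> x)" if "a \<in> A" "b \<in> B" for a b
  proof -
    have "a \<in> carrier G" "b \<in> carrier G" using that assms by auto
    then show ?thesis using assms(3) by (simp add: m_assoc mult_inv_cancel)
  qed
  then have "(\<lambda>a. inv x \<otimes> a \<otimes> x) ` (A <#> B) = (\<lambda>a. inv x \<otimes> a \<otimes> x) ` A <#> (\<lambda>a. inv x \<otimes> a \<otimes> x) ` B"
    unfolding set_mult_def by (auto simp: image_UN)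
  then show ?thesis
    using assms setmult_subset_G by (simp add: conj_subset_image)
qed

lemma conj_subset_le_iff:
  assumes "A \<subseteq> carrier G" "B \<subseteq> carrier G" "x \<in> carrier G"
  shows "conj_subset G A x \<subseteq> B \<longleftrightarrow> A \<subseteq> conj_subset G B (inv x)"
  using conj_subset_mono[of "conj_subset G A x" B "inv x"] conj_subset_mono[of A "conj_subset G B (inv x)" x]
    assms by (auto simp: conj_subset_carrier)

lemma conj_subset_self: "subgroup H G \<Longrightarrow> x \<in> H \<Longrightarrow> conj_subset G H x = H"
  by (rule conj_subset_normalizes[OF normalizes_self]) (auto dest: subgroup.subset)

end

section \<open>Block-nilpotent sections\<close>

context fin_group
begin

lemma splits_index:
  assumes "subgroup J G" "subgroup K G" "K \<subseteq> J" "normalizes J K" "index_in \<rho> J K"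
  shows "splits \<rho> J K"
  unfolding splits_def
  by (rule exI[of _ J], rule exI[of _ K]) (use assms normalizes_self in simp)

lemma splits_coindex:
  assumes "subgroup J G" "subgroup K G" "K \<subseteq> J" "normalizes J K" "index_in (- \<rho>) J K"
  shows "splits \<rho> J K"
  unfolding splits_def
  by (rule exI[of _ K], rule exI[of _ J]) (use assms normalizes_self in simp)

text \<open>\<open>J/(K \<inter> L)\<close> embeds in the product of \<open>J/K\<close> and
  \<open>J/L\<close>. The Hall parts are intersected, and the index is followed through
  \<open>A \<inter> C \<inter> K\<close>. This closure later provides least kernels.\<close>

lemma splits_Int_kernel:
  assumes J: "subgroup J G" and K: "subgroup K G" "K \<subseteq> J" "normalizes J K" "splits \<rho> J K"
    and L: "subgroup L G" "L \<subseteq> J" "normalizes J L" "splits \<rho> J L"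
  shows "splits \<rho> J (K \<inter> L)"
proof -
  obtain A B where A: "subgroup A G" "K \<subseteq> A" "A \<subseteq> J" "normalizes J A" "index_in \<rho> A K" "index_in (- \<rho>) J A"
    and B: "subgroup B G" "K \<subseteq> B" "B \<subseteq> J" "normalizes J B" "index_in (- \<rho>) B K" "index_in \<rho> J B"
    using K(4) by (rule splitsE)
  obtain C D where C: "subgroup C G" "L \<subseteq> C" "C \<subseteq> J" "normalizes J C" "index_in \<rho> C L" "index_in (- \<rho>) J C"
    and D: "subgroup D G" "L \<subseteq> D" "D \<subseteq> J" "normalizes J D" "index_in (- \<rho>) D L" "index_in \<rho> J D"
    using L(4) by (rule splitsE)
  have *: "subgroup (A \<inter> C) G \<and> K \<inter> L \<subseteq> A \<inter> C \<and> A \<inter> C \<subseteq> J \<and> normalizes J (A \<inter> C)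
      \<and> index_in \<sigma> (A \<inter> C) (K \<inter> L) \<and> index_in (- \<sigma>) J (A \<inter> C)"
    if A: "subgroup A G" "K \<subseteq> A" "A \<subseteq> J" "normalizes J A" "index_in \<sigma> A K" "index_in (- \<sigma>) J A"
      and C: "subgroup C G" "L \<subseteq> C" "C \<subseteq> J" "normalizes J C" "index_in \<sigma> C L" "index_in (- \<sigma>) J C" for A C \<sigma>
  proof -
    have s: "subgroup (A \<inter> C) G" "subgroup (A \<inter> C \<inter> K) G" using subgroup_Int A(1) C(1) K(1) by auto
    have "index_in \<sigma> (A \<inter> C) (A \<inter> C \<inter> K)"
      by (rule index_in_Int[OF A(1) K(1) s(1) A(2) _ normalizes_mono[OF K(3)] A(5)]) (use A C in auto)
    moreover have "index_in \<sigma> (A \<inter> C \<inter> K) (A \<inter> C \<inter> K \<inter> L)"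
      by (rule index_in_Int[OF C(1) L(1) s(2) C(2) _ normalizes_mono[OF L(3)] C(5)]) (use A C in auto)
    moreover have "A \<inter> C \<inter> K \<inter> L = K \<inter> L" using A C by blast
    ultimately have 1: "index_in \<sigma> (A \<inter> C) (K \<inter> L)" by (metis index_in_trans)
    have "index_in (- \<sigma>) C (C \<inter> A)"
      by (rule index_in_Int[OF J A(1) C(1) A(3) C(3) normalizes_mono[OF A(4) C(3)] A(6)])
    then have 2: "index_in (- \<sigma>) J (A \<inter> C)" using index_in_trans[OF C(6)] by (simp add: Int_commute)
    show ?thesis using s(1) A(2,3) C(2) 1 2 normalizes_Int[OF A(4) C(4)] by auto
  qed
  have "- (- \<rho>) = \<rho>" by simp
  then show ?thesis
    unfolding splits_def using *[OF A C] *[of B "- \<rho>" D] B D by metis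
qed

lemma block_nilpotent_Int:
  assumes "block_nilpotent \<pi> J K" "subgroup J G" "subgroup K G" "normalizes J K" "subgroup T G" "T \<subseteq> J"
  shows "block_nilpotent \<pi> T (T \<inter> K)"
  using assms splits_Int unfolding block_nilpotent_def by blast

lemma block_nilpotent_Int_kernel:
  assumes "subgroup J G" "subgroup K G" "K \<subseteq> J" "normalizes J K" "block_nilpotent \<pi> J K"
    and "subgroup L G" "L \<subseteq> J" "normalizes J L" "block_nilpotent \<pi> J L"
  shows "block_nilpotent \<pi> J (K \<inter> L)"
  using assms splits_Int_kernel unfolding block_nilpotent_def by blast

text \<open>At its own block the whole section is the Hall part; at any other block it lies in the
  complementary part, as blocks are disjoint.\<close>

lemma block_nilpotent_block:
  assumes "b \<in> blocks \<pi>" "subgroup J G" "subgroup K G" "K \<subseteq> J" "normalizes J K" "index_in b J K"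
  shows "block_nilpotent \<pi> J K"
  unfolding block_nilpotent_def
proof
  fix c assume c: "c \<in> blocks \<pi>"
  show "splits c J K"
  proof (cases "c = b")
    case True
    then show ?thesis using splits_index assms by blast
  next
    case False
    then have "b \<subseteq> - c" using blocks_disjoint[OF assms(1) c] by blast
    then show ?thesis using splits_coindex index_in_mono assms by metis
  qed
qed

text \<open>\<open>U \<inter> V\<close> contains \<open>A\<close> and \<open>B\<close>, so its index
  in \<open>U\<close> avoids \<rho> on one count and consists of \<rho> on the other:
  \<open>A\<close> and \<open>B\<close> generate \<open>U\<close>.\<close>

lemma subset_by_index:
  assumes "subgroup U G" "subgroup V G" "subgroup A G" "subgroup B G"
    "A \<subseteq> U" "A \<subseteq> V" "B \<subseteq> U" "B \<subseteq> V" "index_in (- \<rho>) U A" "index_in \<rho> U B"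
  shows "U \<subseteq> V"
proof -
  have s: "subgroup (U \<inter> V) G" using subgroup_Int assms by blast
  have "index_in (- \<rho>) U (U \<inter> V)" "index_in \<rho> U (U \<inter> V)"
    using index_in_sandwich(1)[OF assms(1) s assms(3)] index_in_sandwich(1)[OF assms(1) s assms(4)] assms by auto
  then have "U = U \<inter> V" using index_in_disjoint_eq[OF assms(1) s] by (metis Compl_disjoint2 inf_le1)
  then show ?thesis by blast
qed

section \<open>Conjugacy of the maximal members of a Fitting set\<close>

lemma fitting_set_largest:
  assumes fs: "fitting_set \<pi> X Y W S" and J: "subgroup J G" "W \<subseteq> J" "J \<subseteq> X" "block_nilpotent \<pi> J W"
  obtains D where "D \<in> S" "D \<subseteq> J" "\<And>U. U \<in> S \<Longrightarrow> U \<subseteq> J \<Longrightarrow> U \<subseteq> D"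
proof -
  let ?F = "{U \<in> S. U \<subseteq> J}"
  have "?F \<subseteq> Pow J" by auto
  then have "finite ?F" using subgroup_finite[OF J(1)] by (meson finite_Pow_iff finite_subset)
  moreover have "?F \<noteq> {}" using fitting_setD(9)[OF fs] J by blast
  ultimately obtain D where D: "D \<in> ?F" "\<forall>U\<in>?F. D \<subseteq> U \<longrightarrow> D = U"
    using finite_has_maximal by meson
  show thesis
  proof (rule that[of D])
    fix U assume U: "U \<in> S" "U \<subseteq> J"
    \<comment> \<open>Members inside \<open>J\<close> are directed by the last clause of
      \<open>fitting_set\<close>, so the maximal \<open>D\<close> absorbs \<open>U\<close>.\<close>
    obtain V where "V \<in> S" "D \<subseteq> V" "U \<subseteq> V" "V \<subseteq> J"
      using fitting_setD(16)[OF fs, of D U J] D(1) U J by blast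
    then show "U \<subseteq> D" using D(2) by blast
  qed (use D in auto)
qed

text \<open>Conjugates of \<open>D\<close> under elements preserving \<open>J\<close> are members
  inside \<open>J\<close> again, so the largest one absorbs them.\<close>

lemma fitting_set_largest_normalizes:
  assumes fs: "fitting_set \<pi> X Y W S" and D: "D \<in> S" "D \<subseteq> J" "\<And>U. U \<in> S \<Longrightarrow> U \<subseteq> J \<Longrightarrow> U \<subseteq> D"
    and M: "subgroup M G" "M \<subseteq> X" "normalizes M J" and J: "J \<subseteq> carrier G"
  shows "normalizes M D"
proof -
  have "conj_subset G D x \<subseteq> D" if x: "x \<in> M" for x
  proof (rule D(3))
    show "conj_subset G D x \<in> S" using fitting_setD(14)[OF fs D(1)] x M(2) by blast
    show "conj_subset G D x \<subseteq> J"
      using conj_subset_mono[OF D(2) J subgroup.mem_carrier[OF M(1) x]] conj_subset_normalizes[OF M(3,1) J x] by simp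
  qed
  then show ?thesis
    using normalizes_iff_conj[OF subgroup.subset[OF M(1)] subgroup.subset[OF fitting_setD(10)[OF fs D(1)]]] by blast
qed

text \<open>Let \<open>b\<close> be the block of \<open>K/W\<close>. In the preimage
  \<open>A\<close> of the b-part of \<open>J/K\<close> the members have a largest one
  \<open>D\<close>, normalized by \<open>J\<close>. In the preimage \<open>B\<close> of the other
  part, \<open>K/W\<close> has a complement \<open>H/W\<close>, and the members inside
  \<open>H\<close> have a largest one \<open>E\<close>. The product \<open>H <#> D\<close> meets
  \<open>K\<close> in \<open>W\<close>, so it is block-nilpotent over \<open>W\<close> and contains
  a member \<open>T\<close> above \<open>D\<close> and \<open>E\<close>. An arbitrary member
  \<open>U\<close> is generated by \<open>U \<inter> A\<close>, which lies in \<open>D\<close>, and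
  \<open>U \<inter> B\<close>, which some element of \<open>K\<close> carries into \<open>H\<close>
  and hence into \<open>E\<close>.\<close>

lemma fitting_set_hall:
  assumes fs: "fitting_set \<pi> X Y W S"
    and K: "subgroup K G" "W \<subseteq> K" "K \<subseteq> Y" "normalizes X K" "soluble_step \<pi> K W"
    and J: "subgroup J G" "K \<subseteq> J" "J \<subseteq> X" "block_nilpotent \<pi> J K"
  obtains T where "T \<in> S" "T \<subseteq> J" "\<And>U. U \<in> S \<Longrightarrow> U \<subseteq> J \<Longrightarrow> \<exists>k\<in>K. conj_subset G U k \<subseteq> T"
proof -
  note X = fitting_setD(1)[OF fs] and Y = fitting_setD(2,5,7)[OF fs] and W = fitting_setD(3,4,6)[OF fs]
  note S = fitting_setD(10-13)[OF fs]
  have JK: "normalizes J K" and JW: "normalizes J W" using normalizes_mono[OF K(4) J(3)] normalizes_mono[OF W(3) J(3)] by auto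
  have WJ: "W \<subseteq> J" using K(2) J(2) by blast
  obtain b where b: "b \<in> blocks \<pi>" "index_in b K W"
    and step: "b = \<pi> \<or> (\<forall>x\<in>K. \<forall>y\<in>K. W #> (x \<otimes> y) = W #> (y \<otimes> x))"
    using K(5) unfolding soluble_step_def blocks_def by blast
  obtain A B where A: "subgroup A G" "K \<subseteq> A" "A \<subseteq> J" "normalizes J A" "index_in b A K" "index_in (- b) J A"
    and B: "subgroup B G" "K \<subseteq> B" "B \<subseteq> J" "normalizes J B" "index_in (- b) B K" "index_in b J B"
  proof -
    have "splits b J K" using J(4) b(1) by (simp add: block_nilpotent_def)
    then show thesis by (rule splitsE) (rule that)
  qed
  have AB: "A \<inter> B = K"
  proof (rule index_in_disjoint_eq[OF _ K(1), of _ b "- b"])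
    show s: "subgroup (A \<inter> B) G" using subgroup_Int A(1) B(1) by blast
    show "index_in b (A \<inter> B) K" "index_in (- b) (A \<inter> B) K"
      using index_in_sandwich(2)[OF A(1) s K(1) _ _ A(5)] index_in_sandwich(2)[OF B(1) s K(1) _ _ B(5)] A(2) B(2) by auto
  qed (use A B in auto)
  have "block_nilpotent \<pi> A W"
    by (rule block_nilpotent_block[OF b(1) A(1) W(1)])
      (use A K WJ index_in_trans[OF A(5) b(2)] normalizes_mono[OF JW A(3)] in auto)
  then obtain D where D: "D \<in> S" "D \<subseteq> A" "\<And>U. U \<in> S \<Longrightarrow> U \<subseteq> A \<Longrightarrow> U \<subseteq> D"
    using fitting_set_largest[OF fs A(1)] A K J by (metis subset_trans)
  have JD: "normalizes J D"
    using fitting_set_largest_normalizes[OF fs D J(1,3) A(4) subgroup.subset[OF A(1)]] .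
  have Ds: "subgroup D G" "W \<subseteq> D" using S D(1) by auto
  have DK: "D \<inter> K = W" using S(4)[OF D(1)] K(2,3) Ds(2) by blast
  have BK: "normalizes B K" "normalizes B W" using normalizes_mono[OF JK B(3)] normalizes_mono[OF JW B(3)] by auto
  \<comment> \<open>For \<open>b = \<pi>\<close> the quotient \<open>B/K\<close> splits at every
    prime outside \<pi> and is therefore a direct product of Sylow subgroups; otherwise
    \<open>K/W\<close> is abelian.\<close>
  have cond: "(\<forall>x\<in>K. \<forall>y\<in>K. W #> (x \<otimes> y) = W #> (y \<otimes> x)) \<or> (\<forall>q. prime q \<and> q \<notin> b \<longrightarrow> splits {q} B K)"
  proof (cases "b = \<pi>")
    case True
    have "splits {q} B K" if q: "prime q" "q \<notin> b" for q
    proof -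
      have "{q} \<in> blocks \<pi>" using q True by (auto simp: blocks_def)
      then have "splits {q} J K" using J(4) by (auto simp: block_nilpotent_def)
      from splits_Int[OF this J(1) K(1) JK B(1,3)] show ?thesis using B(2) by (simp add: inf.absorb2)
    qed
    then show ?thesis by blast
  qed (use step in blast)
  obtain H where c: "complement_over B K W H"
    and dom: "\<And>S. subgroup S G \<Longrightarrow> W \<subseteq> S \<Longrightarrow> S \<subseteq> B \<Longrightarrow> index_in (- b) S W \<Longrightarrow> \<exists>k\<in>K. conj_subset G S k \<subseteq> H"
    using schur_zassenhaus_over[OF B(1) K(1) B(2) BK(1) W(1) K(2) BK(2) b(2) B(5) cond] by blast
  note H = complement_overD[OF c]
  have HJ: "H \<subseteq> J" using H(3) B(3) by blast
  have "block_nilpotent \<pi> H W"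
    using block_nilpotent_Int[OF J(4,1) K(1) JK H(1) HJ] H(4) by simp
  then obtain E where E: "E \<in> S" "E \<subseteq> H" "\<And>U. U \<in> S \<Longrightarrow> U \<subseteq> H \<Longrightarrow> U \<subseteq> E"
    using fitting_set_largest[OF fs H(1,2)] HJ J(3) by (metis subset_trans)
  let ?M = "H <#> D"
  have HD: "normalizes H D" by (rule normalizes_mono[OF JD HJ])
  have M: "subgroup ?M G" by (rule set_mult_subgroup[OF H(1) Ds(1) HD])
  have MJ: "?M \<subseteq> J" by (rule set_mult_least[OF J(1) HJ]) (use D A in blast)
  note Mi = set_mult_incl[OF H(1) Ds(1)]
  \<comment> \<open>The intersection is a b-section over \<open>W\<close>, being inside
    \<open>K\<close>; modulo \<open>D\<close> it is also a section for the primes outside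
    \<open>b\<close>, being inside \<open>H <#> D\<close>. So it lies in \<open>D\<close>, and
    \<open>D\<close> meets \<open>K\<close> only in \<open>W\<close>.\<close>
  have MK: "?M \<inter> K = W"
  proof -
    let ?I = "?M \<inter> K"
    have I: "subgroup ?I G" "?I \<subseteq> J" "W \<subseteq> ?I" using subgroup_Int[OF M K(1)] MJ Mi(2) Ds(2) K(2) by auto
    have nI: "normalizes ?I D" by (rule normalizes_mono[OF JD I(2)])
    have L: "subgroup (?I <#> D) G" by (rule set_mult_subgroup[OF I(1) Ds(1) nI])
    have LM: "?I <#> D \<subseteq> ?M" by (rule set_mult_least[OF M]) (use Mi in auto)
    note Li = set_mult_incl[OF I(1) Ds(1)]
    have "index_in b ?I W" using index_in_sandwich(2)[OF K(1) I(1) W(1) I(3) _ b(2)] by blast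
    moreover have "?I \<inter> D = W" using DK I(3) Ds(2) by blast
    ultimately have 1: "index_in b (?I <#> D) D" using index_in_set_mult_iff[OF I(1) Ds(1)] by simp
    have HDW: "H \<inter> D = W" using AB H(2-4) D(2) Ds(2) by blast
    have "index_in (- b) H (H \<inter> K)"
      by (rule index_in_Int[OF B(1) K(1) H(1) B(2) H(3) normalizes_mono[OF BK(1) H(3)] B(5)])
    then have "index_in (- b) H (H \<inter> D)" using H(4) HDW by simp
    then have "index_in (- b) ?M D" using index_in_set_mult_iff[OF H(1) Ds(1)] by blast
    then have 2: "index_in (- b) (?I <#> D) D" using index_in_sandwich(2)[OF M L Ds(1) Li(2) LM] by blast
    have "?I <#> D = D" using index_in_disjoint_eq[OF L Ds(1) Li(2) 1 2] by blast
    then have "?I \<subseteq> D" using Li(1) by simp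
    then show ?thesis using DK I(3) by blast
  qed
  have "block_nilpotent \<pi> ?M W"
    using block_nilpotent_Int[OF J(4,1) K(1) JK M MJ] MK by simp
  moreover have "D \<subseteq> ?M" "E \<subseteq> ?M" "?M \<subseteq> X" using Mi E(2) MJ J(3) by auto
  ultimately obtain T where T: "T \<in> S" "D \<subseteq> T" "E \<subseteq> T" "T \<subseteq> ?M"
    using fitting_setD(16)[OF fs D(1) E(1) M] by blast
  show thesis
  proof (rule that[OF T(1)])
    show "T \<subseteq> J" using T(4) MJ by blast
    fix U assume U: "U \<in> S" "U \<subseteq> J"
    have Us: "subgroup U G" "W \<subseteq> U" using S U(1) by auto
    have part: "U \<inter> C \<in> S" "subgroup (U \<inter> C) G" if "subgroup C G" "normalizes J C" "W \<subseteq> C" for C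
    proof -
      show "subgroup (U \<inter> C) G" using subgroup_Int[OF Us(1) that(1)] .
      then show "U \<inter> C \<in> S"
        by (rule fitting_setD(15)[OF fs U(1)])
          (use Us that normalizes_Int[OF normalizes_self[OF Us(1)] normalizes_mono[OF that(2) U(2)]] in auto)
    qed
    have UA: "U \<inter> A \<in> S" "subgroup (U \<inter> A) G" and UB: "U \<inter> B \<in> S" "subgroup (U \<inter> B) G"
      using part[OF A(1,4)] part[OF B(1,4)] A(2) B(2) K(2) by auto
    have iA: "index_in (- b) U (U \<inter> A)"
      by (rule index_in_Int[OF J(1) A(1) Us(1) A(3) U(2) normalizes_mono[OF A(4) U(2)] A(6)])
    have iB: "index_in b U (U \<inter> B)"
      by (rule index_in_Int[OF J(1) B(1) Us(1) B(3) U(2) normalizes_mono[OF B(4) U(2)] B(6)])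
    have "index_in (- b) (U \<inter> B) (U \<inter> B \<inter> K)"
      by (rule index_in_Int[OF B(1) K(1) UB(2) B(2) _ normalizes_mono[OF BK(1)] B(5)]) auto
    moreover have "U \<inter> B \<inter> K = W" using S(4)[OF U(1)] K(2,3) Us(2) B(2) by blast
    ultimately have "index_in (- b) (U \<inter> B) W" by simp
    then obtain k where k: "k \<in> K" "conj_subset G (U \<inter> B) k \<subseteq> H"
      using dom[OF UB(2)] Us(2) B(2) K(2) by auto
    have kc: "k \<in> carrier G" "k \<in> J" "k \<in> X" using k(1) subgroup.mem_carrier[OF K(1)] J by auto
    have "conj_subset G (U \<inter> B) k \<in> S" using fitting_setD(14)[OF fs UB(1) kc(3)] .
    then have kB: "conj_subset G (U \<inter> B) k \<subseteq> T" using E(3) k(2) T(3) by blast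
    have "conj_subset G (U \<inter> A) k \<subseteq> conj_subset G D k"
      by (rule conj_subset_mono[OF _ subgroup.subset[OF Ds(1)] kc(1)]) (use D(3)[OF UA(1)] in blast)
    then have kA: "conj_subset G (U \<inter> A) k \<subseteq> T"
      using conj_subset_normalizes[OF JD J(1) subgroup.subset[OF Ds(1)] kc(2)] T(2) by simp
    have Ts: "subgroup T G" using S(1) T(1) by blast
    have T': "subgroup (conj_subset G T (inv k)) G" using conj_subset_subgroup[OF Ts] kc(1) by simp
    have iff: "conj_subset G Z k \<subseteq> T \<longleftrightarrow> Z \<subseteq> conj_subset G T (inv k)" if "subgroup Z G" for Z
      by (rule conj_subset_le_iff[OF subgroup.subset[OF that] subgroup.subset[OF Ts] kc(1)])
    \<comment> \<open>One element \<open>k\<close> serves both parts: it was chosen to send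
      \<open>U \<inter> B\<close> into \<open>H\<close>, and it preserves \<open>D\<close>, which
      contains \<open>U \<inter> A\<close>.\<close>
    have "U \<subseteq> conj_subset G T (inv k)"
      by (rule subset_by_index[OF Us(1) T' UA(2) UB(2) _ _ _ _ iA iB])
        (use kA kB iff[OF UA(2)] iff[OF UB(2)] in auto)
    then show "\<exists>k\<in>K. conj_subset G U k \<subseteq> T" using iff[OF Us(1)] k(1) by blast
  qed
qed

text \<open>The substance is the directedness of the products. By \<open>fitting_set_hall\<close>
  members inside \<open>J\<close> enter a common \<open>T\<close> only up to conjugation by
  \<open>K\<close>; but \<open>K\<close> lies in \<open>T <#> K\<close>, so after multiplication by
  \<open>K\<close> the inclusions hold exactly. Closure under normal subgroups is the modular
  law.\<close>

lemma fitting_set_quotient: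
  assumes fs: "fitting_set \<pi> X Y W S"
    and K: "subgroup K G" "W \<subseteq> K" "K \<subseteq> Y" "normalizes X K" "soluble_step \<pi> K W"
  shows "fitting_set \<pi> X Y K ((\<lambda>T. T <#> K) ` S)"
proof -
  note X = fitting_setD(1)[OF fs] and Y = fitting_setD(2,5,7)[OF fs] and W = fitting_setD(3,4,6)[OF fs]
  note S = fitting_setD(10-13)[OF fs]
  let ?S = "(\<lambda>T. T <#> K) ` S"
  have nK: "normalizes T K" if "T \<in> S" for T by (rule normalizes_mono[OF K(4) S(3)[OF that]])
  have TK: "subgroup (T <#> K) G" if "T \<in> S" for T by (rule set_mult_subgroup[OF S(1)[OF that] K(1) nK[OF that]])
  have comm: "T <#> K = K <#> T" if "T \<in> S" for T
    by (rule set_mult_normal_commute[OF S(1)[OF that] K(1) nK[OF that]])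
  have KX: "K \<subseteq> X" using K(3) Y(2) by blast
  have WK: "W <#> K = K"
    using set_mult_least[OF K(1,2)] set_mult_incl(2)[OF W(1) K(1)] by blast
  have 1: "K \<in> ?S" using fitting_setD(9)[OF fs] WK by (metis image_eqI)
  have 2: "\<forall>M\<in>?S. subgroup M G \<and> K \<subseteq> M \<and> M \<subseteq> X \<and> M \<inter> Y = K"
  proof
    fix M assume "M \<in> ?S"
    then obtain T where T: "T \<in> S" "M = T <#> K" by blast
    have "M \<inter> Y = K <#> (T \<inter> Y)"
      unfolding T(2) comm[OF T(1)] by (rule set_mult_modular[OF K(1) Y(1) K(3) subgroup.subset[OF S(1)[OF T(1)]]])
    also have "\<dots> = K"
      unfolding S(4)[OF T(1)] using set_mult_least[OF K(1) _ K(2), of K] set_mult_incl(1)[OF K(1) W(1)] by blast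
    finally show "subgroup M G \<and> K \<subseteq> M \<and> M \<subseteq> X \<and> M \<inter> Y = K"
      unfolding T(2)
      using TK[OF T(1)] set_mult_incl(2)[OF S(1)[OF T(1)] K(1)] set_mult_least[OF X S(3)[OF T(1)] KX]
      by (intro conjI)
  qed
  have 3: "\<forall>M\<in>?S. \<forall>x\<in>X. conj_subset G M x \<in> ?S"
  proof (intro ballI)
    fix M x assume "M \<in> ?S" and x: "x \<in> X"
    then obtain T where T: "T \<in> S" "M = T <#> K" by blast
    have "conj_subset G M x = conj_subset G T x <#> conj_subset G K x"
      unfolding T(2) by (rule conj_set_mult) (use S(1)[OF T(1)] K(1) X x in \<open>auto dest: subgroup.subset\<close>)
    also have "conj_subset G K x = K" by (rule conj_subset_normalizes[OF K(4) X subgroup.subset[OF K(1)] x])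
    finally show "conj_subset G M x \<in> ?S" using fitting_setD(14)[OF fs T(1) x] by blast
  qed
  have 4: "\<forall>M\<in>?S. \<forall>U. subgroup U G \<and> K \<subseteq> U \<and> U \<subseteq> M \<and> normalizes M U \<longrightarrow> U \<in> ?S"
  proof (intro ballI allI impI, elim conjE)
    fix M U assume "M \<in> ?S" and U: "subgroup U G" "K \<subseteq> U" "U \<subseteq> M" "normalizes M U"
    then obtain T where T: "T \<in> S" "M = T <#> K" by blast
    have TU: "subgroup (T \<inter> U) G" using subgroup_Int[OF S(1)[OF T(1)] U(1)] .
    have TM: "T \<subseteq> M" using set_mult_incl(1)[OF S(1)[OF T(1)] K(1)] T(2) by simp
    have "T \<inter> U \<in> S"
      by (rule fitting_setD(15)[OF fs T(1) TU])
        (use S(2)[OF T(1)] K(2) U(2) normalizes_Int[OF normalizes_self[OF S(1)[OF T(1)]] normalizes_mono[OF U(4) TM]] in auto)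
    moreover have "U = K <#> (T \<inter> U)"
      using set_mult_modular[OF K(1) U(1,2) subgroup.subset[OF S(1)[OF T(1)]]] U(3) T(2) comm[OF T(1)] by blast
    ultimately show "U \<in> ?S" using comm by blast
  qed
  have 5: "\<forall>M\<in>?S. \<forall>U\<in>?S. \<forall>J. subgroup J G \<and> M \<subseteq> J \<and> U \<subseteq> J \<and> J \<subseteq> X \<and> block_nilpotent \<pi> J K \<longrightarrow>
        (\<exists>V\<in>?S. M \<subseteq> V \<and> U \<subseteq> V \<and> V \<subseteq> J)"
  proof (intro ballI allI impI, elim conjE)
    fix M U J assume "M \<in> ?S" "U \<in> ?S" and J: "subgroup J G" "M \<subseteq> J" "U \<subseteq> J" "J \<subseteq> X" "block_nilpotent \<pi> J K"
    then obtain P Q where P: "P \<in> S" "M = P <#> K" and Q: "Q \<in> S" "U = Q <#> K" by blast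
    have KJ: "K \<subseteq> J" using 2 \<open>M \<in> ?S\<close> J(2) by blast
    obtain T where T: "T \<in> S" "T \<subseteq> J" "\<And>U. U \<in> S \<Longrightarrow> U \<subseteq> J \<Longrightarrow> \<exists>k\<in>K. conj_subset G U k \<subseteq> T"
      using fitting_set_hall[OF fs K J(1) KJ J(4,5)] by blast
    note Ti = set_mult_incl[OF S(1)[OF T(1)] K(1)]
    have key: "Z <#> K \<subseteq> T <#> K" if Z: "Z \<in> S" "Z <#> K \<subseteq> J" for Z
    proof -
      have "Z \<subseteq> J" using set_mult_incl(1)[OF S(1)[OF Z(1)] K(1)] Z(2) by blast
      then obtain k where k: "k \<in> K" "conj_subset G Z k \<subseteq> T" using T(3)[OF Z(1)] by blast
      have kc: "k \<in> carrier G" using subgroup.mem_carrier[OF K(1) k(1)] .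
      have "conj_subset G Z k \<subseteq> T <#> K" using k(2) Ti(1) by blast
      then have "Z \<subseteq> conj_subset G (T <#> K) (inv k)"
        using conj_subset_le_iff[OF subgroup.subset[OF S(1)[OF Z(1)]] subgroup.subset[OF TK[OF T(1)]] kc] by blast
      moreover have "inv k \<in> T <#> K" using subgroup.m_inv_closed[OF K(1) k(1)] Ti(2) by blast
      ultimately have "Z \<subseteq> T <#> K" using conj_subset_self[OF TK[OF T(1)]] by simp
      then show ?thesis using set_mult_least[OF TK[OF T(1)] _ Ti(2)] by blast
    qed
    have "T <#> K \<subseteq> J" using set_mult_least[OF J(1) T(2) KJ] .
    then show "\<exists>V\<in>?S. M \<subseteq> V \<and> U \<subseteq> V \<and> V \<subseteq> J"
      using key[OF P(1)] key[OF Q(1)] P(2) Q(2) J(2,3) T(1) by blast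
  qed
  show ?thesis
    unfolding fitting_set_def
    using X Y K 1 2 3 4 5 fitting_setD(8)[OF fs] by (intro conjI) assumption+
qed

lemma maximal_in_conj:
  assumes fs: "fitting_set \<pi> X Y W S" and V: "maximal_in S V" and x: "x \<in> X"
  shows "maximal_in S (conj_subset G V x)"
proof -
  note X = fitting_setD(1)[OF fs] and S = fitting_setD(10-13)[OF fs]
  have VS: "V \<in> S" using V by (simp add: maximal_in_def)
  have xc: "x \<in> carrier G" "inv x \<in> X" using subgroup.mem_carrier[OF X x] subgroup.m_inv_closed[OF X x] by auto
  show ?thesis
    unfolding maximal_in_def
  proof (intro conjI ballI impI)
    show "conj_subset G V x \<in> S" using fitting_setD(14)[OF fs VS x] .
    fix U assume U: "U \<in> S" "conj_subset G V x \<subseteq> U"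
    have sc: "V \<subseteq> carrier G" "U \<subseteq> carrier G" using S(1) VS U(1) subgroup.subset by blast+
    have "V \<subseteq> conj_subset G U (inv x)" using conj_subset_le_iff[OF sc xc(1)] U(2) by blast
    then have "conj_subset G U (inv x) = V"
      using V fitting_setD(14)[OF fs U(1) xc(2)] by (auto simp: maximal_in_def)
    then show "U = conj_subset G V x" using sc xc(1) by auto
  qed
qed

text \<open>If \<open>W = Y\<close>, the set is directed in \<open>X\<close> and has only one
  maximal member. Otherwise multiplication by a step \<open>K\<close> preserves maximality, and by
  induction \<open>V1 <#> K\<close> is conjugate to \<open>V2 <#> K\<close>. This leaves two maximal
  members inside one product, and \<open>fitting_set_hall\<close> carries both onto the same member
  by elements of \<open>K\<close>.\<close>

theorem maximal_in_fitting_set_conj: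
  assumes "fitting_set \<pi> X Y W S" "soluble_steps \<pi> X" "maximal_in S V1" "maximal_in S V2"
  shows "\<exists>y\<in>Y. conj_subset G V1 y = V2"
  using assms
proof (induction "card Y - card W" arbitrary: W S V1 V2 rule: less_induct)
  case less
  note fs = less.prems(1) and ss = less.prems(2) and V1 = less.prems(3) and V2 = less.prems(4)
  note X = fitting_setD(1)[OF fs] and Y = fitting_setD(2,5,7)[OF fs] and W = fitting_setD(3,4,6)[OF fs]
  note S = fitting_setD(10-13)[OF fs]
  have VS: "V1 \<in> S" "V2 \<in> S" using V1 V2 by (auto simp: maximal_in_def)
  show ?case
  proof (cases "W = Y")
    case True
    then obtain V where "V \<in> S" "V1 \<subseteq> V" "V2 \<subseteq> V"
      using fitting_setD(16)[OF fs VS X S(3)[OF VS(1)] S(3)[OF VS(2)]] fitting_setD(8)[OF fs] by blast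
    then have "V1 = V2" using V1 V2 by (auto simp: maximal_in_def)
    then show ?thesis
      using conj_subset_one[OF subgroup.subset[OF S(1)[OF VS(1)]]] subgroup.one_closed[OF Y(1)] by blast
  next
    case False
    then obtain K where K: "subgroup K G" "W \<subset> K" "K \<subseteq> Y" "normalizes X K" "soluble_step \<pi> K W"
      using ss W Y unfolding soluble_steps_def by blast
    have WK: "W \<subseteq> K" using K(2) by blast
    let ?S = "(\<lambda>T. T <#> K) ` S"
    have fsK: "fitting_set \<pi> X Y K ?S" by (rule fitting_set_quotient[OF fs K(1) WK K(3-5)])
    note SK = fitting_setD(10-13)[OF fsK]
    have hall: "\<exists>T\<in>S. T \<subseteq> J \<and> (\<forall>U. U \<in> S \<longrightarrow> U \<subseteq> J \<longrightarrow> (\<exists>k\<in>K. conj_subset G U k \<subseteq> T))" if J: "J \<in> ?S" for J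
    proof -
      have "block_nilpotent \<pi> J K"
        using block_nilpotent_Int[OF fitting_setD(8)[OF fs] X Y(1,3) SK(1)[OF J] SK(3)[OF J]] SK(4)[OF J] by simp
      then obtain T where T: "T \<in> S" "T \<subseteq> J" "\<And>U. U \<in> S \<Longrightarrow> U \<subseteq> J \<Longrightarrow> \<exists>k\<in>K. conj_subset G U k \<subseteq> T"
        using fitting_set_hall[OF fs K(1) WK K(3-5) SK(1,2,3)[OF J]] by blast
      then show ?thesis by (intro bexI[of _ T] conjI allI impI)
    qed
    have KX: "K \<subseteq> X" using K(3) Y(2) by blast
    have Kc: "k \<in> carrier G" if "k \<in> K" for k using that subgroup.mem_carrier[OF K(1)] by blast
    have conj_max: "conj_subset G V k = T" if V: "maximal_in S V" and k: "k \<in> K" and T: "T \<in> S" "conj_subset G V k \<subseteq> T" for V k T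
      using maximal_in_conj[OF fs V, of k] k KX T by (auto simp: maximal_in_def)
    \<comment> \<open>If \<open>M = P <#> K\<close> contains \<open>V <#> K\<close>, then the
      dominating member of \<open>M\<close> is a \<open>K\<close>-conjugate of the maximal
      \<open>V\<close>; a \<open>K\<close>-conjugate of \<open>P\<close> lies in it, so
      \<open>P\<close> itself lies in \<open>V <#> K\<close>.\<close>
    have maxK: "maximal_in ?S (V <#> K)" if V: "maximal_in S V" for V
      unfolding maximal_in_def
    proof (intro conjI ballI impI)
      have VS: "V \<in> S" using V by (simp add: maximal_in_def)
      then show "V <#> K \<in> ?S" by blast
      fix M assume M: "M \<in> ?S" "V <#> K \<subseteq> M"
      obtain P where P: "P \<in> S" "M = P <#> K" using M(1) by blast
      note VK = SK(1)[of "V <#> K"] and Vi = set_mult_incl[OF S(1)[OF VS] K(1)]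
      have VKs: "subgroup (V <#> K) G" using SK(1) VS by blast
      obtain T where T: "T \<in> S" "\<And>U. U \<in> S \<Longrightarrow> U \<subseteq> M \<Longrightarrow> \<exists>k\<in>K. conj_subset G U k \<subseteq> T" using hall[OF M(1)] by blast
      obtain k where k: "k \<in> K" "conj_subset G V k \<subseteq> T" using T(2)[OF VS] Vi(1) M(2) by blast
      have Tk: "T = conj_subset G V k" using conj_max[OF V k(1) T(1) k(2)] by simp
      obtain l where l: "l \<in> K" "conj_subset G P l \<subseteq> T"
        using T(2)[OF P(1)] set_mult_incl(1)[OF S(1)[OF P(1)] K(1)] P(2) by blast
      have "conj_subset G V k \<subseteq> V <#> K"
        using conj_subset_mono[OF Vi(1) subgroup.subset[OF VKs] Kc[OF k(1)]] conj_subset_self[OF VKs, of k] Vi(2) k(1) by blast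
      then have "conj_subset G P l \<subseteq> V <#> K" using l(2) Tk by simp
      then have "P \<subseteq> conj_subset G (V <#> K) (inv l)"
        using conj_subset_le_iff[OF subgroup.subset[OF S(1)[OF P(1)]] subgroup.subset[OF VKs] Kc[OF l(1)]] by blast
      moreover have "inv l \<in> V <#> K" using subgroup.m_inv_closed[OF K(1) l(1)] Vi(2) by blast
      ultimately have "P \<subseteq> V <#> K" using conj_subset_self[OF VKs] by simp
      then have "M \<subseteq> V <#> K" unfolding P(2) using set_mult_least[OF VKs _ Vi(2)] by blast
      then show "M = V <#> K" using M(2) by blast
    qed
    have "card W < card K" using psubset_card_mono[OF subgroup_finite[OF K(1)] K(2)] .
    moreover have "card K \<le> card Y" using card_mono[OF subgroup_finite[OF Y(1)] K(3)] .
    ultimately have dec: "card Y - card K < card Y - card W" by linarith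
    obtain y where y: "y \<in> Y" "conj_subset G (V1 <#> K) y = V2 <#> K"
      using less.hyps[OF dec fsK ss maxK[OF V1] maxK[OF V2]] by blast
    have yX: "y \<in> X" "y \<in> carrier G" using y(1) Y(2) subgroup.mem_carrier[OF Y(1)] by auto
    let ?V = "conj_subset G V1 y"
    have Vm: "maximal_in S ?V" by (rule maximal_in_conj[OF fs V1 yX(1)])
    have VS': "?V \<in> S" using Vm by (simp add: maximal_in_def)
    have "conj_subset G (V1 <#> K) y = ?V <#> K"
      using conj_set_mult[OF subgroup.subset[OF S(1)[OF VS(1)]] subgroup.subset[OF K(1)] yX(2)]
        conj_subset_normalizes[OF K(4) X subgroup.subset[OF K(1)] yX(1)] by simp
    then have eq: "?V <#> K = V2 <#> K" using y(2) by simp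
    have "V2 <#> K \<in> ?S" using VS(2) by blast
    then obtain T where T: "T \<in> S" "\<And>U. U \<in> S \<Longrightarrow> U \<subseteq> V2 <#> K \<Longrightarrow> \<exists>k\<in>K. conj_subset G U k \<subseteq> T"
      using hall by meson
    obtain k where k: "k \<in> K" "conj_subset G ?V k \<subseteq> T"
      using T(2)[OF VS'] set_mult_incl(1)[OF S(1)[OF VS'] K(1)] eq by blast
    obtain l where l: "l \<in> K" "conj_subset G V2 l \<subseteq> T"
      using T(2)[OF VS(2)] set_mult_incl(1)[OF S(1)[OF VS(2)] K(1)] by blast
    have "conj_subset G ?V k = conj_subset G V2 l"
      using conj_max[OF Vm k(1) T(1) k(2)] conj_max[OF V2 l(1) T(1) l(2)] by simp
    then have "conj_subset G (conj_subset G ?V k) (inv l) = V2"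
      using Kc[OF l(1)] subgroup.subset[OF S(1)[OF VS(2)]] by simp
    then have "conj_subset G V1 (y \<otimes> k \<otimes> inv l) = V2"
      using Kc[OF l(1)] Kc[OF k(1)] yX(2) subgroup.subset[OF S(1)[OF VS(1)]]
      by (simp add: conj_subset_mult conj_subset_carrier)
    moreover have "y \<otimes> k \<otimes> inv l \<in> Y"
      using y(1) k(1) l(1) K(3) Y(1) by (meson subgroup.m_closed subgroup.m_inv_closed subsetD)
    ultimately show ?thesis by blast
  qed
qed

end

section \<open>Fitting classes\<close>

lemma fin_group_subgroup: "fin_group G \<Longrightarrow> subgroup H G \<Longrightarrow> fin_group (G\<lparr>carrier := H\<rparr>)"
  by (simp add: fin_group_def fin_group_axioms_def group.subgroup_imp_group)
    (meson finite_subset subgroup.subset)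

text \<open>Matches the guard for large \<pi> in \<open>npi_dnormal\<close> with the trichotomy
  empty, singleton, large.\<close>

lemma big_block_iff: "(infinite \<pi> \<or> card \<pi> \<ge> 2) \<longleftrightarrow> \<not> (\<pi> = {} \<or> (\<exists>p. \<pi> = {p}))" for \<pi> :: "nat set"
proof (cases "finite \<pi>")
  case True
  have "card \<pi> \<ge> 2 \<longleftrightarrow> card \<pi> \<noteq> 0 \<and> card \<pi> \<noteq> Suc 0" by linarith
  then show ?thesis using True by (simp add: card_1_singleton_iff)
next
  case False
  then show ?thesis by auto
qed

context fin_group
begin

lemma Factor_order:
  assumes "subgroup H G" "subgroup N G" "N \<subseteq> H"
  shows "order (G\<lparr>carrier := H\<rparr> Mod N) * card N = card H"
  using card_rcosets_restrict[OF assms(2,1,3)] by (simp add: order_def FactGroup_def rcosets_restrict)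

lemma prime_dvd_Factor_order_iff:
  assumes "subgroup H G" "subgroup N G" "N \<subseteq> H" "prime p"
  shows "p dvd order (G\<lparr>carrier := H\<rparr> Mod N) \<longleftrightarrow> multiplicity p (card H) \<noteq> multiplicity p (card N)"
proof -
  let ?n = "order (G\<lparr>carrier := H\<rparr> Mod N)"
  have eq: "?n * card N = card H" by (rule Factor_order[OF assms(1-3)])
  then have "?n \<noteq> 0" "card N \<noteq> 0" using subgroup_card_pos[OF assms(1)] subgroup_card_pos[OF assms(2)] by (metis mult_is_0 less_irrefl)+
  then have "multiplicity p (card H) = multiplicity p ?n + multiplicity p (card N)"
    unfolding eq[symmetric] using assms(4) by (simp add: prime_elem_multiplicity_mult_distrib)
  then show ?thesis using prime_multiplicity_gt_zero_iff[of p ?n] assms(4) \<open>?n \<noteq> 0\<close> by auto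
qed

lemma pi_group_Factor_iff:
  assumes "subgroup H G" "subgroup N G" "N \<subseteq> H" "normalizes H N"
  shows "pi_group \<rho> (G\<lparr>carrier := H\<rparr> Mod N) \<longleftrightarrow> index_in \<rho> H N"
proof -
  have "N \<lhd> G\<lparr>carrier := H\<rparr>" using normal_restrict_iff[OF assms(1)] assms by blast
  then have "group (G\<lparr>carrier := H\<rparr> Mod N)" by (rule normal.factorgroup_is_group)
  moreover have "finite (carrier (G\<lparr>carrier := H\<rparr> Mod N))"
    using subgroup_finite[OF assms(1)] by (simp add: carrier_FactGroup)
  ultimately show ?thesis
    using prime_dvd_Factor_order_iff[OF assms(1-3)] by (auto simp: pi_group_def index_in_def)
qed

text \<open>Normal subgroups of \<pi>-index are closed under intersection, so a minimal one is least
  and the \<open>LEAST\<close> is attained.\<close>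

lemma O_upper_restrict:
  fixes \<pi> :: "nat set"
  assumes H: "subgroup H G"
  defines "N \<equiv> O_upper \<pi> (G\<lparr>carrier := H\<rparr>)"
  shows "subgroup N G" "N \<subseteq> H" "normalizes H N" "index_in \<pi> H N"
    and "\<And>M. subgroup M G \<Longrightarrow> M \<subseteq> H \<Longrightarrow> normalizes H M \<Longrightarrow> index_in \<pi> H M \<Longrightarrow> N \<subseteq> M"
proof -
  let ?P = "\<lambda>M. subgroup M G \<and> M \<subseteq> H \<and> normalizes H M \<and> index_in \<pi> H M"
  have P: "M \<lhd> G\<lparr>carrier := H\<rparr> \<and> pi_group \<pi> (G\<lparr>carrier := H\<rparr> Mod M) \<longleftrightarrow> ?P M" for M
    using normal_restrict_iff[OF H, of M] pi_group_Factor_iff[OF H, of M] by blast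
  have "{M. ?P M} \<subseteq> Pow H" by auto
  then have "finite {M. ?P M}" using subgroup_finite[OF H] by (meson finite_Pow_iff finite_subset)
  moreover have "?P H" using H normalizes_self by simp
  then have "{M. ?P M} \<noteq> {}" by blast
  ultimately obtain M where M: "?P M" "\<And>L. ?P L \<Longrightarrow> L \<subseteq> M \<Longrightarrow> M = L"
    using finite_has_minimal[of "{M. ?P M}"] by (metis (mono_tags, lifting) mem_Collect_eq)
  have least: "M \<subseteq> L" if L: "?P L" for L
  proof -
    have "index_in \<pi> L (L \<inter> M)"
      by (rule index_in_Int[OF H, of M L]) (use M(1) L in \<open>auto intro: normalizes_mono\<close>)
    then have "?P (L \<inter> M)"
      using L M(1) subgroup_Int normalizes_Int index_in_trans by blast
    then show ?thesis using M(2)[of "L \<inter> M"] by blast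
  qed
  have "N = M"
    unfolding N_def O_upper_def
    by (rule Least_equality) (use P M(1) least in auto)
  then show "subgroup N G" "N \<subseteq> H" "normalizes H N" "index_in \<pi> H N"
    and "\<And>M. subgroup M G \<Longrightarrow> M \<subseteq> H \<Longrightarrow> normalizes H M \<Longrightarrow> index_in \<pi> H M \<Longrightarrow> N \<subseteq> M"
    using M(1) least by auto
qed

text \<open>Conjugation by an element preserving \<open>H\<close> permutes the candidates, so the
  least one is fixed.\<close>

lemma normalizes_O_upper:
  assumes H: "subgroup H G" and M: "subgroup M G" "normalizes M H"
  shows "normalizes M (O_upper \<pi> (G\<lparr>carrier := H\<rparr>))" (is "normalizes M ?N")
proof -
  note N = O_upper_restrict[OF H, where \<pi> = \<pi>]
  have sc: "?N \<subseteq> carrier G" "H \<subseteq> carrier G" using N(1) H subgroup.subset by blast+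
  have "conj_subset G ?N x = ?N" if x: "x \<in> M" for x
  proof -
    have xc: "x \<in> carrier G" using subgroup.mem_carrier[OF M(1) x] .
    have Hx: "conj_subset G H x = H" by (rule conj_subset_normalizes[OF M(2,1) sc(2) x])
    have "?N \<subseteq> conj_subset G ?N x"
    proof (rule N(5))
      show "subgroup (conj_subset G ?N x) G" by (rule conj_subset_subgroup[OF N(1) xc])
      show "conj_subset G ?N x \<subseteq> H" using conj_subset_mono[OF N(2) sc(2) xc] Hx by simp
      show "normalizes H (conj_subset G ?N x)" using normalizes_conj[OF N(3) sc(2,1) xc] Hx by simp
      show "index_in \<pi> H (conj_subset G ?N x)" using index_in_conj[OF sc(2,1) xc] N(4) Hx by simp
    qed
    then show ?thesis
      using card_subset_eq[of "conj_subset G ?N x" ?N] card_conj_subset[OF sc(1) xc]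
        subgroup_finite[OF conj_subset_subgroup[OF N(1) xc]] by simp
  qed
  then show ?thesis using normalizes_iff_conj[OF subgroup.subset[OF M(1)] sc(1)] by simp
qed

lemma sylow_subset_normalizer:
  assumes "sylow_subgroup p G P" "normalizes (carrier G) H" "H \<subseteq> carrier G"
  shows "P \<subseteq> normalizer G H"
proof -
  have "subgroup P G" using assms(1) by (simp add: sylow_subgroup_def)
  then show ?thesis
    using subset_normalizer_iff[OF _ assms(3)] normalizes_mono[OF assms(2) subgroup.subset] by blast
qed

lemma npi_dnormal_normal:
  assumes "N \<lhd> G"
  shows "npi_dnormal \<pi> G N"
proof -
  have N: "subgroup N G" "normalizes (carrier G) N" using assms normal_iff_normalizes by auto
  have 1: "P \<subseteq> normalizer G N" if "sylow_subgroup p G P" for p P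
    by (rule sylow_subset_normalizer[OF that N(2) subgroup.subset[OF N(1)]])
  have 2: "P \<subseteq> normalizer G (O_upper \<pi> (G\<lparr>carrier := N\<rparr>))" if "sylow_subgroup p G P" for p P
    by (rule sylow_subset_normalizer[OF that normalizes_O_upper[OF N(1) subgroup_self N(2)]])
      (rule subgroup.subset[OF O_upper_restrict(1)[OF N(1)]])
  show ?thesis unfolding npi_dnormal_def using N(1) 1 2 by blast
qed

text \<open>The index of \<open>W\<close> in \<open>P <#> W\<close> is a power of \<open>p\<close>
  and also a \<rho>-number, hence 1.\<close>

lemma p_subgroup_in_normal:
  assumes p: "prime p" "p \<notin> \<rho>" and P: "subgroup P G" "card P = p ^ n"
    and W: "subgroup W G" "normalizes P W" and J: "subgroup J G" "P \<subseteq> J" "W \<subseteq> J" "index_in \<rho> J W"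
  shows "P \<subseteq> W"
proof -
  have PW: "subgroup (P <#> W) G" by (rule set_mult_subgroup[OF P(1) W])
  note i = set_mult_incl[OF P(1) W(1)]
  have "P <#> W \<subseteq> J" by (rule set_mult_least[OF J(1-3)])
  then have "index_in \<rho> (P <#> W) W" using index_in_sandwich(2)[OF J(1) PW W(1) i(2) _ J(4)] by blast
  moreover have "index_in {p} (P <#> W) W"
    unfolding index_in_def
  proof (intro allI impI)
    fix q :: nat assume q: "prime q \<and> q \<notin> {p}"
    then have "multiplicity q (card P) = 0" using P(2) multiplicity_distinct_prime_power[OF p(1), of q] by simp
    then show "multiplicity q (card (P <#> W)) = multiplicity q (card W)"
      using multiplicity_set_mult[OF P(1) W(1), of q] q multiplicity_card_mono[OF W(1) PW i(2), of q] by linarith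
  qed
  ultimately have "P <#> W = W" using index_in_disjoint_eq[OF PW W(1) i(2)] p(2) by blast
  then show ?thesis using i(1) by simp
qed

text \<open>\<open>O_upper\<close> is the same for \<open>N\<close> and \<open>W\<close>, since each
  of the two residuals is a candidate for the other; thus it is normal in the whole group. A Sylow
  subgroup for a prime outside \<pi> lies in \<open>W\<close>, hence in \<open>N\<close>. No
  subnormality of \<open>N\<close> is involved, and this is the gain over ordinary Fitting
  classes.\<close>

lemma npi_dnormal_section:
  assumes W: "W \<lhd> G" "W \<subseteq> N" and N: "subgroup N G" and ind: "index_in \<pi> (carrier G) W"
    and big: "infinite \<pi> \<or> card \<pi> \<ge> 2"
  shows "npi_dnormal \<pi> G N"
proof -
  have W': "subgroup W G" "normalizes (carrier G) W" using W normal_iff_normalizes by auto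
  have Nc: "N \<subseteq> carrier G" by (rule subgroup.subset[OF N])
  let ?O = "\<lambda>H. O_upper \<pi> (G\<lparr>carrier := H\<rparr>)"
  note ON = O_upper_restrict[OF N, where \<pi> = \<pi>] and OW = O_upper_restrict[OF W'(1), where \<pi> = \<pi>]
  have nW: "normalizes (carrier G) (?O W)" by (rule normalizes_O_upper[OF W'(1) subgroup_self W'(2)])
  have ind': "index_in \<pi> N W" by (rule index_in_sandwich(2)[OF subgroup_self N W'(1) W(2) Nc ind])
  have "?O N \<subseteq> ?O W"
    by (rule ON(5)[OF OW(1) _ normalizes_mono[OF nW Nc] index_in_trans[OF ind' OW(4)]]) (use OW(2) W(2) in blast)
  moreover from this have "?O W \<subseteq> ?O N"
    using OW(2) by (intro OW(5)[OF ON(1) _ normalizes_mono[OF ON(3) W(2)] index_in_sandwich(2)[OF N W'(1) ON(1) _ W(2) ON(4)]]) auto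
  ultimately have "?O N = ?O W" by blast
  then have 2: "P \<subseteq> normalizer G (?O N)" if "sylow_subgroup p G P" for p P
    using sylow_subset_normalizer[OF that nW subgroup.subset[OF OW(1)]] by simp
  have 1: "P \<subseteq> normalizer G N" if p: "p \<in> primes_compl \<pi>" and P: "sylow_subgroup p G P" for p P
  proof -
    have Ps: "subgroup P G" "card P = p ^ multiplicity p (order G)" using P by (auto simp: sylow_subgroup_def)
    have p': "prime p" "p \<notin> \<pi>" using p by (auto simp: primes_compl_def)
    have "P \<subseteq> W"
      by (rule p_subgroup_in_normal[OF p' Ps W'(1) normalizes_mono[OF W'(2)] subgroup_self _ _ ind])
        (use subgroup.subset[OF Ps(1)] subgroup.subset[OF W'(1)] in auto)
    then have "P \<subseteq> N" using W(2) by blast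
    then show ?thesis using subset_normalizer_iff[OF N Nc] normalizes_self[OF N] by blast
  qed
  have "\<not> (\<exists>p. \<pi> = {p})" using big big_block_iff by blast
  then show ?thesis unfolding npi_dnormal_def using N 1 2 by blast
qed

end

section \<open>Class membership across isomorphic copies\<close>

lemma group_class_iso:
  fixes Y :: "nat monoid"
  assumes "group_class F" "in_class X F" "group Y" "X \<cong> Y"
  shows "Y \<in> F"
proof -
  obtain Z where Z: "Z \<in> F" "X \<cong> Z" "group X" using assms(2) by (auto simp: in_class_def)
  have "Z \<cong> Y" using iso_trans[OF group.iso_sym[OF Z(3,2)] assms(4)] .
  then show ?thesis using assms(1,3) Z(1) unfolding group_class_def by blast
qed

lemma in_class_iso: "in_class X F \<Longrightarrow> X \<cong> Y \<Longrightarrow> group Y \<Longrightarrow> in_class Y F"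
  unfolding in_class_def using group.iso_sym iso_trans by blast

lemma iso_image_subgroup:
  assumes "group G" "group Y" "h \<in> iso G Y" "subgroup N G"
  shows "subgroup (h ` N) Y" "G\<lparr>carrier := N\<rparr> \<cong> Y\<lparr>carrier := h ` N\<rparr>" "card (h ` N) = card N"
proof -
  interpret group_hom G Y h
    using assms by (simp add: group_hom_def group_hom_axioms_def iso_imp_homomorphism)
  show s: "subgroup (h ` N) Y" by (rule subgroup_img_is_subgroup[OF assms(4)])
  show "G\<lparr>carrier := N\<rparr> \<cong> Y\<lparr>carrier := h ` N\<rparr>"
    using iso_restrict[OF assms(3,1,2,4)] by (rule is_isoI)
  have "inj_on h N" using assms(3) subgroup.subset[OF assms(4)] unfolding iso_def bij_betw_def
    by (auto intro: inj_on_subset)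
  then show "card (h ` N) = card N" by (rule card_image)
qed

text \<open>The members of \<open>F\<close> are groups over \<open>nat\<close>, so its closure
  properties have to be applied to a copy, obtained by numbering the elements.\<close>

lemma (in fin_group) nat_copy_exists:
  obtains Y :: "nat monoid" and h where "fin_group Y" "h \<in> iso G Y"
proof -
  obtain f :: "'a \<Rightarrow> nat" where f: "inj_on f (carrier G)"
    using finite_imp_inj_to_nat_seg[OF fin] by blast
  let ?g = "inv_into (carrier G) f"
  define Y where "Y = \<lparr>carrier = f ` carrier G, monoid.mult = \<lambda>a b. f (?g a \<otimes> ?g b), one = f \<one>\<rparr>"
  have g: "?g (f x) = x" if "x \<in> carrier G" for x using f that by simp
  have Y: "group Y"
  proof (rule groupI)
    fix x assume "x \<in> carrier Y"
    then obtain a where a: "a \<in> carrier G" "x = f a" by (auto simp: Y_def)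
    then show "\<one>\<^bsub>Y\<^esub> \<otimes>\<^bsub>Y\<^esub> x = x" by (simp add: Y_def g)
    show "\<exists>y\<in>carrier Y. y \<otimes>\<^bsub>Y\<^esub> x = \<one>\<^bsub>Y\<^esub>"
      using a by (intro bexI[of _ "f (inv a)"]) (auto simp: Y_def g)
  qed (auto simp: Y_def g m_assoc)
  have "fin_group Y" using Y fin by (simp add: fin_group_def fin_group_axioms_def Y_def)
  moreover have "f \<in> iso G Y"
    using f by (intro isoI homI) (auto simp: Y_def g bij_betw_def)
  ultimately show thesis using that by blast
qed

context fin_group
begin

text \<open>The condition is imposed on every copy over \<open>nat\<close>, which is where
  Dnormality is applied; in this form no general invariance of Dnormality under isomorphisms has to
  be shown.\<close>

lemma in_class_dnormal:
  assumes F: "npi_fitting_class \<pi> F" and G: "in_class G F" and N: "subgroup N G"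
    and dn: "\<And>(Y :: nat monoid) h. fin_group Y \<Longrightarrow> h \<in> iso G Y \<Longrightarrow> npi_dnormal \<pi> Y (h ` N)"
  shows "in_class (G\<lparr>carrier := N\<rparr>) F"
proof -
  obtain Y h where Y: "Y \<in> F" "h \<in> iso G Y" using G by (auto simp: in_class_def is_iso_def)
  have "\<forall>X\<in>F. group X \<and> finite (carrier X)"
    using F unfolding npi_fitting_class_def group_class_def by (elim conjE)
  then have Yf: "fin_group Y"
    using Y(1) by (simp add: fin_group_def fin_group_axioms_def)
  have Yg: "group Y" using Yf by (simp add: fin_group_def)
  have "\<forall>G N. G \<in> F \<and> npi_dnormal \<pi> G N \<longrightarrow> G\<lparr>carrier := N\<rparr> \<in> F"
    using F unfolding npi_fitting_class_def by (elim conjE)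
  then have "Y\<lparr>carrier := h ` N\<rparr> \<in> F" using Y(1) dn[OF Yf Y(2)] by blast
  then show ?thesis
    using iso_image_subgroup(2)[OF is_group Yg Y(2) N] subgroup_imp_group[OF N] by (auto simp: in_class_def)
qed

text \<open>Membership of the whole group is the claim, so its copy comes from
  \<open>nat_copy_exists\<close>; the images of \<open>M\<close> and \<open>N\<close> in it belong
  to \<open>F\<close> by closure under isomorphism.\<close>

lemma in_class_dnormal_join:
  assumes F: "npi_fitting_class \<pi> F" and M: "subgroup M G" "in_class (G\<lparr>carrier := M\<rparr>) F"
    and N: "subgroup N G" "in_class (G\<lparr>carrier := N\<rparr>) F" and gen: "carrier G = generate G (M \<union> N)"
    and dn: "\<And>(Y :: nat monoid) h. fin_group Y \<Longrightarrow> h \<in> iso G Y \<Longrightarrow> npi_dnormal \<pi> Y (h ` M) \<and> npi_dnormal \<pi> Y (h ` N)"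
  shows "in_class G F"
proof -
  obtain Y :: "nat monoid" and h where Y: "fin_group Y" "h \<in> iso G Y" by (rule nat_copy_exists)
  interpret Y: fin_group Y by (rule Y(1))
  interpret h: group_hom G Y h
    using Y(2) by (simp add: group_hom_def group_hom_axioms_def iso_imp_homomorphism)
  have cls: "group_class F" using F by (simp add: npi_fitting_class_def)
  have in_F: "Y\<lparr>carrier := h ` A\<rparr> \<in> F" if A: "subgroup A G" "in_class (G\<lparr>carrier := A\<rparr>) F" for A
    using group_class_iso[OF cls A(2)] iso_image_subgroup[OF is_group Y.is_group Y(2) A(1)] Y.subgroup_imp_group by blast
  have "carrier Y = h ` carrier G" using Y(2) by (auto simp: iso_def bij_betw_def)
  also have "\<dots> = generate Y (h ` M \<union> h ` N)"
    unfolding gen using h.generate_img[of "M \<union> N"] subgroup.subset[OF M(1)] subgroup.subset[OF N(1)]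
    by (simp add: image_Un)
  finally have g: "carrier Y = generate Y (h ` M \<union> h ` N)" .
  have "\<forall>(G :: nat monoid) M N. group G \<and> finite (carrier G) \<and> npi_dnormal \<pi> G M \<and> npi_dnormal \<pi> G N \<and>
      carrier G = generate G (M \<union> N) \<and> G\<lparr>carrier := M\<rparr> \<in> F \<and> G\<lparr>carrier := N\<rparr> \<in> F \<longrightarrow> G \<in> F"
    using F unfolding npi_fitting_class_def by (elim conjE)
  from this[rule_format, of Y "h ` M" "h ` N"] have "Y \<in> F"
    using g dn[OF Y] in_F[OF M] in_F[OF N] Y.fin Y.is_group by blast
  then show ?thesis using Y(2) by (auto simp: in_class_def is_iso_def)
qed

lemma iso_image_normal:
  assumes "group Y" "h \<in> iso G Y" "N \<lhd> G"
  shows "h ` N \<lhd> Y"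
  using iso_normal_subgroup[OF assms(2) is_group assms(1,3)] .

lemma in_class_normal_subgroup:
  assumes F: "npi_fitting_class \<pi> F" and G: "in_class G F" and N: "N \<lhd> G"
  shows "in_class (G\<lparr>carrier := N\<rparr>) F"
proof (rule in_class_dnormal[OF F G normal_imp_subgroup[OF N]])
  fix Y :: "nat monoid" and h assume Y: "fin_group Y" "h \<in> iso G Y"
  then have "group Y" by (simp add: fin_group_def)
  then show "npi_dnormal \<pi> Y (h ` N)" using fin_group.npi_dnormal_normal[OF Y(1)] iso_image_normal Y(2) N by blast
qed

lemma in_class_normal_join:
  assumes F: "npi_fitting_class \<pi> F" and M: "M \<lhd> G" "in_class (G\<lparr>carrier := M\<rparr>) F"
    and N: "N \<lhd> G" "in_class (G\<lparr>carrier := N\<rparr>) F" and gen: "carrier G = generate G (M \<union> N)"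
  shows "in_class G F"
proof (rule in_class_dnormal_join[OF F normal_imp_subgroup[OF M(1)] M(2) normal_imp_subgroup[OF N(1)] N(2) gen])
  fix Y :: "nat monoid" and h assume Y: "fin_group Y" "h \<in> iso G Y"
  then have "group Y" by (simp add: fin_group_def)
  then show "npi_dnormal \<pi> Y (h ` M) \<and> npi_dnormal \<pi> Y (h ` N)"
    using fin_group.npi_dnormal_normal[OF Y(1)] iso_image_normal Y(2) M N by blast
qed

lemma iso_image_section:
  assumes Y: "fin_group Y" "h \<in> iso G Y" and W: "W \<lhd> G" "W \<subseteq> N" and N: "subgroup N G"
    and ind: "index_in \<pi> (carrier G) W" and big: "infinite \<pi> \<or> card \<pi> \<ge> 2"
  shows "npi_dnormal \<pi> Y (h ` N)"
proof -
  have Yg: "group Y" using Y by (simp add: fin_group_def)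
  have "card (carrier Y) = card (carrier G)"
    using iso_same_card[OF is_isoI[OF Y(2)]] by simp
  then have "index_in \<pi> (carrier Y) (h ` W)"
    using ind iso_image_subgroup(3)[OF is_group Yg Y(2) normal_imp_subgroup[OF W(1)]] by (simp add: index_in_def)
  then show ?thesis
    using fin_group.npi_dnormal_section[OF Y(1) iso_image_normal[OF Yg Y(2) W(1)] image_mono[OF W(2)]
        iso_image_subgroup(1)[OF is_group Yg Y(2) N]] big by blast
qed

lemma in_class_section_subgroup:
  assumes F: "npi_fitting_class \<pi> F" and G: "in_class G F" and W: "W \<lhd> G" "W \<subseteq> N" and N: "subgroup N G"
    and ind: "index_in \<pi> (carrier G) W" and big: "infinite \<pi> \<or> card \<pi> \<ge> 2"
  shows "in_class (G\<lparr>carrier := N\<rparr>) F"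
  by (rule in_class_dnormal[OF F G N]) (rule iso_image_section[OF _ _ W N ind big])

lemma in_class_section_join:
  assumes F: "npi_fitting_class \<pi> F" and W: "W \<lhd> G" "W \<subseteq> M" "W \<subseteq> N"
    and M: "subgroup M G" "in_class (G\<lparr>carrier := M\<rparr>) F" and N: "subgroup N G" "in_class (G\<lparr>carrier := N\<rparr>) F"
    and ind: "index_in \<pi> (carrier G) W" and big: "infinite \<pi> \<or> card \<pi> \<ge> 2"
    and gen: "carrier G = generate G (M \<union> N)"
  shows "in_class G F"
  by (rule in_class_dnormal_join[OF F M N gen])
    (intro conjI iso_image_section[OF _ _ W(1,2) M(1) ind big] iso_image_section[OF _ _ W(1,3) N(1) ind big])

end

section \<open>Largest \<open>F\<close>-subgroups above \<open>W\<close>\<close>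

locale fitting_class_group = fin_group G for G (structure) +
  fixes \<pi> :: "nat set" and F :: "nat monoid set"
  assumes pi_primes: "\<forall>p\<in>\<pi>. prime p"
    and fitting: "npi_fitting_class \<pi> F"
begin

abbreviation inF :: "'a set \<Rightarrow> bool" where
  "inF T \<equiv> in_class (G\<lparr>carrier := T\<rparr>) F"

lemma inF_normal:
  assumes "subgroup T G" "subgroup S G" "S \<subseteq> T" "normalizes T S" "inF T"
  shows "inF S"
proof -
  interpret T: fin_group "G\<lparr>carrier := T\<rparr>" using fin_group_subgroup[OF fin_group_axioms assms(1)] .
  have "S \<lhd> G\<lparr>carrier := T\<rparr>" using normal_restrict_iff[OF assms(1)] assms by blast
  from T.in_class_normal_subgroup[OF fitting assms(5) this] show ?thesis by simp
qed

lemma inF_set_mult: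
  assumes S: "subgroup S G" "inF S" and T: "subgroup T G" "inF T"
    and n: "normalizes (S <#> T) S" "normalizes (S <#> T) T"
  shows "inF (S <#> T)"
proof -
  note i = set_mult_incl[OF S(1) T(1)]
  have J: "subgroup (S <#> T) G" by (rule set_mult_subgroup[OF S(1) T(1) normalizes_mono[OF n(2) i(1)]])
  interpret J: fin_group "G\<lparr>carrier := S <#> T\<rparr>" using fin_group_subgroup[OF fin_group_axioms J] .
  have sc: "S \<union> T \<subseteq> carrier G" using subgroup.subset[OF S(1)] subgroup.subset[OF T(1)] by blast
  have "generate G (S \<union> T) = S <#> T"
  proof
    show "generate G (S \<union> T) \<subseteq> S <#> T" using generate_subgroup_incl[OF _ J] i by blast
    show "S <#> T \<subseteq> generate G (S \<union> T)"
      using set_mult_least[OF generate_is_subgroup[OF sc]] generate.incl[of _ "S \<union> T" G] by blast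
  qed
  then have "carrier (G\<lparr>carrier := S <#> T\<rparr>) = generate (G\<lparr>carrier := S <#> T\<rparr>) (S \<union> T)"
    using generate_consistent[OF _ J, of "S \<union> T"] i by simp
  moreover have "S \<lhd> G\<lparr>carrier := S <#> T\<rparr>" "T \<lhd> G\<lparr>carrier := S <#> T\<rparr>"
    using normal_restrict_iff[OF J] S T n i by blast+
  ultimately show ?thesis
    using J.in_class_normal_join[OF fitting, of S T] S(2) T(2) by simp
qed

lemma inF_conj:
  assumes T: "subgroup T G" "inF T" and x: "x \<in> carrier G"
  shows "inF (conj_subset G T x)"
proof (rule in_class_iso[OF T(2)])
  let ?h = "\<lambda>a. inv x \<otimes> a \<otimes> x"
  have Tc: "a \<in> carrier G" if "a \<in> T" for a using subgroup.mem_carrier[OF T(1) that] .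
  have im: "conj_subset G T x = ?h ` T" by (rule conj_subset_image[OF subgroup.subset[OF T(1)] x])
  have "?h \<in> iso (G\<lparr>carrier := T\<rparr>) (G\<lparr>carrier := conj_subset G T x\<rparr>)"
  proof (intro isoI homI)
    fix a b assume "a \<in> carrier (G\<lparr>carrier := T\<rparr>)" "b \<in> carrier (G\<lparr>carrier := T\<rparr>)"
    then show "?h (a \<otimes>\<^bsub>G\<lparr>carrier := T\<rparr>\<^esub> b) = ?h a \<otimes>\<^bsub>G\<lparr>carrier := conj_subset G T x\<rparr>\<^esub> ?h b"
      using x Tc by (simp add: m_assoc mult_inv_cancel)
  next
    show "bij_betw ?h (carrier (G\<lparr>carrier := T\<rparr>)) (carrier (G\<lparr>carrier := conj_subset G T x\<rparr>))"
      unfolding im bij_betw_def using inj_on_subset[OF conj_elem_inj[OF x] subgroup.subset[OF T(1)]] by simp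
  qed (simp add: im)
  then show "G\<lparr>carrier := T\<rparr> \<cong> G\<lparr>carrier := conj_subset G T x\<rparr>" by (rule is_isoI)
  show "group (G\<lparr>carrier := conj_subset G T x\<rparr>)"
    using subgroup_imp_group[OF conj_subset_subgroup[OF T(1) x]] .
qed

text \<open>\<open>F\<close> is nonempty, and the trivial subgroup of any of its members is normal
  there.\<close>

lemma inF_trivial: "inF {\<one>}"
proof -
  obtain Y where Y: "Y \<in> F" "group Y" "finite (carrier Y)"
    using fitting unfolding npi_fitting_class_def group_class_def by blast
  interpret Y: fin_group Y using Y by (simp add: fin_group_def fin_group_axioms_def)
  have "npi_dnormal \<pi> Y {\<one>\<^bsub>Y\<^esub>}" by (rule Y.npi_dnormal_normal[OF Y.one_is_normal])
  then have "Y\<lparr>carrier := {\<one>\<^bsub>Y\<^esub>}\<rparr> \<in> F" using fitting Y(1) unfolding npi_fitting_class_def by blast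
  moreover have "(\<lambda>_. \<one>\<^bsub>Y\<^esub>) \<in> iso (G\<lparr>carrier := {\<one>}\<rparr>) (Y\<lparr>carrier := {\<one>\<^bsub>Y\<^esub>}\<rparr>)"
    by (intro isoI homI) (auto simp: bij_betw_def)
  ultimately show ?thesis
    using subgroup_imp_group[OF triv_subgroup] by (auto simp: in_class_def is_iso_def)
qed

text \<open>If \<pi> is empty or a single prime it falls under the first two cases, so only a large
  \<pi> calls for \<open>npi_dnormal_section\<close>.\<close>

lemma blocks_cases:
  assumes "b \<in> blocks \<pi>"
  obtains "b = {}" | p where "prime p" "b = {p}" | "b = \<pi>" "infinite \<pi> \<or> card \<pi> \<ge> 2"
  using assms pi_primes big_block_iff[of \<pi>] unfolding blocks_def by blast

text \<open>For a single prime \<open>T\<close> is subnormal in \<open>J\<close>, as one sees by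
  climbing normalizers; for large \<pi> it is Dnormal at once.\<close>

lemma inF_block_subgroup:
  assumes b: "b \<in> blocks \<pi>" and J: "subgroup J G" "inF J" and W: "subgroup W G" "normalizes J W" "index_in b J W"
    and T: "subgroup T G" "W \<subseteq> T" "T \<subseteq> J"
  shows "inF T"
  using b
proof (cases rule: blocks_cases)
  case 1
  then have "J = W" using index_in_disjoint_eq[OF J(1) W(1), of "{}" "{}"] W(3) T by simp
  then show ?thesis using T J(2) by simp
next
  case (2 p)
  show ?thesis
    using T
  proof (induction "card J - card T" arbitrary: T rule: less_induct)
    case less
    show ?case
    proof (cases "T = J")
      case False
      then have TJ: "T \<subset> J" using less.prems by blast
      obtain N where N: "subgroup N G" "T \<subset> N" "N \<subseteq> J" "normalizes N T"
        using normalizer_grows[OF 2(1) J(1) W(1,2) less.prems(1,2) TJ] W(3) 2(2) by blast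
      have "card T < card N" "card N \<le> card J"
        using psubset_card_mono[OF subgroup_finite[OF N(1)] N(2)] card_mono[OF subgroup_finite[OF J(1)] N(3)] by auto
      then have "inF N" using less.hyps[OF _ N(1)] N(2,3) less.prems(2) by (metis diff_less_mono2 order_less_le_trans psubsetE subset_trans)
      then show ?thesis using inF_normal[OF N(1) less.prems(1) _ N(4)] N(2) by blast
    qed (use J in simp)
  qed
next
  case 3
  interpret JJ: fin_group "G\<lparr>carrier := J\<rparr>" using fin_group_subgroup[OF fin_group_axioms J(1)] .
  have "W \<lhd> G\<lparr>carrier := J\<rparr>" using normal_restrict_iff[OF J(1)] W T by blast
  moreover have "subgroup T (G\<lparr>carrier := J\<rparr>)" using subgroup_incl[OF T(1) J(1) T(3)] .
  ultimately show ?thesis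
    using JJ.in_class_section_subgroup[OF fitting J(2), of W T] T(2) W(3) 3 by simp
qed

definition largest_in :: "'a set \<Rightarrow> 'a set \<Rightarrow> 'a set \<Rightarrow> bool" where
  "largest_in J W D \<longleftrightarrow> subgroup D G \<and> W \<subseteq> D \<and> D \<subseteq> J \<and> inF D \<and>
     (\<forall>T. subgroup T G \<and> W \<subseteq> T \<and> T \<subseteq> J \<and> inF T \<longrightarrow> T \<subseteq> D)"

lemma largest_in_normalized:
  assumes D: "largest_in J W D" and M: "subgroup M G" "normalizes M J" "normalizes M W" and J: "J \<subseteq> carrier G"
  shows "normalizes M D"
proof -
  have Ds: "subgroup D G" "W \<subseteq> D" "D \<subseteq> J" "inF D" using D by (auto simp: largest_in_def)
  have Dc: "D \<subseteq> carrier G" by (rule subgroup.subset[OF Ds(1)])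
  have "conj_subset G D x \<subseteq> D" if x: "x \<in> M" for x
  proof -
    have xc: "x \<in> carrier G" using subgroup.mem_carrier[OF M(1) x] .
    have "subgroup (conj_subset G D x) G" by (rule conj_subset_subgroup[OF Ds(1) xc])
    moreover have "W \<subseteq> conj_subset G D x"
      using conj_subset_mono[OF Ds(2) Dc xc] conj_subset_normalizes[OF M(3,1) _ x] Ds(2) Dc by simp
    moreover have "conj_subset G D x \<subseteq> J"
      using conj_subset_mono[OF Ds(3) J xc] conj_subset_normalizes[OF M(2,1) J x] by simp
    moreover have "inF (conj_subset G D x)" by (rule inF_conj[OF Ds(1,4) xc])
    ultimately show ?thesis using D by (simp add: largest_in_def)
  qed
  then show ?thesis using normalizes_iff_conj[OF subgroup.subset[OF M(1)] Dc] by blast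
qed

lemma maximal_inF_exists:
  assumes "subgroup J G" "P W" "\<And>D. P D \<Longrightarrow> D \<subseteq> J"
  obtains D where "P D" "\<And>E. P E \<Longrightarrow> D \<subseteq> E \<Longrightarrow> E = D"
proof -
  have "{D. P D} \<subseteq> Pow J" using assms(3) by auto
  then have "finite {D. P D}" using subgroup_finite[OF assms(1)] by (meson finite_Pow_iff finite_subset)
  moreover have "{D. P D} \<noteq> {}" using assms(2) by blast
  ultimately obtain D where "D \<in> {D. P D}" "\<forall>E\<in>{D. P D}. D \<subseteq> E \<longrightarrow> D = E"
    using finite_has_maximal by meson
  then show thesis using that[of D] by blast
qed

text \<open>The candidate is the product of all normal \<open>F\<close>-subgroups of
  \<open>J\<close> above \<open>W\<close>, which belongs to \<open>F\<close> by closure under normal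
  products. What remains is the premise \<open>cover\<close>: a subgroup containing all of these
  contains every \<open>F\<close>-subgroup above \<open>W\<close>.\<close>

lemma largest_in_exists_via_normal:
  assumes J: "subgroup J G" and W: "subgroup W G" "W \<subseteq> J" "normalizes J W" "inF W"
    and cover: "\<And>T D. subgroup T G \<Longrightarrow> W \<subseteq> T \<Longrightarrow> T \<subseteq> J \<Longrightarrow> inF T \<Longrightarrow>
      (\<And>E. subgroup E G \<Longrightarrow> W \<subseteq> E \<Longrightarrow> E \<subseteq> J \<Longrightarrow> normalizes J E \<Longrightarrow> inF E \<Longrightarrow> E \<subseteq> D) \<Longrightarrow>
      subgroup D G \<Longrightarrow> T \<subseteq> D"
  shows "\<exists>D. largest_in J W D"
proof -
  let ?P = "\<lambda>D. subgroup D G \<and> W \<subseteq> D \<and> D \<subseteq> J \<and> normalizes J D \<and> inF D"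
  have "?P W" using W by blast
  then obtain D where D: "?P D" "\<And>E. ?P E \<Longrightarrow> D \<subseteq> E \<Longrightarrow> E = D"
    using maximal_inF_exists[OF J, of ?P W] by blast
  have all: "E \<subseteq> D" if E: "?P E" for E
  proof -
    have nDE: "normalizes D E" using normalizes_mono[of J E D] E D(1) by blast
    have i: "D \<subseteq> D <#> E" "E \<subseteq> D <#> E" using set_mult_incl D(1) E by blast+
    have s: "subgroup (D <#> E) G" using set_mult_subgroup nDE D(1) E by blast
    have le: "D <#> E \<subseteq> J" using set_mult_least[OF J] D(1) E by blast
    have n: "normalizes J (D <#> E)"
      by (rule normalizes_set_mult) (use D(1) E subgroup.subset[OF J] in auto)
    have "inF (D <#> E)"
      using inF_set_mult[of D E] D(1) E normalizes_mono[OF _ le] by blast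
    then have "D <#> E = D" using D(2)[of "D <#> E"] s le n i(1) D(1) by blast
    then show ?thesis using i(2) by simp
  qed
  have "T \<subseteq> D" if "subgroup T G" "W \<subseteq> T" "T \<subseteq> J" "inF T" for T
    by (rule cover[OF that]) (use all D(1) in auto)
  then show ?thesis using D(1) unfolding largest_in_def by blast
qed

text \<open>For a single prime, with \<open>J\<close> not in \<open>F\<close>, every
  \<open>F\<close>-subgroup \<open>T\<close> lies in a proper normal subgroup, whose largest
  \<open>F\<close>-subgroup exists by induction and is normal in \<open>J\<close>. For large \<pi>
  the join of two \<open>F\<close>-subgroups above \<open>W\<close> is in \<open>F\<close>, since
  both are Dnormal in it.\<close>

lemma block_largest_exists:
  assumes b: "b \<in> blocks \<pi>" and J: "subgroup J G" and W: "subgroup W G" "W \<subseteq> J" "normalizes J W" "index_in b J W" "inF W"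
  shows "\<exists>D. largest_in J W D"
  using b
proof (cases rule: blocks_cases)
  case 1
  then have "J = W" using index_in_disjoint_eq[OF J W(1,2), of "{}" "{}"] W(4) by simp
  then have "largest_in J W W" using W by (auto simp: largest_in_def)
  then show ?thesis by blast
next
  case (2 p)
  show ?thesis
    using J W
  proof (induction "card J" arbitrary: J rule: less_induct)
    case less
    note J = less.prems(1) and W = less.prems(2-6)
    show ?case
    proof (cases "inF J")
      case True
      then have "largest_in J W J" using J W by (auto simp: largest_in_def)
      then show ?thesis by blast
    next
      case False
      show ?thesis
      proof (rule largest_in_exists_via_normal[OF J W(1,2,3,5)])
        fix T D assume T: "subgroup T G" "W \<subseteq> T" "T \<subseteq> J" "inF T"
          and D: "\<And>E. subgroup E G \<Longrightarrow> W \<subseteq> E \<Longrightarrow> E \<subseteq> J \<Longrightarrow> normalizes J E \<Longrightarrow> inF E \<Longrightarrow> E \<subseteq> D"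
        have "T \<subset> J" using T False by blast
        then obtain M where M: "subgroup M G" "T \<subseteq> M" "M \<subset> J" "normalizes J M"
          using proper_in_normal[OF 2(1) J W(1,3) T(1,2)] W(4) 2(2) by blast
        have MJ: "M \<subseteq> J" and WM: "W \<subseteq> M" using M T by auto
        have "card M < card J" using psubset_card_mono[OF subgroup_finite[OF J] M(3)] .
        then obtain E where E: "largest_in M W E"
          using less.hyps[OF _ M(1) W(1) WM normalizes_mono[OF W(3) MJ] index_in_sandwich(2)[OF J M(1) W(1) WM MJ W(4)] W(5)]
          by blast
        have "normalizes J E" by (rule largest_in_normalized[OF E J M(4) W(3) subgroup.subset[OF M(1)]])
        then have "E \<subseteq> D" using D[of E] E MJ by (auto simp: largest_in_def)
        moreover have "T \<subseteq> E" using E T M(2) by (simp add: largest_in_def)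
        ultimately show "T \<subseteq> D" by blast
      qed
    qed
  qed
next
  case 3
  let ?P = "\<lambda>D. subgroup D G \<and> W \<subseteq> D \<and> D \<subseteq> J \<and> inF D"
  obtain D where D: "?P D" "\<And>E. ?P E \<Longrightarrow> D \<subseteq> E \<Longrightarrow> E = D"
    using maximal_inF_exists[OF J, of ?P W] W by blast
  have "T \<subseteq> D" if T: "?P T" for T
  proof -
    let ?E = "generate G (D \<union> T)"
    have sc: "D \<union> T \<subseteq> carrier G" using D(1) T subgroup.subset by blast
    have E: "subgroup ?E G" by (rule generate_is_subgroup[OF sc])
    have le: "?E \<subseteq> J" using generate_subgroup_incl[OF _ J] D(1) T by blast
    have i: "D \<subseteq> ?E" "T \<subseteq> ?E" using generate.incl[of _ "D \<union> T" G] by blast+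
    have WE: "W \<subseteq> ?E" using i(1) D(1) by blast
    interpret EE: fin_group "G\<lparr>carrier := ?E\<rparr>" using fin_group_subgroup[OF fin_group_axioms E] .
    have 1: "W \<lhd> G\<lparr>carrier := ?E\<rparr>"
      using normal_restrict_iff[OF E] W(1) WE normalizes_mono[OF W(3) le] by blast
    have 2: "subgroup D (G\<lparr>carrier := ?E\<rparr>)" "subgroup T (G\<lparr>carrier := ?E\<rparr>)"
      using subgroup_incl[OF _ E] D(1) T i by blast+
    have 3: "index_in \<pi> ?E W" using index_in_sandwich(2)[OF J E W(1) WE le] W(4) \<open>b = \<pi>\<close> by blast
    have "generate (G\<lparr>carrier := ?E\<rparr>) (D \<union> T) = ?E"
      using generate_consistent[OF _ E, of "D \<union> T"] i by blast
    then have "inF ?E"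
      using EE.in_class_section_join[OF fitting 1 _ _ 2(1) _ 2(2)] D(1) T 3 \<open>infinite \<pi> \<or> card \<pi> \<ge> 2\<close> by simp
    then have "?E = D" using D(2)[of ?E] E WE le i(1) by blast
    then show ?thesis using i(2) by simp
  qed
  then show ?thesis using D(1) unfolding largest_in_def by blast
qed

text \<open>It suffices to compare p-parts. For the block \<open>b\<close> of \<open>p\<close>, with
  Hall part \<open>A\<close>, the intersection \<open>T \<inter> A\<close> is normal in
  \<open>T\<close>, hence in \<open>F\<close> and inside the largest \<open>F\<close>-subgroup of
  \<open>A\<close>. The latter is normal in \<open>J\<close>, and \<open>T \<inter> A\<close> has
  the full p-part of \<open>T\<close>.\<close>

lemma block_nilpotent_largest_exists:
  assumes J: "subgroup J G" and W: "subgroup W G" "W \<subseteq> J" "normalizes J W" "inF W" and bn: "block_nilpotent \<pi> J W"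
  shows "\<exists>D. largest_in J W D"
proof (rule largest_in_exists_via_normal[OF J W])
  fix T D assume T: "subgroup T G" "W \<subseteq> T" "T \<subseteq> J" "inF T"
    and D: "\<And>E. subgroup E G \<Longrightarrow> W \<subseteq> E \<Longrightarrow> E \<subseteq> J \<Longrightarrow> normalizes J E \<Longrightarrow> inF E \<Longrightarrow> E \<subseteq> D" and Ds: "subgroup D G"
  have TD: "subgroup (T \<inter> D) G" using subgroup_Int[OF T(1) Ds] .
  have "multiplicity p (card (T \<inter> D)) = multiplicity p (card T)" if p: "prime p" for p
  proof -
    obtain b where b: "b \<in> blocks \<pi>" "p \<in> b" using blocks_cover[OF p] by blast
    have "splits b J W" using bn b(1) by (simp add: block_nilpotent_def)
    then obtain A where A: "subgroup A G" "W \<subseteq> A" "A \<subseteq> J" "normalizes J A" "index_in b A W" "index_in (- b) J A"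
      by (rule splitsE)
    obtain E where E: "largest_in A W E"
      using block_largest_exists[OF b(1) A(1) W(1) A(2) normalizes_mono[OF W(3) A(3)] A(5) W(4)] by blast
    have "normalizes J E" by (rule largest_in_normalized[OF E J A(4) W(3) subgroup.subset[OF A(1)]])
    then have ED: "E \<subseteq> D" using D[of E] E A(3) by (auto simp: largest_in_def)
    have TA: "subgroup (T \<inter> A) G" using subgroup_Int[OF T(1) A(1)] .
    have "inF (T \<inter> A)"
      by (rule inF_normal[OF T(1) TA _ _ T(4)])
        (use normalizes_Int[OF normalizes_self[OF T(1)] normalizes_mono[OF A(4) T(3)]] in auto)
    then have "T \<inter> A \<subseteq> E" using E TA T(2) A(2) by (auto simp: largest_in_def)
    then have le: "T \<inter> A \<subseteq> T \<inter> D" using ED by blast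
    have "index_in (- b) T (T \<inter> A)"
      by (rule index_in_Int[OF J A(1) T(1) A(3) T(3) normalizes_mono[OF A(4) T(3)] A(6)])
    then have "multiplicity p (card T) = multiplicity p (card (T \<inter> A))" using index_inD[OF _ p] b(2) by blast
    then show ?thesis
      using multiplicity_card_mono[OF TA TD le, of p] multiplicity_card_mono[OF TD T(1), of p] by simp
  qed
  then have "T \<inter> D = T" using subgroup_eqI[OF TD T(1)] by blast
  then show "T \<subseteq> D" by blast
qed

end

section \<open>Soluble series\<close>

lemma (in group) rcos_eq_iff:
  assumes "subgroup M G" "a \<in> carrier G" "b \<in> carrier G"
  shows "M #> a = M #> b \<longleftrightarrow> a \<otimes> inv b \<in> M"
proof -
  interpret M: subgroup M G by fact
  have "M #> a = M #> b \<longleftrightarrow> a \<in> M #> b"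
    using rcos_self[OF assms(2,1)] repr_independence[OF _ assms(3,1)] by metis
  then show ?thesis using M.rcos_module[OF is_group assms(3,2)] by simp
qed

lemma prime_power_if_only_prime:
  fixes n :: nat
  assumes "n > 0" "prime p" "\<And>q. prime q \<Longrightarrow> q dvd n \<Longrightarrow> q = p"
  shows "n = p ^ multiplicity p n"
proof (rule multiplicity_eq_nat)
  fix q :: nat assume q: "prime q"
  show "multiplicity q n = multiplicity q (p ^ multiplicity p n)"
  proof (cases "q = p")
    case True
    then show ?thesis using q by (simp add: multiplicity_same_power prime_gt_0_nat)
  next
    case False
    then have "\<not> q dvd n" using assms(3)[OF q] by blast
    then show ?thesis
      using False q assms(2) by (simp add: not_dvd_imp_multiplicity_0 multiplicity_distinct_prime_power)
  qed
qed (use assms prime_gt_0_nat in auto)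

lemma (in group) center_normal:
  "{z \<in> carrier G. \<forall>g\<in>carrier G. g \<otimes> z = z \<otimes> g} \<lhd> G" (is "?Z \<lhd> G")
proof -
  have comm: "g \<otimes> z = z \<otimes> g" if "z \<in> ?Z" "g \<in> carrier G" for g z using that by blast
  have "subgroup ?Z G"
  proof (rule subgroupI)
    show "?Z \<noteq> {}" by (auto intro!: exI[of _ \<one>])
    fix a assume a: "a \<in> ?Z"
    then have ac: "a \<in> carrier G" by blast
    have "g \<otimes> inv a = inv a \<otimes> g" if g: "g \<in> carrier G" for g
    proof -
      have "inv a \<otimes> (g \<otimes> a) \<otimes> inv a = g \<otimes> inv a"
        unfolding comm[OF a g] using ac g by (simp add: mult_inv_cancel)
      then show ?thesis using ac g by (simp add: m_assoc)
    qed
    then show "inv a \<in> ?Z" using ac by blast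
    fix b assume b: "b \<in> ?Z"
    then have bc: "b \<in> carrier G" by blast
    have "g \<otimes> (a \<otimes> b) = a \<otimes> b \<otimes> g" if g: "g \<in> carrier G" for g
    proof -
      have "g \<otimes> (a \<otimes> b) = a \<otimes> (g \<otimes> b)"
        using comm[OF a g] ac bc g by (simp flip: m_assoc)
      then show ?thesis unfolding comm[OF b g] using ac bc g by (simp add: m_assoc)
    qed
    then show "a \<otimes> b \<in> ?Z" using ac bc by blast
  qed blast
  moreover have "normalizes (carrier G) ?Z" by (rule normalizesI_commuting) auto
  ultimately show ?thesis using normal_iff_normalizes by blast
qed

text \<open>A nontrivial p-group has a nontrivial centre, which in a simple group is
  everything.\<close>

lemma simple_p_group_commutes:
  assumes "simple_group S" "pi_group {p} S" "prime p" "x \<in> carrier S" "y \<in> carrier S"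
  shows "x \<otimes>\<^bsub>S\<^esub> y = y \<otimes>\<^bsub>S\<^esub> x"
proof -
  interpret S: simple_group S by fact
  interpret S: fin_group S
    using assms(2) by (simp add: fin_group_def fin_group_axioms_def pi_group_def)
  have "order S = p ^ multiplicity p (order S)"
    using assms(2,3) S.order_gt_one by (intro prime_power_if_only_prime) (auto simp: pi_group_def)
  moreover have "multiplicity p (order S) > 0"
    using calculation S.order_gt_one by (metis not_gr_zero power_0 less_irrefl)
  ultimately obtain z where z: "z \<in> carrier S" "z \<noteq> \<one>\<^bsub>S\<^esub>" "\<forall>g\<in>carrier S. g \<otimes>\<^bsub>S\<^esub> z = z \<otimes>\<^bsub>S\<^esub> g"
    unfolding order_def by (rule S.p_group_center[OF assms(3)])
  let ?Z = "{z \<in> carrier S. \<forall>g\<in>carrier S. g \<otimes>\<^bsub>S\<^esub> z = z \<otimes>\<^bsub>S\<^esub> g}"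
  have "?Z = carrier S \<or> ?Z = {\<one>\<^bsub>S\<^esub>}" by (rule S.no_real_normal_subgroup[OF S.center_normal])
  moreover have "z \<in> ?Z" using z by blast
  ultimately have "?Z = carrier S" using z(2) by blast
  then show ?thesis using assms(4,5) by blast
qed

text \<open>Dual to \<open>soluble_steps\<close>: a factor at the top instead of the bottom. It can
  be read off a series of the whole group intersected with \<open>H\<close>, and the invariant steps
  are deduced from it afterwards.\<close>

definition (in group) soluble_tops :: "nat set \<Rightarrow> 'a set \<Rightarrow> bool" where
  "soluble_tops \<pi> H \<longleftrightarrow> (\<forall>L. subgroup L G \<and> L \<subset> H \<and> normalizes H L \<longrightarrow>
     (\<exists>M. subgroup M G \<and> L \<subseteq> M \<and> M \<subset> H \<and> normalizes H M \<and> soluble_step \<pi> H M))"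

definition (in group) soluble_series :: "nat set \<Rightarrow> (nat \<Rightarrow> 'a set) \<Rightarrow> nat \<Rightarrow> bool" where
  "soluble_series \<pi> C n \<longleftrightarrow> C 0 = {\<one>} \<and> C n = carrier G \<and> (\<forall>i\<le>n. subgroup (C i) G) \<and>
     (\<forall>i<n. C i \<subseteq> C (Suc i) \<and> normalizes (C (Suc i)) (C i) \<and> soluble_step \<pi> (C (Suc i)) (C i))"

section \<open>From composition factors to soluble sections\<close>

context fin_group
begin

text \<open>Unions of cosets make the normal subgroups of the quotient correspond to normal
  subgroups between \<open>L\<close> and \<open>H\<close>, and \<open>L\<close> is maximal among the
  proper ones.\<close>

lemma simple_Factor:
  assumes H: "subgroup H G" and L: "subgroup L G" "L \<subset> H" "normalizes H L"
    and max: "\<And>M. subgroup M G \<Longrightarrow> L \<subseteq> M \<Longrightarrow> M \<subset> H \<Longrightarrow> normalizes H M \<Longrightarrow> M = L"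
  shows "simple_group (G\<lparr>carrier := H\<rparr> Mod L)"
proof -
  have LH: "L \<lhd> G\<lparr>carrier := H\<rparr>" using normal_restrict_iff[OF H] L by blast
  interpret L: normal L "G\<lparr>carrier := H\<rparr>" by (rule LH)
  let ?Q = "G\<lparr>carrier := H\<rparr> Mod L"
  interpret Q: group ?Q by (rule L.factorgroup_is_group)
  have ord: "order ?Q * card L = card H" using Factor_order[OF H L(1)] L(2) by blast
  have "card L < card H" using psubset_card_mono[OF subgroup_finite[OF H] L(2)] .
  have "order ?Q > 1"
  proof (rule ccontr)
    assume "\<not> order ?Q > 1"
    then have "order ?Q = 0 \<or> order ?Q = 1" by linarith
    then show False using ord \<open>card L < card H\<close> by auto
  qed
  moreover have "A = carrier ?Q \<or> A = {\<one>\<^bsub>?Q\<^esub>}" if A: "A \<lhd> ?Q" for A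
  proof -
    have As: "subgroup A ?Q" using A by (rule normal_imp_subgroup)
    let ?U = "\<Union> A"
    have U: "subgroup ?U G" "?U \<subseteq> H" "normalizes H ?U"
      using normal_restrict_iff[OF H, of ?U] L.factgroup_subgroup_union_normal[OF A] by simp_all
    have "L \<in> A" using subgroup.one_closed[OF As] by simp
    then have LU: "L \<subseteq> ?U" by blast
    have Aeq: "A = (\<lambda>x. L #> x) ` ?U"
      using L.factgroup_subgroup_union_factor[OF As] rcosets_restrict[of ?U L] by simp
    show ?thesis
    proof (cases "?U = H")
      case True
      then show ?thesis using Aeq by (simp add: carrier_FactGroup)
    next
      case False
      then have "?U = L" using max[OF U(1) LU _ U(3)] U(2) by blast
      then have "A = (\<lambda>x. L #> x) ` L" using Aeq by simp
      also have "\<dots> = {L}" using subgroup.rcos_const[OF L(1) is_group] subgroup.one_closed[OF L(1)] by auto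
      finally show ?thesis by simp
    qed
  qed
  ultimately show ?thesis by (intro simple_group.intro simple_group_axioms.intro Q.is_group)
qed

text \<open>\<open>soluble_group\<close> quantifies over composition factors, so a series must be
  exhibited before the hypothesis yields anything. It is built by prolonging a series of a maximal
  normal subgroup.\<close>

lemma composition_series_exists_aux:
  assumes "subgroup H G"
  shows "\<exists>Hs. Hs \<noteq> [] \<and> hd Hs = {\<one>} \<and> last Hs = H \<and> (\<forall>i. Suc i < length Hs \<longrightarrow>
    Hs ! i \<lhd> G\<lparr>carrier := Hs ! Suc i\<rparr> \<and> simple_group (G\<lparr>carrier := Hs ! Suc i\<rparr> Mod Hs ! i))"
  using assms
proof (induction "card H" arbitrary: H rule: less_induct)
  case less
  show ?case
  proof (cases "H = {\<one>}")
    case True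
    then show ?thesis by (intro exI[of _ "[{\<one>}]"]) simp
  next
    case False
    let ?P = "{L. subgroup L G \<and> L \<subset> H \<and> normalizes H L}"
    have "?P \<subseteq> Pow H" by auto
    then have "finite ?P" using subgroup_finite[OF less.prems] by (meson finite_Pow_iff finite_subset)
    moreover have "{\<one>} \<in> ?P"
      using False subgroup.one_closed[OF less.prems] triv_subgroup subgroup.mem_carrier[OF less.prems]
      by (auto simp: normalizes_def)
    then have "?P \<noteq> {}" by blast
    ultimately obtain L where L: "L \<in> ?P" "\<forall>M\<in>?P. L \<subseteq> M \<longrightarrow> L = M" using finite_has_maximal by meson
    have simple: "simple_group (G\<lparr>carrier := H\<rparr> Mod L)"
      using simple_Factor[OF less.prems, of L] L by blast
    have normal: "L \<lhd> G\<lparr>carrier := H\<rparr>" using normal_restrict_iff[OF less.prems] L(1) by blast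
    have "card L < card H" using psubset_card_mono[OF subgroup_finite[OF less.prems]] L(1) by blast
    then obtain Hs where Hs: "Hs \<noteq> []" "hd Hs = {\<one>}" "last Hs = L" "\<forall>i. Suc i < length Hs \<longrightarrow>
      Hs ! i \<lhd> G\<lparr>carrier := Hs ! Suc i\<rparr> \<and> simple_group (G\<lparr>carrier := Hs ! Suc i\<rparr> Mod Hs ! i)"
      using less.hyps[of L] L(1) by blast
    have "(Hs @ [H]) ! i \<lhd> G\<lparr>carrier := (Hs @ [H]) ! Suc i\<rparr> \<and>
      simple_group (G\<lparr>carrier := (Hs @ [H]) ! Suc i\<rparr> Mod (Hs @ [H]) ! i)" if i: "Suc i < length (Hs @ [H])" for i
    proof (cases "Suc i < length Hs")
      case True
      then show ?thesis using Hs(4) by (simp add: nth_append)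
    next
      case False
      then have "i = length Hs - 1" "Suc i = length Hs" using i by auto
      then show ?thesis using Hs(1,3) simple normal by (simp add: nth_append last_conv_nth)
    qed
    then show ?thesis using Hs by (intro exI[of _ "Hs @ [H]"]) simp
  qed
qed

text \<open>A factor for the primes outside \<pi> is a simple p-group, hence abelian, and gives the
  second kind of step; a \<pi>-factor gives the first. Complementing twice returns \<pi> because
  \<pi> consists of primes.\<close>

lemma soluble_series_exists:
  assumes primes: "\<forall>p\<in>\<pi>. prime p" and sol: "soluble_group (primes_compl \<pi>) G"
  shows "\<exists>C n. soluble_series \<pi> C n"
proof -
  obtain Hs where Hs: "Hs \<noteq> []" "hd Hs = {\<one>}" "last Hs = carrier G" "\<forall>i. Suc i < length Hs \<longrightarrow>
    Hs ! i \<lhd> G\<lparr>carrier := Hs ! Suc i\<rparr> \<and> simple_group (G\<lparr>carrier := Hs ! Suc i\<rparr> Mod Hs ! i)"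
    using composition_series_exists_aux[OF subgroup_self] by blast
  have cs: "composition_series G Hs" unfolding composition_series_def using Hs by blast
  let ?n = "length Hs - 1"
  have sub: "subgroup (Hs ! i) G" if "i \<le> ?n" for i
    using that
  proof (induction rule: inc_induct)
    case base
    then show ?case using Hs(1,3) subgroup_self by (simp add: last_conv_nth)
  next
    case (step i)
    then have "Suc i < length Hs" by simp
    then show ?case using Hs(4) normal_restrict_iff[OF step.IH] by blast
  qed
  have "Hs ! i \<subseteq> Hs ! Suc i \<and> normalizes (Hs ! Suc i) (Hs ! i) \<and> soluble_step \<pi> (Hs ! Suc i) (Hs ! i)"
    if i: "i < ?n" for i
  proof -
    let ?K = "Hs ! Suc i" and ?W = "Hs ! i"
    have i': "Suc i < length Hs" using i by simp
    have K: "subgroup ?K G" and W: "subgroup ?W G" using sub i by auto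
    have WK: "?W \<lhd> G\<lparr>carrier := ?K\<rparr>" and simple: "simple_group (G\<lparr>carrier := ?K\<rparr> Mod ?W)"
      using Hs(4) i' by auto
    have n: "?W \<subseteq> ?K" "normalizes ?K ?W" using WK normal_restrict_iff[OF K] by auto
    let ?S = "G\<lparr>carrier := ?K\<rparr> Mod ?W"
    interpret Wn: normal ?W "G\<lparr>carrier := ?K\<rparr>" by (rule WK)
    have "?S \<in> composition_factors G" unfolding composition_factors_def using cs i' by blast
    then consider "pi_group (primes_compl \<pi>) ?S" "\<exists>p\<in>primes_compl \<pi>. pi_group {p} ?S"
      | "pi_group (primes_compl (primes_compl \<pi>)) ?S"
      using sol unfolding soluble_group_def separable_group_def by blast
    then have "soluble_step \<pi> ?K ?W"
    proof cases
      case 1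
      then obtain p where p: "prime p" "p \<notin> \<pi>" "pi_group {p} ?S" by (auto simp: primes_compl_def)
      have "index_in {p} ?K ?W" using pi_group_Factor_iff[OF K W n] p(3) by blast
      moreover have "?W #> (x \<otimes> y) = ?W #> (y \<otimes> x)" if xy: "x \<in> ?K" "y \<in> ?K" for x y
      proof -
        have q: "?W #> x \<in> carrier ?S" "?W #> y \<in> carrier ?S" using xy by (auto simp: carrier_FactGroup)
        have "(?W #> x) <#> (?W #> y) = (?W #> y) <#> (?W #> x)"
          using simple_p_group_commutes[OF simple p(3,1) q] by simp
        moreover have "(?W #> x) <#> (?W #> y) = ?W #> (x \<otimes> y)" "(?W #> y) <#> (?W #> x) = ?W #> (y \<otimes> x)"
          using Wn.rcos_sum[of x y] Wn.rcos_sum[of y x] xy by simp_all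
        ultimately show ?thesis by simp
      qed
      ultimately show ?thesis unfolding soluble_step_def using p(1,2) by blast
    next
      case 2
      have "primes_compl (primes_compl \<pi>) = \<pi>" using primes by (auto simp: primes_compl_def)
      then have "index_in \<pi> ?K ?W" using pi_group_Factor_iff[OF K W n] 2 by simp
      then show ?thesis by (simp add: soluble_step_def)
    qed
    then show ?thesis using n by blast
  qed
  moreover have "Hs ! 0 = {\<one>}" "Hs ! ?n = carrier G"
    using Hs by (simp_all add: hd_conv_nth last_conv_nth)
  ultimately have "soluble_series \<pi> (\<lambda>i. Hs ! i) ?n" unfolding soluble_series_def using sub by blast
  then show ?thesis by blast
qed

text \<open>The products \<open>(C j \<inter> H) <#> L\<close> climb from \<open>L\<close> to
  \<open>H\<close>. The last one before \<open>H\<close> is reached serves as \<open>M\<close>, and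
  \<open>H/M\<close> is an image of a subgroup of \<open>C (Suc j)/C j\<close>.\<close>

lemma soluble_tops_subgroup:
  assumes C: "soluble_series \<pi> C n" and H: "subgroup H G"
  shows "soluble_tops \<pi> H"
  unfolding soluble_tops_def
proof (intro allI impI, elim conjE)
  fix L assume L: "subgroup L G" "L \<subset> H" "normalizes H L"
  have LH: "L \<subseteq> H" and Lc: "L \<subseteq> carrier G" using L subgroup.subset by auto
  let ?D = "\<lambda>j. (C j \<inter> H) <#> L"
  have Cs: "subgroup (C j) G" if "j \<le> n" for j using C that by (simp add: soluble_series_def)
  have CH: "subgroup (C j \<inter> H) G" if "j \<le> n" for j using subgroup_Int[OF Cs[OF that] H] .
  have D: "subgroup (?D j) G" "?D j \<subseteq> H" "C j \<inter> H \<subseteq> ?D j" "L \<subseteq> ?D j" if j: "j \<le> n" for j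
    using set_mult_subgroup[OF CH[OF j] L(1) normalizes_mono[OF L(3)]] set_mult_incl[OF CH[OF j] L(1)]
      set_mult_least[OF H _ LH, of "C j \<inter> H"] by auto
  have "?D n = H"
    using D(2)[of n] D(3)[of n] C subgroup.subset[OF H] by (auto simp: soluble_series_def)
  have "?D 0 = L"
  proof -
    have "C 0 \<inter> H = {\<one>}" using C subgroup.one_closed[OF H] by (auto simp: soluble_series_def)
    then have "?D 0 = (\<lambda>x. \<one> \<otimes> x) ` L" by (auto simp: set_mult_def)
    also have "\<dots> = id ` L" by (rule image_cong) (use Lc in auto)
    finally show ?thesis by simp
  qed
  \<comment> \<open>The first index at which \<open>H\<close> is reached. It is not 0 because
    \<open>L\<close> is proper, so it has a predecessor.\<close>
  define m where "m = (LEAST m. ?D m = H)"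
  have m: "?D m = H" unfolding m_def by (rule LeastI) (rule \<open>?D n = H\<close>)
  have mn: "m \<le> n" unfolding m_def by (rule Least_le) (rule \<open>?D n = H\<close>)
  have less: "?D j \<noteq> H" if "j < m" for j
    using not_less_Least[of j "\<lambda>m. ?D m = H"] that unfolding m_def by blast
  have "m \<noteq> 0"
  proof
    assume "m = 0"
    then show False using m L(2) unfolding \<open>m = 0\<close> \<open>?D 0 = L\<close> by simp
  qed
  then obtain j where j: "m = Suc j" "j < n" "j \<le> n" "Suc j \<le> n" using mn by (cases m) auto
  let ?A = "C j" and ?B = "C (Suc j)"
  let ?M = "?D j"
  have AB: "?A \<subseteq> ?B" "normalizes ?B ?A" "soluble_step \<pi> ?B ?A" using C j(2) by (auto simp: soluble_series_def)
  have Heq: "(?B \<inter> H) <#> L = H" using m j(1) by simp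
  note M = D[OF j(3)]
  have MH: "?M \<subset> H" using M(2) less[of j] j(1) by blast
  have Mc: "?M \<subseteq> carrier G" by (rule subgroup.subset[OF M(1)])
  \<comment> \<open>\<open>H\<close> is the product of \<open>?B \<inter> H\<close>, which
    normalizes both \<open>?A \<inter> H\<close> and \<open>L\<close>, and of \<open>L\<close>,
    which lies in \<open>?M\<close>.\<close>
  have nM: "normalizes H ?M"
  proof -
    have "normalizes (?B \<inter> H) ?M"
      by (rule normalizes_set_mult)
        (use normalizes_Int[of "?B \<inter> H" ?A H] normalizes_mono[OF AB(2)] normalizes_mono[OF normalizes_self[OF H]]
          normalizes_mono[OF L(3)] Lc subgroup.subset[OF H] in auto)
    moreover have "normalizes L ?M" by (rule normalizes_mono[OF normalizes_self[OF M(1)] M(4)])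
    ultimately have "normalizes ((?B \<inter> H) <#> L) ?M"
      by (rule normalizes_by_set_mult) (use Lc Mc subgroup.subset[OF H] in auto)
    then show ?thesis using Heq by simp
  qed
  have ind: "index_in \<rho> H ?M" if \<rho>: "index_in \<rho> ?B ?A" for \<rho>
  proof -
    have part: "index_in \<rho> (?B \<inter> Z) (?A \<inter> Z)" if Z: "subgroup Z G" for Z
    proof -
      have "index_in \<rho> (?B \<inter> Z) (?B \<inter> Z \<inter> ?A)"
        by (rule index_in_Int[OF Cs[OF j(4)] Cs[OF j(3)] subgroup_Int[OF Cs[OF j(4)] Z] AB(1) _ normalizes_mono[OF AB(2)] \<rho>]) auto
      moreover have "?B \<inter> Z \<inter> ?A = ?A \<inter> Z" using AB(1) by blast
      ultimately show ?thesis by simp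
    qed
    show ?thesis
      unfolding index_in_def
    proof (intro allI impI)
      fix q assume q: "prime q \<and> q \<notin> \<rho>"
      have "multiplicity q (card (?B \<inter> H)) = multiplicity q (card (?A \<inter> H))"
        "multiplicity q (card (?B \<inter> H \<inter> L)) = multiplicity q (card (?A \<inter> H \<inter> L))"
        using index_inD[OF part[OF H]] index_inD[OF part[OF subgroup_Int[OF H L(1)]]] q by (auto simp: Int_assoc)
      then show "multiplicity q (card H) = multiplicity q (card ?M)"
        using multiplicity_set_mult[OF CH[OF j(4)] L(1), of q] multiplicity_set_mult[OF CH[OF j(3)] L(1), of q] q Heq
        by simp
    qed
  qed
  have comm: "?M #> (x \<otimes> y) = ?M #> (y \<otimes> x)"
    if AB': "\<forall>x\<in>?B. \<forall>y\<in>?B. ?A #> (x \<otimes> y) = ?A #> (y \<otimes> x)" and x: "x \<in> H" and y: "y \<in> H" for x y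
  proof -
    have "?M \<lhd> G\<lparr>carrier := H\<rparr>" using normal_restrict_iff[OF H] M(1,2) nM by blast
    then interpret M: normal ?M "G\<lparr>carrier := H\<rparr>" .
    \<comment> \<open>Every coset of \<open>?M\<close> in \<open>H\<close> has a representative in
      \<open>?B\<close>, since the factor from \<open>L\<close> is absorbed by
      \<open>?M\<close>.\<close>
    have rep: "\<exists>c\<in>?B \<inter> H. ?M #> z = ?M #> c" if "z \<in> H" for z
    proof -
      obtain c l where z: "c \<in> ?B \<inter> H" "l \<in> L" "z = c \<otimes> l"
      proof -
        have "z \<in> (?B \<inter> H) <#> L" using \<open>z \<in> H\<close> Heq by simp
        then show thesis using that unfolding set_mult_def by blast
      qed
      have cl: "c \<in> carrier G" "l \<in> carrier G" using z Lc subgroup.mem_carrier[OF H] by auto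
      have "c \<otimes> l \<otimes> inv c \<in> ?M" using normalizesD'[OF nM H, of c l] z M(4) by blast
      then have "?M #> z = ?M #> c" unfolding z(3) using rcos_eq_iff[OF M(1), of "c \<otimes> l" c] cl by simp
      then show ?thesis using z(1) by blast
    qed
    obtain c where c: "c \<in> ?B" "c \<in> H" "?M #> x = ?M #> c" using rep[OF x] by blast
    obtain d where d: "d \<in> ?B" "d \<in> H" "?M #> y = ?M #> d" using rep[OF y] by blast
    have cd: "c \<in> carrier G" "d \<in> carrier G" using c d subgroup.mem_carrier[OF H] by auto
    have "(c \<otimes> d) \<otimes> inv (d \<otimes> c) \<in> ?A"
      using AB' c(1) d(1) rcos_eq_iff[OF Cs[OF j(3)], of "c \<otimes> d" "d \<otimes> c"] cd by simp
    moreover have "(c \<otimes> d) \<otimes> inv (d \<otimes> c) \<in> H"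
      using c(2) d(2) H by (simp add: subgroup.m_closed subgroup.m_inv_closed)
    ultimately have "(c \<otimes> d) \<otimes> inv (d \<otimes> c) \<in> ?M" using M(3) by blast
    then have 1: "?M #> (c \<otimes> d) = ?M #> (d \<otimes> c)" using rcos_eq_iff[OF M(1), of "c \<otimes> d" "d \<otimes> c"] cd by simp
    have "?M #> (x \<otimes> y) = (?M #> x) <#> (?M #> y)" using M.rcos_sum[of x y] x y by simp
    also have "\<dots> = ?M #> (c \<otimes> d)" unfolding c(3) d(3) using M.rcos_sum[of c d] c d by simp
    also have "\<dots> = (?M #> y) <#> (?M #> x)" unfolding 1 c(3) d(3) using M.rcos_sum[of d c] c d by simp
    also have "\<dots> = ?M #> (y \<otimes> x)" using M.rcos_sum[of y x] x y by simp
    finally show ?thesis .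
  qed
  have "soluble_step \<pi> H ?M"
    using AB(3) ind comm unfolding soluble_step_def by blast
  then show "\<exists>M. subgroup M G \<and> L \<subseteq> M \<and> M \<subset> H \<and> normalizes H M \<and> soluble_step \<pi> H M"
    using M MH nM by blast
qed

text \<open>A minimal invariant \<open>K\<close> above \<open>W\<close> has a top factor
  \<open>K/M\<close> of the right kind, but \<open>M\<close> need not be invariant under
  \<open>X\<close>. The least normal subgroup of \<open>K\<close> above \<open>W\<close> with a
  factor of that kind is invariant, and the minimality of \<open>K\<close> makes it equal to
  \<open>W\<close>.\<close>

lemma soluble_steps_if_tops:
  assumes tops: "\<And>H. subgroup H G \<Longrightarrow> soluble_tops \<pi> H" and X: "subgroup X G"
  shows "soluble_steps \<pi> X"
  unfolding soluble_steps_def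
proof (intro allI impI, elim conjE)
  fix Y W assume Y: "subgroup Y G" "Y \<subseteq> X" "normalizes X Y" and W: "subgroup W G" "W \<subset> Y" "normalizes X W"
  let ?P = "{K. subgroup K G \<and> W \<subset> K \<and> K \<subseteq> Y \<and> normalizes X K}"
  have "?P \<subseteq> Pow Y" by auto
  then have "finite ?P" using subgroup_finite[OF Y(1)] by (meson finite_Pow_iff finite_subset)
  moreover have "?P \<noteq> {}" using Y W by blast
  ultimately obtain K where K: "K \<in> ?P" "\<forall>M\<in>?P. M \<subseteq> K \<longrightarrow> K = M" using finite_has_minimal by meson
  have Ks: "subgroup K G" "W \<subset> K" "K \<subseteq> Y" "normalizes X K" using K(1) by auto
  have KX: "K \<subseteq> X" using Ks(3) Y(2) by blast
  have Kc: "K \<subseteq> carrier G" by (rule subgroup.subset[OF Ks(1)])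
  obtain M where M: "subgroup M G" "W \<subseteq> M" "M \<subset> K" "normalizes K M" "soluble_step \<pi> K M"
    using tops[OF Ks(1)] W(1) Ks(2) normalizes_mono[OF W(3) KX] unfolding soluble_tops_def by blast
  \<comment> \<open>Both kinds of step are treated at once: the flag \<open>ab\<close> demands an
    abelian factor and is \<open>False\<close> for a \<pi>-step.\<close>
  obtain \<rho> ab where \<rho>: "index_in \<rho> K M" "ab \<longrightarrow> (\<forall>x\<in>K. \<forall>y\<in>K. M #> (x \<otimes> y) = M #> (y \<otimes> x))"
    and step: "\<And>T. index_in \<rho> K T \<Longrightarrow> (ab \<longrightarrow> (\<forall>x\<in>K. \<forall>y\<in>K. T #> (x \<otimes> y) = T #> (y \<otimes> x))) \<Longrightarrow> soluble_step \<pi> K T"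
  proof -
    consider "index_in \<pi> K M" | p where "prime p" "p \<notin> \<pi>" "index_in {p} K M" "\<forall>x\<in>K. \<forall>y\<in>K. M #> (x \<otimes> y) = M #> (y \<otimes> x)"
      using M(5) unfolding soluble_step_def by blast
    then show thesis
    proof cases
      case 1
      then show thesis using that[of \<pi> False] by (simp add: soluble_step_def)
    next
      case 2
      show thesis by (rule that[of "{p}" True]) (use 2 in \<open>auto simp: soluble_step_def\<close>)
    qed
  qed
  have eqv: "(T #> (x \<otimes> y) = T #> (y \<otimes> x)) \<longleftrightarrow> x \<otimes> y \<otimes> inv (y \<otimes> x) \<in> T"
    if "subgroup T G" "x \<in> K" "y \<in> K" for T x y
    by (rule rcos_eq_iff[OF that(1)]) (use that Kc in auto)
  \<comment> \<open>Commutativity of the factor is expressed by commutators lying in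
    \<open>T\<close>, a condition closed under intersection.\<close>
  define Q where "Q T \<longleftrightarrow> subgroup T G \<and> W \<subseteq> T \<and> T \<subseteq> K \<and> normalizes K T \<and> index_in \<rho> K T \<and>
    (ab \<longrightarrow> (\<forall>x\<in>K. \<forall>y\<in>K. x \<otimes> y \<otimes> inv (y \<otimes> x) \<in> T))" for T
  have QM: "Q M" unfolding Q_def using M \<rho> eqv[OF M(1)] by blast
  have "{T. Q T} \<subseteq> Pow K" by (auto simp: Q_def)
  then have "finite {T. Q T}" using subgroup_finite[OF Ks(1)] by (meson finite_Pow_iff finite_subset)
  moreover have "{T. Q T} \<noteq> {}" using QM by blast
  ultimately obtain T where T: "T \<in> {T. Q T}" "\<forall>M\<in>{T. Q T}. M \<subseteq> T \<longrightarrow> T = M" using finite_has_minimal by meson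
  have QT: "Q T" using T(1) by blast
  have Ts: "subgroup T G" "W \<subseteq> T" "T \<subseteq> K" "normalizes K T" "index_in \<rho> K T" using QT by (auto simp: Q_def)
  have least: "T \<subseteq> U" if U: "Q U" for U
  proof -
    have Us: "subgroup U G" "W \<subseteq> U" "U \<subseteq> K" "normalizes K U" "index_in \<rho> K U" using U by (auto simp: Q_def)
    have "index_in \<rho> U (U \<inter> T)"
      by (rule index_in_Int[OF Ks(1) Ts(1) Us(1) Ts(3) Us(3) normalizes_mono[OF Ts(4) Us(3)] Ts(5)])
    then have "index_in \<rho> K (U \<inter> T)" using index_in_trans[OF Us(5)] by blast
    then have "Q (U \<inter> T)"
      using U QT subgroup_Int[OF Us(1) Ts(1)] normalizes_Int[OF Us(4) Ts(4)] unfolding Q_def by blast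
    then show ?thesis using T(2) by blast
  qed
  have Tc: "T \<subseteq> carrier G" by (rule subgroup.subset[OF Ts(1)])
  have "normalizes X T"
  proof -
    have "conj_subset G T x \<subseteq> T" if x: "x \<in> X" for x
    proof -
      have xc: "x \<in> carrier G" using subgroup.mem_carrier[OF X x] .
      have Kx: "conj_subset G K x = K" by (rule conj_subset_normalizes[OF Ks(4) X Kc x])
      have Kx': "conj_subset G K (inv x) = K"
        by (rule conj_subset_normalizes[OF Ks(4) X Kc subgroup.m_inv_closed[OF X x]])
      have Wx: "conj_subset G W x = W" by (rule conj_subset_normalizes[OF W(3) X subgroup.subset[OF W(1)] x])
      let ?T = "conj_subset G T x"
      have c: "a \<otimes> b \<otimes> inv (b \<otimes> a) \<in> ?T" if ab: ab and a: "a \<in> K" and b: "b \<in> K" for a b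
      proof -
        have m: "x \<otimes> a \<otimes> inv x \<in> K" "x \<otimes> b \<otimes> inv x \<in> K"
          using normalizesD'[OF Ks(4) X x] a b by auto
        have ac: "a \<in> carrier G" "b \<in> carrier G" using a b Kc by auto
        have "x \<otimes> (a \<otimes> b \<otimes> inv (b \<otimes> a)) \<otimes> inv x
          = (x \<otimes> a \<otimes> inv x) \<otimes> (x \<otimes> b \<otimes> inv x) \<otimes> inv ((x \<otimes> b \<otimes> inv x) \<otimes> (x \<otimes> a \<otimes> inv x))"
          using ac xc by (simp add: inv_mult_group m_assoc mult_inv_cancel)
        then have "x \<otimes> (a \<otimes> b \<otimes> inv (b \<otimes> a)) \<otimes> inv x \<in> T" using QT ab m unfolding Q_def by auto
        then show ?thesis using mem_conj_subset[OF Tc xc] ac by simp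
      qed
      have "Q ?T"
        unfolding Q_def
      proof (intro conjI impI ballI)
        show "subgroup ?T G" by (rule conj_subset_subgroup[OF Ts(1) xc])
        show "W \<subseteq> ?T" using conj_subset_mono[OF Ts(2) Tc xc] Wx by simp
        show "?T \<subseteq> K" using conj_subset_mono[OF Ts(3) Kc xc] Kx by simp
        show "normalizes K ?T" using normalizes_conj[OF Ts(4) Kc Tc xc] Kx by simp
        show "index_in \<rho> K ?T" using index_in_conj[OF Kc Tc xc] Ts(5) Kx by simp
      qed (rule c)
      then have "T \<subseteq> ?T" by (rule least)
      then have "?T = T"
        using card_subset_eq[of ?T T] card_conj_subset[OF Tc xc] subgroup_finite[OF conj_subset_subgroup[OF Ts(1) xc]] by simp
      then show ?thesis by simp
    qed
    then show ?thesis using normalizes_iff_conj[OF subgroup.subset[OF X] Tc] by blast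
  qed
  moreover have "T \<subset> K" using least[OF QM] M(3) by blast
  ultimately have "T = W" using K(2) Ts Ks(3) by blast
  then have "soluble_step \<pi> K W"
    using step[of W] QT eqv[OF W(1)] unfolding Q_def by blast
  then show "\<exists>K. subgroup K G \<and> W \<subset> K \<and> K \<subseteq> Y \<and> normalizes X K \<and> soluble_step \<pi> K W"
    using Ks by blast
qed

end

context fin_group
begin

section \<open>Injectors\<close>

abbreviation subnormal_in :: "'a set \<Rightarrow> 'a set \<Rightarrow> bool" where
  "subnormal_in H K \<equiv> subnormal (G\<lparr>carrier := H\<rparr>) K"

lemma subnormal_in_self: "subnormal_in H H"
  using subnormal.whole[of "G\<lparr>carrier := H\<rparr>"] by simp

lemma subnormal_in_subgroup:
  assumes "subnormal_in H K" "subgroup H G"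
  shows "subgroup K G \<and> K \<subseteq> H"
  using assms(1)
proof (induction rule: subnormal.induct)
  case whole
  then show ?case using assms(2) by simp
next
  case (step H' K)
  then show ?case using normal_restrict_iff[of H' K] by auto
qed

lemma subnormal_in_step:
  assumes "subnormal_in H K" "subgroup H G" "subgroup L G" "L \<subseteq> K" "normalizes K L"
  shows "subnormal_in H L"
proof -
  have "L \<lhd> G\<lparr>carrier := H\<rparr>\<lparr>carrier := K\<rparr>"
    using normal_restrict_iff[of K L] subnormal_in_subgroup[OF assms(1,2)] assms by simp
  then show ?thesis by (rule subnormal.step[OF assms(1)])
qed

lemma subnormal_in_normal:
  "subgroup H G \<Longrightarrow> subgroup L G \<Longrightarrow> L \<subseteq> H \<Longrightarrow> normalizes H L \<Longrightarrow> subnormal_in H L"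
  using subnormal_in_step[OF subnormal_in_self] by blast

lemma subnormal_in_induct:
  assumes "subnormal_in H K" and H: "subgroup H G" and "P H"
    and step: "\<And>K L. subnormal_in H K \<Longrightarrow> P K \<Longrightarrow> subgroup K G \<Longrightarrow> K \<subseteq> H \<Longrightarrow>
      subgroup L G \<Longrightarrow> L \<subseteq> K \<Longrightarrow> normalizes K L \<Longrightarrow> P L"
  shows "P K"
  using assms(1)
proof (induction rule: subnormal.induct)
  case whole
  then show ?case using \<open>P H\<close> by simp
next
  case (step K L)
  have K: "subgroup K G" "K \<subseteq> H" using subnormal_in_subgroup[OF step.hyps(1) H] by auto
  have "subgroup L G \<and> L \<subseteq> K \<and> normalizes K L" using step.hyps(2) normal_restrict_iff[OF K(1), of L] by simp
  then show ?case using assms(4)[OF step.hyps(1) step.IH K] by blast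
qed

lemma subnormal_in_trans:
  assumes H: "subgroup H G" and HK: "subnormal_in H K" and KL: "subnormal_in K L"
  shows "subnormal_in H L"
proof -
  have K: "subgroup K G" using subnormal_in_subgroup[OF HK H] by blast
  from KL K show ?thesis
    by (rule subnormal_in_induct) (rule HK, rule subnormal_in_step[OF _ H])
qed

text \<open>Exposes the top of a subnormal chain, whereas \<open>subnormal\<close> extends the chain
  at its bottom; the induction on the order of \<open>H\<close> needs the top.\<close>

lemma subnormal_in_cases:
  assumes HK: "subnormal_in H K" and H: "subgroup H G"
  shows "K = H \<or> (\<exists>L. subgroup L G \<and> L \<subset> H \<and> normalizes H L \<and> subnormal_in L K)"
  using HK H
proof (rule subnormal_in_induct)
  fix K L assume K: "subnormal_in H K" "K = H \<or> (\<exists>M. subgroup M G \<and> M \<subset> H \<and> normalizes H M \<and> subnormal_in M K)"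
    and L: "subgroup L G" "L \<subseteq> K" "normalizes K L"
  show "L = H \<or> (\<exists>M. subgroup M G \<and> M \<subset> H \<and> normalizes H M \<and> subnormal_in M L)"
  proof (cases "K = H")
    case True
    then show ?thesis using L subnormal_in_self by blast
  next
    case False
    then show ?thesis using K(2) L subnormal_in_step by blast
  qed
qed simp

lemma subnormal_in_conj:
  assumes HK: "subnormal_in H K" and H: "subgroup H G" and x: "x \<in> carrier G"
  shows "subnormal_in (conj_subset G H x) (conj_subset G K x)"
  using HK H
proof (rule subnormal_in_induct)
  show "subnormal_in (conj_subset G H x) (conj_subset G H x)" by (rule subnormal_in_self)
next
  fix K L assume K: "subnormal_in (conj_subset G H x) (conj_subset G K x)" "subgroup K G"
    and L: "subgroup L G" "L \<subseteq> K" "normalizes K L"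
  show "subnormal_in (conj_subset G H x) (conj_subset G L x)"
    by (rule subnormal_in_step[OF K(1) conj_subset_subgroup[OF H x] conj_subset_subgroup[OF L(1) x]
          conj_subset_mono[OF L(2) subgroup.subset[OF K(2)] x]
          normalizes_conj[OF L(3) subgroup.subset[OF K(2)] subgroup.subset[OF L(1)] x]])
qed

end

section \<open>\<open>F\<close>-maximal subgroups and injectors\<close>

locale soluble_fitting_group = fitting_class_group +
  assumes soluble: "soluble_group (primes_compl \<pi>) G"
begin

lemma ex_soluble_series: "\<exists>C n. soluble_series \<pi> C n"
  by (rule soluble_series_exists[OF pi_primes soluble])

lemma tops: "subgroup H G \<Longrightarrow> soluble_tops \<pi> H"
  using ex_soluble_series soluble_tops_subgroup by blast

lemma steps: "subgroup X G \<Longrightarrow> soluble_steps \<pi> X"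
  by (rule soluble_steps_if_tops[OF tops])

definition Fmax :: "'a set \<Rightarrow> 'a set \<Rightarrow> bool" where
  "Fmax H U \<longleftrightarrow> subgroup U G \<and> U \<subseteq> H \<and> inF U \<and>
     (\<forall>W. subgroup W G \<and> W \<subseteq> H \<and> inF W \<and> U \<subseteq> W \<longrightarrow> W = U)"

abbreviation injector :: "'a set \<Rightarrow> 'a set \<Rightarrow> bool" where
  "injector H V \<equiv> F_injector F (G\<lparr>carrier := H\<rparr>) V"

lemma subgroup_restrict_iff:
  assumes "subgroup H G"
  shows "subgroup U (G\<lparr>carrier := H\<rparr>) \<longleftrightarrow> subgroup U G \<and> U \<subseteq> H"
proof
  assume U: "subgroup U (G\<lparr>carrier := H\<rparr>)"
  then show "subgroup U G \<and> U \<subseteq> H" using incl_subgroup[OF assms U] subgroup.subset[OF U] by simp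
next
  assume "subgroup U G \<and> U \<subseteq> H"
  then show "subgroup U (G\<lparr>carrier := H\<rparr>)" using subgroup_incl assms by blast
qed

lemma F_maximal_iff: "subgroup H G \<Longrightarrow> F_maximal F (G\<lparr>carrier := H\<rparr>) U \<longleftrightarrow> Fmax H U"
  unfolding F_maximal_def Fmax_def by (simp add: subgroup_restrict_iff)

lemma FmaxD:
  assumes "Fmax H U"
  shows "subgroup U G" "U \<subseteq> H" "inF U" "\<And>W. subgroup W G \<Longrightarrow> W \<subseteq> H \<Longrightarrow> inF W \<Longrightarrow> U \<subseteq> W \<Longrightarrow> W = U"
  using assms unfolding Fmax_def by blast+

lemma injector_iff:
  assumes H: "subgroup H G"
  shows "injector H V \<longleftrightarrow> subgroup V G \<and> V \<subseteq> H \<and> (\<forall>K. subnormal_in H K \<longrightarrow> Fmax K (V \<inter> K))"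
proof -
  have "F_maximal F (G\<lparr>carrier := K\<rparr>) (V \<inter> K) \<longleftrightarrow> Fmax K (V \<inter> K)" if "subnormal_in H K" for K
    using F_maximal_iff subnormal_in_subgroup[OF that H] by blast
  then show ?thesis unfolding F_injector_def by (simp add: subgroup_restrict_iff[OF H])
qed

lemma injector_Fmax: "subgroup H G \<Longrightarrow> injector H V \<Longrightarrow> Fmax H V"
  using injector_iff[of H V] subnormal_in_self[of H] by (metis inf.absorb1)

lemma injector_subnormal:
  assumes H: "subgroup H G" and V: "injector H V" and K: "subnormal_in H K"
  shows "injector K (V \<inter> K)"
proof -
  have Ks: "subgroup K G" "K \<subseteq> H" using subnormal_in_subgroup[OF K H] by auto
  have Vs: "subgroup V G" "\<And>L. subnormal_in H L \<Longrightarrow> Fmax L (V \<inter> L)" using V injector_iff[OF H] by auto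
  have "Fmax L (V \<inter> K \<inter> L)" if L: "subnormal_in K L" for L
  proof -
    have "L \<subseteq> K" using subnormal_in_subgroup[OF L Ks(1)] by blast
    then have "V \<inter> K \<inter> L = V \<inter> L" by blast
    then show ?thesis using Vs(2)[OF subnormal_in_trans[OF H K L]] by simp
  qed
  then show ?thesis using injector_iff[OF Ks(1)] subgroup_Int[OF Vs(1) Ks(1)] by blast
qed

lemma Fmax_conj:
  assumes U: "Fmax H U" and H: "subgroup H G" and x: "x \<in> carrier G"
  shows "Fmax (conj_subset G H x) (conj_subset G U x)"
proof -
  note Us = FmaxD[OF U]
  have sc: "H \<subseteq> carrier G" "U \<subseteq> carrier G" using H Us(1) subgroup.subset by blast+
  show ?thesis
    unfolding Fmax_def
  proof (intro conjI allI impI, goal_cases)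
    case 1
    show ?case by (rule conj_subset_subgroup[OF Us(1) x])
  next
    case 2
    show ?case by (rule conj_subset_mono[OF Us(2) sc(1) x])
  next
    case 3
    show ?case by (rule inF_conj[OF Us(1,3) x])
  next
    case (4 W)
    then have W: "subgroup W G" "W \<subseteq> conj_subset G H x" "inF W" "conj_subset G U x \<subseteq> W" by auto
    have Wc: "W \<subseteq> carrier G" by (rule subgroup.subset[OF W(1)])
    have ix: "inv x \<in> carrier G" using x by simp
    have "conj_subset G W (inv x) = U"
    proof (rule Us(4))
      show "subgroup (conj_subset G W (inv x)) G" by (rule conj_subset_subgroup[OF W(1) ix])
      show "conj_subset G W (inv x) \<subseteq> H"
        using conj_subset_mono[OF W(2) conj_subset_carrier[OF sc(1) x] ix] sc x by simp
      show "inF (conj_subset G W (inv x))" by (rule inF_conj[OF W(1,3) ix])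
      show "U \<subseteq> conj_subset G W (inv x)" using conj_subset_le_iff[OF sc(2) Wc x] W(4) by blast
    qed
    then show ?case using Wc x by auto
  qed
qed

lemma injector_conj:
  assumes H: "subgroup H G" and V: "injector H V" and x: "x \<in> carrier G"
  shows "injector (conj_subset G H x) (conj_subset G V x)"
proof -
  have Vs: "subgroup V G" "V \<subseteq> H" "\<And>L. subnormal_in H L \<Longrightarrow> Fmax L (V \<inter> L)" using V injector_iff[OF H] by auto
  have sc: "H \<subseteq> carrier G" "V \<subseteq> carrier G" using H Vs(1) subgroup.subset by blast+
  have ix: "inv x \<in> carrier G" using x by simp
  have Hx: "subgroup (conj_subset G H x) G" by (rule conj_subset_subgroup[OF H x])
  have "Fmax K (conj_subset G V x \<inter> K)" if K: "subnormal_in (conj_subset G H x) K" for K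
  proof -
    let ?K = "conj_subset G K (inv x)"
    have Ks: "subgroup K G" using subnormal_in_subgroup[OF K Hx] by blast
    have Kc: "K \<subseteq> carrier G" by (rule subgroup.subset[OF Ks])
    have "subnormal_in H ?K" using subnormal_in_conj[OF K Hx ix] sc x by simp
    then have "Fmax ?K (V \<inter> ?K)" by (rule Vs(3))
    then have "Fmax (conj_subset G ?K x) (conj_subset G (V \<inter> ?K) x)"
      by (rule Fmax_conj[OF _ conj_subset_subgroup[OF Ks ix] x])
    then show ?thesis using conj_subset_Int[OF sc(2) conj_subset_carrier[OF Kc ix] x] Kc x by simp
  qed
  then show ?thesis
    using injector_iff[OF Hx] conj_subset_subgroup[OF Vs(1) x] conj_subset_mono[OF Vs(2) sc(1) x] by blast
qed

lemma injector_conj_normal: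
  assumes H: "subgroup H G" and V: "injector H V" and M: "subgroup M G" "normalizes M H" and x: "x \<in> M"
  shows "injector H (conj_subset G V x)"
  using injector_conj[OF H V subgroup.mem_carrier[OF M(1) x]]
    conj_subset_normalizes[OF M(2,1) subgroup.subset[OF H] x] by simp

lemma Fmax_exists:
  assumes H: "subgroup H G" and U: "subgroup U G" "U \<subseteq> H" "inF U"
  obtains V where "Fmax H V" "U \<subseteq> V"
proof -
  let ?P = "\<lambda>D. subgroup D G \<and> U \<subseteq> D \<and> D \<subseteq> H \<and> inF D"
  obtain V where V: "?P V" "\<And>E. ?P E \<Longrightarrow> V \<subseteq> E \<Longrightarrow> E = V"
    using maximal_inF_exists[OF H, of ?P U] U by blast
  have "Fmax H V" unfolding Fmax_def using V by blast
  then show thesis using that V(1) by blast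
qed

text \<open>
  An \<open>F\<close>-subgroup of \<open>H\<close> containing \<open>W\<close> meets \<open>N\<close> exactly in \<open>W\<close> and hence normalizes \<open>W\<close>, so these
  subgroups form a Fitting set in the normalizer of \<open>W\<close>.
\<close>

lemma Fmax_over_conj:
  assumes H: "subgroup H G" and N: "subgroup N G" "N \<subseteq> H" "normalizes H N" "block_nilpotent \<pi> H N"
    and W: "Fmax N W" and V1: "Fmax H V1" "W \<subseteq> V1" and V2: "Fmax H V2" "W \<subseteq> V2"
  shows "\<exists>y\<in>N. conj_subset G V1 y = V2"
proof -
  note Ws = FmaxD[OF W]
  have Wc: "W \<subseteq> carrier G" by (rule subgroup.subset[OF Ws(1)])
  define X where "X = normalizer G W \<inter> H"
  define Y where "Y = X \<inter> N"
  define S where "S = {T. subgroup T G \<and> W \<subseteq> T \<and> T \<subseteq> X \<and> inF T}"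
  have X: "subgroup X G" "X \<subseteq> H" "normalizes X W"
    unfolding X_def using subgroup_Int[OF normalizer_subgroup[OF Wc] H]
      normalizes_mono[OF normalizes_normalizer[OF Wc]] by auto
  have Y: "subgroup Y G" "Y \<subseteq> X" "normalizes X Y"
    unfolding Y_def using subgroup_Int[OF X(1) N(1)]
      normalizes_Int[OF normalizes_self[OF X(1)] normalizes_mono[OF N(3) X(2)]] by auto
  have in_X: "T \<subseteq> X" if "subgroup T G" "T \<subseteq> H" "normalizes T W" for T
    unfolding X_def using subset_normalizer_iff[OF that(1) Wc] that by blast
  have WX: "W \<subseteq> X" by (rule in_X[OF Ws(1) _ normalizes_self[OF Ws(1)]]) (use Ws N in blast)
  have meet: "T \<inter> N = W" if T: "subgroup T G" "T \<subseteq> H" "inF T" "W \<subseteq> T" for T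
  proof (rule Ws(4))
    show s: "subgroup (T \<inter> N) G" by (rule subgroup_Int[OF T(1) N(1)])
    show "inF (T \<inter> N)"
      by (rule inF_normal[OF T(1) s _ _ T(3)])
        (use normalizes_Int[OF normalizes_self[OF T(1)] normalizes_mono[OF N(3) T(2)]] in auto)
  qed (use T Ws in auto)
  have le_X: "T \<subseteq> X" if T: "subgroup T G" "T \<subseteq> H" "inF T" "W \<subseteq> T" for T
  proof (rule in_X[OF T(1,2)])
    have "normalizes T (T \<inter> N)"
      by (rule normalizes_Int[OF normalizes_self[OF T(1)] normalizes_mono[OF N(3) T(2)]])
    then show "normalizes T W" using meet[OF T] by simp
  qed
  have fs: "fitting_set \<pi> X Y W S"
    unfolding fitting_set_def
  proof (intro conjI ballI allI impI)
    show "block_nilpotent \<pi> X Y"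
      unfolding Y_def by (rule block_nilpotent_Int[OF N(4) H N(1,3) X(1,2)])
    show "W \<subseteq> Y" unfolding Y_def using WX Ws(2) by blast
    show "W \<in> S" unfolding S_def using Ws WX by blast
  next
    fix T assume "T \<in> S"
    then have T: "subgroup T G" "W \<subseteq> T" "T \<subseteq> X" "inF T" by (auto simp: S_def)
    show "subgroup T G" "W \<subseteq> T" "T \<subseteq> X" using T by auto
    have "T \<inter> N = W" by (rule meet[OF T(1) _ T(4,2)]) (use T(3) X(2) in blast)
    then show "T \<inter> Y = W" unfolding Y_def using T(3) by blast
  next
    fix T x assume "T \<in> S" and x: "x \<in> X"
    then have T: "subgroup T G" "W \<subseteq> T" "T \<subseteq> X" "inF T" by (auto simp: S_def)
    have xc: "x \<in> carrier G" by (rule subgroup.mem_carrier[OF X(1) x])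
    have "W \<subseteq> conj_subset G T x"
      using conj_subset_mono[OF T(2) subgroup.subset[OF T(1)] xc] conj_subset_normalizes[OF X(3,1) Wc x] by simp
    moreover have "conj_subset G T x \<subseteq> X"
      using conj_subset_mono[OF T(3) subgroup.subset[OF X(1)] xc] conj_subset_self[OF X(1) x] by simp
    ultimately show "conj_subset G T x \<in> S"
      unfolding S_def using conj_subset_subgroup[OF T(1) xc] inF_conj[OF T(1,4) xc] by blast
  next
    fix T U assume "T \<in> S" and U: "subgroup U G \<and> W \<subseteq> U \<and> U \<subseteq> T \<and> normalizes T U"
    then have T: "subgroup T G" "W \<subseteq> T" "T \<subseteq> X" "inF T" by (auto simp: S_def)
    have "inF U" using inF_normal[OF T(1) _ _ _ T(4)] U by blast
    then show "U \<in> S" unfolding S_def using U T by blast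
  next
    fix T U J assume TU: "T \<in> S" "U \<in> S"
      and J: "subgroup J G \<and> T \<subseteq> J \<and> U \<subseteq> J \<and> J \<subseteq> X \<and> block_nilpotent \<pi> J W"
    have WJ: "W \<subseteq> J" using TU J by (auto simp: S_def)
    have nJ: "normalizes J W" using normalizes_mono[OF X(3)] J by blast
    \<comment> \<open>The common upper bound is the largest \<open>F\<close>-subgroup of
      \<open>J\<close> above \<open>W\<close>.\<close>
    obtain D where D: "largest_in J W D"
      using block_nilpotent_largest_exists[OF _ Ws(1) WJ nJ Ws(3)] J by blast
    have "D \<in> S" using D J by (auto simp: largest_in_def S_def)
    moreover have "T \<subseteq> D" "U \<subseteq> D" "D \<subseteq> J" using D TU J by (auto simp: largest_in_def S_def)
    ultimately show "\<exists>V\<in>S. T \<subseteq> V \<and> U \<subseteq> V \<and> V \<subseteq> J" by blast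
  qed (use X Y Ws in auto)
  have max: "maximal_in S V" if V: "Fmax H V" "W \<subseteq> V" for V
  proof -
    note Vs = FmaxD[OF V(1)]
    have "V \<in> S" unfolding S_def using Vs V(2) le_X[OF Vs(1,2,3) V(2)] by blast
    moreover have "U = V" if "U \<in> S" "V \<subseteq> U" for U
      using Vs(4)[of U] that X(2) by (auto simp: S_def)
    ultimately show ?thesis by (simp add: maximal_in_def)
  qed
  obtain y where "y \<in> Y" "conj_subset G V1 y = V2"
    using maximal_in_fitting_set_conj[OF fs steps[OF X(1)] max[OF V1] max[OF V2]] by blast
  then show ?thesis unfolding Y_def by blast
qed

lemma soluble_step_block_nilpotent:
  assumes "subgroup H G" "subgroup M G" "M \<subseteq> H" "normalizes H M" "soluble_step \<pi> H M"
  shows "block_nilpotent \<pi> H M"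
proof -
  obtain b where "b \<in> blocks \<pi>" "index_in b H M"
    using assms(5) unfolding soluble_step_def blocks_def by blast
  then show ?thesis using block_nilpotent_block assms by blast
qed

lemma block_nilpotent_self: "subgroup H G \<Longrightarrow> block_nilpotent \<pi> H H"
  using block_nilpotent_block[of \<pi> \<pi> H H] normalizes_self by (simp add: blocks_def)

text \<open>Inside \<open>H\<close> this \<open>R\<close> takes the place of the
  \<open>N\<^sup>\<pi>\<close>-residual, so the induction over subgroups can stay with
  \<open>block_nilpotent\<close> kernels.\<close>

lemma least_block_nilpotent:
  assumes H: "subgroup H G"
  obtains R where "subgroup R G" "R \<subseteq> H" "normalizes H R" "block_nilpotent \<pi> H R"
    "\<And>N. subgroup N G \<Longrightarrow> N \<subseteq> H \<Longrightarrow> normalizes H N \<Longrightarrow> block_nilpotent \<pi> H N \<Longrightarrow> R \<subseteq> N"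
proof -
  let ?P = "{N. subgroup N G \<and> N \<subseteq> H \<and> normalizes H N \<and> block_nilpotent \<pi> H N}"
  have "?P \<subseteq> Pow H" by auto
  then have "finite ?P" using subgroup_finite[OF H] by (meson finite_Pow_iff finite_subset)
  moreover have "H \<in> ?P" using H block_nilpotent_self normalizes_self by simp
  then have "?P \<noteq> {}" by blast
  ultimately obtain R where R: "R \<in> ?P" "\<forall>M\<in>?P. M \<subseteq> R \<longrightarrow> R = M" using finite_has_minimal by meson
  show thesis
  proof (rule that)
    fix N assume N: "subgroup N G" "N \<subseteq> H" "normalizes H N" "block_nilpotent \<pi> H N"
    have "R \<inter> N \<in> ?P"
      using R(1) N subgroup_Int[of R N] normalizes_Int[of H R N] block_nilpotent_Int_kernel[OF H, of R \<pi> N] by blast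
    then show "R \<subseteq> N" using R(2) by blast
  qed (use R(1) in auto)
qed

text \<open>An \<open>F\<close>-maximal subgroup \<open>V\<close> of \<open>H\<close> above an
  injector \<open>W\<close> of \<open>R\<close> is an injector: a proper subnormal subgroup lies
  subnormally in a proper normal \<open>M\<close> containing \<open>R\<close>, and an injector of
  \<open>M\<close> extending \<open>W\<close> lies in an \<open>F\<close>-maximal subgroup of
  \<open>H\<close>, which is conjugate to \<open>V\<close> under \<open>R\<close>. For conjugacy,
  the intersections with \<open>R\<close> are matched by induction, and
  \<open>Fmax_over_conj\<close> finishes. The conjugating element lies in \<open>R\<close>, hence in
  every kernel \<open>N\<close>.\<close>

theorem injectors_exist_and_conj:
  assumes "subgroup H G"
  shows "(\<exists>V. injector H V) \<and> (\<forall>N V V'. subgroup N G \<longrightarrow> N \<subseteq> H \<longrightarrow> normalizes H N \<longrightarrow> block_nilpotent \<pi> H N \<longrightarrow>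
    injector H V \<longrightarrow> injector H V' \<longrightarrow> (\<exists>g\<in>N. conj_subset G V g = V'))"
  using assms
proof (induction "card H" arbitrary: H rule: less_induct)
  case less
  note H = less.prems
  show ?case
  proof (cases "H = {\<one>}")
    case True
    have trivial: "K = {\<one>}" if "subgroup K G" "K \<subseteq> {\<one>}" for K
      using that subgroup.one_closed by blast
    have "Fmax {\<one>} {\<one>}" unfolding Fmax_def using triv_subgroup inF_trivial trivial by blast
    then have "Fmax K (H \<inter> K)" if "subnormal_in H K" for K
      using trivial[of K] subnormal_in_subgroup[OF that H] True by auto
    then have ex: "injector H H" unfolding injector_iff[OF H] using H by blast
    have unique: "V = {\<one>}" if "injector H V" for V
    proof -
      have "subgroup V G" "V \<subseteq> {\<one>}" using that True unfolding injector_iff[OF H] by auto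
      then show ?thesis by (rule trivial)
    qed
    have "conj_subset G {\<one>} \<one> = {\<one>}" by (rule conj_subset_one) simp
    then have "\<exists>g\<in>N. conj_subset G V g = V'" if "subgroup N G" "injector H V" "injector H V'" for N V V'
      using unique[OF that(2)] unique[OF that(3)] subgroup.one_closed[OF that(1)] by blast
    then show ?thesis using ex by blast
  next
    case False
    obtain R where R: "subgroup R G" "R \<subseteq> H" "normalizes H R" "block_nilpotent \<pi> H R"
      and Rleast: "\<And>N. subgroup N G \<Longrightarrow> N \<subseteq> H \<Longrightarrow> normalizes H N \<Longrightarrow> block_nilpotent \<pi> H N \<Longrightarrow> R \<subseteq> N"
      using least_block_nilpotent[OF H] by blast
    \<comment> \<open>A top factor \<open>H/M\<close> is block-nilpotent, so \<open>R\<close> lies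
      in \<open>M\<close> by leastness.\<close>
    have above: "\<exists>M. subgroup M G \<and> L \<subseteq> M \<and> M \<subset> H \<and> normalizes H M \<and> R \<subseteq> M"
      if L: "subgroup L G" "L \<subset> H" "normalizes H L" for L
    proof -
      obtain M where M: "subgroup M G" "L \<subseteq> M" "M \<subset> H" "normalizes H M" "soluble_step \<pi> H M"
        using tops[OF H] L unfolding soluble_tops_def by blast
      have "M \<subseteq> H" using M(3) by blast
      then have "R \<subseteq> M" using Rleast[OF M(1) _ M(4)] soluble_step_block_nilpotent[OF H M(1) _ M(4,5)] by blast
      then show ?thesis using M by blast
    qed
    have "subgroup {\<one>} G" "{\<one>} \<subset> H" "normalizes H {\<one>}"
      using False subgroup.one_closed[OF H] subgroup.mem_carrier[OF H] triv_subgroup by (auto simp: normalizes_def)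
    \<comment> \<open>Here \<open>H\<close> must be nontrivial: the trivial subgroup is then proper,
      and \<open>above\<close> puts \<open>R\<close> into a proper subgroup.\<close>
    then have RH: "R \<subset> H" using above by blast
    have IH: "(\<exists>V. injector L V) \<and> (\<forall>N V V'. subgroup N G \<longrightarrow> N \<subseteq> L \<longrightarrow> normalizes L N \<longrightarrow> block_nilpotent \<pi> L N \<longrightarrow>
      injector L V \<longrightarrow> injector L V' \<longrightarrow> (\<exists>g\<in>N. conj_subset G V g = V'))" if "subgroup L G" "L \<subset> H" for L
      using less.hyps[OF psubset_card_mono[OF subgroup_finite[OF H] that(2)] that(1)] .
    have R_conj: "\<exists>g\<in>R. conj_subset G V g = V'" if "injector R V" "injector R V'" for V V'
      using IH[OF R(1) RH] R(1) normalizes_self[OF R(1)] block_nilpotent_self[OF R(1)] that by blast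
    have Rc: "g \<in> carrier G" "g \<in> H" if "g \<in> R" for g using that R(2) subgroup.mem_carrier[OF R(1)] by auto
    have RR: "conj_subset G R g = R" if "g \<in> H" for g
      by (rule conj_subset_normalizes[OF R(3) H subgroup.subset[OF R(1)] that])
    have restrict_R: "injector R (V \<inter> R)" if M: "subgroup M G" "R \<subseteq> M" "M \<subseteq> H" "injector M V" for M V
      by (rule injector_subnormal[OF M(1,4) subnormal_in_normal[OF M(1) R(1) M(2) normalizes_mono[OF R(3) M(3)]]])
    \<comment> \<open>Injectors of \<open>R\<close> are conjugate in \<open>R\<close> by induction,
      so an injector of \<open>M\<close> can be arranged to meet \<open>R\<close> in a prescribed
      \<open>W\<close>.\<close>
    have adjust: "\<exists>g\<in>R. injector M (conj_subset G V g) \<and> conj_subset G V g \<inter> R = W"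
      if M: "subgroup M G" "R \<subseteq> M" "M \<subseteq> H" "injector M V" and W: "injector R W" for M V W
    proof -
      obtain g where g: "g \<in> R" "conj_subset G (V \<inter> R) g = W" using R_conj[OF restrict_R[OF M] W] by blast
      have Vs: "subgroup V G" using M(4) injector_iff[OF M(1)] by blast
      have "conj_subset G (V \<inter> R) g = conj_subset G V g \<inter> R"
        using conj_subset_Int[OF subgroup.subset[OF Vs] subgroup.subset[OF R(1)] Rc(1)[OF g(1)]] RR[OF Rc(2)[OF g(1)]] by simp
      moreover have "injector M (conj_subset G V g)"
        by (rule injector_conj_normal[OF M(1,4,1) normalizes_self[OF M(1)]]) (use g(1) M(2) in blast)
      ultimately show ?thesis using g by blast
    qed
    show ?thesis
    proof (intro conjI allI impI)
      obtain W where W: "injector R W" using IH[OF R(1) RH] by blast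
      have Wm: "Fmax R W" by (rule injector_Fmax[OF R(1) W])
      obtain V where V: "Fmax H V" "W \<subseteq> V"
        using Fmax_exists[OF H FmaxD(1)[OF Wm] _ FmaxD(3)[OF Wm]] FmaxD(2)[OF Wm] R(2) by blast
      note Vs = FmaxD[OF V(1)]
      have "Fmax K (V \<inter> K)" if K: "subnormal_in H K" for K
      proof (cases "K = H")
        case True
        then show ?thesis using V(1) Vs(2) by (simp add: inf.absorb1)
      next
        case False
        then obtain L where L: "subgroup L G" "L \<subset> H" "normalizes H L" "subnormal_in L K"
          using subnormal_in_cases[OF K H] by blast
        obtain M where M: "subgroup M G" "L \<subseteq> M" "M \<subset> H" "normalizes H M" "R \<subseteq> M" using above[OF L(1-3)] by blast
        have MH: "M \<subseteq> H" using M(3) by blast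
        have MK: "subnormal_in M K"
          by (rule subnormal_in_trans[OF M(1) subnormal_in_normal[OF M(1) L(1) M(2) normalizes_mono[OF L(3) MH]] L(4)])
        obtain T0 where T0: "injector M T0" using IH[OF M(1,3)] by blast
        obtain g where g: "injector M (conj_subset G T0 g)" "conj_subset G T0 g \<inter> R = W"
          using adjust[OF M(1,5) MH T0 W] by blast
        define T where "T = conj_subset G T0 g"
        have T: "injector M T" "T \<inter> R = W" using g by (auto simp: T_def)
        have Tm: "Fmax M T" by (rule injector_Fmax[OF M(1) T(1)])
        note Ts = FmaxD[OF Tm]
        obtain U where U: "Fmax H U" "T \<subseteq> U" using Fmax_exists[OF H Ts(1) _ Ts(3)] Ts(2) MH by blast
        note Us = FmaxD[OF U(1)]
        have "W \<subseteq> U" using T(2) U(2) by blast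
        then obtain y where y: "y \<in> R" "conj_subset G U y = V"
          using Fmax_over_conj[OF H R Wm U(1) _ V] by blast
        \<comment> \<open>\<open>U \<inter> M\<close> is normal in \<open>U\<close>, hence in
          \<open>F\<close>, while \<open>T\<close> is already \<open>F\<close>-maximal in
          \<open>M\<close>.\<close>
        have "U \<inter> M = T"
        proof (rule Ts(4))
          show s: "subgroup (U \<inter> M) G" by (rule subgroup_Int[OF Us(1) M(1)])
          show "inF (U \<inter> M)"
            by (rule inF_normal[OF Us(1) s _ _ Us(3)])
              (use normalizes_Int[OF normalizes_self[OF Us(1)] normalizes_mono[OF M(4) Us(2)]] in auto)
        qed (use U(2) Ts(2) in auto)
        moreover have "conj_subset G (U \<inter> M) y = V \<inter> M"
          using conj_subset_Int[OF subgroup.subset[OF Us(1)] subgroup.subset[OF M(1)] Rc(1)[OF y(1)]] y(2)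
            conj_subset_normalizes[OF M(4) H subgroup.subset[OF M(1)] Rc(2)[OF y(1)]] by simp
        ultimately have "V \<inter> M = conj_subset G T y" by simp
        moreover have "injector M (conj_subset G T y)"
          by (rule injector_conj_normal[OF M(1) T(1) H M(4) Rc(2)[OF y(1)]])
        ultimately have "injector M (V \<inter> M)" by simp
        then have "Fmax K (V \<inter> M \<inter> K)" using injector_iff[OF M(1)] MK by blast
        moreover have "K \<subseteq> M" using subnormal_in_subgroup[OF MK M(1)] by blast
        then have "V \<inter> M \<inter> K = V \<inter> K" by blast
        ultimately show ?thesis by simp
      qed
      then show "\<exists>V. injector H V" using injector_iff[OF H] Vs(1,2) by blast
    next
      fix N V V' assume N: "subgroup N G" "N \<subseteq> H" "normalizes H N" "block_nilpotent \<pi> H N"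
        and V: "injector H V" and V': "injector H V'"
      have RN: "R \<subseteq> N" using N by (rule Rleast)
      have W: "injector R (V' \<inter> R)" by (rule restrict_R[OF H R(2) subset_refl V'])
      obtain g where g: "g \<in> R" "injector H (conj_subset G V g)" "conj_subset G V g \<inter> R = V' \<inter> R"
        using adjust[OF H R(2) subset_refl V W] by blast
      have "V' \<inter> R \<subseteq> conj_subset G V g" using g(3) by blast
      then obtain y where y: "y \<in> R" "conj_subset G (conj_subset G V g) y = V'"
        using Fmax_over_conj[OF H R injector_Fmax[OF R(1) W] injector_Fmax[OF H g(2)] _ injector_Fmax[OF H V']] by blast
      have Vs: "subgroup V G" using V injector_iff[OF H] by blast
      have "conj_subset G V (g \<otimes> y) = V'"
        using y(2) conj_subset_mult[OF subgroup.subset[OF Vs] Rc(1)[OF g(1)] Rc(1)[OF y(1)]] by simp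
      moreover have "g \<otimes> y \<in> N" using g(1) y(1) RN subgroup.m_closed[OF R(1)] by blast
      ultimately show "\<exists>g\<in>N. conj_subset G V g = V'" by blast
    qed
  qed
qed

text \<open>A subgroup containing a normal subgroup of block index is not subnormal in general; this is where
  closure under all \<open>N\<^sup>\<pi>\<close>-Dnormal subgroups is needed.\<close>

lemma injector_Int_section:
  assumes P: "subgroup P G" "normalizes (carrier G) P" "index_in \<pi> (carrier G) P"
    and M: "subgroup M G" "P \<subseteq> M" and I: "injector (carrier G) I"
  shows "injector M (I \<inter> M)"
proof -
  note top = subgroup_self
  have Pc: "P \<subseteq> carrier G" and Mc: "M \<subseteq> carrier G" using P(1) M(1) subgroup.subset by auto
  have bn: "block_nilpotent \<pi> (carrier G) P"
    by (rule block_nilpotent_block[of \<pi>]) (use P Pc subgroup_self in \<open>auto simp: blocks_def\<close>)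
  have nMP: "normalizes M P" by (rule normalizes_mono[OF P(2) Mc])
  have IP: "injector P (I \<inter> P)" by (rule injector_subnormal[OF top I subnormal_in_normal[OF top P(1) Pc P(2)]])
  obtain J0 where J0: "injector M J0" using injectors_exist_and_conj[OF M(1)] by blast
  have "injector P (J0 \<inter> P)" by (rule injector_subnormal[OF M(1) J0 subnormal_in_normal[OF M(1) P(1) M(2) nMP]])
  then obtain g where g: "g \<in> P" "conj_subset G (J0 \<inter> P) g = I \<inter> P"
    using injectors_exist_and_conj[OF P(1)] P(1) normalizes_self[OF P(1)] block_nilpotent_self[OF P(1)] IP by blast
  have gc: "g \<in> carrier G" using g(1) Pc by blast
  define J where "J = conj_subset G J0 g"
  have J: "injector M J" unfolding J_def
    by (rule injector_conj_normal[OF M(1) J0 M(1) normalizes_self[OF M(1)]]) (use g(1) M(2) in blast)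
  have J0s: "subgroup J0 G" using J0 injector_iff[OF M(1)] by blast
  have JP: "J \<inter> P = I \<inter> P"
    using conj_subset_Int[OF subgroup.subset[OF J0s] Pc gc] g(2) conj_subset_self[OF P(1) g(1)] by (simp add: J_def)
  have Jm: "Fmax M J" by (rule injector_Fmax[OF M(1) J])
  note Js = FmaxD[OF Jm]
  obtain V where V: "Fmax (carrier G) V" "J \<subseteq> V" using Fmax_exists[OF top Js(1) _ Js(3)] Js(2) Mc by blast
  note Vs = FmaxD[OF V(1)]
  let ?W = "I \<inter> P"
  have Wm: "Fmax P ?W" by (rule injector_Fmax[OF P(1) IP])
  note Ws = FmaxD[OF Wm]
  have WV: "?W \<subseteq> V" using JP V(2) by blast
  obtain y where y: "y \<in> P" "conj_subset G V y = I"
    using Fmax_over_conj[OF top P(1) Pc P(2) bn Wm V(1) WV injector_Fmax[OF top I]] by blast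
  have yc: "y \<in> carrier G" "y \<in> M" using y(1) Pc M(2) by auto
  have VP: "V \<inter> P = ?W"
  proof (rule Ws(4))
    show s: "subgroup (V \<inter> P) G" by (rule subgroup_Int[OF Vs(1) P(1)])
    show "inF (V \<inter> P)"
      by (rule inF_normal[OF Vs(1) s _ _ Vs(3)])
        (use normalizes_Int[OF normalizes_self[OF Vs(1)] normalizes_mono[OF P(2) Vs(2)]] in auto)
  qed (use WV in auto)
  have nVW: "normalizes V ?W"
    using normalizes_Int[OF normalizes_self[OF Vs(1)] normalizes_mono[OF P(2) Vs(2)]] VP by simp
  have "index_in \<pi> V (V \<inter> P)"
    by (rule index_in_Int[OF top P(1) Vs(1) Pc Vs(2) normalizes_mono[OF P(2) Vs(2)] P(3)])
  then have ind: "index_in \<pi> V ?W" using VP by simp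
  \<comment> \<open>\<open>V \<inter> M\<close> need not be subnormal in \<open>V\<close>; it
    belongs to \<open>F\<close> because it lies above \<open>?W\<close> and \<open>V\<close> is a
    \<pi>-section over \<open>?W\<close>.\<close>
  have VM: "V \<inter> M = J"
  proof (rule Js(4))
    show s: "subgroup (V \<inter> M) G" by (rule subgroup_Int[OF Vs(1) M(1)])
    show "inF (V \<inter> M)"
      by (rule inF_block_subgroup[OF _ Vs(1,3) Ws(1) nVW ind s]) (use WV M(2) in \<open>auto simp: blocks_def\<close>)
  qed (use V(2) Js(2) in auto)
  have "I \<inter> M = conj_subset G (V \<inter> M) y"
    using conj_subset_Int[OF subgroup.subset[OF Vs(1)] Mc yc(1)] y(2) conj_subset_self[OF M(1) yc(2)] by simp
  then have "I \<inter> M = conj_subset G J y" using VM by simp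
  then show ?thesis using injector_conj_normal[OF M(1) J M(1) normalizes_self[OF M(1)] yc(2)] by simp
qed

end

context group
begin

section \<open>The residual and Dnormal subgroups\<close>

lemma lower_central_subgroup: "subgroup (lower_central G n) G"
proof (induction n)
  case 0
  then show ?case by (simp add: subgroup_self)
next
  case (Suc n)
  have "{x \<otimes> y \<otimes> inv x \<otimes> inv y | x y. x \<in> lower_central G n \<and> y \<in> carrier G} \<subseteq> carrier G"
    using subgroup.mem_carrier[OF Suc.IH] by auto
  then show ?case by (simp add: generate_is_subgroup)
qed

lemma lower_central_commutator:
  "x \<in> lower_central G n \<Longrightarrow> y \<in> carrier G \<Longrightarrow> x \<otimes> y \<otimes> inv x \<otimes> inv y \<in> lower_central G (Suc n)"
  by (auto intro!: generate.incl)

lemma lower_central_Suc_le: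
  assumes "subgroup A G" "\<And>x y. x \<in> lower_central G n \<Longrightarrow> y \<in> carrier G \<Longrightarrow> x \<otimes> y \<otimes> inv x \<otimes> inv y \<in> A"
  shows "lower_central G (Suc n) \<subseteq> A"
proof -
  have "{x \<otimes> y \<otimes> inv x \<otimes> inv y | x y. x \<in> lower_central G n \<and> y \<in> carrier G} \<subseteq> A" using assms(2) by blast
  then show ?thesis using generate_subgroup_incl[OF _ assms(1)] by simp
qed

text \<open>Once inside a normal subgroup the series stays there, so bounds reached at different
  lengths can be compared.\<close>

lemma lower_central_le_normal:
  assumes A: "subgroup A G" "normalizes (carrier G) A" and n: "lower_central G n \<subseteq> A"
  shows "lower_central G (n + m) \<subseteq> A"
proof (induction m)
  case 0
  then show ?case using n by simp
next
  case (Suc m)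
  have "x \<otimes> y \<otimes> inv x \<otimes> inv y \<in> A" if x: "x \<in> lower_central G (n + m)" and y: "y \<in> carrier G" for x y
  proof -
    have xA: "x \<in> A" using Suc.IH x by blast
    have xc: "x \<in> carrier G" using subgroup.mem_carrier[OF A(1) xA] .
    have "y \<otimes> inv x \<otimes> inv y \<in> A"
      by (rule normalizesD'[OF A(2) subgroup_self y]) (rule subgroup.m_inv_closed[OF A(1) xA])
    then have "x \<otimes> (y \<otimes> inv x \<otimes> inv y) \<in> A" by (rule subgroup.m_closed[OF A(1) xA])
    then show ?thesis using xc y by (simp add: m_assoc)
  qed
  from lower_central_Suc_le[OF A(1) this] show ?case by simp
qed

lemma lower_central_restrict_le:
  assumes K: "subgroup K G"
  shows "lower_central (G\<lparr>carrier := K\<rparr>) n \<subseteq> lower_central G n"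
proof (induction n)
  case 0
  then show ?case using subgroup.subset[OF K] by simp
next
  case (Suc n)
  interpret K: group "G\<lparr>carrier := K\<rparr>" using K by (rule subgroup_imp_group)
  have Kn: "lower_central (G\<lparr>carrier := K\<rparr>) n \<subseteq> K" using subgroup.subset[OF K.lower_central_subgroup] by simp
  have sub: "subgroup (lower_central G (Suc n) \<inter> K) (G\<lparr>carrier := K\<rparr>)"
    by (rule subgroup_incl[OF subgroups_Inter_pair[OF lower_central_subgroup K] K]) blast
  have "lower_central (G\<lparr>carrier := K\<rparr>) (Suc n) \<subseteq> lower_central G (Suc n) \<inter> K"
  proof (rule K.lower_central_Suc_le[OF sub])
    fix x y assume x: "x \<in> lower_central (G\<lparr>carrier := K\<rparr>) n" and "y \<in> carrier (G\<lparr>carrier := K\<rparr>)"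
    then have xy: "x \<in> K" "y \<in> K" using Kn by auto
    have "x \<otimes> y \<otimes> inv x \<otimes> inv y \<in> lower_central G (Suc n)"
      using lower_central_commutator[of x n y] x Suc.IH xy(2) subgroup.mem_carrier[OF K] by blast
    moreover have "x \<otimes> y \<otimes> inv x \<otimes> inv y \<in> K"
      using xy K by (simp add: subgroup.m_closed subgroup.m_inv_closed)
    ultimately show "x \<otimes>\<^bsub>G\<lparr>carrier := K\<rparr>\<^esub> y \<otimes>\<^bsub>G\<lparr>carrier := K\<rparr>\<^esub> inv\<^bsub>G\<lparr>carrier := K\<rparr>\<^esub> x \<otimes>\<^bsub>G\<lparr>carrier := K\<rparr>\<^esub>
        inv\<^bsub>G\<lparr>carrier := K\<rparr>\<^esub> y \<in> lower_central G (Suc n) \<inter> K"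
      using xy by (simp add: m_inv_consistent[OF K] del: lower_central.simps)
  qed
  then show ?case by blast
qed

lemma commuting_factors_normal:
  assumes H: "subgroup H G" and K: "subgroup K G" and comm: "\<And>h k. h \<in> H \<Longrightarrow> k \<in> K \<Longrightarrow> k \<otimes> h = h \<otimes> k"
    and gen: "H <#> K = carrier G"
  shows "H \<lhd> G" "K \<lhd> G"
proof -
  note c = subgroup.subset[OF H] subgroup.subset[OF K]
  have "normalizes K H" by (rule normalizesI_commuting[OF _ c(2,1)]) (rule comm)
  moreover have "normalizes H K" by (rule normalizesI_commuting[OF _ c]) (rule comm[symmetric])
  ultimately have "normalizes (H <#> K) H" "normalizes (H <#> K) K"
    using normalizes_by_set_mult[OF normalizes_self[OF H] _ c c(1)] normalizes_by_set_mult[OF _ normalizes_self[OF K] c c(2)]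
    by auto
  then show "H \<lhd> G" "K \<lhd> G" using normal_iff_normalizes H K gen by auto
qed

text \<open>With commuting factors a commutator is the product of the commutators of the two
  components, and only the one in \<open>K\<close> has to be tracked.\<close>

lemma lower_central_commuting_product:
  assumes H: "subgroup H G" and K: "subgroup K G" and comm: "\<And>h k. h \<in> H \<Longrightarrow> k \<in> K \<Longrightarrow> k \<otimes> h = h \<otimes> k"
    and gen: "H <#> K = carrier G"
  shows "lower_central G n \<subseteq> H <#> lower_central (G\<lparr>carrier := K\<rparr>) n"
proof (induction n)
  case 0
  show ?case using gen by simp
next
  case (Suc n)
  let ?L = "lower_central (G\<lparr>carrier := K\<rparr>)"
  interpret K: group "G\<lparr>carrier := K\<rparr>" using K by (rule subgroup_imp_group)
  have L: "subgroup (?L m) G" "?L m \<subseteq> K" for m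
    using incl_subgroup[OF K K.lower_central_subgroup] subgroup.subset[OF K.lower_central_subgroup[of m]] by auto
  have Hc: "h \<in> carrier G" if "h \<in> H" for h using subgroup.mem_carrier[OF H that] .
  have Kc: "k \<in> carrier G" if "k \<in> K" for k using subgroup.mem_carrier[OF K that] .
  have "normalizes H (?L (Suc n))"
    by (rule normalizesI_commuting) (use comm L(2)[of "Suc n"] Hc Kc in \<open>auto simp del: lower_central.simps\<close>)
  then have sub: "subgroup (H <#> ?L (Suc n)) G" using set_mult_subgroup[OF H L(1)] by blast
  show ?case
  proof (rule lower_central_Suc_le[OF sub])
    fix x y assume x: "x \<in> lower_central G n" and y: "y \<in> carrier G"
    obtain a u where a: "a \<in> H" "u \<in> ?L n" "x = a \<otimes> u" using x Suc.IH unfolding set_mult_def by blast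
    obtain b v where b: "b \<in> H" "v \<in> K" "y = b \<otimes> v" using y unfolding gen[symmetric] set_mult_def by blast
    have uK: "u \<in> K" using a(2) L(2) by blast
    note cc = Hc[OF a(1)] Hc[OF b(1)] Kc[OF uK] Kc[OF b(2)]
    have i: "inv a \<in> H" "inv b \<in> H" "inv u \<in> K" "inv v \<in> K"
      using a b uK H K by (simp_all add: subgroup.m_inv_closed)
    have "a \<otimes> u \<otimes> (b \<otimes> v) = a \<otimes> (u \<otimes> b) \<otimes> v" using cc by (simp add: m_assoc)
    then have 1: "x \<otimes> y = (a \<otimes> b) \<otimes> (u \<otimes> v)" unfolding a(3) b(3) comm[OF b(1) uK] using cc by (simp add: m_assoc)
    have "inv x \<otimes> inv y = inv a \<otimes> (inv u \<otimes> inv b) \<otimes> inv v"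
      unfolding a(3) b(3) using cc comm[OF i(1,3)] comm[OF i(2,4)] by (simp add: inv_mult_group m_assoc)
    then have 2: "inv x \<otimes> inv y = (inv a \<otimes> inv b) \<otimes> (inv u \<otimes> inv v)"
      unfolding comm[OF i(2,3)] using cc by (simp add: m_assoc)
    have 3: "(u \<otimes> v) \<otimes> (inv a \<otimes> inv b) = (inv a \<otimes> inv b) \<otimes> (u \<otimes> v)"
      by (rule comm) (use i uK b(2) H K in \<open>simp_all add: subgroup.m_closed\<close>)
    have "x \<otimes> y \<otimes> inv x \<otimes> inv y = (x \<otimes> y) \<otimes> (inv x \<otimes> inv y)" using a(3) y cc by (simp add: m_assoc)
    also have "\<dots> = (a \<otimes> b) \<otimes> ((u \<otimes> v) \<otimes> (inv a \<otimes> inv b)) \<otimes> (inv u \<otimes> inv v)"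
      unfolding 1 2 using cc by (simp add: m_assoc)
    also have "\<dots> = (a \<otimes> b \<otimes> inv a \<otimes> inv b) \<otimes> (u \<otimes> v \<otimes> inv u \<otimes> inv v)"
      unfolding 3 using cc by (simp add: m_assoc)
    finally have "x \<otimes> y \<otimes> inv x \<otimes> inv y = (a \<otimes> b \<otimes> inv a \<otimes> inv b) \<otimes> (u \<otimes> v \<otimes> inv u \<otimes> inv v)" .
    moreover have "a \<otimes> b \<otimes> inv a \<otimes> inv b \<in> H" using a b i H by (simp add: subgroup.m_closed)
    moreover have "u \<otimes> v \<otimes> inv u \<otimes> inv v \<in> ?L (Suc n)"
      using K.lower_central_commutator[OF a(2), of v] b(2) uK by (simp add: m_inv_consistent[OF K] del: lower_central.simps)
    ultimately show "x \<otimes> y \<otimes> inv x \<otimes> inv y \<in> H <#> ?L (Suc n)" unfolding set_mult_def by blast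
  qed
qed

end

lemma (in group_hom) lower_central_image:
  assumes surj: "h ` carrier G = carrier H"
  shows "lower_central H n = h ` lower_central G n"
proof (induction n)
  case 0
  then show ?case using surj by simp
next
  case (Suc n)
  let ?CG = "{x \<otimes> y \<otimes> inv x \<otimes> inv y | x y. x \<in> lower_central G n \<and> y \<in> carrier G}"
  let ?CH = "{x \<otimes>\<^bsub>H\<^esub> y \<otimes>\<^bsub>H\<^esub> inv\<^bsub>H\<^esub> x \<otimes>\<^bsub>H\<^esub> inv\<^bsub>H\<^esub> y | x y. x \<in> lower_central H n \<and> y \<in> carrier H}"
  have c: "x \<in> carrier G" if "x \<in> lower_central G n" for x
    using that subgroup.mem_carrier[OF G.lower_central_subgroup] by blast
  have hc: "h (x \<otimes> y \<otimes> inv x \<otimes> inv y) = h x \<otimes>\<^bsub>H\<^esub> h y \<otimes>\<^bsub>H\<^esub> inv\<^bsub>H\<^esub> h x \<otimes>\<^bsub>H\<^esub> inv\<^bsub>H\<^esub> h y"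
    if "x \<in> carrier G" "y \<in> carrier G" for x y
    using that by simp
  have "?CH = h ` ?CG"
  proof
    show "?CH \<subseteq> h ` ?CG"
    proof
      fix z assume "z \<in> ?CH"
      then obtain x y where z: "x \<in> lower_central H n" "y \<in> carrier H" "z = x \<otimes>\<^bsub>H\<^esub> y \<otimes>\<^bsub>H\<^esub> inv\<^bsub>H\<^esub> x \<otimes>\<^bsub>H\<^esub> inv\<^bsub>H\<^esub> y"
        by blast
      obtain a b where ab: "a \<in> lower_central G n" "b \<in> carrier G" "x = h a" "y = h b"
        using z(1,2) unfolding Suc.IH surj[symmetric] by blast
      have "z = h (a \<otimes> b \<otimes> inv a \<otimes> inv b)" unfolding z(3) ab(3,4) using hc[OF c[OF ab(1)] ab(2)] by simp
      then show "z \<in> h ` ?CG" using ab(1,2) by blast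
    qed
    show "h ` ?CG \<subseteq> ?CH"
    proof
      fix z assume "z \<in> h ` ?CG"
      then obtain a b where ab: "a \<in> lower_central G n" "b \<in> carrier G" "z = h (a \<otimes> b \<otimes> inv a \<otimes> inv b)" by blast
      have "h a \<in> lower_central H n" "h b \<in> carrier H" using ab Suc.IH by auto
      then show "z \<in> ?CH" unfolding ab(3) hc[OF c[OF ab(1)] ab(2)] by blast
    qed
  qed
  moreover have "?CG \<subseteq> carrier G" using c by auto
  ultimately show ?case using generate_img[of ?CG] by simp
qed

text \<open>
  A description of \<open>G/N \<in> N\<^sup>\<pi>\<close> inside \<open>G\<close>: nilpotency of the \<open>\<pi>'\<close>-factor means that some term of
  the lower central series of \<open>G/N\<close> is a \<open>\<pi>\<close>-group.
\<close>

definition (in group) npi_kernel :: "nat set \<Rightarrow> 'a set \<Rightarrow> bool" where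
  "npi_kernel \<pi> N \<longleftrightarrow> subgroup N G \<and> normalizes (carrier G) N \<and> splits \<pi> (carrier G) N \<and>
     (\<exists>A n. subgroup A G \<and> N \<subseteq> A \<and> normalizes (carrier G) A \<and> index_in \<pi> A N \<and> lower_central G n \<subseteq> A)"

section \<open>Factor groups in the class and the residual\<close>

context fin_group
begin

lemma index_in_group_order:
  assumes "card A = m * card B" "m > 0" "card B > 0" "\<And>p. prime p \<Longrightarrow> p dvd m \<Longrightarrow> p \<in> \<rho>"
  shows "index_in \<rho> A B"
  unfolding index_in_def
proof (intro allI impI)
  fix p assume p: "prime p \<and> p \<notin> \<rho>"
  then have "multiplicity p m = 0" using assms(4) not_dvd_imp_multiplicity_0 by blast
  then show "multiplicity p (card A) = multiplicity p (card B)"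
    using assms(1-3) p by (simp add: prime_elem_multiplicity_mult_distrib)
qed

lemma internal_product_iso:
  assumes H: "subgroup H G" and K: "subgroup K G" and comm: "\<And>h k. h \<in> H \<Longrightarrow> k \<in> K \<Longrightarrow> k \<otimes> h = h \<otimes> k"
    and Int: "H \<inter> K = {\<one>}" and gen: "H <#> K = carrier G"
  shows "(\<lambda>(h, k). h \<otimes> k) \<in> iso (G\<lparr>carrier := H\<rparr> \<times>\<times> G\<lparr>carrier := K\<rparr>) G"
proof (rule isoI)
  have Hc: "h \<in> carrier G" if "h \<in> H" for h using subgroup.mem_carrier[OF H that] .
  have Kc: "k \<in> carrier G" if "k \<in> K" for k using subgroup.mem_carrier[OF K that] .
  show "(\<lambda>(h, k). h \<otimes> k) \<in> hom (G\<lparr>carrier := H\<rparr> \<times>\<times> G\<lparr>carrier := K\<rparr>) G"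
  proof (rule homI)
    fix x y assume "x \<in> carrier (G\<lparr>carrier := H\<rparr> \<times>\<times> G\<lparr>carrier := K\<rparr>)" "y \<in> carrier (G\<lparr>carrier := H\<rparr> \<times>\<times> G\<lparr>carrier := K\<rparr>)"
    then obtain h k h' k' where xy: "x = (h, k)" "y = (h', k')" "h \<in> H" "h' \<in> H" "k \<in> K" "k' \<in> K"
      by (cases x; cases y) auto
    note c = Hc[OF xy(3)] Hc[OF xy(4)] Kc[OF xy(5)] Kc[OF xy(6)]
    have "h \<otimes> h' \<otimes> (k \<otimes> k') = h \<otimes> (h' \<otimes> k) \<otimes> k'" using c by (simp add: m_assoc)
    also have "\<dots> = h \<otimes> k \<otimes> (h' \<otimes> k')" unfolding comm[OF xy(4,5), symmetric] using c by (simp add: m_assoc)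
    finally show "(case x \<otimes>\<^bsub>G\<lparr>carrier := H\<rparr> \<times>\<times> G\<lparr>carrier := K\<rparr>\<^esub> y of (h, k) \<Rightarrow> h \<otimes> k)
        = (case x of (h, k) \<Rightarrow> h \<otimes> k) \<otimes> (case y of (h, k) \<Rightarrow> h \<otimes> k)"
      unfolding xy(1,2) by (simp add: mult_DirProd)
  qed (auto simp: Hc Kc)
  have surj: "(\<lambda>(h, k). h \<otimes> k) ` (H \<times> K) = carrier G"
    unfolding gen[symmetric] by (auto simp: set_mult_def)
  moreover have "card (carrier G) = card (H \<times> K)"
    using card_set_mult[OF H K] unfolding gen Int by (simp add: card_cartesian_product)
  ultimately have "inj_on (\<lambda>(h, k). h \<otimes> k) (H \<times> K)"
    by (intro eq_card_imp_inj_on) (simp_all add: subgroup_finite[OF H] subgroup_finite[OF K])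
  then show "bij_betw (\<lambda>(h, k). h \<otimes> k) (carrier (G\<lparr>carrier := H\<rparr> \<times>\<times> G\<lparr>carrier := K\<rparr>)) (carrier G)"
    using surj by (simp add: bij_betw_def)
qed

text \<open>Elements of the quotient are cosets, so \<open>\<Union> H\<close> and
  \<open>\<Union> K\<close> are the preimages of the two factors. They are normal because the
  factors commute.\<close>

lemma npi_kernel_if_npi_group:
  assumes N: "N \<lhd> G" and Z: "npi_group \<pi> (G Mod N)"
  shows "npi_kernel \<pi> N"
proof -
  let ?Z = "G Mod N"
  interpret N: normal N G by (rule N)
  have Zg: "group ?Z" by (rule N.factorgroup_is_group)
  interpret Z: fin_group ?Z
    by (intro fin_group.intro Zg fin_group_axioms.intro) (simp add: carrier_FactGroup fin)
  interpret q: group_hom G ?Z "\<lambda>x. N #> x"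
    by (intro group_hom.intro is_group Zg group_hom_axioms.intro N.r_coset_hom_Mod)
  obtain H K where H: "subgroup H ?Z" and K: "subgroup K ?Z"
    and iso: "(\<lambda>(h, k). h \<otimes>\<^bsub>?Z\<^esub> k) \<in> iso (?Z\<lparr>carrier := H\<rparr> \<times>\<times> ?Z\<lparr>carrier := K\<rparr>) ?Z"
    and Hpi: "pi_group \<pi> (?Z\<lparr>carrier := H\<rparr>)" and Kpi: "pi_group (primes_compl \<pi>) (?Z\<lparr>carrier := K\<rparr>)"
    and nil: "nilpotent_group (?Z\<lparr>carrier := K\<rparr>)"
    using Z unfolding npi_group_def by blast
  have Hc: "h \<in> carrier ?Z" if "h \<in> H" for h using subgroup.mem_carrier[OF H that] .
  have Kc: "k \<in> carrier ?Z" if "k \<in> K" for k using subgroup.mem_carrier[OF K that] .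
  have comm: "k \<otimes>\<^bsub>?Z\<^esub> h = h \<otimes>\<^bsub>?Z\<^esub> k" if hk: "h \<in> H" "k \<in> K" for h k
  proof -
    have m: "(\<one>\<^bsub>?Z\<^esub>, k) \<in> carrier (?Z\<lparr>carrier := H\<rparr> \<times>\<times> ?Z\<lparr>carrier := K\<rparr>)"
      "(h, \<one>\<^bsub>?Z\<^esub>) \<in> carrier (?Z\<lparr>carrier := H\<rparr> \<times>\<times> ?Z\<lparr>carrier := K\<rparr>)"
      using hk subgroup.one_closed[OF H] subgroup.one_closed[OF K] by auto
    have "h \<otimes>\<^bsub>?Z\<^esub> k = k \<otimes>\<^bsub>?Z\<^esub> h"
      using hom_mult[OF iso_imp_homomorphism[OF iso] m] Hc[OF hk(1)] Kc[OF hk(2)]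
      by (simp add: mult_DirProd del: mult_FactGroup one_FactGroup)
    then show ?thesis by simp
  qed
  have bij: "bij_betw (\<lambda>(h, k). h \<otimes>\<^bsub>?Z\<^esub> k) (H \<times> K) (carrier ?Z)"
    using iso by (simp add: iso_def)
  have "H <#>\<^bsub>?Z\<^esub> K = (\<lambda>(h, k). h \<otimes>\<^bsub>?Z\<^esub> k) ` (H \<times> K)"
    unfolding set_mult_def by force
  then have gen: "H <#>\<^bsub>?Z\<^esub> K = carrier ?Z" using bij by (simp only: bij_betw_def)
  have cardZ: "card (carrier ?Z) = card H * card K"
    using bij_betw_same_card[OF bij] by (simp add: card_cartesian_product)
  note normal = Z.commuting_factors_normal[OF H K comm gen]
  have lift: "subgroup (\<Union> T) G \<and> N \<subseteq> \<Union> T \<and> normalizes (carrier G) (\<Union> T) \<and> card (\<Union> T) = card T * card N"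
    if T: "T \<lhd> ?Z" for T
  proof -
    have Ts: "subgroup T ?Z" using T by (rule normal_imp_subgroup)
    have U: "subgroup (\<Union> T) G" "normalizes (carrier G) (\<Union> T)"
      using N.factgroup_subgroup_union_normal[OF T] normal_iff_normalizes by auto
    have NT: "N \<subseteq> \<Union> T" using subgroup.one_closed[OF Ts] by auto
    have "T = (\<lambda>x. N #> x) ` (\<Union> T)"
      using N.factgroup_subgroup_union_factor[OF Ts] rcosets_restrict[of "\<Union> T" N] by simp
    then have "card T * card N = card (\<Union> T)"
      using card_rcosets_restrict[OF N.is_subgroup U(1) NT] by simp
    then show ?thesis using U NT by simp
  qed
  note A = lift[OF normal(1)] and B = lift[OF normal(2)]
  have cardG: "card (carrier G) = card H * card K * card N"
    using Factor_order[OF subgroup_self N.is_subgroup N.subset] cardZ by (simp add: order_def)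
  have pos: "card H > 0" "card K > 0" "card N > 0"
    using Z.subgroup_card_pos[OF H] Z.subgroup_card_pos[OF K] subgroup_card_pos[OF N.is_subgroup] by auto
  have Hp: "p \<in> \<pi>" if "prime p" "p dvd card H" for p using Hpi that by (auto simp: pi_group_def order_def)
  have Kp: "p \<in> - \<pi>" if "prime p" "p dvd card K" for p
    using Kpi that by (auto simp: pi_group_def order_def primes_compl_def)
  have iA: "index_in \<pi> (\<Union> H) N" by (rule index_in_group_order[OF _ pos(1,3) Hp]) (use A in simp)
  have iB: "index_in (- \<pi>) (\<Union> K) N" by (rule index_in_group_order[OF _ pos(2,3) Kp]) (use B in simp)
  have iA': "index_in (- \<pi>) (carrier G) (\<Union> H)"
    by (rule index_in_group_order[OF _ pos(2) _ Kp]) (use A cardG pos in simp_all)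
  have iB': "index_in \<pi> (carrier G) (\<Union> K)"
    by (rule index_in_group_order[OF _ pos(1) _ Hp]) (use B cardG pos in simp_all)
  have spl: "splits \<pi> (carrier G) N"
    unfolding splits_def using A B iA iB iA' iB' subgroup.subset[of "\<Union> H" G] subgroup.subset[of "\<Union> K" G] by blast
  \<comment> \<open>Up to the factor \<open>H\<close>, the lower central series of the quotient is
    that of \<open>K\<close>, which ends; pulled back, it falls into
    \<open>\<Union> H\<close>.\<close>
  obtain n where "lower_central (?Z\<lparr>carrier := K\<rparr>) n = {\<one>\<^bsub>?Z\<^esub>}" using nil by (auto simp: nilpotent_group_def)
  then have "lower_central ?Z n \<subseteq> H"
    using Z.lower_central_commuting_product[OF H K comm gen, of n] Hc
    by (auto simp: set_mult_def simp del: mult_FactGroup one_FactGroup)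
  moreover have "lower_central ?Z n = (\<lambda>x. N #> x) ` lower_central G n"
    by (rule q.lower_central_image) (simp add: carrier_FactGroup)
  ultimately have img: "(\<lambda>x. N #> x) ` lower_central G n \<subseteq> H" by simp
  have "lower_central G n \<subseteq> \<Union> H"
  proof
    fix x assume x: "x \<in> lower_central G n"
    have xc: "x \<in> carrier G" using x subgroup.mem_carrier[OF lower_central_subgroup] by blast
    show "x \<in> \<Union> H" using img x rcos_self[OF xc N.is_subgroup] by blast
  qed
  then show ?thesis
    unfolding npi_kernel_def using N.is_subgroup N normal_iff_normalizes spl A iA by blast
qed


text \<open>The images of \<open>A\<close> and \<open>B\<close> are the two factors; they commute
  because commutators lie in \<open>A \<inter> B = N\<close>. The full \<pi>-part \<open>A\<close>
  contains the \<pi>-section \<open>A0\<close>, so the bound on the lower central series makes the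
  image of \<open>B\<close> nilpotent.\<close>

lemma npi_group_if_npi_kernel:
  assumes k: "npi_kernel \<pi> N"
  shows "npi_group \<pi> (G Mod N)"
proof -
  let ?Z = "G Mod N"
  have N: "subgroup N G" "normalizes (carrier G) N" "splits \<pi> (carrier G) N" using k by (auto simp: npi_kernel_def)
  obtain A B where A: "subgroup A G" "N \<subseteq> A" "A \<subseteq> carrier G" "normalizes (carrier G) A" "index_in \<pi> A N" "index_in (- \<pi>) (carrier G) A"
    and B: "subgroup B G" "N \<subseteq> B" "B \<subseteq> carrier G" "normalizes (carrier G) B" "index_in (- \<pi>) B N" "index_in \<pi> (carrier G) B"
    using N(3) by (rule splitsE)
  obtain A0 n where A0: "subgroup A0 G" "N \<subseteq> A0" "normalizes (carrier G) A0" "index_in \<pi> A0 N" "lower_central G n \<subseteq> A0"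
    using k unfolding npi_kernel_def by blast
  have "N \<lhd> G" using N normal_iff_normalizes by blast
  then interpret N: normal N G .
  have Zg: "group ?Z" by (rule N.factorgroup_is_group)
  interpret Z: fin_group ?Z
    by (intro fin_group.intro Zg fin_group_axioms.intro) (simp add: carrier_FactGroup fin)
  interpret q: group_hom G ?Z "\<lambda>x. N #> x"
    by (intro group_hom.intro is_group Zg group_hom_axioms.intro N.r_coset_hom_Mod)
  let ?q = "\<lambda>x. N #> x"
  have AB: "A \<inter> B = N"
  proof (rule index_in_disjoint_eq[OF _ N(1), of _ \<pi> "- \<pi>"])
    show s: "subgroup (A \<inter> B) G" using subgroup_Int A(1) B(1) by blast
    show "index_in \<pi> (A \<inter> B) N" "index_in (- \<pi>) (A \<inter> B) N"
      using index_in_sandwich(2)[OF A(1) s N(1) _ _ A(5)] index_in_sandwich(2)[OF B(1) s N(1) _ _ B(5)] A(2) B(2) by auto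
  qed (use A B in auto)
  have ABG: "A <#> B = carrier G"
  proof -
    have s: "subgroup (A <#> B) G" by (rule set_mult_subgroup[OF A(1) B(1) normalizes_mono[OF B(4) A(3)]])
    note i = set_mult_incl[OF A(1) B(1)]
    have le: "A <#> B \<subseteq> carrier G" by (rule subgroup.subset[OF s])
    have "index_in (- \<pi>) (carrier G) (A <#> B)" "index_in \<pi> (carrier G) (A <#> B)"
      using index_in_sandwich(1)[OF subgroup_self s A(1) i(1) le A(6)]
        index_in_sandwich(1)[OF subgroup_self s B(1) i(2) le B(6)] by auto
    then show ?thesis using index_in_disjoint_eq[OF subgroup_self s le] by (metis Compl_disjoint2)
  qed
  have A0A: "A0 \<subseteq> A"
  proof -
    have A0c: "A0 \<subseteq> carrier G" by (rule subgroup.subset[OF A0(1)])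
    have s: "subgroup (A0 <#> A) G" by (rule set_mult_subgroup[OF A0(1) A(1) normalizes_mono[OF A(4) A0c]])
    note i = set_mult_incl[OF A0(1) A(1)]
    have "index_in \<pi> A0 (A0 \<inter> A)"
      by (rule index_in_sandwich(1)[OF A0(1) subgroup_Int[OF A0(1) A(1)] N(1) _ _ A0(4)]) (use A A0 in auto)
    then have 1: "index_in \<pi> (A0 <#> A) A" using index_in_set_mult_iff[OF A0(1) A(1)] by blast
    have 2: "index_in (- \<pi>) (A0 <#> A) A"
      by (rule index_in_sandwich(2)[OF subgroup_self s A(1) i(2) subgroup.subset[OF s] A(6)])
    have "A0 <#> A = A" using index_in_disjoint_eq[OF s A(1) i(2) 1 2] by blast
    then show ?thesis using i(1) by simp
  qed
  have img: "subgroup (?q ` T) ?Z" "card (?q ` T) * card N = card T" if "subgroup T G" "N \<subseteq> T" for T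
    using q.subgroup_img_is_subgroup[OF that(1)] card_rcosets_restrict[OF N(1) that(1,2)] by auto
  have mem: "x \<in> T" if T: "subgroup T G" "N \<subseteq> T" and x: "x \<in> carrier G" "?q x \<in> ?q ` T" for x T
  proof -
    obtain t where t: "t \<in> T" "?q x = ?q t" using x(2) by blast
    have tc: "t \<in> carrier G" using subgroup.mem_carrier[OF T(1) t(1)] .
    have "x \<otimes> inv t \<in> N" using rcos_eq_iff[OF N(1) x(1) tc] t(2) by blast
    then have "x \<otimes> inv t \<otimes> t \<in> T" using T(2) t(1) subgroup.m_closed[OF T(1)] by blast
    then show ?thesis using x(1) tc by (simp add: m_assoc)
  qed
  let ?H = "?q ` A" and ?K = "?q ` B"
  have HK: "?H \<inter> ?K = {N}"
  proof
    show "?H \<inter> ?K \<subseteq> {N}"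
    proof
      fix z assume "z \<in> ?H \<inter> ?K"
      then obtain a where a: "a \<in> A" "z = ?q a" "?q a \<in> ?K" by blast
      have "a \<in> B" by (rule mem[OF B(1,2) _ a(3)]) (use a(1) A(3) in blast)
      then have "a \<in> N" using a(1) AB by blast
      then show "z \<in> {N}" using a(2) N.rcos_const[OF is_group] by simp
    qed
    show "{N} \<subseteq> ?H \<inter> ?K"
      using subgroup.one_closed[OF img(1)[OF A(1,2)]] subgroup.one_closed[OF img(1)[OF B(1,2)]] by simp
  qed
  have comm: "?q (a \<otimes> b) = ?q (b \<otimes> a)" if ab: "a \<in> A" "b \<in> B" for a b
  proof -
    have c: "a \<in> carrier G" "b \<in> carrier G" using ab A(3) B(3) by auto
    have "b \<otimes> inv a \<otimes> inv b \<in> A" by (rule normalizesD'[OF A(4) subgroup_self c(2)]) (rule subgroup.m_inv_closed[OF A(1) ab(1)])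
    then have "a \<otimes> (b \<otimes> inv a \<otimes> inv b) \<in> A" by (rule subgroup.m_closed[OF A(1) ab(1)])
    moreover have "a \<otimes> b \<otimes> inv a \<in> B" by (rule normalizesD'[OF B(4) subgroup_self c(1) ab(2)])
    then have "a \<otimes> b \<otimes> inv a \<otimes> inv b \<in> B" using subgroup.m_closed[OF B(1)] subgroup.m_inv_closed[OF B(1) ab(2)] by blast
    ultimately have "(a \<otimes> b) \<otimes> inv (b \<otimes> a) \<in> A \<inter> B" using c by (simp add: m_assoc inv_mult_group)
    then show ?thesis using AB rcos_eq_iff[OF N(1), of "a \<otimes> b" "b \<otimes> a"] c by simp
  qed
  have commZ: "k \<otimes>\<^bsub>?Z\<^esub> h = h \<otimes>\<^bsub>?Z\<^esub> k" if hk: "h \<in> ?H" "k \<in> ?K" for h k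
  proof -
    obtain a b where ab: "a \<in> A" "b \<in> B" "h = ?q a" "k = ?q b" using hk by blast
    have c: "a \<in> carrier G" "b \<in> carrier G" using ab A(3) B(3) by auto
    show ?thesis unfolding ab(3,4) using comm[OF ab(1,2)] N.rcos_sum[OF c] N.rcos_sum[OF c(2,1)] by simp
  qed
  have gen: "?H <#>\<^bsub>?Z\<^esub> ?K = carrier ?Z"
  proof -
    have "?q a <#> ?q b = ?q (a \<otimes> b)" if "a \<in> A" "b \<in> B" for a b
      by (rule N.rcos_sum) (use that A(3) B(3) in auto)
    then have "?H <#>\<^bsub>?Z\<^esub> ?K = ?q ` (A <#> B)" by (auto simp: set_mult_def[of ?Z] set_mult_def[of G A B])
    then show ?thesis unfolding ABG by (simp add: carrier_FactGroup)
  qed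
  have "(\<lambda>(h, k). h \<otimes>\<^bsub>?Z\<^esub> k) \<in> iso (?Z\<lparr>carrier := ?H\<rparr> \<times>\<times> ?Z\<lparr>carrier := ?K\<rparr>) ?Z"
    by (rule Z.internal_product_iso[OF img(1)[OF A(1,2)] img(1)[OF B(1,2)] commZ _ gen]) (use HK in simp_all)
  moreover have pi: "pi_group \<rho> (?Z\<lparr>carrier := ?q ` T\<rparr>)"
    if T: "subgroup T G" "N \<subseteq> T" "index_in \<sigma> T N" "\<And>p. prime p \<Longrightarrow> p \<in> \<sigma> \<Longrightarrow> p \<in> \<rho>" for T \<rho> \<sigma>
  proof -
    have "p \<in> \<rho>" if p: "prime p" "p dvd card (?q ` T)" for p
    proof -
      have "order (G\<lparr>carrier := T\<rparr> Mod N) = card (?q ` T)"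
        by (simp add: order_def carrier_FactGroup)
      then have "multiplicity p (card T) \<noteq> multiplicity p (card N)"
        using prime_dvd_Factor_order_iff[OF T(1) N(1) T(2) p(1)] p(2) by simp
      then show ?thesis using index_inD[OF T(3) p(1)] T(4)[OF p(1)] by blast
    qed
    then show ?thesis
      using Z.subgroup_imp_group[OF img(1)[OF T(1,2)]] Z.subgroup_finite[OF img(1)[OF T(1,2)]]
      by (simp add: pi_group_def order_def)
  qed
  have "pi_group \<pi> (?Z\<lparr>carrier := ?H\<rparr>)" by (rule pi[OF A(1,2,5)])
  moreover have "pi_group (primes_compl \<pi>) (?Z\<lparr>carrier := ?K\<rparr>)"
    by (rule pi[OF B(1,2,5)]) (simp add: primes_compl_def)
  moreover have "nilpotent_group (?Z\<lparr>carrier := ?K\<rparr>)"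
  proof -
    have Ks: "subgroup ?K ?Z" by (rule img(1)[OF B(1,2)])
    interpret KK: group "?Z\<lparr>carrier := ?K\<rparr>" using Ks by (rule Z.subgroup_imp_group)
    have "lower_central ?Z n = ?q ` lower_central G n"
      by (rule q.lower_central_image) (simp add: carrier_FactGroup)
    then have "lower_central ?Z n \<subseteq> ?H" using A0(5) A0A by blast
    then have "lower_central (?Z\<lparr>carrier := ?K\<rparr>) n \<subseteq> ?H \<inter> ?K"
      using Z.lower_central_restrict_le[OF Ks, of n] subgroup.subset[OF KK.lower_central_subgroup[of n]] by auto
    then have "lower_central (?Z\<lparr>carrier := ?K\<rparr>) n = {N}"
      using HK subgroup.one_closed[OF KK.lower_central_subgroup[of n]] by auto
    then show ?thesis using KK.is_group by (auto simp: nilpotent_group_def)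
  qed
  ultimately show ?thesis
    unfolding npi_group_def using Zg img(1)[OF A(1,2)] img(1)[OF B(1,2)] by blast
qed

text \<open>The two bounds on the lower central series are brought to the common length
  \<open>m + n\<close>.\<close>

lemma npi_kernel_Int:
  assumes "npi_kernel \<pi> M" "npi_kernel \<pi> N"
  shows "npi_kernel \<pi> (M \<inter> N)"
proof -
  have M: "subgroup M G" "normalizes (carrier G) M" "splits \<pi> (carrier G) M"
    and N: "subgroup N G" "normalizes (carrier G) N" "splits \<pi> (carrier G) N"
    using assms by (auto simp: npi_kernel_def)
  obtain A m where A: "subgroup A G" "M \<subseteq> A" "normalizes (carrier G) A" "index_in \<pi> A M" "lower_central G m \<subseteq> A"
    using assms(1) unfolding npi_kernel_def by blast
  obtain B n where B: "subgroup B G" "N \<subseteq> B" "normalizes (carrier G) B" "index_in \<pi> B N" "lower_central G n \<subseteq> B"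
    using assms(2) unfolding npi_kernel_def by blast
  have AB: "subgroup (A \<inter> B) G" "subgroup (A \<inter> B \<inter> M) G" using subgroup_Int A(1) B(1) M(1) by auto
  have "index_in \<pi> (A \<inter> B) (A \<inter> B \<inter> M)"
    by (rule index_in_Int[OF A(1) M(1) AB(1) A(2) _ normalizes_mono[OF M(2)] A(4)]) (use subgroup.subset[OF AB(1)] in auto)
  moreover have "index_in \<pi> (A \<inter> B \<inter> M) (A \<inter> B \<inter> M \<inter> N)"
    by (rule index_in_Int[OF B(1) N(1) AB(2) B(2) _ normalizes_mono[OF N(2)] B(4)]) (use subgroup.subset[OF AB(2)] in auto)
  moreover have "A \<inter> B \<inter> M \<inter> N = M \<inter> N" using A(2) B(2) by blast
  ultimately have "index_in \<pi> (A \<inter> B) (M \<inter> N)" by (metis index_in_trans)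
  moreover have "lower_central G (m + n) \<subseteq> A \<inter> B"
    using lower_central_le_normal[OF A(1,3,5), of n] lower_central_le_normal[OF B(1,3,5), of m] by (auto simp: add.commute)
  moreover have "splits \<pi> (carrier G) (M \<inter> N)"
    by (rule splits_Int_kernel[OF subgroup_self M(1) subgroup.subset[OF M(1)] M(2,3) N(1) subgroup.subset[OF N(1)] N(2,3)])
  ultimately show ?thesis
    unfolding npi_kernel_def
    using subgroup_Int[OF M(1) N(1)] normalizes_Int[OF M(2) N(2)] AB(1) A(2) B(2) normalizes_Int[OF A(3) B(3)]
    by (intro conjI exI[of _ "A \<inter> B"] exI[of _ "m + n"]) auto
qed

lemma npi_kernel_carrier: "npi_kernel \<pi> (carrier G)"
proof -
  have "splits \<pi> (carrier G) (carrier G)"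
    by (rule splits_index) (use subgroup_self normalizes_self[OF subgroup_self] in auto)
  moreover have "lower_central G 0 \<subseteq> carrier G" by simp
  ultimately show ?thesis
    unfolding npi_kernel_def using subgroup_self normalizes_self[OF subgroup_self] index_in_refl by blast
qed

text \<open>By closure under intersection a minimal kernel is least, so the \<open>LEAST\<close> in
  the residual is attained.\<close>

lemma npi_kernel_npi_residual: "npi_kernel \<pi> (npi_residual \<pi> G)"
proof -
  have P: "N \<lhd> G \<and> npi_group \<pi> (G Mod N) \<longleftrightarrow> npi_kernel \<pi> N" for N
  proof
    assume "N \<lhd> G \<and> npi_group \<pi> (G Mod N)"
    then show "npi_kernel \<pi> N" using npi_kernel_if_npi_group by blast
  next
    assume k: "npi_kernel \<pi> N"
    then have "subgroup N G" "normalizes (carrier G) N" by (simp_all add: npi_kernel_def)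
    then show "N \<lhd> G \<and> npi_group \<pi> (G Mod N)"
      using npi_group_if_npi_kernel[OF k] normal_iff_normalizes by blast
  qed
  have "{N. npi_kernel \<pi> N} \<subseteq> Pow (carrier G)" using subgroup.subset by (auto simp: npi_kernel_def)
  then have "finite {N. npi_kernel \<pi> N}" using fin by (meson finite_Pow_iff finite_subset)
  moreover have "{N. npi_kernel \<pi> N} \<noteq> {}" using npi_kernel_carrier by blast
  ultimately obtain R where R: "R \<in> {N. npi_kernel \<pi> N}" "\<forall>M\<in>{N. npi_kernel \<pi> N}. M \<subseteq> R \<longrightarrow> R = M"
    using finite_has_minimal by meson
  have least: "R \<subseteq> N" if "npi_kernel \<pi> N" for N
  proof -
    have "npi_kernel \<pi> (R \<inter> N)" using npi_kernel_Int R(1) that by blast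
    then show ?thesis using R(2) by blast
  qed
  have "npi_residual \<pi> G = R"
    unfolding npi_residual_def P by (rule Least_equality) (use R(1) least in auto)
  then show ?thesis using R(1) by simp
qed

text \<open>By Sylow's theorem over \<open>A\<close>, the normalizer of \<open>P\<close> is its own
  normalizer, and such a subgroup absorbs the lower central series term by term until it is the
  whole group.\<close>

lemma relative_sylow_normal:
  assumes p: "prime p" and A: "subgroup A G" "normalizes (carrier G) A" and lc: "lower_central G n \<subseteq> A"
    and P: "subgroup P G" "A \<subseteq> P" "index_in {p} P A" "index_in (- {p}) (carrier G) P"
  shows "normalizes (carrier G) P"
proof -
  have Pc: "P \<subseteq> carrier G" by (rule subgroup.subset[OF P(1)])
  let ?N = "normalizer G P"
  have Ns: "subgroup ?N G" by (rule normalizer_subgroup[OF Pc])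
  have Nc: "?N \<subseteq> carrier G" by (rule subgroup.subset[OF Ns])
  have nNP: "normalizes ?N P" by (rule normalizes_normalizer[OF Pc])
  have PN: "P \<subseteq> ?N" using subset_normalizer_iff[OF P(1) Pc] normalizes_self[OF P(1)] by blast
  have self: "x \<in> ?N" if x: "x \<in> carrier G" and conj: "conj_subset G ?N x \<subseteq> ?N" for x
  proof -
    let ?P = "conj_subset G P x"
    have Ps: "subgroup ?P G" by (rule conj_subset_subgroup[OF P(1) x])
    have Ax: "conj_subset G A x = A"
      by (rule conj_subset_normalizes[OF A(2) subgroup_self subgroup.subset[OF A(1)] x])
    have AP: "A \<subseteq> ?P" using conj_subset_mono[OF P(2) Pc x] Ax by simp
    have PxN: "?P \<subseteq> ?N" using conj_subset_mono[OF PN Nc x] conj by blast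
    have iP: "index_in {p} ?P A" using index_in_conj[OF Pc subgroup.subset[OF A(1)] x] P(3) Ax by simp
    have iN: "index_in (- {p}) ?N P" by (rule index_in_sandwich(2)[OF subgroup_self Ns P(1) PN Nc P(4)])
    obtain z where z: "z \<in> ?N" "conj_subset G ?P z \<subseteq> P"
      using relative_sylow_dominates[OF p Ns A(1) normalizes_mono[OF A(2) Nc] P(1,2) PN iN Ps AP PxN iP] .
    have zc: "z \<in> carrier G" using z(1) Nc by blast
    have "?P \<subseteq> conj_subset G P (inv z)"
      using conj_subset_le_iff[OF subgroup.subset[OF Ps] Pc zc] z(2) by blast
    also have "\<dots> = P"
      by (rule conj_subset_normalizes[OF nNP Ns Pc subgroup.m_inv_closed[OF Ns z(1)]])
    finally have "?P = P"
      using card_subset_eq[OF subgroup_finite[OF P(1)]] card_conj_subset[OF Pc x] by blast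
    then show ?thesis using mem_normalizer_iff[OF Pc] x by blast
  qed
  \<comment> \<open>The index \<open>n - k\<close> runs upwards through the series from its bound:
    if one term lies in the normalizer, commutators show that the preceding term normalizes the
    normalizer, so it lies in it too.\<close>
  have "lower_central G (n - k) \<subseteq> ?N" if "k \<le> n" for k
    using that
  proof (induction k)
    case 0
    then show ?case using lc P(2) PN by auto
  next
    case (Suc k)
    have nk: "n - k = Suc (n - Suc k)" using Suc.prems by simp
    have IH: "lower_central G (Suc (n - Suc k)) \<subseteq> ?N" using Suc nk by simp
    show ?case
    proof
      fix x assume x: "x \<in> lower_central G (n - Suc k)"
      have xc: "x \<in> carrier G" using x subgroup.mem_carrier[OF lower_central_subgroup] by blast
      have "x \<otimes> y \<otimes> inv x \<in> ?N" if y: "y \<in> ?N" for y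
      proof -
        have yc: "y \<in> carrier G" using y Nc by blast
        have "x \<otimes> y \<otimes> inv x \<otimes> inv y \<in> ?N" using lower_central_commutator[OF x yc] IH by blast
        then have "x \<otimes> y \<otimes> inv x \<otimes> inv y \<otimes> y \<in> ?N" using subgroup.m_closed[OF Ns _ y] by blast
        then show ?thesis using xc yc by (simp add: m_assoc)
      qed
      then have "conj_subset G ?N (inv x) \<subseteq> ?N" using conj_subset_image[OF Nc, of "inv x"] xc by auto
      then have "inv x \<in> ?N" using self[of "inv x"] xc by simp
      then have "inv (inv x) \<in> ?N" by (rule subgroup.m_inv_closed[OF Ns])
      then show "x \<in> ?N" using xc by simp
    qed
  qed
  from this[of n] have "carrier G \<subseteq> ?N" by simp
  then show ?thesis using subset_normalizer_iff[OF subgroup_self Pc] by blast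
qed

text \<open>For a prime outside \<pi> the Sylow subgroup over \<open>?A\<close> is normal, and
  intersecting it with \<open>B\<close> removes the \<pi>-part. The complementary part is the
  largest normal subgroup \<open>C\<close> with |C : N| prime to \<open>p\<close>; it contains
  \<open>A\<close> and the pieces for all other primes, so nothing but the p-part is
  missing.\<close>

lemma npi_kernel_block_nilpotent:
  assumes k: "npi_kernel \<pi> N"
  shows "block_nilpotent \<pi> (carrier G) N"
proof -
  have N: "subgroup N G" "normalizes (carrier G) N" "splits \<pi> (carrier G) N" using k by (auto simp: npi_kernel_def)
  note Nc = subgroup.subset[OF N(1)] and top = subgroup_self
  obtain A B where A: "subgroup A G" "N \<subseteq> A" "A \<subseteq> carrier G" "normalizes (carrier G) A" "index_in \<pi> A N" "index_in (- \<pi>) (carrier G) A"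
    and B: "subgroup B G" "N \<subseteq> B" "B \<subseteq> carrier G" "normalizes (carrier G) B" "index_in (- \<pi>) B N" "index_in \<pi> (carrier G) B"
    using N(3) by (rule splitsE)
  obtain A0 n where A0: "subgroup A0 G" "N \<subseteq> A0" "normalizes (carrier G) A0" "index_in \<pi> A0 N" "lower_central G n \<subseteq> A0"
    using k unfolding npi_kernel_def by blast
  let ?A = "A0 <#> A"
  have A0c: "A0 \<subseteq> carrier G" by (rule subgroup.subset[OF A0(1)])
  have A': "subgroup ?A G" by (rule set_mult_subgroup[OF A0(1) A(1) normalizes_mono[OF A(4) A0c]])
  note Ai = set_mult_incl[OF A0(1) A(1)]
  have nA: "normalizes (carrier G) ?A" by (rule normalizes_set_mult[OF A0(3) A(4) subset_refl A0c A(3)])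
  have iA: "index_in \<pi> ?A N"
  proof -
    have "index_in \<pi> A0 (A0 \<inter> A)"
      by (rule index_in_sandwich(1)[OF A0(1) subgroup_Int[OF A0(1) A(1)] N(1) _ _ A0(4)]) (use A A0 in auto)
    then show ?thesis using index_in_set_mult_iff[OF A0(1) A(1)] index_in_trans A(5) by blast
  qed
  have lcA: "lower_central G n \<subseteq> ?A" using A0(5) Ai(1) by blast
  have piece: "\<exists>Q. subgroup Q G \<and> N \<subseteq> Q \<and> normalizes (carrier G) Q \<and> index_in {p} Q N \<and> index_in (- {p}) (carrier G) Q"
    if p: "prime p" "p \<notin> \<pi>" for p
  proof -
    obtain P where P: "subgroup P G" "?A \<subseteq> P" "P \<subseteq> carrier G" "index_in {p} P ?A" "index_in (- {p}) (carrier G) P"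
      using relative_sylow_exists[OF p(1) top A' subgroup.subset[OF A'] nA] .
    have nP: "normalizes (carrier G) P" by (rule relative_sylow_normal[OF p(1) A' nA lcA P(1,2,4,5)])
    let ?Q = "P \<inter> B"
    have Q: "subgroup ?Q G" by (rule subgroup_Int[OF P(1) B(1)])
    have NQ: "N \<subseteq> ?Q" using B(2) A0(2) Ai(1) P(2) by blast
    have nQ: "normalizes (carrier G) ?Q" by (rule normalizes_Int[OF nP B(4)])
    have QA: "?Q \<inter> ?A = N"
    proof (rule index_in_disjoint_eq[OF subgroup_Int[OF Q A'] N(1), of \<pi> "- \<pi>"])
      show "N \<subseteq> ?Q \<inter> ?A" using NQ A(2) Ai(2) by blast
      then show "index_in \<pi> (?Q \<inter> ?A) N" "index_in (- \<pi>) (?Q \<inter> ?A) N"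
        using index_in_sandwich(2)[OF A' subgroup_Int[OF Q A'] N(1) _ _ iA]
          index_in_sandwich(2)[OF B(1) subgroup_Int[OF Q A'] N(1) _ _ B(5)] by auto
    qed blast
    have "index_in {p} ?Q (?Q \<inter> ?A)"
      by (rule index_in_Int[OF P(1) A' Q P(2) _ normalizes_mono[OF nA] P(4)]) (use P(3) in auto)
    then have i1: "index_in {p} ?Q N" using QA by simp
    have "index_in \<pi> P ?Q"
      by (rule index_in_Int[OF top B(1) P(1) B(3) P(3) normalizes_mono[OF B(4) P(3)] B(6)])
    then have "multiplicity p (card P) = multiplicity p (card ?Q)" using index_inD p by blast
    then have i2: "index_in (- {p}) (carrier G) ?Q" using P(5) by (simp add: index_in_Compl_prime[OF p(1)])
    show ?thesis using Q NQ nQ i1 i2 by blast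
  qed
  show ?thesis
    unfolding block_nilpotent_def
  proof
    fix b assume "b \<in> blocks \<pi>"
    then consider "b = \<pi>" | p where "prime p" "p \<notin> \<pi>" "b = {p}" by (auto simp: blocks_def)
    then show "splits b (carrier G) N"
    proof cases
      case 1
      then show ?thesis using N(3) by simp
    next
      case 2
      obtain Q where Q: "subgroup Q G" "N \<subseteq> Q" "normalizes (carrier G) Q" "index_in {p} Q N" "index_in (- {p}) (carrier G) Q"
        using piece[OF 2(1,2)] by blast
      let ?P = "\<lambda>C. subgroup C G \<and> N \<subseteq> C \<and> normalizes (carrier G) C \<and> index_in (- {p}) C N"
      have "{C. ?P C} \<subseteq> Pow (carrier G)" using subgroup.subset by blast
      then have "finite {C. ?P C}" using fin by (meson finite_Pow_iff finite_subset)
      moreover have "{C. ?P C} \<noteq> {}" using N by (auto intro!: exI[of _ N])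
      ultimately obtain C where C: "C \<in> {C. ?P C}" "\<forall>D\<in>{C. ?P C}. C \<subseteq> D \<longrightarrow> C = D"
        using finite_has_maximal by meson
      have Cs: "subgroup C G" "N \<subseteq> C" "normalizes (carrier G) C" "index_in (- {p}) C N" using C(1) by auto
      have Cc: "C \<subseteq> carrier G" by (rule subgroup.subset[OF Cs(1)])
      have all: "D \<subseteq> C" if D: "?P D" for D
      proof -
        have Ds: "subgroup D G" "N \<subseteq> D" "normalizes (carrier G) D" "index_in (- {p}) D N" using D by auto
        have Dc: "D \<subseteq> carrier G" by (rule subgroup.subset[OF Ds(1)])
        note i = set_mult_incl[OF Ds(1) Cs(1)]
        have "index_in (- {p}) D (D \<inter> C)"
          by (rule index_in_sandwich(1)[OF Ds(1) subgroup_Int[OF Ds(1) Cs(1)] N(1) _ _ Ds(4)]) (use Ds Cs in auto)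
        then have "index_in (- {p}) (D <#> C) N"
          using index_in_set_mult_iff[OF Ds(1) Cs(1)] index_in_trans Cs(4) by blast
        then have "?P (D <#> C)"
          using set_mult_subgroup[OF Ds(1) Cs(1) normalizes_mono[OF Cs(3) Dc]] i Cs(2)
            normalizes_set_mult[OF Ds(3) Cs(3) subset_refl Dc Cc] by blast
        then have "C = D <#> C" using C(2) i(2) by blast
        then show ?thesis using i(1) by simp
      qed
      have "index_in {p} (carrier G) C"
        unfolding index_in_def
      proof (intro allI impI)
        fix r assume r: "prime r \<and> r \<notin> {p}"
        obtain D where D: "subgroup D G" "D \<subseteq> C" "multiplicity r (card (carrier G)) = multiplicity r (card D)"
        proof (cases "r \<in> \<pi>")
          case True
          \<comment> \<open>\<open>A\<close> is a \<pi>-section over \<open>N\<close> and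
            \<open>p\<close> lies outside \<pi>, so \<open>A\<close> is one of the subgroups
            absorbed by \<open>C\<close>.\<close>
          have "index_in (- {p}) A N" by (rule index_in_mono[OF A(5)]) (use 2 in blast)
          then have "A \<subseteq> C" using all A by blast
          moreover have "multiplicity r (card (carrier G)) = multiplicity r (card A)" using index_inD[OF A(6)] r True by blast
          ultimately show thesis using that A(1) by blast
        next
          case False
          then obtain D where D: "subgroup D G" "N \<subseteq> D" "normalizes (carrier G) D" "index_in {r} D N" "index_in (- {r}) (carrier G) D"
            using piece[of r] r by blast
          have "index_in (- {p}) D N" by (rule index_in_mono[OF D(4)]) (use r in blast)
          then have "D \<subseteq> C" using all D by blast
          moreover have "multiplicity r (card (carrier G)) = multiplicity r (card D)" using index_inD[OF D(5)] r by blast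
          ultimately show thesis using that D(1) by blast
        qed
        show "multiplicity r (card (carrier G)) = multiplicity r (card C)"
          using multiplicity_card_mono[OF D(1) Cs(1) D(2), of r] multiplicity_card_mono[OF Cs(1) top Cc, of r] D(3) by simp
      qed
      then show ?thesis
        unfolding splits_def 2(3) using Q Cs Cc subgroup.subset[OF Q(1)] by blast
    qed
  qed
qed

text \<open>Dnormality speaks only of Sylow subgroups that reduce into \<open>N\<close>; enlarging a
  Sylow subgroup of \<open>N\<close> supplies one for each prime.\<close>

lemma sylow_reducing_exists:
  assumes p: "prime p" and N: "subgroup N G"
  obtains P where "sylow_subgroup p G P" "sylow_reduces p G P N"
proof -
  note top = subgroup_self
  obtain S where S: "subgroup S G" "S \<subseteq> N" "card S = p ^ multiplicity p (card N)" using sylow_exists[OF p N] .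
  obtain P0 where P0: "subgroup P0 G" "P0 \<subseteq> carrier G" "card P0 = p ^ multiplicity p (card (carrier G))"
    using sylow_exists[OF p top] .
  obtain x where x: "x \<in> carrier G" "conj_subset G S x \<subseteq> P0"
    using sylow_dominates[OF p top P0 S(1) subgroup.subset[OF S(1)] S(3)] .
  have ix: "inv x \<in> carrier G" using x(1) by simp
  define P where "P = conj_subset G P0 (inv x)"
  have P: "subgroup P G" "card P = p ^ multiplicity p (card (carrier G))"
    unfolding P_def using conj_subset_subgroup[OF P0(1) ix] card_conj_subset[OF P0(2) ix] P0(3) by auto
  have SP: "S \<subseteq> P" unfolding P_def using conj_subset_le_iff[OF subgroup.subset[OF S(1)] P0(2) x(1)] x(2) by blast
  have PN: "subgroup (P \<inter> N) G" by (rule subgroup_Int[OF P(1) N])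
  have "S = P \<inter> N"
  proof (rule subgroup_eqI[OF S(1) PN])
    show SPN: "S \<subseteq> P \<inter> N" using SP S(2) by blast
    fix q :: nat assume q: "prime q"
    show "multiplicity q (card S) = multiplicity q (card (P \<inter> N))"
    proof (cases "q = p")
      case True
      have "multiplicity p (card S) = multiplicity p (card N)" using S(3) multiplicity_prime_power[OF p] by simp
      then show ?thesis
        using multiplicity_card_mono[OF S(1) PN SPN, of p] multiplicity_card_mono[OF PN N, of p] True by simp
    next
      case False
      then have "multiplicity q (card P) = 0" using P(2) multiplicity_distinct_prime_power[OF p q] by simp
      then show ?thesis
        using multiplicity_card_mono[OF S(1) PN SPN, of q] multiplicity_card_mono[OF PN P(1), of q] by simp
    qed
  qed
  then have "sylow_reduces p G P N"
    unfolding sylow_reduces_def sylow_subgroup_def using S(3) subgroup_incl[OF PN N] by (simp add: order_def)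
  moreover have "sylow_subgroup p G P" unfolding sylow_subgroup_def using P by (simp add: order_def)
  ultimately show thesis using that by blast
qed

text \<open>For each prime the normalizer has the full p-part of the group order.\<close>

lemma normalizes_if_sylows:
  assumes H: "H \<subseteq> carrier G" and syl: "\<And>p. prime p \<Longrightarrow> \<exists>P. sylow_subgroup p G P \<and> P \<subseteq> normalizer G H"
  shows "normalizes (carrier G) H"
proof -
  have Z: "subgroup (normalizer G H) G" by (rule normalizer_subgroup[OF H])
  have "normalizer G H = carrier G"
  proof (rule subgroup_eqI[OF Z subgroup_self subgroup.subset[OF Z]])
    fix p :: nat assume p: "prime p"
    obtain P where P: "subgroup P G" "card P = p ^ multiplicity p (card (carrier G))" "P \<subseteq> normalizer G H"
      using syl[OF p] by (auto simp: sylow_subgroup_def order_def)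
    show "multiplicity p (card (normalizer G H)) = multiplicity p (card (carrier G))"
      using multiplicity_card_mono[OF P(1) Z P(3), of p] multiplicity_card_mono[OF Z subgroup_self subgroup.subset[OF Z], of p]
        P(2) multiplicity_prime_power[OF p] by simp
  qed
  then show ?thesis using normalizes_normalizer[OF H] by simp
qed

text \<open>If \<pi> has at most one element, a reducing Sylow subgroup for each prime normalizes
  \<open>N\<close>, so \<open>N\<close> is normal. Otherwise the same argument makes
  \<open>O_upper\<close> of \<open>N\<close> normal; this forces every Sylow subgroup for a prime
  outside \<pi> to reduce into \<open>N\<close> and so to normalize it, and the core of the
  normalizer then has \<pi>-index.\<close>

lemma npi_dnormalD:
  assumes dn: "npi_dnormal \<pi> G N" and primes: "\<forall>p\<in>\<pi>. prime p"
  shows "normalizes (carrier G) N \<or>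
    (\<exists>P. subgroup P G \<and> normalizes (carrier G) P \<and> normalizes P N \<and> index_in \<pi> (carrier G) P)"
proof -
  note top = subgroup_self
  have N: "subgroup N G" using dn by (simp add: npi_dnormal_def)
  have Nc: "N \<subseteq> carrier G" by (rule subgroup.subset[OF N])
  have out: "P \<subseteq> normalizer G N" if "prime p" "p \<notin> \<pi>" "sylow_subgroup p G P" "sylow_reduces p G P N" for p P
    using dn that unfolding npi_dnormal_def primes_compl_def by blast
  show ?thesis
  proof (cases "infinite \<pi> \<or> card \<pi> \<ge> 2")
    case False
    then have small: "\<pi> = {} \<or> (\<exists>p. \<pi> = {p})" using big_block_iff by blast
    have "normalizes (carrier G) N"
    proof (rule normalizes_if_sylows[OF Nc])
      fix p :: nat assume p: "prime p"
      obtain P where P: "sylow_subgroup p G P" "sylow_reduces p G P N" using sylow_reducing_exists[OF p N] .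
      have "P \<subseteq> normalizer G N"
      proof (cases "p \<in> \<pi>")
        case True
        then have "\<pi> = {p}" using small by blast
        then show ?thesis using dn True P unfolding npi_dnormal_def by blast
      qed (rule out[OF p _ P])
      then show "\<exists>P. sylow_subgroup p G P \<and> P \<subseteq> normalizer G N" using P by blast
    qed
    then show ?thesis by blast
  next
    case True
    let ?O = "O_upper \<pi> (G\<lparr>carrier := N\<rparr>)"
    note O = O_upper_restrict[OF N, where \<pi> = \<pi>]
    have Oc: "?O \<subseteq> carrier G" by (rule subgroup.subset[OF O(1)])
    have nO: "normalizes (carrier G) ?O"
    proof (rule normalizes_if_sylows[OF Oc])
      fix p :: nat assume p: "prime p"
      obtain P where P: "sylow_subgroup p G P" "sylow_reduces p G P N" using sylow_reducing_exists[OF p N] .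
      have Ps: "subgroup P G" using P(1) by (simp add: sylow_subgroup_def)
      have "P \<subseteq> normalizer G ?O"
      proof (cases "p \<in> \<pi>")
        case in_pi: True
        then show ?thesis using dn True P unfolding npi_dnormal_def by blast
      next
        case False
        have "normalizes P N" using out[OF p False P] subset_normalizer_iff[OF Ps Nc] by blast
        then have "normalizes P ?O" by (rule normalizes_O_upper[OF N Ps])
        then show ?thesis using subset_normalizer_iff[OF Ps Oc] by blast
      qed
      then show "\<exists>P. sylow_subgroup p G P \<and> P \<subseteq> normalizer G ?O" using P by blast
    qed
    \<comment> \<open>Reduction is automatic: \<open>P\<close> meets the normal subgroup
      \<open>?O\<close> in a Sylow p-subgroup, and \<open>?O\<close> contains the full p-part of
      \<open>N\<close>.\<close>
    have all: "P \<subseteq> normalizer G N" if p: "prime p" "p \<notin> \<pi>" and P: "sylow_subgroup p G P" for p P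
    proof (rule out[OF p P])
      have Ps: "subgroup P G" "card P = p ^ multiplicity p (card (carrier G))"
        using P by (auto simp: sylow_subgroup_def order_def)
      have vP: "multiplicity p (card P) = multiplicity p (card (carrier G))" using Ps(2) multiplicity_prime_power[OF p(1)] by simp
      have PO: "subgroup (P <#> ?O) G"
        by (rule set_mult_subgroup[OF Ps(1) O(1) normalizes_mono[OF nO subgroup.subset[OF Ps(1)]]])
      have PN: "subgroup (P \<inter> N) G" and PO': "subgroup (P \<inter> ?O) G" using subgroup_Int Ps(1) N O(1) by auto
      have "multiplicity p (card (P <#> ?O)) = multiplicity p (card P)"
        using multiplicity_card_mono[OF Ps(1) PO set_mult_incl(1)[OF Ps(1) O(1)], of p]
          multiplicity_card_mono[OF PO top subgroup.subset[OF PO], of p] vP by simp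
      then have "multiplicity p (card (P \<inter> ?O)) = multiplicity p (card ?O)"
        using multiplicity_set_mult[OF Ps(1) O(1) p(1)] by simp
      also have "\<dots> = multiplicity p (card N)" using index_inD[OF O(4) p] by simp
      finally have "multiplicity p (card N) \<le> multiplicity p (card (P \<inter> N))"
        using multiplicity_card_mono[OF PO' PN, of p] O(2) by auto
      then have v: "multiplicity p (card (P \<inter> N)) = multiplicity p (card N)"
        using multiplicity_card_mono[OF PN N, of p] by simp
      have "card (P \<inter> N) = p ^ multiplicity p (card (P \<inter> N))"
      proof (rule prime_power_if_only_prime[OF subgroup_card_pos[OF PN] p(1)])
        fix q assume q: "prime q" "q dvd card (P \<inter> N)"
        then have "q dvd p ^ multiplicity p (card (carrier G))"
          using card_subgroup_dvd[OF PN Ps(1)] Ps(2) by (metis dvd_trans inf_le1)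
        then show "q = p" using q(1) p(1) by (metis prime_dvd_power primes_dvd_imp_eq)
      qed
      then show "sylow_reduces p G P N"
        unfolding sylow_reduces_def sylow_subgroup_def using v subgroup_incl[OF PN N] by (simp add: order_def)
    qed
    let ?Z = "normalizer G N"
    have Z: "subgroup ?Z G" by (rule normalizer_subgroup[OF Nc])
    have Zc: "?Z \<subseteq> carrier G" by (rule subgroup.subset[OF Z])
    \<comment> \<open>The core of \<open>?Z\<close>. All Sylow subgroups for primes outside \<pi>
      lie in \<open>?Z\<close>, hence in each of its conjugates, so passing to the core keeps the
      index a \<pi>-number.\<close>
    define P where "P = \<Inter> (conj_subset G ?Z ` carrier G)"
    have memP: "w \<in> P \<longleftrightarrow> (\<forall>x\<in>carrier G. x \<otimes> w \<otimes> inv x \<in> ?Z)" if w: "w \<in> carrier G" for w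
      unfolding P_def using mem_conj_subset[OF Zc _ w] by blast
    have Ps: "subgroup P G"
      unfolding P_def by (rule subgroups_Inter) (use conj_subset_subgroup[OF Z] in auto)
    have Pc: "P \<subseteq> carrier G" by (rule subgroup.subset[OF Ps])
    have PZ: "P \<subseteq> ?Z" unfolding P_def using conj_subset_one[OF Zc] by blast
    have nP: "normalizes (carrier G) P"
      unfolding normalizes_def
    proof (intro ballI)
      fix y w assume y: "y \<in> carrier G" and w: "w \<in> P"
      have wc: "w \<in> carrier G" using w Pc by blast
      have "x \<otimes> (inv y \<otimes> w \<otimes> y) \<otimes> inv x \<in> ?Z" if x: "x \<in> carrier G" for x
      proof -
        have "x \<otimes> (inv y \<otimes> w \<otimes> y) \<otimes> inv x = (x \<otimes> inv y) \<otimes> w \<otimes> inv (x \<otimes> inv y)"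
          using x y wc by (simp add: m_assoc inv_mult_group)
        then show ?thesis using memP[OF wc] w x y by simp
      qed
      then show "inv y \<otimes> w \<otimes> y \<in> P" using memP[of "inv y \<otimes> w \<otimes> y"] y wc by simp
    qed
    have "index_in \<pi> (carrier G) P"
      unfolding index_in_def
    proof (intro allI impI)
      fix p assume p: "prime p \<and> p \<notin> \<pi>"
      obtain S where S: "subgroup S G" "S \<subseteq> carrier G" "card S = p ^ multiplicity p (card (carrier G))"
        using sylow_exists[OF conjunct1[OF p] top] .
      have "S \<subseteq> conj_subset G ?Z x" if x: "x \<in> carrier G" for x
      proof -
        have ix: "inv x \<in> carrier G" using x by simp
        have "sylow_subgroup p G (conj_subset G S (inv x))"
          unfolding sylow_subgroup_def using conj_subset_subgroup[OF S(1) ix] card_conj_subset[OF S(2) ix] S(3)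
          by (simp add: order_def)
        then have "conj_subset G S (inv x) \<subseteq> ?Z" using all p by blast
        then show ?thesis using conj_subset_le_iff[OF S(2) Zc ix] x by simp
      qed
      then have SP: "S \<subseteq> P" unfolding P_def by blast
      show "multiplicity p (card (carrier G)) = multiplicity p (card P)"
        using multiplicity_card_mono[OF S(1) Ps SP, of p] multiplicity_card_mono[OF Ps top Pc, of p] S(3)
          multiplicity_prime_power[of p] p by simp
    qed
    moreover have "normalizes P N" using subset_normalizer_iff[OF Ps Nc] PZ by blast
    ultimately show ?thesis using Ps nP by blast
  qed
qed

end

lemma (in soluble_fitting_group) injector_Int_dnormal:
  assumes I: "injector (carrier G) I" and dn: "npi_dnormal \<pi> G N"
  shows "injector N (I \<inter> N)"
proof -
  have N: "subgroup N G" using dn by (simp add: npi_dnormal_def)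
  have Nc: "N \<subseteq> carrier G" by (rule subgroup.subset[OF N])
  from npi_dnormalD[OF dn pi_primes] show ?thesis
  proof
    assume "normalizes (carrier G) N"
    then show ?thesis using injector_subnormal[OF subgroup_self I subnormal_in_normal[OF subgroup_self N Nc]] by blast
  next
    assume "\<exists>P. subgroup P G \<and> normalizes (carrier G) P \<and> normalizes P N \<and> index_in \<pi> (carrier G) P"
    then obtain P where P: "subgroup P G" "normalizes (carrier G) P" "normalizes P N" "index_in \<pi> (carrier G) P" by blast
    let ?M = "N <#> P"
    have M: "subgroup ?M G" by (rule set_mult_subgroup[OF N P(1) normalizes_mono[OF P(2) Nc]])
    note i = set_mult_incl[OF N P(1)]
    have nN: "normalizes ?M N"
      by (rule normalizes_by_set_mult[OF normalizes_self[OF N] P(3) Nc subgroup.subset[OF P(1)] Nc])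
    have "injector ?M (I \<inter> ?M)" by (rule injector_Int_section[OF P(1,2,4) M i(2) I])
    then have "injector N (I \<inter> ?M \<inter> N)"
      by (rule injector_subnormal[OF M _ subnormal_in_normal[OF M N i(1) nN]])
    moreover have "I \<inter> ?M \<inter> N = I \<inter> N" using i(1) by blast
    ultimately show ?thesis by simp
  qed
qed

theorem corollary2p11:
  fixes \<pi> :: "nat set"
    and F :: "nat monoid set"
    and G :: "('a, 'm) monoid_scheme"
  assumes "\<forall>p \<in> \<pi>. Factorial_Ring.prime p"
    and "npi_fitting_class \<pi> F"
    and "group G"
    and "finite (carrier G)"
    and "soluble_group (primes_compl \<pi>) G"
  shows "(\<exists>V. F_injector F G V \<and>
            {W. F_injector F G W} = {conj_subset G V x | x. x \<in> carrier G}) \<and>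
         (\<forall>V W. F_injector F G V \<and> F_injector F G W \<longrightarrow>
            (\<exists>g \<in> npi_residual \<pi> G. conj_subset G W g = V)) \<and>
         (\<forall>I N. F_injector F G I \<and> npi_dnormal \<pi> G N \<longrightarrow>
            F_injector F (G\<lparr>carrier := N\<rparr>) (I \<inter> N))"
proof -
  interpret soluble_fitting_group G \<pi> F
    by (intro soluble_fitting_group.intro fitting_class_group.intro fin_group.intro fin_group_axioms.intro
        fitting_class_group_axioms.intro soluble_fitting_group_axioms.intro assms)
  have G: "G\<lparr>carrier := carrier G\<rparr> = G" by simp
  note main = injectors_exist_and_conj[OF subgroup_self, unfolded G]
  have R: "npi_kernel \<pi> (npi_residual \<pi> G)" by (rule npi_kernel_npi_residual)
  have Rs: "subgroup (npi_residual \<pi> G) G" "normalizes (carrier G) (npi_residual \<pi> G)"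
    using R by (auto simp: npi_kernel_def)
  \<comment> \<open>The residual is a block-nilpotent kernel, so the conjugating element can be
    taken inside it; the single conjugacy class is deduced from this sharper form.\<close>
  have conj: "\<exists>g\<in>npi_residual \<pi> G. conj_subset G W g = V" if "F_injector F G V" "F_injector F G W" for V W
    using main Rs(1) subgroup.subset[OF Rs(1)] Rs(2) npi_kernel_block_nilpotent[OF R] that by blast
  obtain V where V: "F_injector F G V" using main by blast
  have "{W. F_injector F G W} = {conj_subset G V x | x. x \<in> carrier G}"
  proof
    show "{W. F_injector F G W} \<subseteq> {conj_subset G V x | x. x \<in> carrier G}"
      using conj[OF _ V] subgroup.mem_carrier[OF Rs(1)] by blast
    show "{conj_subset G V x | x. x \<in> carrier G} \<subseteq> {W. F_injector F G W}"
      using injector_conj_normal[OF subgroup_self, unfolded G, OF V subgroup_self normalizes_self[OF subgroup_self]] by blast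
  qed
  then have "\<exists>V. F_injector F G V \<and> {W. F_injector F G W} = {conj_subset G V x | x. x \<in> carrier G}"
    using V by (intro exI[of _ V] conjI)
  moreover have "F_injector F (G\<lparr>carrier := N\<rparr>) (I \<inter> N)" if "F_injector F G I" "npi_dnormal \<pi> G N" for I N
    by (rule injector_Int_dnormal[unfolded G, OF that])
  ultimately show ?thesis using conj by (intro conjI allI impI) (assumption | elim conjE)+
qed

end
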